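(* Let $n\geq 6$ be such that $n\equiv 2\pmod{4}$, and let $S:=S^{(n-2,1^2)}_{\mathbb{Z}_2}$. Let $T_1,T_2,T_3$ be the uniquely determined $\mathbb{Z}_2\mathfrak{S}_n$-lattices such that, with $T_0:=S$ and $T_4:=2S$, one has $T_4\subseteq T_3\subseteq T_2\subseteq T_1\subseteq T_0$ and $T_i$ is a maximal $\mathbb{Z}_2\mathfrak{S}_n$-sublattice of $T_{i-1}$ for $i\in\{1,\ldots,4\}$. Then $S,T_1,T_2$ and $T_3$ are representatives of the isomorphism classes of $\mathbb{Z}_2$-forms of the Specht $\mathbb{Q}_2\mathfrak{S}_n$-module $S^{(n-2,1^2)}_{\mathbb{Q}_2}$.
   Context: $\mathbb{Z}_2$ denotes the $2$-adic integers and $\mathbb{Q}_2$ the $2$-adic numbers. A $\mathbb{Z}_2$-form of a $\mathbb{Q}_2\mathfrak{S}_n$-module $V$ is a $\mathbb{Z}_2\mathfrak{S}_n$-module $M$, finitely generated and free over $\mathbb{Z}_2$, with $\mathbb{Q}_2\otimes_{\mathbb{Z}_2}M\cong V$. Representatives: pairwise non-isomorphic, and every $\mathbb{Z}_2$-form is isomorphic to one of them. For a principal ideal domain $R$, let $\mathfrak{S}_n$ permute the basis $\mathbf{1},\ldots,\mathbf{n}$ of the natural permutation lattice $M^{(n-1,1)}_R$; the natural Specht lattice is $S^{(n-1,1)}_R=\{\sum a_i\mathbf{i}:\sum a_i=0\}$, and the Specht lattice $S^{(n-2,1^2)}_R$ is identified with $\bigwedge^2(S^{(n-1,1)}_R)$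 (diagonal action). The chain $2S\subseteq T_3\subseteq T_2\subseteq T_1\subseteq S$ exists and is unique because, for $n\equiv 2\pmod 4$, the $\mathbb{F}_2\mathfrak{S}_n$-module $S/2S$ is uniserial of composition length $4$. A maximal sublattice is a maximal proper $\mathbb{Z}_2\mathfrak{S}_n$-submodule. *)

theory Defs
  imports
    "HOL-Algebra.Module"
    "HOL-Algebra.AbelCoset"
    "HOL-Algebra.Sym_Groups"
    "HOL-Computational_Algebra.Fraction_Field"
    "HOL-Computational_Algebra.Primes"
    "HOL-Decision_Procs.Algebra_Aux"
begin

section \<open>The 2-adic integers and numbers\<close>

text \<open>
  The inverse limit of the rings \<open>\<int>/2\<^sup>k\<int>\<close>: an element is a coherent sequence of residues,
  each represented by its member of \<open>{0..<2\<^sup>k}\<close>.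
\<close>

definition coherent :: "(nat \<Rightarrow> int) \<Rightarrow> bool"
  where "coherent x \<longleftrightarrow> (\<forall>k. x k \<in> {0..<2 ^ k} \<and> x (Suc k) mod 2 ^ k = x k)"

typedef padic2 = "{x. coherent x}"
  by (rule exI[of _ "\<lambda>_. 0"]) (simp add: coherent_def)

setup_lifting type_definition_padic2

lemma coherentI:
  assumes "\<And>k. f (Suc k) mod 2 ^ k = f k mod 2 ^ k"
  shows "coherent (\<lambda>k. f k mod 2 ^ k)"
proof -
  have "f (Suc k) mod 2 ^ Suc k mod 2 ^ k = f k mod 2 ^ k" for k
    using assms[of k] by (simp add: mod_mod_cancel)
  then show ?thesis by (simp add: coherent_def del: power_Suc)
qed

lemma coherentD:
  assumes "coherent x"
  shows "0 \<le> x k" "x k < 2 ^ k" "x k mod 2 ^ k = x k" "x (Suc k) mod 2 ^ k = x k"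
  using assms by (simp_all add: coherent_def)

lemma coherent_one: "coherent (\<lambda>k. 1 mod 2 ^ k)"
  by (rule coherentI) (rule refl)

lemma
  assumes x: "coherent x" and y: "coherent y"
  shows coherent_add: "coherent (\<lambda>k. (x k + y k) mod 2 ^ k)"
    and coherent_diff: "coherent (\<lambda>k. (x k - y k) mod 2 ^ k)"
    and coherent_mult: "coherent (\<lambda>k. (x k * y k) mod 2 ^ k)"
  by (rule coherentI,
      rule mod_add_cong mod_diff_cong mod_mult_cong;
      simp add: coherentD[OF x] coherentD[OF y])+

lemma coherent_minus: "coherent x \<Longrightarrow> coherent (\<lambda>k. (- x k) mod 2 ^ k)"
  by (rule coherentI, rule mod_minus_cong) (simp add: coherentD)

instantiation padic2 :: comm_ring_1
begin

lift_definition zero_padic2 :: padic2 is "\<lambda>_. 0"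
  by (simp add: coherent_def)

lift_definition one_padic2 :: padic2 is "\<lambda>k. 1 mod 2 ^ k"
  by (fact coherent_one)

lift_definition plus_padic2 :: "padic2 \<Rightarrow> padic2 \<Rightarrow> padic2"
  is "\<lambda>x y k. (x k + y k) mod 2 ^ k"
  by (fact coherent_add)

lift_definition minus_padic2 :: "padic2 \<Rightarrow> padic2 \<Rightarrow> padic2"
  is "\<lambda>x y k. (x k - y k) mod 2 ^ k"
  by (fact coherent_diff)

lift_definition uminus_padic2 :: "padic2 \<Rightarrow> padic2"
  is "\<lambda>x k. (- x k) mod 2 ^ k"
  by (fact coherent_minus)

lift_definition times_padic2 :: "padic2 \<Rightarrow> padic2 \<Rightarrow> padic2"
  is "\<lambda>x y k. (x k * y k) mod 2 ^ k"
  by (fact coherent_mult)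

instance
proof
  fix a b c :: padic2
  show "a + b + c = a + (b + c)"
    by transfer (simp add: mod_simps add.assoc)
  show "a + b = b + a"
    by transfer (simp add: add.commute)
  show "0 + a = a"
    by transfer (simp add: coherentD(3))
  show "- a + a = 0"
    by transfer (simp add: mod_simps)
  show "a - b = a + - b"
    by transfer (simp add: mod_simps)
  show "a * b * c = a * (b * c)"
    by transfer (simp add: mod_simps mult.assoc)
  show "a * b = b * a"
    by transfer (simp add: mult.commute)
  show "1 * a = a"
    by transfer (simp add: mod_mult_left_eq coherentD(3) del: one_mod_2_pow_eq)
  show "(a + b) * c = a * c + b * c"
    by transfer (simp add: mod_simps distrib_right)
  show "(0 :: padic2) \<noteq> 1"
    by transfer (auto dest!: fun_cong[where x = 1])
qed

end

lemma coherent_mod: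
  assumes "coherent x"
  shows "x (k + l) mod 2 ^ k = x k"
proof (induction l)
  case 0
  then show ?case using coherentD(3)[OF assms] by simp
next
  case (Suc l)
  have "x (k + Suc l) mod 2 ^ k = x (Suc (k + l)) mod 2 ^ (k + l) mod 2 ^ k"
    by (simp add: mod_mod_cancel le_imp_power_dvd)
  then show ?case using coherentD(4)[OF assms] Suc by simp
qed

lemma not_pow2_dvd_mult:
  fixes x y :: int
  assumes "\<not> 2 ^ k dvd x" "\<not> 2 ^ l dvd y"
  shows "\<not> 2 ^ (k + l) dvd x * y"
proof
  assume *: "2 ^ (k + l) dvd x * y"
  have nz: "x \<noteq> 0" "y \<noteq> 0" using assms by auto
  have p: "prime_elem (2 :: int)" by (simp add: prime_elem_iff_prime_abs)
  have "multiplicity 2 x < k" "multiplicity 2 y < l"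
    using assms nz by (auto simp: power_dvd_iff_le_multiplicity)
  moreover have "k + l \<le> multiplicity 2 (x * y)"
    using * nz by (simp add: power_dvd_iff_le_multiplicity)
  moreover have "multiplicity 2 (x * y) = multiplicity 2 x + multiplicity 2 y"
    using p nz by (simp add: prime_elem_multiplicity_mult_distrib)
  ultimately show False by linarith
qed

instance padic2 :: idom
proof
  fix a b :: padic2
  assume "a \<noteq> 0" "b \<noteq> 0"
  then show "a * b \<noteq> 0"
  proof transfer
    fix x y :: "nat \<Rightarrow> int"
    assume coh: "coherent x" "coherent y" and "x \<noteq> (\<lambda>_. 0)" "y \<noteq> (\<lambda>_. 0)"
    then obtain k l where kl: "x k \<noteq> 0" "y l \<noteq> 0" by blast
    have "x (k + l) mod 2 ^ k = x k" "y (k + l) mod 2 ^ l = y l"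
      using coherent_mod[OF coh(1), of k l] coherent_mod[OF coh(2), of l k]
      by (simp_all add: add.commute)
    with kl have "\<not> 2 ^ k dvd x (k + l)" "\<not> 2 ^ l dvd y (k + l)"
      by (auto dest: dvd_imp_mod_0)
    then have "\<not> 2 ^ (k + l) dvd x (k + l) * y (k + l)"
      by (rule not_pow2_dvd_mult)
    then have "x (k + l) * y (k + l) mod 2 ^ (k + l) \<noteq> 0"
      by (simp add: mod_eq_0_iff_dvd)
    then show "(\<lambda>k. x k * y k mod 2 ^ k) \<noteq> (\<lambda>_. 0)"
      by (auto dest: fun_cong[where x = "k + l"])
  qed
qed

abbreviation Z2 :: "padic2 ring"
  where "Z2 \<equiv> cring_class_ops"

abbreviation Q2 :: "padic2 fract ring"
  where "Q2 \<equiv> cring_class_ops"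

definition Z2_in_Q2 :: "padic2 \<Rightarrow> padic2 fract"
  where "Z2_in_Q2 x = Fract x 1"


section \<open>Spans, free modules and quotient modules\<close>

definition module_span :: "('r, 'a) ring_scheme \<Rightarrow> ('r, 'm, 'b) module_scheme \<Rightarrow> 'm set \<Rightarrow> 'm set"
  where "module_span R M X = \<Inter>{N. submodule N R M \<and> X \<subseteq> N}"

definition finitely_generated :: "('r, 'a) ring_scheme \<Rightarrow> ('r, 'm, 'b) module_scheme \<Rightarrow> bool"
  where "finitely_generated R M \<longleftrightarrow>
    (\<exists>X. finite X \<and> X \<subseteq> carrier M \<and> module_span R M X = carrier M)"

definition lin_indep :: "('r, 'a) ring_scheme \<Rightarrow> ('r, 'm, 'b) module_scheme \<Rightarrow> 'm set \<Rightarrow> bool"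
  where "lin_indep R M B \<longleftrightarrow>
    (\<forall>F c. finite F \<and> F \<subseteq> B \<and> c \<in> F \<rightarrow> carrier R
      \<and> (\<Oplus>\<^bsub>M\<^esub>b\<in>F. c b \<odot>\<^bsub>M\<^esub> b) = \<zero>\<^bsub>M\<^esub> \<longrightarrow> (\<forall>b\<in>F. c b = \<zero>\<^bsub>R\<^esub>))"

definition is_free :: "('r, 'a) ring_scheme \<Rightarrow> ('r, 'm, 'b) module_scheme \<Rightarrow> bool"
  where "is_free R M \<longleftrightarrow>
    (\<exists>B \<subseteq> carrier M. lin_indep R M B \<and> module_span R M B = carrier M)"

text \<open>
  The record type of modules extends that of rings, so it has fields \<open>mult\<close> and \<open>one\<close>, which
  play no role for modules. They are left undefined throughout.
\<close>

definition free_module :: "('r, 'a) ring_scheme \<Rightarrow> 'x set \<Rightarrow> ('r, 'x \<Rightarrow> 'r) module"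
  where "free_module R X =
    \<lparr>carrier = {f. range f \<subseteq> carrier R \<and> finite {x. f x \<noteq> \<zero>\<^bsub>R\<^esub>} \<and> {x. f x \<noteq> \<zero>\<^bsub>R\<^esub>} \<subseteq> X},
     monoid.mult = undefined, one = undefined,
     zero = (\<lambda>x. \<zero>\<^bsub>R\<^esub>),
     add = (\<lambda>f g x. f x \<oplus>\<^bsub>R\<^esub> g x),
     smult = (\<lambda>r f x. r \<otimes>\<^bsub>R\<^esub> f x)\<rparr>"

definition basis_vec :: "('r, 'a) ring_scheme \<Rightarrow> 'x \<Rightarrow> 'x \<Rightarrow> 'r"
  where "basis_vec R x = (\<lambda>y. if y = x then \<one>\<^bsub>R\<^esub> else \<zero>\<^bsub>R\<^esub>)"

text \<open>The linear map from a free module to \<open>M\<close> that sends each \<open>basis_vec R x\<close> to \<open>\<phi> x\<close>.\<close>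

definition lin_ext ::
    "('r, 'a) ring_scheme \<Rightarrow> ('r, 'm, 'b) module_scheme \<Rightarrow> ('x \<Rightarrow> 'm) \<Rightarrow> ('x \<Rightarrow> 'r) \<Rightarrow> 'm"
  where "lin_ext R M \<phi> f = (\<Oplus>\<^bsub>M\<^esub>x\<in>{x. f x \<noteq> \<zero>\<^bsub>R\<^esub>}. f x \<odot>\<^bsub>M\<^esub> \<phi> x)"

text \<open>
  The endomap of \<open>M/N\<close> induced by a linear endomap \<open>\<phi>\<close> of \<open>M\<close> with \<open>\<phi> ` N \<subseteq> N\<close>: on a coset
  \<open>N + x\<close> the union consists of copies of the single coset \<open>N + \<phi> x\<close>.
\<close>

definition quot_map ::
    "('r, 'm, 'b) module_scheme \<Rightarrow> 'm set \<Rightarrow> ('m \<Rightarrow> 'm) \<Rightarrow> 'm set \<Rightarrow> 'm set"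
  where "quot_map M N \<phi> C = (\<Union>x\<in>C. N +>\<^bsub>M\<^esub> \<phi> x)"

definition quot_module :: "('r, 'm, 'b) module_scheme \<Rightarrow> 'm set \<Rightarrow> ('r, 'm set) module"
  where "quot_module M N =
    \<lparr>carrier = a_rcosets\<^bsub>M\<^esub> N,
     monoid.mult = undefined, one = undefined,
     zero = N,
     add = set_add M,
     smult = (\<lambda>r. quot_map M N (\<lambda>x. r \<odot>\<^bsub>M\<^esub> x))\<rparr>"


section \<open>Tensor products\<close>

definition tensor_rels :: "('r, 'a) ring_scheme \<Rightarrow> ('r, 'm, 'b) module_scheme \<Rightarrow>
    ('r, 'n, 'c) module_scheme \<Rightarrow> ('m \<times> 'n \<Rightarrow> 'r) set"
  where "tensor_rels R M N =
    (let F = free_module R (carrier M \<times> carrier N); e = basis_vec R in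
      {e (x \<oplus>\<^bsub>M\<^esub> x', y) \<ominus>\<^bsub>F\<^esub> (e (x, y) \<oplus>\<^bsub>F\<^esub> e (x', y)) | x x' y.
         x \<in> carrier M \<and> x' \<in> carrier M \<and> y \<in> carrier N} \<union>
      {e (x, y \<oplus>\<^bsub>N\<^esub> y') \<ominus>\<^bsub>F\<^esub> (e (x, y) \<oplus>\<^bsub>F\<^esub> e (x, y')) | x y y'.
         x \<in> carrier M \<and> y \<in> carrier N \<and> y' \<in> carrier N} \<union>
      {e (r \<odot>\<^bsub>M\<^esub> x, y) \<ominus>\<^bsub>F\<^esub> (r \<odot>\<^bsub>F\<^esub> e (x, y)) | r x y.
         r \<in> carrier R \<and> x \<in> carrier M \<and> y \<in> carrier N} \<union>
      {e (x, r \<odot>\<^bsub>N\<^esub> y) \<ominus>\<^bsub>F\<^esub> (r \<odot>\<^bsub>F\<^esub> e (x, y)) | r x y.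
         r \<in> carrier R \<and> x \<in> carrier M \<and> y \<in> carrier N})"

definition tensor_ker :: "('r, 'a) ring_scheme \<Rightarrow> ('r, 'm, 'b) module_scheme \<Rightarrow>
    ('r, 'n, 'c) module_scheme \<Rightarrow> ('m \<times> 'n \<Rightarrow> 'r) set"
  where "tensor_ker R M N =
    module_span R (free_module R (carrier M \<times> carrier N)) (tensor_rels R M N)"

definition tensor :: "('r, 'a) ring_scheme \<Rightarrow> ('r, 'm, 'b) module_scheme \<Rightarrow>
    ('r, 'n, 'c) module_scheme \<Rightarrow> ('r, ('m \<times> 'n \<Rightarrow> 'r) set) module"
  where "tensor R M N =
    quot_module (free_module R (carrier M \<times> carrier N)) (tensor_ker R M N)"

definition pure_tensor :: "('r, 'a) ring_scheme \<Rightarrow> ('r, 'm, 'b) module_scheme \<Rightarrow>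
    ('r, 'n, 'c) module_scheme \<Rightarrow> 'm \<Rightarrow> 'n \<Rightarrow> ('m \<times> 'n \<Rightarrow> 'r) set"
  where "pure_tensor R M N x y =
    tensor_ker R M N +>\<^bsub>free_module R (carrier M \<times> carrier N)\<^esub> basis_vec R (x, y)"

text \<open>The map \<open>\<phi> \<otimes> \<psi>\<close> for linear endomaps \<open>\<phi>\<close> of \<open>M\<close> and \<open>\<psi>\<close> of \<open>N\<close>.\<close>

definition tensor_map :: "('r, 'a) ring_scheme \<Rightarrow> ('r, 'm, 'b) module_scheme \<Rightarrow>
    ('r, 'n, 'c) module_scheme \<Rightarrow> ('m \<Rightarrow> 'm) \<Rightarrow> ('n \<Rightarrow> 'n) \<Rightarrow>
    ('m \<times> 'n \<Rightarrow> 'r) set \<Rightarrow> ('m \<times> 'n \<Rightarrow> 'r) set"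
  where "tensor_map R M N \<phi> \<psi> =
    (let F = free_module R (carrier M \<times> carrier N)
     in quot_map F (tensor_ker R M N) (lin_ext R F (\<lambda>(x, y). basis_vec R (\<phi> x, \<psi> y))))"


section \<open>Modules with a linear group action\<close>

text \<open>
  A module over the group ring of \<open>G\<close> over \<open>R\<close> is an \<open>R\<close>-module on which \<open>G\<close> acts by
  \<open>R\<close>-linear maps.
\<close>

record ('r, 'm, 'g) gmodule = "('r, 'm) module" +
  act :: "'g \<Rightarrow> 'm \<Rightarrow> 'm"

locale group_module = module R M + G?: group G
  for R (structure) and G (structure) and M :: "('r, 'm, 'g, 'b) gmodule_scheme" (structure) +
  assumes act_closed: "\<lbrakk>g \<in> carrier G; x \<in> carrier M\<rbrakk> \<Longrightarrow> act M g x \<in> carrier M"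
    and act_add: "\<lbrakk>g \<in> carrier G; x \<in> carrier M; y \<in> carrier M\<rbrakk> \<Longrightarrow>
      act M g (x \<oplus>\<^bsub>M\<^esub> y) = act M g x \<oplus>\<^bsub>M\<^esub> act M g y"
    and act_smult: "\<lbrakk>g \<in> carrier G; r \<in> carrier R; x \<in> carrier M\<rbrakk> \<Longrightarrow>
      act M g (r \<odot>\<^bsub>M\<^esub> x) = r \<odot>\<^bsub>M\<^esub> act M g x"
    and act_one: "x \<in> carrier M \<Longrightarrow> act M \<one>\<^bsub>G\<^esub> x = x"
    and act_mult: "\<lbrakk>g \<in> carrier G; h \<in> carrier G; x \<in> carrier M\<rbrakk> \<Longrightarrow>
      act M (g \<otimes>\<^bsub>G\<^esub> h) x = act M g (act M h x)"

definition with_action :: "('r, 'm) module \<Rightarrow> ('g \<Rightarrow> 'm \<Rightarrow> 'm) \<Rightarrow> ('r, 'm, 'g) gmodule"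
  where "with_action M a = module.extend M (gmodule.fields a)"

definition gmodule_isomorphic :: "('r, 'a) ring_scheme \<Rightarrow> ('g, 'c) monoid_scheme \<Rightarrow>
    ('r, 'm, 'g, 'b) gmodule_scheme \<Rightarrow> ('r, 'n, 'g, 'd) gmodule_scheme \<Rightarrow> bool"
  where "gmodule_isomorphic R G M N \<longleftrightarrow>
    (\<exists>f. bij_betw f (carrier M) (carrier N) \<and>
      (\<forall>x\<in>carrier M. \<forall>y\<in>carrier M. f (x \<oplus>\<^bsub>M\<^esub> y) = f x \<oplus>\<^bsub>N\<^esub> f y) \<and>
      (\<forall>r\<in>carrier R. \<forall>x\<in>carrier M. f (r \<odot>\<^bsub>M\<^esub> x) = r \<odot>\<^bsub>N\<^esub> f x) \<and>
      (\<forall>g\<in>carrier G. \<forall>x\<in>carrier M. f (act M g x) = act N g (f x)))"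

definition gsubmodule :: "('r, 'a) ring_scheme \<Rightarrow> ('g, 'c) monoid_scheme \<Rightarrow>
    ('r, 'm, 'g, 'b) gmodule_scheme \<Rightarrow> 'm set \<Rightarrow> bool"
  where "gsubmodule R G M H \<longleftrightarrow>
    submodule H R M \<and> (\<forall>g\<in>carrier G. \<forall>x\<in>H. act M g x \<in> H)"

definition maximal_gsubmodule :: "('r, 'a) ring_scheme \<Rightarrow> ('g, 'c) monoid_scheme \<Rightarrow>
    ('r, 'm, 'g, 'b) gmodule_scheme \<Rightarrow> 'm set \<Rightarrow> bool"
  where "maximal_gsubmodule R G M H \<longleftrightarrow>
    gsubmodule R G M H \<and> H \<noteq> carrier M \<and>
    (\<forall>L. gsubmodule R G M L \<and> H \<subseteq> L \<longrightarrow> L = H \<or> L = carrier M)"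

definition restrict_to :: "('r, 'm, 'g, 'b) gmodule_scheme \<Rightarrow> 'm set \<Rightarrow>
    ('r, 'm, 'g, 'b) gmodule_scheme"
  where "restrict_to M H = M\<lparr>carrier := H\<rparr>"


section \<open>Extension of scalars and forms\<close>

text \<open>A ring \<open>K\<close> as a module over \<open>R\<close> along a ring homomorphism \<open>\<iota>\<close> from \<open>R\<close> to \<open>K\<close>.\<close>

definition ring_as_module :: "('k, 'a) ring_scheme \<Rightarrow> ('r \<Rightarrow> 'k) \<Rightarrow> ('r, 'k) module"
  where "ring_as_module K \<iota> =
    \<lparr>carrier = carrier K, monoid.mult = undefined, one = undefined,
     zero = \<zero>\<^bsub>K\<^esub>, add = (\<oplus>\<^bsub>K\<^esub>), smult = (\<lambda>r k. \<iota> r \<otimes>\<^bsub>K\<^esub> k)\<rparr>"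

text \<open>\<open>K \<otimes>\<^sub>R M\<close>, with \<open>K\<close> acting on the first and \<open>G\<close> on the second factor.\<close>

definition extend_scalars :: "('r, 'a) ring_scheme \<Rightarrow> ('k, 'c) ring_scheme \<Rightarrow> ('r \<Rightarrow> 'k) \<Rightarrow>
    ('r, 'm, 'g, 'b) gmodule_scheme \<Rightarrow> ('k, ('k \<times> 'm \<Rightarrow> 'r) set, 'g) gmodule"
  where "extend_scalars R K \<iota> M =
    (let A = ring_as_module K \<iota>; T = tensor R A M in
      \<lparr>carrier = carrier T, monoid.mult = undefined, one = undefined,
       zero = \<zero>\<^bsub>T\<^esub>, add = (\<oplus>\<^bsub>T\<^esub>),
       smult = (\<lambda>k. tensor_map R A M (\<lambda>k'. k \<otimes>\<^bsub>K\<^esub> k') (\<lambda>m. m)),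
       act = (\<lambda>g. tensor_map R A M (\<lambda>k. k) (act M g))\<rparr>)"

text \<open>\<open>M\<close> is an \<open>R\<close>-form of the module \<open>V\<close> over the group ring of \<open>G\<close> over \<open>K\<close>.\<close>

definition is_form :: "('r, 'a) ring_scheme \<Rightarrow> ('k, 'c) ring_scheme \<Rightarrow> ('r \<Rightarrow> 'k) \<Rightarrow>
    ('g, 'd) monoid_scheme \<Rightarrow> ('r, 'm, 'g, 'b) gmodule_scheme \<Rightarrow>
    ('k, 'v, 'g, 'e) gmodule_scheme \<Rightarrow> bool"
  where "is_form R K \<iota> G M V \<longleftrightarrow>
    group_module R G M \<and> finitely_generated R M \<and> is_free R M \<and>
    gmodule_isomorphic K G (extend_scalars R K \<iota> M) V"


section \<open>Exterior squares and Specht lattices\<close>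

definition alternating_ker :: "('r, 'a) ring_scheme \<Rightarrow> ('r, 'm, 'b) module_scheme \<Rightarrow>
    ('m \<times> 'm \<Rightarrow> 'r) set set"
  where "alternating_ker R M = module_span R (tensor R M M) {pure_tensor R M M x x | x. x \<in> carrier M}"

text \<open>
  The exterior square \<open>(M \<otimes>\<^sub>R M) / \<langle>x \<otimes> x\<rangle>\<close>, with the diagonal action.
\<close>

definition ext_square :: "('r, 'a) ring_scheme \<Rightarrow> ('r, 'm, 'g, 'b) gmodule_scheme \<Rightarrow>
    ('r, ('m \<times> 'm \<Rightarrow> 'r) set set, 'g) gmodule"
  where "ext_square R M =
    with_action (quot_module (tensor R M M) (alternating_ker R M))
      (\<lambda>g. quot_map (tensor R M M) (alternating_ker R M) (tensor_map R M M (act M g) (act M g)))"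

text \<open>
  The natural permutation lattice \<open>M\<^bsup>(n-1,1)\<^esup>\<close>. Permuting the basis by \<open>\<sigma>\<close> turns
  \<open>\<Sum>i. a i \<cdot> i\<close> into \<open>\<Sum>i. a i \<cdot> \<sigma> i = \<Sum>j. a (\<sigma>\<^sup>-\<^sup>1 j) \<cdot> j\<close>.
\<close>

definition perm_lattice :: "('r, 'a) ring_scheme \<Rightarrow> nat \<Rightarrow> ('r, nat \<Rightarrow> 'r, nat \<Rightarrow> nat) gmodule"
  where "perm_lattice R n =
    with_action (free_module R {1..n}) (\<lambda>\<sigma> a j. a (Hilbert_Choice.inv \<sigma> j))"

text \<open>\<open>S\<^bsup>(n-1,1)\<^esup>\<close>\<close>

definition natural_specht :: "('r, 'a) ring_scheme \<Rightarrow> nat \<Rightarrow> ('r, nat \<Rightarrow> 'r, nat \<Rightarrow> nat) gmodule"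
  where "natural_specht R n =
    restrict_to (perm_lattice R n)
      {a \<in> carrier (perm_lattice R n). (\<Oplus>\<^bsub>R\<^esub>i\<in>{1..n}. a i) = \<zero>\<^bsub>R\<^esub>}"

text \<open>\<open>S\<^bsup>(n-2,1\<^sup>2)\<^esup>\<close>, identified with the exterior square of \<open>S\<^bsup>(n-1,1)\<^esup>\<close>\<close>

definition hook_specht :: "('r, 'a) ring_scheme \<Rightarrow> nat \<Rightarrow>
    ('r, ((nat \<Rightarrow> 'r) \<times> (nat \<Rightarrow> 'r) \<Rightarrow> 'r) set set, nat \<Rightarrow> nat) gmodule"
  where "hook_specht R n = ext_square R (natural_specht R n)"

definition is_lattice_chain :: "nat \<Rightarrow>
    ((nat \<Rightarrow> padic2) \<times> (nat \<Rightarrow> padic2) \<Rightarrow> padic2) set set set list \<Rightarrow> bool"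
  where "is_lattice_chain n T \<longleftrightarrow>
    (let S = hook_specht Z2 n in
      length T = 5 \<and>
      T ! 0 = carrier S \<and>
      T ! 4 = {2 \<odot>\<^bsub>S\<^esub> x | x. x \<in> carrier S} \<and>
      (\<forall>i<5. gsubmodule Z2 (sym_group n) S (T ! i)) \<and>
      (\<forall>i\<in>{1..4}. maximal_gsubmodule Z2 (sym_group n) (restrict_to S (T ! (i - 1))) (T ! i)))"

end

theory Submission
  imports Defs "HOL-Library.Z2" "HOL-Library.Function_Algebras"
begin

text \<open>
  The exterior square of the natural Specht lattice is the lattice of alternating \<open>n \<times> n\<close> matrices
  with vanishing row sums. Modulo 2 such a matrix is an even graph on \<open>{1..n}\<close>, and applying
  \<open>1 + (i j)\<close> repeatedly to a graph produces 4-cycles or cuts. Hence the only submodules modulo 2 are: all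
  even graphs, those with an even number of edges, the cuts and their complements, the cuts, and 0.

  Let \<open>L\<close> be a lattice and \<open>T\<^sub>i\<close> the smallest term of the chain containing it, \<open>i < 4\<close>; then the reductions of
  \<open>L\<close> and \<open>T\<^sub>i\<close> coincide. For \<open>i > 0\<close> a sum of conjugates of an element of \<open>L\<close> is found that equals \<open>2 X\<close> with
  \<open>X\<close> outside \<open>T\<^sub>1\<close>. Hence \<open>L\<close> contains \<open>2 S\<close> by Nakayama's lemma, and \<open>L = T\<^sub>i\<close>.

  Every form embeds into \<open>S\<close> after clearing denominators, and after dividing by a power of 2 its image
  is not contained in \<open>2 S\<close>. Isomorphisms between lattices are scalars, as they preserve the
  line of the sign eigenvectors of the symmetric group on \<open>{1, 2, 3}\<close> fixed by the symmetric group on \<open>{4..n}\<close>.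
\<close>

section \<open>Parity of 2-adic integers\<close>

text \<open>Reduction modulo 2 sees \<open>L\<close> only up to \<open>2 S\<close>, so it cannot
  show that \<open>2 S\<close> lies in \<open>L\<close>; of the elements of \<open>L\<close>,
  however, nothing but residues is known. The way out is that \<open>T\<^sub>1\<close> is the only
  maximal sublattice of \<open>S\<close>: one element \<open>2 X\<close> of \<open>L\<close> with
  \<open>X\<close> odd, meaning an odd number of odd entries above the diagonal, already generates
  \<open>2 S\<close>. The unknown part of a lift changes the parity of \<open>X\<close> by an
  unknown bit. For \<open>T\<^sub>1\<close> and \<open>T\<^sub>3\<close> two relations of different
  parity are kept ready to meet either value; for \<open>T\<^sub>2\<close> the parity of
  \<open>X\<close> is read off from the lift itself. The congruence of \<open>n\<close> acts in
  three ways: \<open>n\<close> even ties the size of a cut to its complementation bit,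
  \<open>n choose 2\<close> odd puts complements of cuts into \<open>T\<^sub>1\<close>, and
  \<open>n div 2\<close> odd makes the vertex pairs an odd number of conjugates. Matrices replace
  the exterior square because in a quotient of a quotient vanishing and membership cannot be read
  off.\<close>

lift_definition parity :: "padic2 \<Rightarrow> bit" is "\<lambda>x. of_int (x 1)" .

lemma of_int_bit_mod2: "(of_int (a mod 2) :: bit) = of_int a"
proof -
  have "(of_int a :: bit) = of_int (a mod 2 + 2 * (a div 2))" by simp
  also have "\<dots> = of_int (a mod 2)" by (simp only: of_int_add of_int_mult) simp
  finally show ?thesis by simp
qed

lemma parity_add: "parity (x + y) = parity x + parity y"
  by transfer (simp add: of_int_bit_mod2)

lemma parity_minus: "parity (- x) = - parity x"
  by transfer (simp add: of_int_bit_mod2)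

lemma parity_mult: "parity (x * y) = parity x * parity y"
  by transfer (simp add: of_int_bit_mod2)

lemma parity_0: "parity 0 = 0"
  by transfer simp

lemma parity_1: "parity 1 = 1"
  by transfer simp

lemma parity_diff: "parity (x - y) = parity x - parity y"
  by (simp only: diff_conv_add_uminus parity_add parity_minus)

lemma parity_sum: "parity (sum f A) = (\<Sum>x\<in>A. parity (f x))"
  by (induction A rule: infinite_finite_induct) (auto simp: parity_0 parity_add)

lemma parity_2: "parity 2 = 0"
  by (simp only: one_add_one[symmetric] parity_add parity_1) simp

lemmas parity_simps = parity_add parity_minus parity_mult parity_0 parity_1 parity_diff parity_sum parity_2

lemma two_neq_0: "(2 :: padic2) \<noteq> 0"
proof
  assume "(2 :: padic2) = 0"
  then have "(1 :: padic2) + 1 = 0" by simp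
  then show False
    by transfer (auto dest: fun_cong[where x = 2])
qed

lemma parity_eq_0D:
  assumes "parity x = 0" obtains y where "x = 2 * y"
proof -
  have "\<exists>y. x = y + y"
    using assms
  proof transfer
    fix x :: "nat \<Rightarrow> int"
    assume x: "coherent x" and "(of_int (x 1) :: bit) = 0"
    moreover have "x 1 = 0 \<or> x 1 = 1" using coherentD(1,2)[OF x, of 1] by auto
    ultimately have x1: "x 1 = 0" by auto
    have ev: "2 dvd x (Suc k)" for k
      using coherent_mod[OF x, of 1 k] x1 by (auto simp: dvd_eq_mod_eq_0)
    \<comment> \<open>Halving costs one binary digit, so the residue of \<open>y\<close> modulo
      \<open>2 ^ k\<close> is taken from the residue of \<open>x\<close> modulo
      \<open>2 ^ Suc k\<close>.\<close>
    define y where "y = (\<lambda>k. x (Suc k) div 2)"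
    have y2: "2 * y k = x (Suc k)" for k
      using ev[of k] by (simp add: y_def)
    have "coherent y"
      unfolding coherent_def
    proof (intro allI conjI)
      fix k
      show "y k \<in> {0..<2 ^ k}"
        using coherentD(1,2)[OF x, of "Suc k"] y2[of k] by auto
      have "2 * (y (Suc k) mod 2 ^ k) = (2 * y (Suc k)) mod (2 * 2 ^ k)"
        by (rule mult_mod_right)
      also have "\<dots> = 2 * y k"
        unfolding y2 using coherentD(4)[OF x, of "Suc k"] by simp
      finally show "y (Suc k) mod 2 ^ k = y k" by linarith
    qed
    moreover have "x = (\<lambda>k. (y k + y k) mod 2 ^ k)"
      unfolding mult_2[symmetric] y2 coherentD(4)[OF x] ..
    ultimately show "\<exists>y\<in>Collect coherent. x = (\<lambda>k. (y k + y k) mod 2 ^ k)" by blast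
  qed
  then show ?thesis using that by (auto simp flip: mult_2)
qed

text \<open>The number \<open>x ^ 2 ^ Suc k - 1\<close> has the factors \<open>x ^ 2 ^ k - 1\<close>
  and \<open>x ^ 2 ^ k + 1\<close>, and the second one is even. This provides inverses modulo powers
  of 2.\<close>

lemma odd_power_cong: "odd (x :: int) \<Longrightarrow> 2 ^ Suc k dvd x ^ (2 ^ k) - 1"
proof (induction k)
  case 0
  then show ?case by simp
next
  case (Suc k)
  then obtain m where m: "x ^ (2 ^ k) - 1 = 2 ^ Suc k * m" by (auto elim: dvdE)
  have "x ^ (2 ^ Suc k) - 1 = (x ^ (2 ^ k) - 1) * (x ^ (2 ^ k) + 1)"
    by (simp add: power_mult[symmetric] algebra_simps power2_eq_square power_mult)
  moreover have "2 dvd x ^ (2 ^ k) + 1" using Suc.prems by simp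
  moreover have "2 ^ Suc k dvd x ^ (2 ^ k) - 1" using Suc by simp
  ultimately show ?case by (metis mult_dvd_mono power_Suc2)
qed

text \<open>The inverse modulo \<open>2 ^ k\<close> is \<open>x ^ (2 ^ k - 1)\<close>. These
  residues are coherent because the next exponent is larger by \<open>2 ^ k\<close>, and the
  \<open>2 ^ k\<close>-th power of an odd number is 1 modulo \<open>2 ^ k\<close>.\<close>

lemma parity_1_unit:
  assumes "parity x = 1" obtains y where "x * y = 1"
proof -
  have "\<exists>y. x * y = 1"
    using assms
  proof transfer
    fix x :: "nat \<Rightarrow> int"
    assume x: "coherent x" and "(of_int (x 1) :: bit) = 1"
    moreover have "x 1 = 0 \<or> x 1 = 1" using coherentD(1,2)[OF x, of 1] by auto
    ultimately have x1: "x 1 = 1" by auto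
    have od: "odd (x (Suc k))" for k
      using coherent_mod[OF x, of 1 k] x1 by (auto simp: odd_iff_mod_2_eq_one)
    have one: "x (Suc k) ^ (2 ^ k) mod 2 ^ k = 1 mod 2 ^ k" for k
      using odd_power_cong[OF od[of k], of k] by (meson dvd_trans le_imp_power_dvd lessI less_imp_le mod_eq_dvd_iff)
    have one': "x k ^ (2 ^ k) mod 2 ^ k = 1 mod 2 ^ k" for k
      using one[of k] coherentD(4)[OF x, of k] by (metis power_mod)
    define y where "y = (\<lambda>k. x k ^ (2 ^ k - 1) mod 2 ^ k)"
    have "coherent y"
      unfolding y_def
    proof (rule coherentI)
      fix k
      have e: "(2::nat) ^ Suc k - 1 = (2 ^ k - 1) + 2 ^ k" by simp
      have "x (Suc k) ^ (2 ^ Suc k - 1) mod 2 ^ k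
          = (x (Suc k) ^ (2 ^ k - 1) * (x (Suc k) ^ 2 ^ k mod 2 ^ k)) mod 2 ^ k"
        unfolding e power_add by (simp add: mod_simps)
      also have "\<dots> = x (Suc k) ^ (2 ^ k - 1) mod 2 ^ k"
        unfolding one by (simp add: mod_simps del: one_mod_2_pow_eq)
      also have "\<dots> = x k ^ (2 ^ k - 1) mod 2 ^ k"
        using coherentD(4)[OF x, of k] by (metis power_mod)
      finally show "x (Suc k) ^ (2 ^ Suc k - 1) mod 2 ^ k = x k ^ (2 ^ k - 1) mod 2 ^ k" .
    qed
    moreover have "(\<lambda>k. x k * y k mod 2 ^ k) = (\<lambda>k. 1 mod 2 ^ k)"
    proof
      fix k
      have "x k * y k mod 2 ^ k = x k ^ (Suc (2 ^ k - 1)) mod 2 ^ k"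
        unfolding power_Suc by (simp add: y_def mod_simps)
      then show "x k * y k mod 2 ^ k = 1 mod 2 ^ k" using one'[of k] by simp
    qed
    ultimately show "\<exists>y\<in>Collect coherent. (\<lambda>k. x k * y k mod 2 ^ k) = (\<lambda>k. 1 mod 2 ^ k)" by blast
  qed
  then show ?thesis using that by blast
qed

text \<open>The induction runs over an index with nonzero residue, which each division by 2 lowers
  by one. The exponent \<open>k\<close> is the 2-adic valuation.\<close>

lemma padic2_factor:
  assumes "x \<noteq> 0" obtains k u where "x = 2 ^ k * u" "parity u = 1"
proof -
  have "\<exists>k u. x = 2 ^ k * u \<and> parity u = 1" if "Rep_padic2 x j \<noteq> 0" for j
    using that
  proof (induction j arbitrary: x)
    case 0
    then show ?case using Rep_padic2[of x] coherentD(1,2)[of "Rep_padic2 x" 0] by simp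
  next
    case (Suc j)
    show ?case
    proof (cases "parity x = 0")
      case True
      then obtain y where y: "x = 2 * y" by (rule parity_eq_0D)
      have c: "coherent (Rep_padic2 y)" using Rep_padic2[of y] by simp
      have "Rep_padic2 x (Suc j) = (Rep_padic2 y (Suc j) + Rep_padic2 y (Suc j)) mod 2 ^ Suc j"
        by (simp only: y mult_2 plus_padic2.rep_eq)
      then have "Rep_padic2 x (Suc j) = 2 * (Rep_padic2 y (Suc j) mod 2 ^ j)"
        unfolding mult_2[symmetric] power_Suc mult_mod_right .
      then have "Rep_padic2 y j \<noteq> 0"
        using Suc.prems coherentD(4)[OF c] by simp
      then obtain k u where "y = 2 ^ k * u" "parity u = 1" using Suc.IH by blast
      then have "x = 2 ^ Suc k * u" using y by (simp add: mult.assoc)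
      then show ?thesis using \<open>parity u = 1\<close> by blast
    next
      case False
      then show ?thesis by (intro exI[of _ 0] exI[of _ x]) simp
    qed
  qed
  moreover have "\<exists>j. Rep_padic2 x j \<noteq> 0"
    using assms by (metis Rep_padic2_inject zero_padic2.rep_eq ext)
  ultimately show ?thesis using that by blast
qed

section \<open>The 2-adic integers inside the 2-adic numbers\<close>

lemma Z2_in_Q2_simps:
  "Z2_in_Q2 (x + y) = Z2_in_Q2 x + Z2_in_Q2 y"
  "Z2_in_Q2 (x * y) = Z2_in_Q2 x * Z2_in_Q2 y"
  "Z2_in_Q2 (- x) = - Z2_in_Q2 x"
  "Z2_in_Q2 0 = 0" "Z2_in_Q2 1 = 1"
  by (simp_all add: Z2_in_Q2_def One_fract_def Zero_fract_def)

lemma Z2_in_Q2_power: "Z2_in_Q2 (x ^ k) = Z2_in_Q2 x ^ k"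
  by (induction k) (simp_all add: Z2_in_Q2_simps)

lemma Z2_in_Q2_2: "Z2_in_Q2 2 = 2"
  by (simp only: one_add_one[symmetric] Z2_in_Q2_simps)

lemma Z2_in_Q2_sum: "Z2_in_Q2 (sum f A) = (\<Sum>x\<in>A. Z2_in_Q2 (f x))"
  by (induction A rule: infinite_finite_induct) (auto simp: Z2_in_Q2_simps)

lemma Z2_in_Q2_inject: "Z2_in_Q2 x = Z2_in_Q2 y \<longleftrightarrow> x = y"
  by (simp add: Z2_in_Q2_def eq_fract)

lemma two_neq_0_Q2: "(2 :: padic2 fract) \<noteq> 0"
  using two_neq_0 by (metis Z2_in_Q2_2 Z2_in_Q2_inject Z2_in_Q2_simps(4))

text \<open>A denominator is a power of 2 times a unit, so only the power of 2 has to be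
  cleared.\<close>

lemma Q2_clear_denominator:
  obtains k x where "2 ^ k * q = Z2_in_Q2 x"
proof -
  obtain a b where q: "q = Fract a b" "b \<noteq> 0" by (cases q) auto
  obtain k u where b: "b = 2 ^ k * u" "parity u = 1" using padic2_factor[OF q(2)] .
  obtain v where v: "u * v = 1" using parity_1_unit[OF b(2)] .
  have "2 ^ k * q = Z2_in_Q2 (2 ^ k) * q"
    by (simp add: Z2_in_Q2_power Z2_in_Q2_2)
  also have "\<dots> = Z2_in_Q2 (a * v)"
    using q b v by (simp add: Z2_in_Q2_def eq_fract) (metis mult.left_commute mult.right_neutral)
  finally show ?thesis using that by blast
qed

section \<open>Alternating matrices with vanishing row sums\<close>

definition sc :: "'r::times \<Rightarrow> ('x \<Rightarrow> 'r) \<Rightarrow> 'x \<Rightarrow> 'r"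
  where "sc c f = (\<lambda>x. c * f x)"

lemma sc_apply [simp]: "sc c f x = c * f x"
  by (simp add: sc_def)

lemma sc_add: "sc (c :: 'r::semiring) (f + g) = sc c f + sc c g"
  by (simp add: fun_eq_iff distrib_left)

lemma sc_sc: "sc (c :: 'r::semigroup_mult) (sc d f) = sc (c * d) f"
  by (simp add: fun_eq_iff mult.assoc)

lemma sc_1: "sc (1 :: 'r::monoid_mult) f = f"
  by (simp add: fun_eq_iff)

lemma sc_minus_1: "sc (- 1 :: 'r::ring_1) f = - f"
  by (simp add: fun_eq_iff)

lemma sc_0_left: "sc (0 :: 'r::mult_zero) f = 0"
  by (simp add: fun_eq_iff)

lemma sc_0_right: "sc (c :: 'r::mult_zero) 0 = 0"
  by (simp add: fun_eq_iff)

lemma sum_fun_apply: "(sum F X) x = (\<Sum>i\<in>X. F i x)"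
  for F :: "'i \<Rightarrow> 'x \<Rightarrow> 'r::comm_monoid_add"
  by (induction X rule: infinite_finite_induct) auto

lemma sc_sum: "sc (c :: 'r::semiring_0) (sum F X) = (\<Sum>i\<in>X. sc c (F i))"
  by (simp add: fun_eq_iff sum_fun_apply sum_distrib_left)

type_synonym 'r mat = "nat \<times> nat \<Rightarrow> 'r"

text \<open>The zero diagonal is a condition of its own since over \<open>bit\<close> skew-symmetry
  is mere symmetry. The ring is left open because the same matrices occur over
  \<open>padic2\<close>, its fraction field and \<open>bit\<close>.\<close>

definition alt :: "nat \<Rightarrow> 'r::comm_ring_1 mat set"
  where "alt n = {A. (\<forall>i j. A (i, j) \<noteq> 0 \<longrightarrow> i \<in> {1..n} \<and> j \<in> {1..n}) \<and>
    (\<forall>i j. A (j, i) = - A (i, j)) \<and> (\<forall>i. A (i, i) = 0) \<and> (\<forall>i. (\<Sum>j\<in>{1..n}. A (i, j)) = 0)}"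

lemma altD:
  assumes "A \<in> alt n"
  shows "i \<notin> {1..n} \<Longrightarrow> A (i, j) = 0" "j \<notin> {1..n} \<Longrightarrow> A (i, j) = 0"
    and "A (j, i) = - A (i, j)" "A (i, i) = 0" "(\<Sum>j\<in>{1..n}. A (i, j)) = 0"
proof -
  note * = assms[unfolded alt_def mem_Collect_eq]
  show "A (j, i) = - A (i, j)" "A (i, i) = 0" "(\<Sum>j\<in>{1..n}. A (i, j)) = 0"
    using * by blast+
  show "i \<notin> {1..n} \<Longrightarrow> A (i, j) = 0" "j \<notin> {1..n} \<Longrightarrow> A (i, j) = 0"
    using * by blast+
qed

lemma altI:
  assumes "\<And>i j. i \<notin> {1..n} \<or> j \<notin> {1..n} \<Longrightarrow> A (i, j) = 0"
    and "\<And>i j. A (j, i) = - A (i, j)" "\<And>i. A (i, i) = 0"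
    and "\<And>i. i \<in> {1..n} \<Longrightarrow> (\<Sum>j\<in>{1..n}. A (i, j)) = 0"
  shows "A \<in> alt n"
proof -
  have "(\<Sum>j\<in>{1..n}. A (i, j)) = 0" for i
    using assms(1,4) by (cases "i \<in> {1..n}") (auto intro!: sum.neutral)
  moreover have "i \<in> {1..n} \<and> j \<in> {1..n}" if "A (i, j) \<noteq> 0" for i j
    using that assms(1) by blast
  ultimately show ?thesis
    using assms(2,3) unfolding alt_def by blast
qed

lemma alt_zero: "0 \<in> alt n"
  by (rule altI) simp_all

lemma alt_add: "A \<in> alt n \<Longrightarrow> B \<in> alt n \<Longrightarrow> A + B \<in> alt n"
proof (rule altI)
  assume A: "A \<in> alt n" and B: "B \<in> alt n"
  show "(A + B) (j, i) = - (A + B) (i, j)" for i j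
    unfolding plus_fun_apply altD(3)[OF A, of j i] altD(3)[OF B, of j i] by simp
qed (auto simp: altD(1,2,4) altD(5)[simplified] sum.distrib simp del: atLeastAtMost_iff)

lemma alt_sc: "A \<in> alt n \<Longrightarrow> sc c A \<in> alt n"
proof (rule altI)
  assume A: "A \<in> alt n"
  show "sc c A (j, i) = - sc c A (i, j)" for i j
    unfolding sc_apply altD(3)[OF A, of j i] by simp
qed (auto simp: altD(1,2,4) altD(5)[simplified] simp del: atLeastAtMost_iff simp flip: sum_distrib_left)

lemma alt_uminus: "A \<in> alt n \<Longrightarrow> - A \<in> alt n"
  using alt_sc[of A n "-1"] by (simp add: sc_minus_1)

lemma alt_diff: "A \<in> alt n \<Longrightarrow> B \<in> alt n \<Longrightarrow> A - B \<in> alt n"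
  using alt_add[of A n "- B"] alt_uminus[of B n] by simp

lemma alt_sum: "(\<And>i. i \<in> X \<Longrightarrow> F i \<in> alt n) \<Longrightarrow> sum F X \<in> alt n"
  by (induction X rule: infinite_finite_induct) (auto intro: alt_zero alt_add)

text \<open>Positions of the free entries of an alternating matrix with vanishing row sums; their
  number \<open>(n - 1) choose 2\<close> is the rank of the lattice.\<close>

definition ind_less :: "nat \<Rightarrow> (nat \<times> nat) set"
  where "ind_less n = {(k, l). 1 \<le> k \<and> k < l \<and> l < n}"

lemma finite_ind_less: "finite (ind_less n)"
  by (rule finite_subset[of _ "{..n} \<times> {..n}"]) (auto simp: ind_less_def)

lemma alt_eq_0I:
  assumes A: "A \<in> alt n" and z: "\<And>i j. 1 \<le> i \<Longrightarrow> i < j \<Longrightarrow> j < n \<Longrightarrow> A (i, j) = 0"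
  shows "A = 0"
proof -
  have 1: "A (i, j) = 0" if "i \<in> {1..<n}" "j \<in> {1..<n}" for i j
  proof (cases i j rule: linorder_cases)
    case less
    then show ?thesis using z that by simp
  next
    case equal
    then show ?thesis using altD(4)[OF A] by simp
  next
    case greater
    then show ?thesis using z[of j i] that altD(3)[OF A, of i j] by simp
  qed
  have 2: "A (i, n) = 0" if "i \<in> {1..<n}" for i
  proof -
    have "{1..n} = insert n {1..<n}" using that by auto
    then have "(\<Sum>j\<in>{1..n}. A (i, j)) = A (i, n) + (\<Sum>j\<in>{1..<n}. A (i, j))" by simp
    then show ?thesis using altD(5)[OF A, of i] 1 that by simp
  qed
  have "A (i, j) = 0" for i j
  proof (cases "i \<in> {1..n} \<and> j \<in> {1..n}")
    case True
    consider "i < n" "j < n" | "i < n" "j = n" | "i = n" "j < n" | "i = n" "j = n"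
      using True by fastforce
    then show ?thesis
      using True 1[of i j] 2[of i] 2[of j] altD(3)[OF A, of i j] altD(4)[OF A] by cases auto
  qed (use altD(1,2)[OF A] in blast)
  then show ?thesis by (simp add: fun_eq_iff)
qed

lemma alt_eqI:
  assumes "A \<in> alt n" "B \<in> alt n" "\<And>i j. 1 \<le> i \<Longrightarrow> i < j \<Longrightarrow> j < n \<Longrightarrow> A (i, j) = B (i, j)"
  shows "A = B"
  using alt_eq_0I[OF alt_diff[OF assms(1,2)]] assms(3) by simp

text \<open>The matrix \<open>x y\<^sup>T - y x\<^sup>T\<close>, which represents the wedge of
  \<open>x\<close> and \<open>y\<close> when the exterior square is identified with
  \<open>alt n\<close>.\<close>

definition wedge :: "(nat \<Rightarrow> 'r) \<Rightarrow> (nat \<Rightarrow> 'r) \<Rightarrow> 'r::comm_ring_1 mat"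
  where "wedge x y = (\<lambda>(i, j). x i * y j - x j * y i)"

lemma wedge_apply: "wedge x y (i, j) = x i * y j - x j * y i"
  by (simp add: wedge_def)

lemma wedge_bilinear:
  "wedge (x + x') y = wedge x y + wedge x' y" "wedge x (y + y') = wedge x y + wedge x y'"
  "wedge (x - x') y = wedge x y - wedge x' y" "wedge x (y - y') = wedge x y - wedge x y'"
  "wedge (- x) y = - wedge x y" "wedge x (- y) = - wedge x y"
  "wedge (sc c x) y = sc c (wedge x y)" "wedge x (sc c y) = sc c (wedge x y)"
  "wedge 0 y = 0" "wedge x 0 = 0"
  by (auto simp: fun_eq_iff wedge_def algebra_simps)

lemma wedge_sum_left: "wedge (sum F X) y = (\<Sum>i\<in>X. wedge (F i) y)"
  by (induction X rule: infinite_finite_induct)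
    (simp_all only: sum.infinite sum.empty sum.insert wedge_bilinear not_False_eq_True)

lemma wedge_self: "wedge x x = 0"
  by (auto simp: fun_eq_iff wedge_def mult.commute)

lemma wedge_swap: "wedge y x = - wedge x y"
  by (auto simp: fun_eq_iff wedge_def mult.commute)

text \<open>The carrier of the natural Specht lattice, freed from its module record.\<close>

definition sum0 :: "nat \<Rightarrow> (nat \<Rightarrow> 'r::comm_ring_1) set"
  where "sum0 n = {x. (\<forall>i. x i \<noteq> 0 \<longrightarrow> i \<in> {1..n}) \<and> (\<Sum>i\<in>{1..n}. x i) = 0}"

lemma zsD: "x \<in> sum0 n \<Longrightarrow> i \<notin> {1..n} \<Longrightarrow> x i = 0"
  unfolding sum0_def by blast

lemma wedge_alt:
  assumes "x \<in> sum0 n" "y \<in> sum0 n"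
  shows "wedge x y \<in> alt n"
proof (rule altI)
  show "wedge x y (i, j) = 0" if "i \<notin> {1..n} \<or> j \<notin> {1..n}" for i j
  proof -
    have "x i * y j = 0" "x j * y i = 0"
      using zsD[OF assms(1)] zsD[OF assms(2)] that mult_zero_left mult_zero_right by metis+
    then show ?thesis by (simp add: wedge_def)
  qed
next
  show "(\<Sum>j = 1..n. wedge x y (i, j)) = 0" for i
    using assms by (simp add: wedge_def sum0_def sum_subtractf flip: sum_distrib_left sum_distrib_right)
qed (simp_all add: wedge_def mult.commute)

definition uvec :: "nat \<Rightarrow> nat \<Rightarrow> 'r::comm_ring_1"
  where "uvec i = (\<lambda>j. if j = i then 1 else 0)"

lemma uvec_diff_sum0: "i \<in> {1..n} \<Longrightarrow> j \<in> {1..n} \<Longrightarrow> uvec i - uvec j \<in> sum0 n"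
  by (auto simp: sum0_def uvec_def sum_subtractf split: if_splits)

lemma sum0_add: "x \<in> sum0 n \<Longrightarrow> y \<in> sum0 n \<Longrightarrow> x + y \<in> sum0 n"
  by (auto simp: sum0_def sum.distrib) (metis add.right_neutral add_0)+

lemma sum0_zero: "0 \<in> sum0 n"
  by (simp add: sum0_def)

lemma sum0_sc: "x \<in> sum0 n \<Longrightarrow> sc c x \<in> sum0 n"
proof -
  assume x: "x \<in> sum0 n"
  have "i \<in> {1..n}" if "sc c x i \<noteq> 0" for i
    using that zsD[OF x, of i] by fastforce
  moreover have "(\<Sum>i\<in>{1..n}. sc c x i) = 0"
    using x unfolding sum0_def sc_apply sum_distrib_left[symmetric] by simp
  ultimately show ?thesis unfolding sum0_def by blast
qed

lemma sum0_sum: "(\<And>i. i \<in> X \<Longrightarrow> F i \<in> sum0 n) \<Longrightarrow> sum F X \<in> sum0 n"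
  by (induction X rule: infinite_finite_induct) (auto intro: sum0_zero sum0_add)

lemma sum0_expand:
  assumes "x \<in> sum0 n"
  shows "x = (\<Sum>i\<in>{1..<n}. sc (x i) (uvec i - uvec n))"
proof (cases "n = 0")
  case True
  then show ?thesis using assms by (auto simp: sum0_def fun_eq_iff)
next
  case False
  then have n: "{1..n} = insert n {1..<n}" by auto
  then have s: "x n = - (\<Sum>i\<in>{1..<n}. x i)"
    using assms by (simp add: sum0_def eq_neg_iff_add_eq_0)
  show ?thesis
  proof
    fix j
    have "(\<Sum>i\<in>{1..<n}. sc (x i) (uvec i - uvec n)) j
        = (\<Sum>i\<in>{1..<n}. x i * uvec i j) - (\<Sum>i\<in>{1..<n}. x i) * uvec n j"
      unfolding sum_fun_apply sc_apply minus_apply right_diff_distrib sum_subtractf sum_distrib_right ..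
    also have "(\<Sum>i\<in>{1..<n}. x i * uvec i j) = (if j \<in> {1..<n} then x j else 0)"
      by (simp add: uvec_def if_distrib[of "\<lambda>y. _ * y"] sum.delta cong: if_cong)
    finally have *: "(\<Sum>i\<in>{1..<n}. sc (x i) (uvec i - uvec n)) j
        = (if j \<in> {1..<n} then x j else 0) - (\<Sum>i\<in>{1..<n}. x i) * uvec n j" .
    consider "j \<in> {1..<n}" | "j = n" | "j \<notin> {1..n}" by fastforce
    then show "x j = (\<Sum>i\<in>{1..<n}. sc (x i) (uvec i - uvec n)) j"
    proof cases
      case 2
      then show ?thesis unfolding * using s by (simp add: uvec_def)
    next
      case 3
      then have "x j = 0" using assms by (auto simp: sum0_def)
      then show ?thesis unfolding * using 3 False by (auto simp: uvec_def)
    qed (unfold *, simp add: uvec_def)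
  qed
qed

text \<open>
  The wedges \<open>(i - k) \<and> (j - k)\<close>, viewed as oriented triangles.
\<close>

definition tri :: "nat \<Rightarrow> nat \<Rightarrow> nat \<Rightarrow> 'r::comm_ring_1 mat"
  where "tri i j k = wedge (uvec i - uvec k) (uvec j - uvec k)"

lemma tri_alt: "\<lbrakk>i \<in> {1..n}; j \<in> {1..n}; k \<in> {1..n}\<rbrakk> \<Longrightarrow> tri i j k \<in> alt n"
  unfolding tri_def by (intro wedge_alt uvec_diff_sum0)

text \<open>
  Row sums zero make an alternating matrix determined by its entries above the diagonal off the
  last column, so the triangles through the vertex \<open>n\<close> form a basis.
\<close>

lemma alt_expand:
  assumes "A \<in> alt n"
  shows "A = (\<Sum>(k, l)\<in>ind_less n. sc (A (k, l)) (tri k l n))"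
proof (rule alt_eqI[OF assms])
  show "(\<Sum>(k, l)\<in>ind_less n. sc (A (k, l)) (tri k l n)) \<in> alt n"
    by (rule alt_sum) (auto simp: ind_less_def intro!: alt_sc tri_alt)
  fix i j :: nat
  assume ij: "1 \<le> i" "i < j" "j < n"
  have "(\<Sum>(k, l)\<in>ind_less n. sc (A (k, l)) (tri k l n)) (i, j)
      = (\<Sum>p\<in>ind_less n. if p = (i, j) then A p else 0)"
    unfolding sum_fun_apply
    by (rule sum.cong) (use ij in \<open>auto simp: ind_less_def tri_def wedge_def uvec_def split: if_splits\<close>)
  also have "\<dots> = A (i, j)"
    using ij by (simp add: sum.delta[OF finite_ind_less]) (simp add: ind_less_def)
  finally show "A (i, j) = (\<Sum>(k, l)\<in>ind_less n. sc (A (k, l)) (tri k l n)) (i, j)" ..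
qed

section \<open>The symmetric group acting on vectors and matrices\<close>

definition vact :: "(nat \<Rightarrow> nat) \<Rightarrow> (nat \<Rightarrow> 'r) \<Rightarrow> nat \<Rightarrow> 'r"
  where "vact \<sigma> a = (\<lambda>j. a (Hilbert_Choice.inv \<sigma> j))"

definition pact :: "(nat \<Rightarrow> nat) \<Rightarrow> 'r mat \<Rightarrow> 'r mat"
  where "pact \<sigma> A = (\<lambda>(i, j). A (Hilbert_Choice.inv \<sigma> i, Hilbert_Choice.inv \<sigma> j))"

lemma pact_linear:
  "pact \<sigma> (A + B) = pact \<sigma> A + pact \<sigma> B" "pact \<sigma> (A - B) = pact \<sigma> A - pact \<sigma> B"
  "pact \<sigma> (- A) = - pact \<sigma> A" "pact \<sigma> (sc c A) = sc c (pact \<sigma> A)" "pact \<sigma> 0 = 0"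
  for A B :: "'r::comm_ring_1 mat"
  by (auto simp: pact_def fun_eq_iff)

lemma vact_linear:
  "vact \<sigma> (x + y) = vact \<sigma> x + vact \<sigma> y" "vact \<sigma> (x - y) = vact \<sigma> x - vact \<sigma> y"
  "vact \<sigma> (- x) = - vact \<sigma> x" "vact \<sigma> (sc c x) = sc c (vact \<sigma> x)" "vact \<sigma> 0 = 0"
  for x y :: "nat \<Rightarrow> 'r::comm_ring_1"
  by (auto simp: vact_def fun_eq_iff)

lemma vact_sum: "vact \<sigma> (sum F X) = (\<Sum>i\<in>X. vact \<sigma> (F i :: nat \<Rightarrow> 'r::comm_ring_1))"
  by (simp add: vact_def fun_eq_iff sum_fun_apply)

lemma pact_wedge: "pact \<sigma> (wedge x y) = wedge (vact \<sigma> x) (vact \<sigma> y)"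
  by (simp add: pact_def vact_def wedge_def fun_eq_iff)

lemma vact_uvec: "\<sigma> permutes S \<Longrightarrow> vact \<sigma> (uvec i) = uvec (\<sigma> i)"
  by (auto simp: vact_def uvec_def fun_eq_iff permutes_inverses)

lemma vact_sum0:
  assumes "\<sigma> permutes {1..n}" "x \<in> sum0 n"
  shows "vact \<sigma> x \<in> sum0 n"
proof -
  have i: "Hilbert_Choice.inv \<sigma> permutes {1..n}" using assms(1) by (rule permutes_inv)
  have "(\<Sum>j\<in>{1..n}. x (Hilbert_Choice.inv \<sigma> j)) = (\<Sum>j\<in>{1..n}. x j)"
    by (rule sum.permute[OF i, symmetric, unfolded comp_def])
  then show ?thesis
    using assms(2) permutes_in_image[OF i]
    by (auto simp: sum0_def vact_def simp del: atLeastAtMost_iff)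
qed

lemma pact_tri: "\<sigma> permutes S \<Longrightarrow> pact \<sigma> (tri i j k) = tri (\<sigma> i) (\<sigma> j) (\<sigma> k)"
  by (simp add: tri_def pact_wedge vact_linear vact_uvec)

lemma pact_alt:
  assumes "\<sigma> permutes {1..n}" "A \<in> alt n"
  shows "pact \<sigma> A \<in> alt n"
proof (rule altI)
  have i: "Hilbert_Choice.inv \<sigma> permutes {1..n}" using assms(1) by (rule permutes_inv)
  show "pact \<sigma> A (i, j) = 0" if "i \<notin> {1..n} \<or> j \<notin> {1..n}" for i j
    using that altD(1,2)[OF assms(2)] permutes_in_image[OF i]
    by (auto simp: pact_def simp del: atLeastAtMost_iff)
  show "(\<Sum>j = 1..n. pact \<sigma> A (k, j)) = 0" for k
    using sum.permute[OF i, of "\<lambda>j. A (Hilbert_Choice.inv \<sigma> k, j)"] altD(5)[OF assms(2)]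
    by (simp add: pact_def comp_def)
  show "pact \<sigma> A (l, k) = - pact \<sigma> A (k, l)" "pact \<sigma> A (k, k) = 0" for k l
    using altD(3)[OF assms(2), of "Hilbert_Choice.inv \<sigma> l"] altD(4)[OF assms(2)]
    by (simp_all add: pact_def)
qed

lemma pact_id: "pact id A = A"
  by (simp add: pact_def)

lemma pact_comp:
  "bij \<sigma> \<Longrightarrow> bij \<tau> \<Longrightarrow> pact (\<sigma> \<circ> \<tau>) A = pact \<sigma> (pact \<tau> A)"
  by (simp add: pact_def fun_eq_iff o_inv_distrib)

text \<open>Over \<open>padic2\<close>, a sublattice of \<open>S\<close> stable under the symmetric
  group, zero included; over \<open>bit\<close>, a submodule of the reduction of \<open>S\<close>
  modulo 2.\<close>

definition lattice :: "nat \<Rightarrow> 'r::comm_ring_1 mat set \<Rightarrow> bool"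
  where "lattice n L \<longleftrightarrow> L \<subseteq> alt n \<and> 0 \<in> L \<and> (\<forall>A\<in>L. \<forall>B\<in>L. A + B \<in> L) \<and>
    (\<forall>c. \<forall>A\<in>L. sc c A \<in> L) \<and> (\<forall>\<sigma>. \<sigma> permutes {1..n} \<longrightarrow> (\<forall>A\<in>L. pact \<sigma> A \<in> L))"

lemma latticeD:
  assumes "lattice n L"
  shows "L \<subseteq> alt n" "0 \<in> L" "A \<in> L \<Longrightarrow> B \<in> L \<Longrightarrow> A + B \<in> L" "A \<in> L \<Longrightarrow> sc c A \<in> L"
    "\<sigma> permutes {1..n} \<Longrightarrow> A \<in> L \<Longrightarrow> pact \<sigma> A \<in> L"
    "A \<in> L \<Longrightarrow> - A \<in> L" "A \<in> L \<Longrightarrow> B \<in> L \<Longrightarrow> A - B \<in> L"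
    "(\<And>i. i \<in> X \<Longrightarrow> F i \<in> L) \<Longrightarrow> sum F X \<in> L"
proof -
  show *: "L \<subseteq> alt n" "0 \<in> L" and add: "\<And>A B. A \<in> L \<Longrightarrow> B \<in> L \<Longrightarrow> A + B \<in> L"
    and sc: "\<And>A c. A \<in> L \<Longrightarrow> sc c A \<in> L"
    and "\<sigma> permutes {1..n} \<Longrightarrow> A \<in> L \<Longrightarrow> pact \<sigma> A \<in> L"
    using assms by (auto simp: lattice_def)
  show m: "A \<in> L \<Longrightarrow> - A \<in> L" for A
    using sc[of A "-1"] by (simp add: sc_minus_1)
  show "A \<in> L \<Longrightarrow> B \<in> L \<Longrightarrow> A - B \<in> L"
    using add[of A "- B"] m[of B] by simp
  show "(\<And>i. i \<in> X \<Longrightarrow> F i \<in> L) \<Longrightarrow> sum F X \<in> L"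
    by (induction X rule: infinite_finite_induct) (auto intro: * add)
qed

lemma lattice_alt: "lattice n (alt n)"
  by (auto simp: lattice_def alt_zero alt_add alt_sc pact_alt)

declare add_bit_eq_xor [simp del] mult_bit_eq_and [simp del]

section \<open>Even graphs\<close>

lemma bit_add_self: "a + a = (0::bit)" "a + (a + b) = (b::bit)"
  by (cases a; cases b; simp)+

lemma bit_alt_sym: "A \<in> alt n \<Longrightarrow> A (j, i) = (A (i, j) :: bit)"
  using altD(3)[of A n j i] by simp

lemma bit_fun_diff: "f - g = (f + g :: 'x \<Rightarrow> bit)"
  by (simp add: fun_eq_iff)

definition less_pairs :: "nat set \<Rightarrow> (nat \<times> nat) set"
  where "less_pairs D = {(i, j). i \<in> D \<and> j \<in> D \<and> i < j}"

text \<open>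
  Over the field with two elements an alternating matrix is the adjacency matrix of a graph;
  \<open>edges D\<close> is the parity of the number of its edges inside \<open>D\<close>.
\<close>

definition edges :: "nat set \<Rightarrow> bit mat \<Rightarrow> bit"
  where "edges D A = sum A (less_pairs D)"

lemma finite_less_pairs: "finite D \<Longrightarrow> finite (less_pairs D)"
  by (rule finite_subset[of _ "D \<times> D"]) (auto simp: less_pairs_def)

lemma edges_add: "edges D (A + B) = edges D A + edges D B"
  by (simp add: edges_def sum.distrib)

lemma edges_0: "edges D 0 = 0"
  by (simp add: edges_def)

lemma edges_sc: "edges D (sc c A) = c * edges D A"
  by (simp add: edges_def sum_distrib_left)

lemma edges_sum: "edges D (sum F X) = (\<Sum>i\<in>X. edges D (F i))"
  by (induction X rule: infinite_finite_induct)
    (simp_all only: sum.infinite sum.empty sum.insert edges_0 edges_add not_False_eq_True)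

lemma edges_insert:
  assumes "finite D" "i \<notin> D" and sym: "\<And>p q. A (q, p) = A (p, q)"
  shows "edges (insert i D) A = edges D A + (\<Sum>k\<in>D. A (i, k))"
proof -
  \<comment> \<open>\<open>less_pairs\<close> contains each edge in increasing order only, so the
    edge between \<open>i\<close> and \<open>k\<close> sits at one of two positions, depending on
    which vertex is smaller.\<close>
  let ?g = "\<lambda>k. if i < k then (i, k) else (k, i)"
  have im: "(p, q) \<in> ?g ` D \<longleftrightarrow> p = i \<and> q \<in> D \<and> i < q \<or> q = i \<and> p \<in> D \<and> p < i" for p q
  proof
    show "(p, q) \<in> ?g ` D \<Longrightarrow> p = i \<and> q \<in> D \<and> i < q \<or> q = i \<and> p \<in> D \<and> p < i"
      using assms(2) by (auto split: if_splits)
    show "p = i \<and> q \<in> D \<and> i < q \<or> q = i \<and> p \<in> D \<and> p < i \<Longrightarrow> (p, q) \<in> ?g ` D"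
      by (auto intro: image_eqI[of _ _ q] image_eqI[of _ _ p])
  qed
  have "less_pairs (insert i D) = less_pairs D \<union> ?g ` D"
  proof (rule Set.set_eqI)
    fix x :: "nat \<times> nat"
    obtain p q where x: "x = (p, q)" by (cases x)
    show "x \<in> less_pairs (insert i D) \<longleftrightarrow> x \<in> less_pairs D \<union> ?g ` D"
      unfolding x Un_iff im using assms(2) by (auto simp: less_pairs_def)
  qed
  moreover have "less_pairs D \<inter> ?g ` D = {}"
  proof (rule equals0I)
    fix x assume "x \<in> less_pairs D \<inter> ?g ` D"
    moreover obtain p q where x: "x = (p, q)" by (cases x)
    ultimately show False
      unfolding x Int_iff im using assms(2) by (auto simp: less_pairs_def)
  qed
  ultimately have "edges (insert i D) A = edges D A + sum A (?g ` D)"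
    using assms(1) by (simp add: edges_def sum.union_disjoint finite_less_pairs)
  also have "inj_on ?g D"
    by (auto simp: inj_on_def split: if_splits)
  then have "sum A (?g ` D) = (\<Sum>k\<in>D. A (?g k))"
    by (simp only: sum.reindex comp_def)
  also have "\<dots> = (\<Sum>k\<in>D. A (i, k))"
    using sym by (intro sum.cong) auto
  finally show ?thesis .
qed

lemma edges_wedge_uvec:
  assumes "finite D" "i \<in> D" "j \<in> D" "i \<noteq> j"
  shows "edges D (wedge (uvec i) (uvec j)) = 1"
proof -
  have "edges D (wedge (uvec i) (uvec j)) = (\<Sum>p\<in>less_pairs D. if p = (min i j, max i j) then 1 else 0)"
    unfolding edges_def using assms(4)
    by (intro sum.cong) (auto simp: wedge_def uvec_def less_pairs_def min_def max_def split: if_splits)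
  also have "\<dots> = 1"
    using assms by (simp add: sum.delta finite_less_pairs) (auto simp: less_pairs_def min_def max_def)
  finally show ?thesis .
qed

lemma tri_expand: "tri i j k = wedge (uvec i) (uvec j) - wedge (uvec i) (uvec k) - wedge (uvec k) (uvec j)"
  by (simp add: tri_def wedge_bilinear wedge_self)

text \<open>A triangle has three edges, and signs disappear over \<open>bit\<close>.\<close>

lemma edges_tri:
  assumes "finite D" "i \<in> D" "j \<in> D" "k \<in> D" "i \<noteq> j" "i \<noteq> k" "j \<noteq> k"
  shows "edges D (tri i j k) = 1"
  using assms by (simp add: tri_expand bit_fun_diff edges_add edges_wedge_uvec)

text \<open>Permutations do not respect the vertex order inside \<open>less_pairs\<close>, so the
  sum cannot simply be reindexed. Adding one vertex at a time refers to whole rows only, and these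
  may be permuted freely.\<close>

lemma edges_image:
  assumes "finite D" "inj_on \<sigma> D" and sym: "\<And>p q. A (q, p) = A (p, q)"
  shows "edges (\<sigma> ` D) A = edges D (\<lambda>(i, j). A (\<sigma> i, \<sigma> j))"
  using assms(1,2)
proof (induction D rule: finite_induct)
  case empty
  then show ?case by (simp add: edges_def less_pairs_def)
next
  case (insert i D)
  have "edges (\<sigma> ` insert i D) A = edges (\<sigma> ` D) A + (\<Sum>k\<in>\<sigma> ` D. A (\<sigma> i, k))"
    unfolding image_insert using insert.hyps(1,2) insert.prems
    by (intro edges_insert) (auto simp: sym)
  also have "(\<Sum>k\<in>\<sigma> ` D. A (\<sigma> i, k)) = (\<Sum>k\<in>D. A (\<sigma> i, \<sigma> k))"
    using insert.prems by (simp add: sum.reindex)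
  also have "edges (\<sigma> ` D) A + \<dots> = edges (insert i D) (\<lambda>(i, j). A (\<sigma> i, \<sigma> j))"
    using insert sym by (subst edges_insert) auto
  finally show ?case .
qed

lemma edges_pact:
  assumes "\<sigma> permutes {1..n}" "A \<in> alt n"
  shows "edges {1..n} (pact \<sigma> A) = edges {1..n} A"
proof -
  have i: "Hilbert_Choice.inv \<sigma> permutes {1..n}" using assms(1) by (rule permutes_inv)
  have "edges (Hilbert_Choice.inv \<sigma> ` {1..n}) A = edges {1..n} (pact \<sigma> A)"
    unfolding pact_def
    by (rule edges_image) (use bit_alt_sym[OF assms(2)] permutes_inj_on[OF i] in auto)
  then show ?thesis by (simp only: permutes_image[OF i])
qed

text \<open>The value \<open>f i\<close> occurs in the \<open>card D - 1\<close> edges at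
  \<open>i\<close>, a number congruent to \<open>card D + 1\<close> modulo 2, and \<open>c\<close>
  occurs once for each pair.\<close>

lemma edges_cut:
  assumes "finite D" and "\<And>i j. i \<in> D \<Longrightarrow> j \<in> D \<Longrightarrow> i \<noteq> j \<Longrightarrow> A (i, j) = f i + f j + c"
    and sym: "\<And>p q. A (q, p) = A (p, q)"
  shows "edges D A = of_nat (card D) * sum f D + sum f D + of_nat (card D choose 2) * c"
  using assms(1,2)
proof (induction D rule: finite_induct)
  case empty
  then show ?case by (simp add: edges_def less_pairs_def numeral_2_eq_2)
next
  case (insert i D)
  have "edges (insert i D) A = edges D A + (\<Sum>k\<in>D. A (i, k))"
    using insert.hyps sym by (intro edges_insert)
  also have "(\<Sum>k\<in>D. A (i, k)) = (\<Sum>k\<in>D. f i + f k + c)"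
    using insert by (intro sum.cong) auto
  also have "\<dots> = of_nat (card D) * f i + sum f D + of_nat (card D) * c"
    by (simp add: sum.distrib)
  also have "edges D A = of_nat (card D) * sum f D + sum f D + of_nat (card D choose 2) * c"
    using insert by blast
  finally have "edges (insert i D) A = of_nat (card D) * sum f D + sum f D + of_nat (card D choose 2) * c
    + (of_nat (card D) * f i + sum f D + of_nat (card D) * c)" .
  moreover have "Suc (card D) choose 2 = card D + (card D choose 2)"
    by (simp add: numeral_2_eq_2)
  ultimately show ?case
    using insert.hyps by (simp add: algebra_simps bit_add_self)
qed

text \<open>
  The graph is the cut between \<open>{f = 0}\<close> and \<open>{f = 1}\<close>, complemented if \<open>c = 1\<close>.
\<close>

definition is_cut :: "nat \<Rightarrow> (nat \<Rightarrow> bit) \<Rightarrow> bit \<Rightarrow> bit mat \<Rightarrow> bool"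
  where "is_cut n f c A \<longleftrightarrow> (\<forall>i\<in>{1..n}. \<forall>j\<in>{1..n}. i \<noteq> j \<longrightarrow> A (i, j) = f i + f j + c)"

text \<open>The reductions modulo 2 of the lattices \<open>T\<^sub>i\<close> of the theorem, with
  the same numbering; index 4 is the reduction of \<open>2 S\<close>.\<close>

definition lat2 :: "nat \<Rightarrow> nat \<Rightarrow> bit mat set"
  where "lat2 n i = (if i = 0 then alt n else if i = 1 then {A \<in> alt n. edges {1..n} A = 0}
    else if i = 2 then {A \<in> alt n. \<exists>f c. is_cut n f c A}
    else if i = 3 then {A \<in> alt n. \<exists>f. is_cut n f 0 A} else {0})"

lemma lat2_simps:
  "lat2 n 0 = alt n" "lat2 n (Suc 0) = {A \<in> alt n. edges {1..n} A = 0}"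
  "lat2 n 2 = {A \<in> alt n. \<exists>f c. is_cut n f c A}" "lat2 n 3 = {A \<in> alt n. \<exists>f. is_cut n f 0 A}" "lat2 n 4 = {0}"
  by (simp_all add: lat2_def)

lemma is_cut_add: "is_cut n f c A \<Longrightarrow> is_cut n g d B \<Longrightarrow> is_cut n (f + g) (c + d) (A + B)"
  by (auto simp: is_cut_def)

lemma is_cut_sc: "is_cut n f c A \<Longrightarrow> is_cut n (sc a f) (a * c) (sc a A)"
  by (auto simp: is_cut_def distrib_left)

lemma is_cut_pact:
  assumes "is_cut n f c A" "\<sigma> permutes {1..n}"
  shows "is_cut n (vact \<sigma> f) c (pact \<sigma> A)"
proof -
  have i: "Hilbert_Choice.inv \<sigma> permutes {1..n}" using assms(2) by (rule permutes_inv)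
  then show ?thesis
    using assms(1) permutes_in_image[OF i] inj_eq[OF permutes_inj[OF i]]
    unfolding is_cut_def pact_def vact_def by simp
qed

lemma lattice_lat2: "i \<le> 4 \<Longrightarrow> lattice n (lat2 n i)"
proof -
  assume "i \<le> 4"
  then consider "i = 0" | "i = 1" | "i = 2" | "i = 3" | "i = 4" by linarith
  then show ?thesis
  proof cases
    case 1
    then show ?thesis by (simp add: lat2_simps lattice_alt)
  next
    case 2
    then show ?thesis
      by (auto simp: lat2_simps lattice_def alt_zero alt_add alt_sc pact_alt edges_0 edges_add edges_sc edges_pact[unfolded One_nat_def])
  next
    case 3
    have "is_cut n 0 0 0" by (simp add: is_cut_def)
    then show ?thesis
      unfolding 3 lat2_simps lattice_def
      by (auto simp: alt_zero alt_add alt_sc pact_alt intro: is_cut_add is_cut_sc is_cut_pact[unfolded One_nat_def])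
  next
    case 4
    have 0: "is_cut n 0 0 0" by (simp add: is_cut_def)
    have add: "\<And>f g A B. is_cut n f 0 A \<Longrightarrow> is_cut n g 0 B \<Longrightarrow> is_cut n (f + g) 0 (A + B)"
      using is_cut_add[where c = 0 and d = 0] by simp
    have sc: "\<And>f a A. is_cut n f 0 A \<Longrightarrow> is_cut n (sc a f) 0 (sc a A)"
      using is_cut_sc[where c = 0] by simp
    show ?thesis
      unfolding 4 lat2_simps lattice_def
      by (auto simp: alt_zero alt_add alt_sc pact_alt intro: 0 add sc is_cut_pact[unfolded One_nat_def])
  next
    case 5
    then show ?thesis by (auto simp: lat2_simps lattice_def alt_zero sc_0_right pact_linear)
  qed
qed

text \<open>The row of vertex 1 sums to \<open>(n - 1) f 1\<close> plus the other values of
  \<open>f\<close> plus \<open>(n - 1) c\<close>. As \<open>n - 1\<close> is odd, the vanishing of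
  this row ties \<open>c\<close> to the total of \<open>f\<close>.\<close>

lemma even_cut_sum:
  assumes A: "A \<in> alt n" and n: "even n" "n > 0" and c: "is_cut n f c A"
  shows "sum f {1..n} = c"
proof -
  have "(\<Sum>j\<in>{1..n}. A (1, j)) = (\<Sum>j\<in>{1..n} - {1}. A (1, j))"
    using n altD(4)[OF A] by (subst sum.remove[of _ 1]) auto
  also have "\<dots> = (\<Sum>j\<in>{1..n} - {1}. f 1 + f j + c)"
    using c n by (intro sum.cong) (auto simp: is_cut_def)
  also have "\<dots> = of_nat (n - 1) * f 1 + sum f ({1..n} - {1}) + of_nat (n - 1) * c"
    using n by (simp add: sum.distrib)
  also have "(of_nat (n - 1) :: bit) = 1"
  proof -
    obtain k where "n = 2 * k" using n(1) by (rule evenE)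
    then have "n - 1 = 2 * (k - 1) + 1" using n(2) by simp
    then show ?thesis by simp
  qed
  also have "1 * f 1 + sum f ({1..n} - {1}) + 1 * c = sum f {1..n} + c"
    using n by (subst sum.remove[of "{1..n}" 1 f]) auto
  finally have "sum f {1..n} + c = 0" using altD(5)[OF A, of 1] by simp
  then show ?thesis by (cases c; cases "sum f {1..n}") auto
qed

text \<open>Everything that is used of the congruence: \<open>n = 4 k + 2\<close> gives
  \<open>n choose 2 = (2 k + 1) (4 k + 1)\<close> and \<open>n div 2 = 2 k + 1\<close>.\<close>

lemma mod4_facts:
  assumes "n mod 4 = (2::nat)"
  shows "even n" "n > 0" "(of_nat n :: bit) = 0" "(of_nat (n choose 2) :: bit) = 1" "odd (n div 2)"
proof -
  obtain k where k: "n = 4 * k + 2" using assms by (metis mult_div_mod_eq)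
  show "even n" "n > 0" "odd (n div 2)" unfolding k by simp_all
  show "(of_nat n :: bit) = 0" unfolding k by simp
  have "n choose 2 = (2 * k + 1) * (4 * k + 1)"
    unfolding choose_two k by simp
  then show "(of_nat (n choose 2) :: bit) = 1" by (simp del: of_nat_mult)
qed

lemma lat2_chain:
  assumes "n mod 4 = 2" "i < 4"
  shows "lat2 n (Suc i) \<subseteq> lat2 n i"
proof -
  note m = mod4_facts[OF assms(1)]
  consider "i = 0" | "i = 1" | "i = 2" | "i = 3" using assms(2) by linarith
  then show ?thesis
  proof cases
    case 2
    \<comment> \<open>As \<open>n\<close> is even and \<open>n choose 2\<close> odd, the edge parity
      is the total of \<open>f\<close> plus \<open>c\<close>, and the row sums make these two
      equal.\<close>
    have "edges {1..n} A = 0" if A: "A \<in> alt n" and f: "is_cut n f c A" for A f c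
    proof -
      have "edges {1..n} A = of_nat (card {1..n}) * sum f {1..n} + sum f {1..n} + of_nat (card {1..n} choose 2) * c"
        using f bit_alt_sym[OF A] by (intro edges_cut) (auto simp: is_cut_def)
      then show ?thesis using m even_cut_sum[OF A m(1,2) f] by simp
    qed
    then show ?thesis using 2 by (auto simp: lat2_simps numeral_2_eq_2[symmetric])
  next
    case 4
    have "is_cut n 0 0 0" by (simp add: is_cut_def)
    then show ?thesis using 4 by (auto simp: lat2_simps alt_zero)
  qed (auto simp: lat2_simps numeral_2_eq_2[symmetric] numeral_3_eq_3[symmetric])
qed

section \<open>Submodules generated by a single graph\<close>

text \<open>Composing with the transposition of \<open>\<sigma> x\<close> and \<open>y\<close>
  corrects the value at \<open>x\<close>, and distinctness keeps the values already prescribed away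
  from both points.\<close>

lemma permutes_extend:
  assumes "distinct xs" "distinct ys" "length xs = length ys" "set xs \<subseteq> S" "set ys \<subseteq> S"
  shows "\<exists>\<sigma>. \<sigma> permutes S \<and> map \<sigma> xs = ys"
  using assms(3,1,2,4,5)
proof (induction xs ys rule: list_induct2)
  case Nil
  then show ?case by (auto intro: permutes_id)
next
  case (Cons x xs y ys)
  then obtain \<sigma> where s: "\<sigma> permutes S" "map \<sigma> xs = ys" by auto
  let ?t = "Transposition.transpose (\<sigma> x) y"
  have "?t permutes S"
    using Cons.prems permutes_in_image[OF s(1)] by (intro permutes_swap_id) auto
  then have "(?t \<circ> \<sigma>) permutes S" using s(1) by (rule permutes_compose[rotated])
  moreover have "map (?t \<circ> \<sigma>) xs = ys"
  proof -
    have "?t (\<sigma> z) = \<sigma> z" if "z \<in> set xs" for z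
    proof (rule transpose_apply_other)
      show "\<sigma> z \<noteq> \<sigma> x" using that Cons.prems inj_eq[OF permutes_inj[OF s(1)]] by auto
      show "\<sigma> z \<noteq> y" using that Cons.prems s(2) by auto
    qed
    then show ?thesis using s(2) by auto
  qed
  moreover from this have "map (?t \<circ> \<sigma>) (x # xs) = y # ys" by simp
  ultimately show ?case by (intro exI[of _ "?t \<circ> \<sigma>"] conjI)
qed

text \<open>Over \<open>bit\<close> the 4-cycle through \<open>i\<close>, \<open>k\<close>,
  \<open>j\<close>, \<open>l\<close> in this order.\<close>

definition cyc4 :: "nat \<Rightarrow> nat \<Rightarrow> nat \<Rightarrow> nat \<Rightarrow> 'r::comm_ring_1 mat"
  where "cyc4 i j k l = wedge (uvec i - uvec j) (uvec k - uvec l)"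

lemma cyc4_alt: "\<lbrakk>i \<in> {1..n}; j \<in> {1..n}; k \<in> {1..n}; l \<in> {1..n}\<rbrakk> \<Longrightarrow> cyc4 i j k l \<in> alt n"
  unfolding cyc4_def by (intro wedge_alt uvec_diff_sum0)

lemma pact_cyc4: "\<sigma> permutes S \<Longrightarrow> pact \<sigma> (cyc4 i j k l) = cyc4 (\<sigma> i) (\<sigma> j) (\<sigma> k) (\<sigma> l)"
  by (simp add: cyc4_def pact_wedge vact_linear vact_uvec)

lemma all_cyc4:
  assumes V: "lattice n V" and c: "cyc4 i j k l \<in> V"
    and d: "distinct [i, j, k, l]" "{i, j, k, l} \<subseteq> {1..n}"
    and d': "distinct [i', j', k', l']" "{i', j', k', l'} \<subseteq> {1..n}"
  shows "cyc4 i' j' k' l' \<in> V"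
proof -
  obtain \<sigma> where s: "\<sigma> permutes {1..n}" "map \<sigma> [i, j, k, l] = [i', j', k', l']"
    using permutes_extend[OF d(1) d'(1), of "{1..n}"] d(2) d'(2) by auto
  then show ?thesis using latticeD(5)[OF V s(1) c] unfolding pact_cyc4[OF s(1)] by simp
qed

lemma add_vact_transpose:
  fixes b :: "nat \<Rightarrow> bit"
  assumes "k \<noteq> l"
  shows "b + vact (Transposition.transpose k l) b = sc (b k + b l) (uvec k + uvec l)"
proof
  fix m
  consider "m = k" | "m = l" | "m \<noteq> k" "m \<noteq> l" by blast
  then show "(b + vact (Transposition.transpose k l) b) m = sc (b k + b l) (uvec k + uvec l) m"
    using assms by cases (simp_all add: vact_def uvec_def bit_add_self add.commute)
qed

lemma bit_neq_iff: "a \<noteq> b \<longleftrightarrow> a + b = (1 :: bit)"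
  by (cases a; cases b) simp_all

text \<open>
  The hypothesis makes \<open>(1 + (k l)) (1 + (i j)) A\<close> a 4-cycle.
\<close>

lemma cyc4_mem:
  fixes A :: "bit mat"
  assumes V: "lattice n V" and A: "A \<in> V"
    and d: "distinct [i, j, k, l]" "{i, j, k, l} \<subseteq> {1..n}"
    and ne: "A (i, k) + A (j, k) \<noteq> A (i, l) + A (j, l)"
  shows "cyc4 i j k l \<in> V"
proof -
  have An: "A \<in> alt n" using latticeD(1)[OF V] A by blast
  let ?s = "Transposition.transpose i j" and ?t = "Transposition.transpose k l"
  have st: "?s permutes {1..n}" "?t permutes {1..n}"
    using d by (auto intro!: permutes_swap_id)
  have sym: "A (p, q) = A (q, p)" for p q by (rule bit_alt_sym[OF An])
  \<comment> \<open>\<open>B\<close> is supported on the rows and columns \<open>i\<close> and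
    \<open>j\<close>, which all carry the sum \<open>b\<close> of the two rows of \<open>A\<close>;
    its entry at \<open>(i, j)\<close> cancels by symmetry.\<close>
  define b where "b = (\<lambda>m. if m = i \<or> m = j then 0 else A (i, m) + A (j, m))"
  define B where "B = A + pact ?s A"
  have B: "B = wedge (uvec i + uvec j) b"
  proof (rule ext, clarify)
    fix p q
    have "p = i \<or> p = j \<or> p \<noteq> i \<and> p \<noteq> j" "q = i \<or> q = j \<or> q \<noteq> i \<and> q \<noteq> j" by auto
    then show "B (p, q) = wedge (uvec i + uvec j) b (p, q)"
      using d(1) sym altD(4)[OF An]
      by (elim disjE) (simp_all add: B_def pact_def b_def wedge_def uvec_def bit_add_self ac_simps)
  qed
  have "b k + b l = 1"
    using ne[unfolded bit_neq_iff] d(1) by (simp add: b_def)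
  then have b: "b + vact ?t b = uvec k + uvec l"
    using d(1) add_vact_transpose[of k l b] by (simp add: sc_1)
  have t: "vact ?t (uvec i + uvec j) = uvec i + uvec j"
    using d(1) by (simp add: vact_linear vact_uvec[OF st(2)] transpose_apply_other)
  have tB: "pact ?t B = wedge (uvec i + uvec j) (vact ?t b)"
    unfolding B pact_wedge t ..
  have "B + pact ?t B = wedge (uvec i + uvec j) b + wedge (uvec i + uvec j) (vact ?t b)"
    by (rule arg_cong2[where f = "(+)", OF B tB])
  also have "\<dots> = wedge (uvec i + uvec j) (b + vact ?t b)"
    by (rule wedge_bilinear(2)[symmetric])
  also have "\<dots> = cyc4 i j k l"
    unfolding b cyc4_def bit_fun_diff ..
  finally have "B + pact ?t B = cyc4 i j k l" .
  moreover have "B + pact ?t B \<in> V"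
    unfolding B_def by (intro latticeD(3,5)[OF V] st A)
  ultimately show ?thesis by simp
qed

text \<open>First \<open>k\<close> is exchanged for \<open>i\<close>, then \<open>l\<close> for
  \<open>j\<close>. For \<open>i = 1\<close> and \<open>j = 2\<close> both terms are 4-cycles or
  zero, so the triangles through \<open>n\<close> agree modulo 4-cycles.\<close>

lemma tri_diff:
  "tri k l n - tri i j n = wedge (uvec k - uvec i) (uvec l - uvec n) + wedge (uvec i - uvec n) (uvec l - uvec j)"
  by (auto simp: fun_eq_iff tri_def wedge_def algebra_simps)

text \<open>Each triangle in the expansion of a graph by triangles through \<open>n\<close> adds one
  to the edge parity. An even number of edges thus means an even number of triangles, so that
  subtracting \<open>tri 1 2 n\<close> from each of them changes nothing in total and leaves sums of
  4-cycles.\<close>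

lemma span_cyc4:
  assumes V: "lattice n V" and n: "n \<ge> 5"
    and c: "\<And>i j k l. distinct [i, j, k, l] \<Longrightarrow> {i, j, k, l} \<subseteq> {1..n} \<Longrightarrow> cyc4 i j k l \<in> V"
  shows "lat2 n 1 \<subseteq> V"
proof
  fix X assume "X \<in> lat2 n 1"
  then have X: "X \<in> alt n" "edges {1..n} X = 0" by (simp_all add: lat2_def)
  let ?I = "ind_less n"
  define x where "x = (\<Sum>p\<in>?I. X p)"
  have e: "X = (\<Sum>(k, l)\<in>?I. sc (X (k, l)) (tri k l n))" by (rule alt_expand[OF X(1)])
  have "edges {1..n} X = (\<Sum>(k, l)\<in>?I. edges {1..n} (sc (X (k, l)) (tri k l n)))"
    by (subst e) (simp only: edges_sum case_prod_unfold)
  also have "\<dots> = x"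
    unfolding x_def by (rule sum.cong) (auto simp: edges_sc edges_tri ind_less_def)
  finally have x0: "x = 0" using X(2) by simp
  have split: "sc a (tri k l n) = sc a (tri k l n - tri 1 2 n) + sc a (tri 1 2 n)" for a :: bit and k l
    by (simp flip: sc_add)
  have "X = (\<Sum>(k, l)\<in>?I. sc (X (k, l)) (tri k l n - tri 1 2 n)) + (\<Sum>p\<in>?I. sc (X p) (tri 1 2 n))"
    by (subst e) (subst split, simp add: sum.distrib case_prod_unfold)
  also have "(\<Sum>p\<in>?I. sc (X p) (tri 1 2 n)) = sc x (tri 1 2 n)"
    by (rule ext) (simp only: x_def sc_apply sum_fun_apply sum_distrib_right)
  finally have X': "X = (\<Sum>(k, l)\<in>?I. sc (X (k, l)) (tri k l n - tri 1 2 n))"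
    unfolding x0 sc_0_left add_0_right .
  have "tri k l n - tri 1 2 n \<in> V" if "(k, l) \<in> ?I" for k l
  proof -
    have kl: "1 \<le> k" "k < l" "l < n" using that by (auto simp: ind_less_def)
    have "(tri k l n :: bit mat) - tri 1 2 n = wedge (uvec k - uvec 1) (uvec l - uvec n) + wedge (uvec 1 - uvec n) (uvec l - uvec 2)"
      by (rule tri_diff)
    moreover have "wedge (uvec k - uvec 1) (uvec l - uvec n) \<in> V"
    proof (cases "k = 1")
      case True
      then show ?thesis using latticeD(2)[OF V] by (simp add: wedge_bilinear)
    next
      case False
      then show ?thesis using c[of k 1 l n] kl by (simp add: cyc4_def)
    qed
    moreover have "wedge (uvec 1 - uvec n) (uvec l - uvec 2) \<in> V"
    proof (cases "l = 2")
      case True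
      then show ?thesis using latticeD(2)[OF V] by (simp add: wedge_bilinear)
    next
      case False
      then show ?thesis using c[of 1 n l 2] kl n by (simp add: cyc4_def)
    qed
    ultimately show ?thesis using latticeD(3)[OF V] by simp
  qed
  then show "X \<in> V"
    by (subst X') (auto intro!: latticeD(4,8)[OF V])
qed

text \<open>Linear in \<open>f\<close>, which lets cuts be expanded like vectors. For even
  \<open>n\<close> the row sum at each vertex is the sum of \<open>f\<close> over
  \<open>{1..n}\<close>.\<close>

definition cut_mat :: "nat \<Rightarrow> (nat \<Rightarrow> bit) \<Rightarrow> bit mat"
  where "cut_mat n f = (\<lambda>(i, j). if i \<in> {1..n} \<and> j \<in> {1..n} \<and> i \<noteq> j then f i + f j else 0)"

lemma cut_mat_linear: "cut_mat n (f + g) = cut_mat n f + cut_mat n g" "cut_mat n (sc a f) = sc a (cut_mat n f)" "cut_mat n 0 = 0"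
  by (auto simp: cut_mat_def fun_eq_iff distrib_left)

lemma cut_mat_sum: "cut_mat n (sum F X) = (\<Sum>i\<in>X. cut_mat n (F i))"
  by (induction X rule: infinite_finite_induct)
    (simp_all only: sum.infinite sum.empty sum.insert cut_mat_linear not_False_eq_True)

lemma pact_cut_mat:
  assumes "\<sigma> permutes {1..n}"
  shows "pact \<sigma> (cut_mat n f) = cut_mat n (vact \<sigma> f)"
proof -
  have i: "Hilbert_Choice.inv \<sigma> permutes {1..n}" using assms by (rule permutes_inv)
  show ?thesis
    using permutes_in_image[OF i] inj_eq[OF permutes_inj[OF i]]
    by (auto simp: pact_def vact_def cut_mat_def fun_eq_iff simp del: atLeastAtMost_iff)
qed

lemma eq_cut_mat:
  assumes "A \<in> alt n" "is_cut n f 0 A"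
  shows "A = cut_mat n f"
proof (rule ext, clarify)
  fix p q
  show "A (p, q) = cut_mat n f (p, q)"
    using altD(1,2,4)[OF assms(1)] assms(2) by (auto simp: cut_mat_def is_cut_def simp del: atLeastAtMost_iff)
qed

lemma span_cuts:
  assumes V: "lattice n V" and n: "even n" "n > 0"
    and c: "\<And>i j. i \<noteq> j \<Longrightarrow> {i, j} \<subseteq> {1..n} \<Longrightarrow> cut_mat n (uvec i + uvec j) \<in> V"
  shows "lat2 n 3 \<subseteq> V"
proof
  fix A assume "A \<in> lat2 n 3"
  then obtain f where A: "A \<in> alt n" "is_cut n f 0 A" by (auto simp: lat2_simps)
  \<comment> \<open>\<open>f\<close> is arbitrary outside \<open>{1..n}\<close>, whereas membership
    in \<open>sum0 n\<close> demands support in \<open>{1..n}\<close>.\<close>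
  define g where "g = (\<lambda>i. if i \<in> {1..n} then f i else 0)"
  have "sum g {1..n} = 0"
    using even_cut_sum[OF A(1) n A(2)] by (simp add: g_def)
  then have "g \<in> sum0 n" by (auto simp: sum0_def g_def split: if_splits)
  then have g: "g = (\<Sum>i\<in>{1..<n}. sc (g i) (uvec i - uvec n))" by (rule sum0_expand)
  have "A = cut_mat n g"
    using A(2) by (intro eq_cut_mat[OF A(1)]) (simp add: is_cut_def g_def)
  also have "\<dots> = (\<Sum>i\<in>{1..<n}. sc (g i) (cut_mat n (uvec i - uvec n)))"
    by (subst g) (simp only: cut_mat_sum cut_mat_linear)
  also have "\<dots> \<in> V"
    using c n by (intro latticeD(4,8)[OF V]) (auto simp: bit_fun_diff)
  finally show "A \<in> V" .
qed

text \<open>If \<open>f\<close> takes different values at \<open>i\<close> and \<open>j\<close>,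
  then \<open>A + (i j) A\<close> is the cut of \<open>{i, j}\<close>, as the bit \<open>c\<close>
  doubles away; the other two-element cuts are conjugates. A constant \<open>f\<close> has total
  zero for even \<open>n\<close>, which forces \<open>c = 0\<close> and
  \<open>A = 0\<close>.\<close>

lemma cut_mat_mem:
  assumes V: "lattice n V" and A: "A \<in> V" "A \<noteq> 0" "is_cut n f c A" and n: "even n" "n > 0"
  shows "lat2 n 3 \<subseteq> V"
proof -
  have An: "A \<in> alt n" using latticeD(1)[OF V] A by blast
  have "\<exists>i\<in>{1..n}. \<exists>j\<in>{1..n}. f i \<noteq> f j"
  proof (rule ccontr)
    assume neg: "\<not> ?thesis"
    have "1 \<in> {1..n}" using n by simp
    with neg have const: "f i = f 1" if "i \<in> {1..n}" for i using that by blast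
    then have "sum f {1..n} = (\<Sum>i\<in>{1..n}. f 1)" by (intro sum.cong refl)
    also have "\<dots> = of_nat n * f 1" by simp
    also have "(of_nat n :: bit) = 0"
      using n(1) by (elim evenE) (simp only: of_nat_mult of_nat_numeral bit_2_eq_0 mult_zero_left)
    finally have "c = 0" using even_cut_sum[OF An n A(3)] by simp
    then have "A = cut_mat n f" using eq_cut_mat[OF An] A(3) by simp
    also have "\<dots> = 0"
    proof (rule ext, clarify)
      fix p q
      show "cut_mat n f (p, q) = 0 (p, q)"
        using const[of p] const[of q] by (simp add: cut_mat_def bit_add_self)
    qed
    finally show False using A(2) by simp
  qed
  then obtain i j where ij: "i \<in> {1..n}" "j \<in> {1..n}" "f i \<noteq> f j" by blast
  let ?s = "Transposition.transpose i j"
  have s: "?s permutes {1..n}" using ij by (intro permutes_swap_id)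
  have f: "f i + f j = 1" using ij(3) by (cases "f i"; cases "f j") auto
  define B where "B = A + pact ?s A"
  have B: "B \<in> V" unfolding B_def by (intro latticeD(3,5)[OF V] s A)
  have "is_cut n (f + vact ?s f) (c + c) B"
    unfolding B_def by (intro is_cut_add A(3) is_cut_pact s)
  also have "f + vact ?s f = uvec i + uvec j"
    using f ij(3) add_vact_transpose[of i j f] by (auto simp: sc_1)
  finally have "is_cut n (uvec i + uvec j) 0 B" by (simp only: bit_add_self)
  then have Bc: "B = cut_mat n (uvec i + uvec j)"
    using latticeD(1)[OF V] B by (intro eq_cut_mat) auto
  show ?thesis
  proof (rule span_cuts[OF V n])
    fix k l assume kl: "k \<noteq> l" "{k, l} \<subseteq> {1..n}"
    obtain \<sigma> where s: "\<sigma> permutes {1..n}" "map \<sigma> [i, j] = [k, l]"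
      using permutes_extend[of "[i, j]" "[k, l]" "{1..n}"] ij kl by auto
    have "pact \<sigma> B = cut_mat n (uvec k + uvec l)"
      unfolding Bc pact_cut_mat[OF s(1)] vact_linear vact_uvec[OF s(1)] using s(2) by simp
    then show "cut_mat n (uvec k + uvec l) \<in> V"
      using latticeD(5)[OF V s(1) B] by simp
  qed
qed

text \<open>If the criterion for producing a 4-cycle fails everywhere, then
  \<open>A (j, k) + A (1, j) + A (1, k)\<close> is the same for all distinct \<open>j\<close> and
  \<open>k\<close> other than 1, and \<open>A\<close> is a cut or the complement of one.\<close>

lemma not_cut_cyc4:
  assumes V: "lattice n V" and n: "n \<ge> 5" and A: "A \<in> V" "A \<notin> lat2 n 2"
  shows "lat2 n 1 \<subseteq> V"
proof -
  have An: "A \<in> alt n" using latticeD(1)[OF V] A by blast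
  have sym: "A (p, q) = A (q, p)" for p q by (rule bit_alt_sym[OF An])
  have "\<exists>i j k l. distinct [i, j, k, l] \<and> {i, j, k, l} \<subseteq> {1..n} \<and> A (i, k) + A (j, k) \<noteq> A (i, l) + A (j, l)"
  proof (rule ccontr)
    assume "\<not> ?thesis"
    then have eq: "A (i, k) + A (j, k) = A (i, l) + A (j, l)"
      if "distinct [i, j, k, l]" "{i, j, k, l} \<subseteq> {1..n}" for i j k l
      using that by blast
    define d where "d = A (2, 3) + A (1, 2) + A (1, 3)"
    \<comment> \<open>The value at vertex 1 cancels \<open>d\<close> in
      \<open>f 1 + f k + d\<close>, leaving the entry \<open>A (1, k)\<close>.\<close>
    define f where "f = (\<lambda>k. if k = 1 then d else A (1, k))"
    have d: "A (j, k) = A (1, j) + A (1, k) + d" if jk: "{j, k} \<subseteq> {2..n}" "j \<noteq> k" for j k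
    proof -
      define g where "g = (\<lambda>j k. A (j, k) + A (1, j) + A (1, k))"
      have gs: "g j k = g k j" for j k
        by (simp add: g_def sym[of j k] add.commute add.left_commute)
      have g1: "g j k = g j l" if "{j, k, l} \<subseteq> {2..n}" "distinct [j, k, l]" for j k l
      proof -
        have "A (1, k) + A (j, k) = A (1, l) + A (j, l)"
          using that by (intro eq) auto
        then show ?thesis
          unfolding g_def by (cases "A (1, k)"; cases "A (j, k)"; cases "A (1, l)"; cases "A (j, l)") auto
      qed
      have g2: "g j k = g j l" if "{j, k, l} \<subseteq> {2..n}" "j \<noteq> k" "j \<noteq> l" for j k l
        using g1[of j k l] that by (cases "k = l") auto
      \<comment> \<open>Any pair is joined to \<open>{2, 3}\<close> by changing one vertex at a
        time, through pairs containing 3.\<close>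
      have "g j k = g 2 3"
      proof (cases "j = 3")
        case True
        then show ?thesis using g2[of 3 k 2] gs[of 2 3] jk n by auto
      next
        case False
        then show ?thesis using g2[of j k 3] g2[of 3 j 2] gs[of j 3] gs[of 2 3] jk n by auto
      qed
      then have "g j k = d" by (simp add: g_def d_def)
      then show ?thesis
        unfolding g_def by (cases "A (j, k)"; cases "A (1, j)"; cases "A (1, k)"; cases d) auto
    qed
    have "is_cut n f d A"
      unfolding is_cut_def
    proof (intro ballI impI)
      fix i j assume ij: "i \<in> {1..n}" "j \<in> {1..n}" "i \<noteq> j"
      consider "i = 1" | "j = 1" | "i \<noteq> 1" "j \<noteq> 1" by blast
      then show "A (i, j) = f i + f j + d"
      proof cases
        case 1
        then show ?thesis using ij by (simp add: f_def bit_add_self ac_simps)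
      next
        case 2
        then show ?thesis using ij sym[of i 1] by (simp add: f_def bit_add_self ac_simps)
      next
        case 3
        then show ?thesis using ij d[of i j] by (simp add: f_def)
      qed
    qed
    then show False using A(2) An by (auto simp: lat2_simps)
  qed
  then obtain i j k l where d: "distinct [i, j, k, l]" "{i, j, k, l} \<subseteq> {1..n}"
    "A (i, k) + A (j, k) \<noteq> A (i, l) + A (j, l)" by blast
  have "cyc4 i j k l \<in> V" by (rule cyc4_mem[OF V A(1) d])
  then show ?thesis
    using all_cyc4[OF V _ d(1,2)] by (intro span_cyc4[OF V n])
qed

text \<open>Together with the inclusions of the chain this determines all submodules. For
  \<open>i = 0\<close> and \<open>i = 2\<close> the next term is cut out by a single bit, so either
  \<open>X\<close> or \<open>X + A\<close> lies in it; for \<open>i = 1\<close> and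
  \<open>i = 3\<close> the 4-cycles and the two-element cuts generate.\<close>

lemma lat2_classify:
  assumes V: "lattice n V" and n: "n \<ge> 6" "n mod 4 = 2" and i: "i < 4" and nV: "\<not> V \<subseteq> lat2 n (Suc i)"
  shows "lat2 n i \<subseteq> V"
proof -
  note m = mod4_facts[OF n(2)]
  obtain A where A: "A \<in> V" "A \<notin> lat2 n (Suc i)" using nV by blast
  have An: "A \<in> alt n" using latticeD(1)[OF V] A by blast
  have n5: "n \<ge> 5" using n by simp
  consider "i = 0" | "i = 1" | "i = 2" | "i = 3" using i by linarith
  then show ?thesis
  proof cases
    case 1
    have A1: "A \<notin> lat2 n 1" using A 1 by simp
    then have "A \<notin> lat2 n 2" using lat2_chain[OF n(2), of 1] by (auto simp: numeral_2_eq_2)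
    then have C: "lat2 n 1 \<subseteq> V" by (rule not_cut_cyc4[OF V n5 A(1)])
    show ?thesis
    proof
      fix X assume "X \<in> lat2 n i"
      then have X: "X \<in> alt n" by (simp add: 1 lat2_simps)
      show "X \<in> V"
      proof (cases "edges {1..n} X = 0")
        case True
        then show ?thesis using C X by (auto simp: lat2_simps)
      next
        case False
        then have "edges {1..n} (X + A) = 0" using A1 An by (simp add: edges_add lat2_simps)
        then have "X + A \<in> V" using C alt_add[OF X An] by (auto simp: lat2_simps)
        then have "(X + A) - A \<in> V" using A(1) by (rule latticeD(7)[OF V])
        then show ?thesis by (simp only: add_diff_cancel_right')
      qed
    qed
  next
    case 2
    then have "A \<notin> lat2 n 2" using A by (simp add: numeral_2_eq_2)
    then show ?thesis unfolding 2 by (rule not_cut_cyc4[OF V n5 A(1)])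
  next
    case 3
    then have A3: "A \<notin> lat2 n 3" using A by (simp add: numeral_3_eq_3 numeral_2_eq_2)
    show ?thesis
    proof (cases "A \<in> lat2 n 2")
      case False
      then show ?thesis
        using not_cut_cyc4[OF V n5 A(1)] lat2_chain[OF n(2), of 1] 3 by (auto simp: numeral_2_eq_2)
    next
      case True
      then obtain f c where f: "is_cut n f c A" by (auto simp: lat2_simps)
      have "c = 1" using A3 An f by (cases c) (auto simp: lat2_simps)
      have "is_cut n 0 0 0" by (simp add: is_cut_def)
      then have "0 \<in> lat2 n 3" using alt_zero by (auto simp: lat2_simps)
      then have "A \<noteq> 0" using A3 by blast
      then have W: "lat2 n 3 \<subseteq> V" by (rule cut_mat_mem[OF V A(1) _ f m(1,2)])
      show ?thesis
      proof
        fix X assume "X \<in> lat2 n i"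
        then obtain g d where X: "X \<in> alt n" and g: "is_cut n g d X" by (auto simp: 3 lat2_simps)
        show "X \<in> V"
        proof (cases "d = 0")
          case True
          then show ?thesis using W X g by (auto simp: lat2_simps)
        next
          case False
          then have "is_cut n (g + f) 0 (X + A)" using is_cut_add[OF g f] \<open>c = 1\<close> by simp
          then have "X + A \<in> V" using W alt_add[OF X An] by (auto simp: lat2_simps)
          then have "(X + A) - A \<in> V" using A(1) by (rule latticeD(7)[OF V])
          then show ?thesis by (simp only: add_diff_cancel_right')
        qed
      qed
    qed
  next
    case 4
    then have A4: "A \<noteq> 0" using A by (simp add: lat2_def)
    show ?thesis
    proof (cases "A \<in> lat2 n 2")
      case False
      then have "lat2 n 1 \<subseteq> V" by (rule not_cut_cyc4[OF V n5 A(1)])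
      then show ?thesis
        using lat2_chain[OF n(2), of 1] lat2_chain[OF n(2), of 2] 4 by (auto simp: numeral_2_eq_2 numeral_3_eq_3)
    next
      case True
      then obtain f c where f: "is_cut n f c A" by (auto simp: lat2_simps)
      then show ?thesis unfolding 4 by (intro cut_mat_mem[OF V A(1) A4 f m(1,2)])
    qed
  qed
qed

section \<open>Lattices of alternating matrices\<close>

definition mod2 :: "('x \<Rightarrow> padic2) \<Rightarrow> 'x \<Rightarrow> bit"
  where "mod2 A = (\<lambda>p. parity (A p))"

lemma mod2_simps:
  "mod2 (A + B) = mod2 A + mod2 B" "mod2 (A - B) = mod2 A - mod2 B" "mod2 (- A) = - mod2 A"
  "mod2 (sc c A) = sc (parity c) (mod2 A)" "mod2 0 = 0"
  by (simp_all add: mod2_def fun_eq_iff parity_simps)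

lemma mod2_sum: "mod2 (sum F X) = (\<Sum>i\<in>X. mod2 (F i))"
  by (simp add: mod2_def fun_eq_iff sum_fun_apply parity_sum)

lemma mod2_pact: "mod2 (pact \<sigma> A) = pact \<sigma> (mod2 A)"
  by (auto simp: mod2_def pact_def fun_eq_iff)

lemma mod2_uvec: "mod2 (uvec i) = uvec i"
  by (simp add: mod2_def uvec_def fun_eq_iff parity_simps)

lemma mod2_wedge: "mod2 (wedge x y) = wedge (mod2 x) (mod2 y)"
  by (auto simp: mod2_def wedge_def fun_eq_iff parity_simps)

lemma mod2_alt:
  assumes "A \<in> alt n" shows "mod2 A \<in> alt n"
proof (rule altI)
  show "mod2 A (i, j) = 0" if "i \<notin> {1..n} \<or> j \<notin> {1..n}" for i j
    using that altD(1,2)[OF assms] by (auto simp: mod2_def parity_0 simp del: atLeastAtMost_iff)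
  show "mod2 A (j, i) = - mod2 A (i, j)" for i j
    unfolding mod2_def altD(3)[OF assms, of j i] parity_minus ..
  show "mod2 A (i, i) = 0" for i
    unfolding mod2_def altD(4)[OF assms] parity_0 ..
  show "(\<Sum>j = 1..n. mod2 A (i, j)) = 0" for i
    unfolding mod2_def parity_sum[symmetric] altD(5)[OF assms] parity_0 ..
qed

lemma sc_2_inject: "sc (2::padic2) A = sc 2 B \<longleftrightarrow> A = B"
  using two_neq_0 by (simp add: fun_eq_iff)

lemma sc_2_alt_iff: "sc (2::padic2) B \<in> alt n \<longleftrightarrow> B \<in> alt n"
proof
  assume A: "sc 2 B \<in> alt n"
  show "B \<in> alt n"
  proof (rule altI)
    show "B (i, j) = 0" if "i \<notin> {1..n} \<or> j \<notin> {1..n}" for i j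
      using that altD(1,2)[OF A] two_neq_0 by (auto simp del: atLeastAtMost_iff)
    show "B (j, i) = - B (i, j)" for i j
    proof -
      have "2 * B (j, i) = 2 * (- B (i, j))" using altD(3)[OF A, of j i] by simp
      then show ?thesis using two_neq_0 by (metis mult_left_cancel)
    qed
    show "B (i, i) = 0" for i
      using altD(4)[OF A, of i] two_neq_0 by simp
    show "(\<Sum>j = 1..n. B (i, j)) = 0" for i
      using altD(5)[OF A, of i] two_neq_0 by (simp flip: sum_distrib_left)
  qed
qed (rule alt_sc)

lemma mod2_eq_0D:
  assumes "A \<in> alt n" "mod2 A = 0"
  obtains B where "B \<in> alt n" "A = sc 2 B"
proof -
  have "\<exists>y. A p = 2 * y" for p
    using parity_eq_0D[of "A p"] fun_cong[OF assms(2), of p] by (auto simp: mod2_def)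
  then obtain B where B: "\<And>p. A p = 2 * B p" by metis
  then have "A = sc 2 B" by (simp add: fun_eq_iff)
  then show ?thesis using that assms(1) sc_2_alt_iff by blast
qed

lemma mod2_eqD:
  assumes "A \<in> alt n" "B \<in> alt n" "mod2 A = mod2 B"
  obtains C where "C \<in> alt n" "A = B + sc 2 C"
proof -
  have "mod2 (A - B) = 0" using assms(3) by (simp add: mod2_simps)
  then obtain C where "C \<in> alt n" "A - B = sc 2 C"
    using mod2_eq_0D alt_diff[OF assms(1,2)] by metis
  then show ?thesis using that by (metis diff_add_cancel add.commute)
qed

text \<open>Lifting entry by entry would destroy the row sums; lifting the coefficients of the
  triangles, which reduce to triangles, preserves them.\<close>

lemma mod2_lift:
  assumes "X \<in> alt n"
  obtains A where "A \<in> alt n" "mod2 A = X"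
proof -
  define lf :: "bit \<Rightarrow> padic2" where "lf b = (if b = 0 then 0 else 1)" for b
  have lf: "parity (lf b) = b" for b by (cases b) (simp_all add: lf_def parity_0 parity_1)
  define A where "A = (\<Sum>(k, l)\<in>ind_less n. sc (lf (X (k, l))) (tri k l n))"
  have "A \<in> alt n"
    unfolding A_def by (rule alt_sum) (auto simp: ind_less_def intro!: alt_sc tri_alt)
  moreover have "mod2 A = (\<Sum>(k, l)\<in>ind_less n. sc (X (k, l)) (tri k l n))"
    by (simp only: A_def mod2_sum case_prod_unfold mod2_simps lf tri_def mod2_wedge mod2_uvec)
  then have "mod2 A = X" using alt_expand[OF assms] by simp
  ultimately show ?thesis using that by blast
qed

text \<open>Full preimages under reduction modulo 2, so that each of them contains
  \<open>2 S\<close>, the lattice with index 4.\<close>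

definition lat :: "nat \<Rightarrow> nat \<Rightarrow> padic2 mat set"
  where "lat n i = {A \<in> alt n. mod2 A \<in> lat2 n i}"

lemma lattice_lat:
  assumes "i \<le> 4" shows "lattice n (lat n i)"
proof -
  note B = latticeD[OF lattice_lat2[OF assms, of n]]
  show ?thesis
    unfolding lattice_def
  proof (intro conjI ballI allI impI)
    show "lat n i \<subseteq> alt n" by (auto simp: lat_def)
    show "0 \<in> lat n i" using B(2) by (simp add: lat_def alt_zero mod2_simps)
    show "A + B \<in> lat n i" if "A \<in> lat n i" "B \<in> lat n i" for A B
      using that B(3) by (simp add: lat_def alt_add mod2_simps)
    show "sc c A \<in> lat n i" if "A \<in> lat n i" for c A
      using that B(4) by (simp add: lat_def alt_sc mod2_simps)
    show "pact \<sigma> A \<in> lat n i" if "\<sigma> permutes {1..n}" "A \<in> lat n i" for \<sigma> A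
      using that B(5)[OF that(1)] by (simp add: lat_def pact_alt[OF that(1)] mod2_pact)
  qed
qed

lemma lat_0: "lat n 0 = alt n"
  by (auto simp: lat_def lat2_simps mod2_alt)

lemma lat_4: "lat n 4 = sc 2 ` alt n"
proof
  show "lat n 4 \<subseteq> sc 2 ` alt n"
  proof
    fix A assume "A \<in> lat n 4"
    then have "A \<in> alt n" "mod2 A = 0" by (simp_all add: lat_def lat2_simps)
    then obtain B where "B \<in> alt n" "A = sc 2 B" by (rule mod2_eq_0D)
    then show "A \<in> sc 2 ` alt n" by blast
  qed
  have "mod2 (sc 2 B) = 0" for B :: "padic2 mat"
    by (simp only: mod2_simps parity_2 sc_0_left)
  then show "sc 2 ` alt n \<subseteq> lat n 4"
    unfolding lat_def lat2_simps using alt_sc by blast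
qed

lemma lattice_mod2:
  assumes "lattice n L" shows "lattice n (mod2 ` L)"
proof -
  note L = latticeD[OF assms]
  show ?thesis
    unfolding lattice_def
  proof (intro conjI ballI allI impI)
    show "mod2 ` L \<subseteq> alt n" using L(1) mod2_alt by blast
    show "0 \<in> mod2 ` L" using imageI[OF L(2), of mod2] by (simp only: mod2_simps)
    show "X + Y \<in> mod2 ` L" if "X \<in> mod2 ` L" "Y \<in> mod2 ` L" for X Y
      using that L(3) by (elim imageE) (simp only: mod2_simps(1)[symmetric] imageI)
    show "sc c X \<in> mod2 ` L" if "X \<in> mod2 ` L" for c X
    proof -
      have "c = parity (if c = 0 then 0 else 1)" by (cases c; simp add: parity_0 parity_1)
      then obtain d where "c = parity d" by blast
      then show ?thesis
        using that L(4) by (elim imageE) (simp only: mod2_simps(4)[symmetric] imageI)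
    qed
    show "pact \<sigma> X \<in> mod2 ` L" if "\<sigma> permutes {1..n}" "X \<in> mod2 ` L" for \<sigma> X
      using that L(5) by (elim imageE) (simp only: mod2_pact[symmetric] imageI)
  qed
qed

text \<open>With \<open>j = 1\<close> this turns the question which \<open>2 X\<close> lie in
  \<open>L\<close> into one about a lattice, to which Nakayama's lemma applies. With general
  \<open>j\<close> it normalises an embedded form.\<close>

lemma lattice_divide:
  assumes L: "lattice n L"
  shows "lattice n {B \<in> alt n. sc (2 ^ j) B \<in> (L :: padic2 mat set)}"
proof -
  have c: "sc (2 ^ j) (sc r B) = sc r (sc (2 ^ j) B)" for r :: padic2 and B :: "padic2 mat"
    by (simp add: fun_eq_iff)
  show ?thesis
    unfolding lattice_def
  proof (intro conjI ballI allI impI)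
    show "0 \<in> {B \<in> alt n. sc (2 ^ j) B \<in> L}" by (simp only: mem_Collect_eq sc_0_right alt_zero latticeD(2)[OF L] simp_thms)
    show "A + B \<in> {B \<in> alt n. sc (2 ^ j) B \<in> L}"
      if "A \<in> {B \<in> alt n. sc (2 ^ j) B \<in> L}" "B \<in> {B \<in> alt n. sc (2 ^ j) B \<in> L}" for A B
      unfolding mem_Collect_eq sc_add using that alt_add latticeD(3)[OF L] by blast
    show "sc r A \<in> {B \<in> alt n. sc (2 ^ j) B \<in> L}" if "A \<in> {B \<in> alt n. sc (2 ^ j) B \<in> L}" for r A
      unfolding mem_Collect_eq c using that alt_sc latticeD(4)[OF L] by blast
    show "pact \<sigma> A \<in> {B \<in> alt n. sc (2 ^ j) B \<in> L}"
      if s: "\<sigma> permutes {1..n}" and "A \<in> {B \<in> alt n. sc (2 ^ j) B \<in> L}" for \<sigma> A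
      unfolding mem_Collect_eq pact_linear(4)[symmetric] using that pact_alt[OF s] latticeD(5)[OF L s] by blast
  qed blast
qed

text \<open>
  Nakayama's lemma, by eliminating the triangles one after the other: each time the coefficient to be
  inverted has the form \<open>1 - 2 c\<close> and is therefore a unit.
\<close>

lemma lattice_nakayama:
  assumes L: "lattice n L" and gen: "\<And>A. A \<in> alt n \<Longrightarrow> mod2 A \<in> mod2 ` L"
  shows "alt n \<subseteq> L"
proof -
  let ?t = "\<lambda>(k, l). tri k l n"
  \<comment> \<open>\<open>G F\<close> states that \<open>L\<close> and the triangles indexed by
    \<open>F\<close> together span \<open>alt n\<close>. One index is removed at a time until
    \<open>G {}\<close> is reached.\<close>
  define G where "G F \<longleftrightarrow> (\<forall>A\<in>alt n. \<exists>B\<in>L. \<exists>c. A = B + (\<Sum>p\<in>F. sc (c p) (?t p)))" for F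
  have red: "G F" if G: "G (insert p F)" and F: "finite F" "p \<notin> F" "p \<in> ind_less n" for p F
  proof -
    have tp: "?t p \<in> alt n" using F(3) by (auto simp: ind_less_def intro!: tri_alt)
    obtain B where B: "B \<in> L" "mod2 (?t p) = mod2 B" using gen[OF tp] by blast
    have Bn: "B \<in> alt n" using latticeD(1)[OF L] B by blast
    obtain X where X: "X \<in> alt n" "?t p = B + sc 2 X" using mod2_eqD[OF tp Bn B(2)] .
    obtain B' c where B': "B' \<in> L" "X = B' + (\<Sum>p\<in>insert p F. sc (c p) (?t p))"
      using G X(1) unfolding G_def by blast
    have "parity (1 - 2 * c p) = 1" by (simp add: parity_simps)
    then obtain v where v: "(1 - 2 * c p) * v = 1" by (rule parity_1_unit)
    have e: "?t p = B + sc 2 (B' + (sc (c p) (?t p) + (\<Sum>q\<in>F. sc (c q) (?t q))))"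
      using X(2) B'(2) F by simp
    have "sc (1 - 2 * c p) (?t p) = ?t p - sc (2 * c p) (?t p)"
      by (simp add: fun_eq_iff left_diff_distrib)
    also have "\<dots> = B + sc 2 B' + sc 2 (\<Sum>q\<in>F. sc (c q) (?t q))"
      by (subst e) (simp add: sc_add sc_sc)
    finally have "sc v (sc (1 - 2 * c p) (?t p)) = sc v (B + sc 2 B') + (\<Sum>q\<in>F. sc (v * 2 * c q) (?t q))"
      by (simp add: sc_add sc_sum sc_sc mult.assoc)
    then have tp': "?t p = sc v (B + sc 2 B') + (\<Sum>q\<in>F. sc (v * 2 * c q) (?t q))"
      using v by (simp add: sc_sc sc_1 mult.commute)
    show ?thesis
      unfolding G_def
    proof
      fix A :: "padic2 mat" assume "A \<in> alt n"
      then obtain B1 c1 where A: "B1 \<in> L" "A = B1 + (\<Sum>p\<in>insert p F. sc (c1 p) (?t p))"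
        using G unfolding G_def by blast
      have "A = B1 + sc (c1 p) (?t p) + (\<Sum>q\<in>F. sc (c1 q) (?t q))"
        using A(2) F by (simp add: add.assoc)
      also have "sc (c1 p) (?t p) = sc (c1 p * v) (B + sc 2 B') + (\<Sum>q\<in>F. sc (c1 p * (v * 2 * c q)) (?t q))"
        by (subst tp') (simp add: sc_add sc_sum sc_sc mult.assoc)
      finally have "A = (B1 + sc (c1 p * v) (B + sc 2 B')) + (\<Sum>q\<in>F. sc (c1 p * (v * 2 * c q) + c1 q) (?t q))"
        by (simp add: fun_eq_iff sum_fun_apply distrib_right sum.distrib add.assoc)
      moreover have "B1 + sc (c1 p * v) (B + sc 2 B') \<in> L"
        by (intro latticeD(3,4)[OF L] A(1) B(1) B'(1))
      ultimately show "\<exists>B\<in>L. \<exists>c. A = B + (\<Sum>p\<in>F. sc (c p) (?t p))"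
        by (intro bexI[where x = "B1 + sc (c1 p * v) (B + sc 2 B')"]
            exI[where x = "\<lambda>q. c1 p * (v * 2 * c q) + c1 q"])
    qed
  qed
  have "G F \<Longrightarrow> G {}" if "finite F" "F \<subseteq> ind_less n" for F
    using that by (induction F rule: finite_induct) (auto dest: red)
  moreover have "G (ind_less n)"
    unfolding G_def
  proof
    fix A :: "padic2 mat" assume "A \<in> alt n"
    then have "A = 0 + (\<Sum>p\<in>ind_less n. sc (A p) (?t p))"
      using alt_expand[of A n] by (simp add: case_prod_unfold)
    then show "\<exists>B\<in>L. \<exists>c. A = B + (\<Sum>p\<in>ind_less n. sc (c p) (?t p))"
      using latticeD(2)[OF L] by blast
  qed
  ultimately have "G {}" using finite_ind_less by blast
  then show ?thesis unfolding G_def by fastforce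
qed

text \<open>Modulo 2 every proper submodule lies in \<open>lat2 n 1\<close>. A lattice outside its
  preimage therefore has full reduction.\<close>

lemma top_lattice:
  assumes "lattice n L" "n \<ge> 6" "n mod 4 = 2" "\<not> L \<subseteq> lat n 1"
  shows "alt n \<subseteq> L"
proof (rule lattice_nakayama[OF assms(1)])
  have "\<not> mod2 ` L \<subseteq> lat2 n (Suc 0)"
    using assms(4) latticeD(1)[OF assms(1)] by (auto simp: lat_def)
  then have "alt n \<subseteq> mod2 ` L"
    using lat2_classify[OF lattice_mod2[OF assms(1)] assms(2,3), of 0] by (simp add: lat2_simps)
  then show "A \<in> alt n \<Longrightarrow> mod2 A \<in> mod2 ` L" for A
    using mod2_alt by blast
qed

text \<open>
  A lattice containing twice a matrix with an odd number of odd entries above the diagonal contains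
  all of \<open>sc 2 ` alt n\<close>, after which only its reduction modulo 2 matters.
\<close>

lemma lattice_step:
  assumes L: "lattice n L" and n: "n \<ge> 6" "n mod 4 = 2" and i: "i < 4"
    and nL: "\<not> L \<subseteq> lat n (Suc i)" and X: "X \<in> alt n" "X \<notin> lat n 1" "sc 2 X \<in> L"
  shows "lat n i \<subseteq> L"
proof
  fix Y assume "Y \<in> lat n i"
  then have Y: "Y \<in> alt n" "mod2 Y \<in> lat2 n i" by (auto simp: lat_def)
  have "\<not> {X \<in> alt n. sc 2 X \<in> L} \<subseteq> lat n 1" using X by blast
  then have two: "sc 2 Z \<in> L" if "Z \<in> alt n" for Z
    using top_lattice[OF lattice_divide[OF L, of 1, unfolded power_one_right] n] that by blast
  have "\<not> mod2 ` L \<subseteq> lat2 n (Suc i)"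
    using nL latticeD(1)[OF L] by (auto simp: lat_def)
  then have "mod2 Y \<in> mod2 ` L"
    using lat2_classify[OF lattice_mod2[OF L] n i] Y(2) by blast
  then obtain B where B: "B \<in> L" "mod2 Y = mod2 B" by blast
  then obtain Z where "Z \<in> alt n" "Y = B + sc 2 Z"
    using mod2_eqD[OF Y(1)] latticeD(1)[OF L] by blast
  then show "Y \<in> L" using two B(1) latticeD(3)[OF L] by simp
qed

section \<open>Finding twice an odd matrix in a lattice\<close>

lemma not_lat_1: "X \<in> alt n \<Longrightarrow> edges {1..n} (mod2 X) = 1 \<Longrightarrow> X \<notin> lat n 1"
  by (simp add: lat_def lat2_simps)

lemma odd_of_nat_bit: "odd k \<Longrightarrow> (of_nat k :: bit) = 1"
  by (elim oddE) (simp only: of_nat_add of_nat_mult of_nat_numeral bit_2_eq_0 mult_zero_left of_nat_1 add_0)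

text \<open>Permutations preserve the edge parity, so an odd number of conjugates of
  \<open>B\<close> contributes the parity of \<open>B\<close> itself.\<close>

lemma half_relation:
  assumes L: "lattice n L" and A: "z + sc 2 B \<in> L" "B \<in> alt n" and y: "y \<in> alt n"
    and I: "finite I" "odd (card I)" "\<And>i. i \<in> I \<Longrightarrow> \<sigma> i permutes {1..n}"
    and rel: "(\<Sum>i\<in>I. pact (\<sigma> i) z) = sc 2 y"
  obtains X where "X \<in> alt n" "sc 2 X \<in> L"
    "edges {1..n} (mod2 X) = edges {1..n} (mod2 y) + edges {1..n} (mod2 B)"
proof -
  define X where "X = y + (\<Sum>i\<in>I. pact (\<sigma> i) B)"
  have "X \<in> alt n"
    unfolding X_def by (intro alt_add alt_sum y pact_alt I(3) A(2))
  moreover have "sc 2 X = (\<Sum>i\<in>I. pact (\<sigma> i) (z + sc 2 B))"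
    by (simp only: X_def sc_add sc_sum pact_linear sum.distrib rel)
  then have "sc 2 X \<in> L"
    using latticeD(5)[OF L I(3) A(1)] by (simp only:, intro latticeD(8)[OF L])
  moreover have "edges {1..n} (mod2 X) = edges {1..n} (mod2 y) + (\<Sum>i\<in>I. edges {1..n} (pact (\<sigma> i) (mod2 B)))"
    by (simp only: X_def mod2_simps mod2_sum edges_add edges_sum mod2_pact)
  moreover have "(\<Sum>i\<in>I. edges {1..n} (pact (\<sigma> i) (mod2 B))) = (\<Sum>i\<in>I. edges {1..n} (mod2 B))"
    by (intro sum.cong refl edges_pact I(3) mod2_alt A(2))
  moreover have "(\<Sum>i\<in>I. edges {1..n} (mod2 B)) = edges {1..n} (mod2 B)"
    unfolding sum_constant using odd_of_nat_bit[OF I(2)] by simp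
  ultimately show ?thesis using that by simp
qed

text \<open>
  Suppose that an odd number of conjugates of \<open>z\<close> adds up to \<open>2 y\<close>. The corresponding conjugates of
  \<open>z + 2 B \<in> L\<close> add up to \<open>2 (y + B')\<close>, where \<open>B'\<close> has the parity of \<open>B\<close>. Having relations with both
  parities of \<open>y\<close>, one can choose one for which \<open>y + B'\<close> is odd.
\<close>

lemma half_of_relations:
  assumes L: "lattice n L" and A: "A \<in> L" and z: "z \<in> alt n" "mod2 A = mod2 z"
    and rel: "\<And>b. \<exists>(I::nat set) \<sigma> y. finite I \<and> odd (card I) \<and> (\<forall>i\<in>I. \<sigma> i permutes {1..n}) \<and>
      y \<in> alt n \<and> (\<Sum>i\<in>I. pact (\<sigma> i) z) = sc 2 y \<and> edges {1..n} (mod2 y) = b"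
  shows "\<exists>X\<in>alt n. X \<notin> lat n 1 \<and> sc 2 X \<in> L"
proof -
  obtain B where B: "B \<in> alt n" "A = z + sc 2 B"
    using mod2_eqD[of A n z] latticeD(1)[OF L] A z by blast
  obtain I :: "nat set" and \<sigma> y where I: "finite I" "odd (card I)" "\<And>i. i \<in> I \<Longrightarrow> \<sigma> i permutes {1..n}"
    and y: "y \<in> alt n" "(\<Sum>i\<in>I. pact (\<sigma> i) z) = sc 2 y" "edges {1..n} (mod2 y) = edges {1..n} (mod2 B) + 1"
    using rel[of "edges {1..n} (mod2 B) + 1"] by blast
  obtain X where X: "X \<in> alt n" "sc 2 X \<in> L"
    "edges {1..n} (mod2 X) = edges {1..n} (mod2 y) + edges {1..n} (mod2 B)"
    by (rule half_relation[OF L A[unfolded B(2)] B(1) y(1) I y(2)])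
  have "edges {1..n} (mod2 X) = 1"
    unfolding X(3) y(3) by (cases "edges {1..n} (mod2 B)") simp_all
  then show ?thesis using X not_lat_1 by blast
qed

text \<open>The first identity telescopes in the second factor. In the second one the cyclic
  permutations of \<open>b\<close>, \<open>c\<close>, \<open>d\<close> make all terms in
  \<open>a\<close> cancel, and minus twice a triangle remains, which has an odd number of
  edges.\<close>

lemma cyc4_relation:
  "wedge (a - b) (c - d) + wedge (a - b) (d - e) + wedge (a - b) (e - c) = (0 :: 'r::comm_ring_1 mat)"
  "wedge (a - b) (c - d) + wedge (a - c) (d - b) + wedge (a - d) (b - c) = sc 2 (- wedge (b - d) (c - d))"
  by (auto simp: fun_eq_iff wedge_def algebra_simps)

lemma edges_cyc4:
  assumes "distinct [i, j, k, l]" "{i, j, k, l} \<subseteq> {1..n}"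
  shows "edges {1..n} (cyc4 i j k l) = 0"
proof -
  have c: "(cyc4 i j k l :: bit mat) = wedge (uvec i) (uvec k) + wedge (uvec j) (uvec k) + (wedge (uvec i) (uvec l) + wedge (uvec j) (uvec l))"
    by (simp only: cyc4_def bit_fun_diff wedge_bilinear)
  have "edges {1..n} (wedge (uvec p) (uvec q)) = 1" if "p \<in> {1..n}" "q \<in> {1..n}" "p \<noteq> q" for p q
    using that by (intro edges_wedge_uvec) simp_all
  then show ?thesis
    unfolding c edges_add using assms by simp
qed

text \<open>The element \<open>z\<close> lifts a 4-cycle. Three conjugates with the same first
  factor add up to zero, which takes a fifth vertex; three conjugates obtained by rotating 2, 3, 4
  add up to minus twice the triangle on these vertices. The two relations have parities 0 and
  1.\<close>

lemma half_1:
  assumes L: "lattice n L" and n: "n \<ge> 6" "n mod 4 = 2" and L2: "\<not> L \<subseteq> lat n 2"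
  shows "\<exists>X\<in>alt n. X \<notin> lat n 1 \<and> sc 2 X \<in> L"
proof -
  define z :: "padic2 mat" where "z = cyc4 1 2 3 4"
  have z: "z \<in> alt n" unfolding z_def using n by (intro cyc4_alt) auto
  have mz: "mod2 z = cyc4 1 2 3 4" by (simp only: z_def cyc4_def mod2_wedge mod2_simps mod2_uvec)
  have "\<not> mod2 ` L \<subseteq> lat2 n (Suc 1)"
    using L2 latticeD(1)[OF L] by (auto simp: lat_def numeral_2_eq_2)
  then have sub: "lat2 n 1 \<subseteq> mod2 ` L"
    using lat2_classify[OF lattice_mod2[OF L] n, of 1] by simp
  have "edges {1..n} (mod2 z) = 0" unfolding mz using n by (intro edges_cyc4) auto
  then have "mod2 z \<in> lat2 n 1" using mod2_alt[OF z] by (simp add: lat2_simps)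
  then obtain A where A: "A \<in> L" "mod2 A = mod2 z" using sub by (metis imageE subsetD)
  show ?thesis
  proof (rule half_of_relations[OF L A(1) z A(2)])
    have perm: "\<exists>\<sigma>. \<sigma> permutes {1..n} \<and> map \<sigma> [1, 2, 3, 4, 5] = ys"
      if "distinct ys" "length ys = 5" "set ys \<subseteq> {1..n}" for ys
      using that n by (intro permutes_extend) auto
    have I: "finite {0, 1, 2 :: nat}" "odd (card {0, 1, 2 :: nat})" by simp_all
    fix b :: bit
    show "\<exists>(I::nat set) \<sigma> y. finite I \<and> odd (card I) \<and> (\<forall>i\<in>I. \<sigma> i permutes {1..n}) \<and>
      y \<in> alt n \<and> (\<Sum>i\<in>I. pact (\<sigma> i) z) = sc 2 y \<and> edges {1..n} (mod2 y) = b"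
    proof (cases "b = 0")
      case zero: True
      obtain \<sigma> where s: "\<sigma> permutes {1..n}" "map \<sigma> [1, 2, 3, 4, 5] = [1, 2, 4, 5, 3]"
        using perm[of "[1, 2, 4, 5, 3]"] n by auto
      obtain \<tau> where t: "\<tau> permutes {1..n}" "map \<tau> [1, 2, 3, 4, 5] = [1, 2, 5, 3, 4]"
        using perm[of "[1, 2, 5, 3, 4]"] n by auto
      define \<rho> where "\<rho> i = (if i = 0 then id else if i = 1 then \<sigma> else \<tau>)" for i :: nat
      have "(\<Sum>i\<in>{0, 1, 2}. pact (\<rho> i) z) = cyc4 1 2 3 4 + cyc4 1 2 4 5 + cyc4 1 2 5 3"
        using s(2) t(2) by (simp add: \<rho>_def z_def pact_id pact_cyc4[OF s(1)] pact_cyc4[OF t(1)] add.assoc)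
      also have "\<dots> = 0" unfolding cyc4_def by (rule cyc4_relation)
      also have "(0 :: padic2 mat) = sc 2 0" by (simp only: sc_0_right)
      finally have "(\<Sum>i\<in>{0, 1, 2}. pact (\<rho> i) z) = sc 2 0" .
      moreover have "\<forall>i\<in>{0, 1, 2}. \<rho> i permutes {1..n}"
        using s(1) t(1) permutes_id by (simp add: \<rho>_def)
      moreover have "edges {1..n} (mod2 0) = b"
        unfolding zero mod2_simps edges_0 ..
      ultimately show ?thesis using I alt_zero by blast
    next
      case False
      then have one: "b = 1" by simp
      obtain \<sigma> where s: "\<sigma> permutes {1..n}" "map \<sigma> [1, 2, 3, 4, 5] = [1, 3, 4, 2, 5]"
        using perm[of "[1, 3, 4, 2, 5]"] n by auto
      obtain \<tau> where t: "\<tau> permutes {1..n}" "map \<tau> [1, 2, 3, 4, 5] = [1, 4, 2, 3, 5]"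
        using perm[of "[1, 4, 2, 3, 5]"] n by auto
      define \<rho> where "\<rho> i = (if i = 0 then id else if i = 1 then \<sigma> else \<tau>)" for i :: nat
      have "(\<Sum>i\<in>{0, 1, 2}. pact (\<rho> i) z) = cyc4 1 2 3 4 + cyc4 1 3 4 2 + cyc4 1 4 2 3"
        using s(2) t(2) by (simp add: \<rho>_def z_def pact_id pact_cyc4[OF s(1)] pact_cyc4[OF t(1)] add.assoc)
      also have "\<dots> = sc 2 (- tri 2 3 4)" unfolding cyc4_def tri_def by (rule cyc4_relation)
      finally have "(\<Sum>i\<in>{0, 1, 2}. pact (\<rho> i) z) = sc 2 (- tri 2 3 4)" .
      moreover have "\<forall>i\<in>{0, 1, 2}. \<rho> i permutes {1..n}"
        using s(1) t(1) permutes_id by (simp add: \<rho>_def)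
      moreover have "- mod2 (tri 2 3 4) = tri 2 3 4"
        by (simp only: tri_def mod2_wedge mod2_simps mod2_uvec) (simp add: fun_eq_iff)
      then have "edges {1..n} (mod2 (- tri 2 3 4)) = b"
        unfolding one mod2_simps using n by (simp add: edges_tri)
      moreover have "- tri 2 3 4 \<in> (alt n :: padic2 mat set)"
        using n by (intro alt_uminus tri_alt) auto
      ultimately show ?thesis using I by blast
    qed
  qed
qed

text \<open>The degrees of \<open>i\<close> and \<open>j\<close> are even, and their sum counts the
  edge between the two vertices twice. The edges meeting \<open>{i, j}\<close> therefore have the
  parity of \<open>x (i, j)\<close>.\<close>

lemma edges_remove2:
  assumes "x \<in> alt n" and ij: "i \<in> {1..n}" "j \<in> {1..n}" "i \<noteq> j"
  shows "edges {1..n} x = edges ({1..n} - {i, j}) x + x (i, j)"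
proof -
  let ?D = "{1..n} - {i, j}"
  have sym: "x (q, p) = x (p, q)" for p q by (rule bit_alt_sym[OF assms(1)])
  have e: "{1..n} = insert i (insert j ?D)" using ij by auto
  have "edges {1..n} x = edges (insert j ?D) x + (\<Sum>k\<in>insert j ?D. x (i, k))"
    by (subst e, rule edges_insert) (use ij sym in auto)
  also have "edges (insert j ?D) x = edges ?D x + (\<Sum>k\<in>?D. x (j, k))"
    by (rule edges_insert) (use sym in auto)
  also have "(\<Sum>k\<in>insert j ?D. x (i, k)) = (\<Sum>k\<in>{1..n}. x (i, k))"
    by (subst (2) e) (use ij altD(4)[OF assms(1)] in simp)
  also have "\<dots> = 0" by (rule altD(5)[OF assms(1)])
  also have "(\<Sum>k\<in>{1..n}. x (j, k)) = x (i, j) + (\<Sum>k\<in>?D. x (j, k))"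
    by (subst e) (use ij altD(4)[OF assms(1)] sym[of j i] in simp)
  then have "(\<Sum>k\<in>?D. x (j, k)) = x (i, j)"
    unfolding altD(5)[OF assms(1)] by (cases "x (i, j)"; cases "\<Sum>k\<in>?D. x (j, k)") simp_all
  finally show ?thesis by simp
qed

text \<open>
  If the graph of \<open>A\<close> is the complement of a cut with \<open>i\<close> and \<open>j\<close> on the same side, then \<open>A + (i j) A = 2 X\<close> where
  \<open>X\<close> agrees with \<open>A\<close> off the rows and columns of \<open>i\<close> and \<open>j\<close>, but has no edge from \<open>i\<close> to \<open>j\<close>.
\<close>

lemma half_2:
  assumes L: "lattice n L" and n: "n \<ge> 6" "n mod 4 = 2" and L3: "L \<subseteq> lat n 2" "\<not> L \<subseteq> lat n 3"
  shows "\<exists>X\<in>alt n. X \<notin> lat n 1 \<and> sc 2 X \<in> L"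
proof -
  note m = mod4_facts[OF n(2)]
  obtain A where A: "A \<in> L" "A \<notin> lat n 3" using L3 by blast
  have An: "A \<in> alt n" using A latticeD(1)[OF L] by blast
  obtain f c where f: "is_cut n f c (mod2 A)" using A L3(1) by (auto simp: lat_def lat2_simps)
  have c: "c = 1" using A An f mod2_alt[OF An] by (cases c) (auto simp: lat_def lat2_simps)
  \<comment> \<open>Of three vertices two lie on the same side.\<close>
  have "f 1 = f 2 \<or> f 1 = f 3 \<or> f 2 = f 3" by (cases "f 1"; cases "f 2"; cases "f 3") simp_all
  moreover have "1 \<in> {1..n}" "2 \<in> {1..n}" "3 \<in> {1..n}" using n by auto
  moreover have "(1::nat) \<noteq> 2" "(1::nat) \<noteq> 3" "(2::nat) \<noteq> 3" by simp_all
  ultimately obtain i j where ij: "i \<in> {1..n}" "j \<in> {1..n}" "i \<noteq> j" "f i = f j" by blast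
  let ?s = "Transposition.transpose i j"
  have s: "?s permutes {1..n}" using ij by (intro permutes_swap_id)
  have A': "A + pact ?s A \<in> L" by (intro latticeD(3,5)[OF L] s A)
  have "is_cut n (f + vact ?s f) (c + c) (mod2 A + pact ?s (mod2 A))"
    by (intro is_cut_add is_cut_pact f s)
  also have "f + vact ?s f = 0"
    using add_vact_transpose[OF ij(3), of f] ij(4) by (simp only: bit_add_self sc_0_left)
  also have "c + c = 0" by (rule bit_add_self)
  finally have "mod2 A + pact ?s (mod2 A) = cut_mat n 0"
    by (intro eq_cut_mat alt_add pact_alt mod2_alt An s)
  then have "mod2 (A + pact ?s A) = 0" by (simp only: mod2_simps mod2_pact cut_mat_linear)
  then obtain X where X: "X \<in> alt n" "A + pact ?s A = sc 2 X"
    using A' latticeD(1)[OF L] mod2_eq_0D by blast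
  have X2: "2 * X (p, q) = A (p, q) + A (?s p, ?s q)" for p q
    using fun_cong[OF X(2), of "(p, q)"] by (simp add: pact_def)
  have "2 * X (i, j) = 0" unfolding X2 using altD(3)[OF An, of i j] by simp
  then have Xij: "X (i, j) = 0" using two_neq_0 by simp
  have XA: "X (p, q) = A (p, q)" if "p \<in> {1..n} - {i, j}" "q \<in> {1..n} - {i, j}" for p q
  proof -
    have "2 * X (p, q) = 2 * A (p, q)"
      unfolding X2 using that by (simp add: transpose_apply_other)
    then show ?thesis using two_neq_0 by (metis mult_left_cancel)
  qed
  \<comment> \<open>Off \<open>i\<close> and \<open>j\<close> the two graphs agree, while the edge
    from \<open>i\<close> to \<open>j\<close> is present in \<open>A\<close> and absent from
    \<open>X\<close>. Since \<open>A\<close> has an even number of edges, \<open>X\<close> has an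
    odd number.\<close>
  have "edges ({1..n} - {i, j}) (mod2 X) = edges ({1..n} - {i, j}) (mod2 A)"
    unfolding edges_def by (rule sum.cong) (auto simp: less_pairs_def mod2_def XA)
  moreover have "mod2 X (i, j) = 0" "mod2 A (i, j) = 1"
    using Xij f c ij by (simp_all add: mod2_def parity_0 is_cut_def bit_add_self)
  moreover have "A \<in> lat n 1"
    using L3(1) A lat2_chain[OF n(2), of 1] by (auto simp: lat_def numeral_2_eq_2)
  then have "edges {1..n} (mod2 A) = 0" by (simp add: lat_def lat2_simps)
  ultimately have "edges {1..n} (mod2 X) = 1"
    using edges_remove2[OF mod2_alt[OF X(1)] ij(1-3)] edges_remove2[OF mod2_alt[OF An] ij(1-3)]
    by (cases "edges ({1..n} - {i, j}) (mod2 A)") auto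
  then show ?thesis using not_lat_1[OF X(1)] X A' by auto
qed

text \<open>
  The lift of the cut of \<open>{1, 2}\<close> to be used is \<open>d\<^sub>0 \<and> (d\<^sub>0 + \<dots> + d\<^sub>m\<^sub>-\<^sub>1)\<close> with \<open>n = 2 m\<close> and the
  differences \<open>d\<^sub>k\<close> of the pairs \<open>{2 k + 1, 2 k + 2}\<close>. Permuting the pairs, its \<open>m\<close> conjugates (an odd number)
  add up to zero.
\<close>

definition pair_diff :: "nat \<Rightarrow> nat \<Rightarrow> 'r::comm_ring_1"
  where "pair_diff k = uvec (2 * k + 1) - uvec (2 * k + 2)"

definition pair_sum :: "nat \<Rightarrow> nat \<Rightarrow> 'r::comm_ring_1"
  where "pair_sum m = (\<Sum>k<m. pair_diff k)"

lemma pair_diff_sum0: "2 * k + 2 \<le> n \<Longrightarrow> pair_diff k \<in> sum0 n"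
  unfolding pair_diff_def by (intro uvec_diff_sum0) auto

lemma pair_sum_sum0: "pair_sum m \<in> sum0 (2 * m)"
  unfolding pair_sum_def by (intro sum0_sum pair_diff_sum0) auto

text \<open>Each vertex lies in exactly one pair, so the sum reduces to the all-one vector on the
  vertices. Wedging \<open>pair_diff 0\<close> with it therefore gives the cut of
  \<open>{1, 2}\<close>.\<close>

lemma mod2_pair_sum:
  assumes "j \<in> {1..2 * m}" shows "mod2 (pair_sum m) j = 1"
proof -
  have "mod2 (pair_sum m) j = (\<Sum>k<m. mod2 (pair_diff k) j)"
    by (simp add: pair_sum_def mod2_sum sum_fun_apply)
  also have "\<dots> = (\<Sum>k<m. if k = (j - 1) div 2 then 1 else 0)"
  proof (rule sum.cong[OF refl])
    fix k
    have "mod2 (pair_diff k) = uvec (2 * k + 1) + uvec (2 * k + 2)"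
      by (simp only: pair_diff_def mod2_simps mod2_uvec bit_fun_diff)
    moreover have "k = (j - 1) div 2 \<longleftrightarrow> j = 2 * k + 1 \<or> j = 2 * k + 2"
      using assms by auto
    ultimately show "mod2 (pair_diff k) j = (if k = (j - 1) div 2 then 1 else 0)"
      by (auto simp: uvec_def)
  qed
  also have "\<dots> = 1" using assms by (subst sum.delta) auto
  finally show ?thesis .
qed

text \<open>Exchanges the pairs with numbers 0 and \<open>i\<close> and keeps the order inside them,
  so that no signs arise; for \<open>i = 0\<close> it is the identity.\<close>

definition pair_swap :: "nat \<Rightarrow> nat \<Rightarrow> nat"
  where "pair_swap i = Transposition.transpose 1 (2 * i + 1) \<circ> Transposition.transpose 2 (2 * i + 2)"

lemma pair_swap_permutes: "2 * i + 2 \<le> n \<Longrightarrow> pair_swap i permutes {1..n}"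
  unfolding pair_swap_def by (intro permutes_compose permutes_swap_id) auto

lemma pair_swap_apply:
  "pair_swap i (2 * k + 1) = 2 * Transposition.transpose 0 i k + 1"
  "pair_swap i (2 * k + 2) = 2 * Transposition.transpose 0 i k + 2"
  unfolding pair_swap_def Transposition.transpose_def by (auto, presburger+)

lemma vact_pair_diff:
  "2 * i + 2 \<le> n \<Longrightarrow> vact (pair_swap i) (pair_diff k) = pair_diff (Transposition.transpose 0 i k)"
  unfolding pair_diff_def vact_linear vact_uvec[OF pair_swap_permutes] pair_swap_apply ..

lemma vact_pair_sum:
  assumes "i < m" shows "vact (pair_swap i) (pair_sum m) = pair_sum m"
proof -
  have t: "Transposition.transpose 0 i permutes {..<m}"
    using assms by (intro permutes_swap_id) auto
  have "vact (pair_swap i) (pair_sum m) = (\<Sum>k<m. pair_diff (Transposition.transpose 0 i k))"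
    unfolding pair_sum_def vact_sum using assms by (intro sum.cong refl vact_pair_diff[of i "2 * m"]) auto
  also have "\<dots> = pair_sum m"
    unfolding pair_sum_def by (rule sum.permute[OF t, unfolded comp_def, symmetric])
  finally show ?thesis .
qed

text \<open>The sum runs over the cyclic permutations of \<open>a\<close>, \<open>b\<close>,
  \<open>c\<close>. The terms in \<open>r\<close> telescope to zero, and the others leave minus
  twice a triangle.\<close>

lemma cut_relation:
  "wedge (a - b) (c + r) + wedge (b - c) (a + r) + wedge (c - a) (b + r) = sc 2 (- wedge (a - c) (b - c) :: 'r::comm_ring_1 mat)"
  by (auto simp: fun_eq_iff wedge_def algebra_simps)

lemma mod2_pair_cut:
  assumes "n = 2 * m" "n > 0"
  shows "is_cut n (uvec 1 + uvec 2) 0 (mod2 (wedge (pair_diff 0) (pair_sum m)))"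
proof -
  have "mod2 (pair_diff 0) = uvec 1 + uvec 2"
    by (simp only: pair_diff_def mod2_simps mod2_uvec bit_fun_diff) (simp add: numeral_2_eq_2)
  then show ?thesis
    using assms(1) mod2_pair_sum[of _ m] by (auto simp: is_cut_def mod2_wedge wedge_apply)
qed

text \<open>The relation of parity 0 sums over all pairs, whose number \<open>m\<close> is odd. The
  relation of parity 1 uses the three rotations of the vertices 1, 2, 3.\<close>

lemma half_3:
  assumes L: "lattice n L" and n: "n \<ge> 6" "n mod 4 = 2" and L4: "\<not> L \<subseteq> lat n 4"
  shows "\<exists>X\<in>alt n. X \<notin> lat n 1 \<and> sc 2 X \<in> L"
proof -
  note mf = mod4_facts[OF n(2)]
  define m where "m = n div 2"
  have nm: "n = 2 * m" "m \<ge> 3" "odd m" using mf n by (auto simp: m_def)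
  define z :: "padic2 mat" where "z = wedge (pair_diff 0) (pair_sum m)"
  have z: "z \<in> alt n"
    unfolding z_def using nm pair_sum_sum0[of m] by (intro wedge_alt pair_diff_sum0) auto
  have "mod2 z \<in> lat2 n 3"
    using mod2_pair_cut[OF nm(1) mf(2)] mod2_alt[OF z] by (auto simp: lat2_simps z_def)
  moreover have "\<not> mod2 ` L \<subseteq> lat2 n (Suc 3)"
    using L4 latticeD(1)[OF L] by (auto simp: lat_def)
  then have "lat2 n 3 \<subseteq> mod2 ` L"
    using lat2_classify[OF lattice_mod2[OF L] n, of 3] by simp
  ultimately obtain A where A: "A \<in> L" "mod2 A = mod2 z" by (metis imageE subsetD)
  show ?thesis
  proof (rule half_of_relations[OF L A(1) z A(2)])
    fix b :: bit
    show "\<exists>(I::nat set) \<sigma> y. finite I \<and> odd (card I) \<and> (\<forall>i\<in>I. \<sigma> i permutes {1..n}) \<and>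
      y \<in> alt n \<and> (\<Sum>i\<in>I. pact (\<sigma> i) z) = sc 2 y \<and> edges {1..n} (mod2 y) = b"
    proof (cases "b = 0")
      case zero: True
      have "pact (pair_swap i) z = wedge (pair_diff i) (pair_sum m)" if "i < m" for i
        using that nm unfolding z_def pact_wedge vact_pair_sum[OF that] by (simp add: vact_pair_diff[of i n])
      then have "(\<Sum>i<m. pact (pair_swap i) z) = wedge (pair_sum m) (pair_sum m)"
        by (simp add: pair_sum_def wedge_sum_left)
      also have "\<dots> = sc 2 0" by (simp only: wedge_self sc_0_right)
      finally have "(\<Sum>i<m. pact (pair_swap i) z) = sc 2 0" .
      moreover have "\<forall>i\<in>{..<m}. pair_swap i permutes {1..n}"
        by (intro ballI pair_swap_permutes) (use nm in auto)
      moreover have "edges {1..n} (mod2 0) = b"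
        unfolding zero mod2_simps edges_0 ..
      moreover have "finite {..<m}" "odd (card {..<m})" using nm by simp_all
      ultimately show ?thesis using alt_zero by blast
    next
      case False
      then have one: "b = 1" by simp
      \<comment> \<open>What \<open>pair_sum m\<close> contains besides \<open>pair_diff 0\<close>
        and vertex 3. It involves only vertices from 4 on, so the rotations of 1, 2, 3 fix it, and
        \<open>pair_diff 0\<close> drops out of the wedge with itself.\<close>
      define r :: "nat \<Rightarrow> padic2" where "r = (\<Sum>k\<in>{2..<m}. pair_diff k) - uvec 4"
      have e: "{..<m} = insert 0 (insert 1 {2..<m})" using nm(2) by auto
      have "pair_sum m = pair_diff 0 + (pair_diff 1 + (\<Sum>k\<in>{2..<m}. pair_diff k))"
        unfolding pair_sum_def e by simp
      also have "pair_diff 1 = uvec 3 - uvec 4"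
        by (simp add: pair_diff_def eval_nat_numeral)
      finally have D: "pair_sum m = pair_diff 0 + (uvec 3 + r)"
        unfolding r_def by (simp only: add.assoc add_diff_eq diff_add_eq)
      have z': "z = wedge (uvec 1 - uvec 2) (uvec 3 + r)"
        unfolding z_def D wedge_bilinear(2) wedge_self by (simp add: pair_diff_def numeral_2_eq_2)
      \<comment> \<open>The rotation sending 1, 2, 3 to 2, 3, 1, and its inverse.\<close>
      define \<sigma> where "\<sigma> = Transposition.transpose (1::nat) 2 \<circ> Transposition.transpose 2 3"
      define \<tau> where "\<tau> = Transposition.transpose (1::nat) 3 \<circ> Transposition.transpose 2 3"
      have st: "\<sigma> permutes {1..n}" "\<tau> permutes {1..n}"
        unfolding \<sigma>_def \<tau>_def using n by (auto intro!: permutes_compose permutes_swap_id)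
      have r: "vact \<pi> r = r" if "\<pi> permutes {1..n}" "\<And>k. k \<ge> 4 \<Longrightarrow> \<pi> k = k" for \<pi>
        unfolding r_def vact_linear vact_sum pair_diff_def vact_uvec[OF that(1)]
        using that(2) by simp
      have app: "\<sigma> 1 = 2" "\<sigma> 2 = 3" "\<sigma> 3 = 1" "\<And>k. k \<ge> 4 \<Longrightarrow> \<sigma> k = k"
        "\<tau> 1 = 3" "\<tau> 2 = 1" "\<tau> 3 = 2" "\<And>k. k \<ge> 4 \<Longrightarrow> \<tau> k = k"
        by (simp_all add: \<sigma>_def \<tau>_def Transposition.transpose_def)
      have rs: "vact \<sigma> r = r" "vact \<tau> r = r"
        by (rule r[OF st(1)], rule app(4), assumption, rule r[OF st(2)], rule app(8), assumption)
      define \<rho> where "\<rho> i = (if i = 0 then id else if i = 1 then \<sigma> else \<tau>)" for i :: nat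
      have "pact \<sigma> z = wedge (uvec 2 - uvec 3) (uvec 1 + r)" "pact \<tau> z = wedge (uvec 3 - uvec 1) (uvec 2 + r)"
        by (simp_all only: z' pact_wedge vact_linear vact_uvec[OF st(1)] vact_uvec[OF st(2)] rs app)
      then have "(\<Sum>i\<in>{0, 1, 2}. pact (\<rho> i) z) =
          wedge (uvec 1 - uvec 2) (uvec 3 + r) + wedge (uvec 2 - uvec 3) (uvec 1 + r) + wedge (uvec 3 - uvec 1) (uvec 2 + r)"
        by (simp add: \<rho>_def pact_id add.assoc) (simp add: z')
      also have "\<dots> = sc 2 (- tri 1 2 3)" unfolding tri_def by (rule cut_relation)
      finally have "(\<Sum>i\<in>{0, 1, 2}. pact (\<rho> i) z) = sc 2 (- tri 1 2 3)" .
      moreover have "\<forall>i\<in>{0, 1, 2}. \<rho> i permutes {1..n}"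
        using st permutes_id by (simp add: \<rho>_def)
      moreover have "- mod2 (tri 1 2 3) = tri 1 2 3"
        by (simp only: tri_def mod2_wedge mod2_simps mod2_uvec) (simp add: fun_eq_iff)
      then have "edges {1..n} (mod2 (- tri 1 2 3)) = b"
        unfolding one mod2_simps using n by (simp add: edges_tri)
      moreover have "- tri 1 2 3 \<in> (alt n :: padic2 mat set)"
        using n by (intro alt_uminus tri_alt) auto
      moreover have "finite {0, 1, 2 :: nat}" "odd (card {0, 1, 2 :: nat})" by simp_all
      ultimately show ?thesis by blast
    qed
  qed
qed

text \<open>Every proper sublattice of one term lies in the next. This yields the maximality
  required of the chain as well as the classification.\<close>

lemma lat_step:
  assumes L: "lattice n L" and n: "n \<ge> 6" "n mod 4 = 2" and i: "i < 4"
    and Li: "L \<subseteq> lat n i" "\<not> L \<subseteq> lat n (Suc i)"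
  shows "L = lat n i"
proof -
  consider "i = 0" | "i = 1" | "i = 2" | "i = 3" using i by linarith
  then have "lat n i \<subseteq> L"
  proof cases
    case 1
    then show ?thesis using top_lattice[OF L n] Li by (simp add: lat_0)
  next
    case 2
    then show ?thesis using half_1[OF L n] lattice_step[OF L n i Li(2)] Li by (auto simp: numeral_2_eq_2)
  next
    case 3
    then show ?thesis using half_2[OF L n] lattice_step[OF L n i Li(2)] Li by (auto simp: numeral_3_eq_3 numeral_2_eq_2)
  next
    case 4
    then show ?thesis using half_3[OF L n] lattice_step[OF L n i Li(2)] Li by (auto simp: eval_nat_numeral)
  qed
  then show ?thesis using Li(1) by blast
qed

lemma lattice_classify:
  assumes L: "lattice n L" and n: "n \<ge> 6" "n mod 4 = 2" and L4: "\<not> L \<subseteq> lat n 4"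
  shows "\<exists>i<4. L = lat n i"
proof -
  have "L \<subseteq> lat n 0" using latticeD(1)[OF L] by (simp add: lat_0)
  have "L \<subseteq> lat n i \<or> (\<exists>j<i. L = lat n j)" if "i \<le> 4" for i
    using that
  proof (induction i)
    case 0
    then show ?case using \<open>L \<subseteq> lat n 0\<close> by blast
  next
    case (Suc i)
    then show ?case using lat_step[OF L n, of i] by (auto simp: less_Suc_eq)
  qed
  from this[of 4] show ?thesis using L4 by auto
qed

lemma lat_chain: "n mod 4 = 2 \<Longrightarrow> i < 4 \<Longrightarrow> lat n (Suc i) \<subseteq> lat n i"
  using lat2_chain[of n i] by (auto simp: lat_def)

lemma lat_antimono:
  assumes "n mod 4 = 2" "a \<le> b" "b \<le> 4" shows "lat n b \<subseteq> lat n a"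
  using assms(2,3)
proof (induction b rule: dec_induct)
  case (step b)
  then show ?case using lat_chain[OF assms(1), of b] by auto
qed simp

text \<open>Witnesses modulo 2: a triangle, a 4-cycle, the complete graph on the vertices below
  \<open>n\<close>, and the cut of \<open>{1, 2}\<close>.\<close>

lemma lat_strict:
  assumes n: "n \<ge> 6" "n mod 4 = 2" and i: "i < 4"
  shows "\<not> lat n i \<subseteq> lat n (Suc i)"
proof -
  have "\<exists>X\<in>lat2 n i. X \<notin> lat2 n (Suc i)"
  proof -
    note m = mod4_facts[OF n(2)]
    consider "i = 0" | "i = 1" | "i = 2" | "i = 3" using i by linarith
    then show ?thesis
    proof cases
      case 1
      have "tri 1 2 3 \<in> (alt n :: bit mat set)" using n by (intro tri_alt) auto
      moreover have "edges {1..n} (tri 1 2 3) = 1" using n by (intro edges_tri) auto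
      ultimately show ?thesis by (intro bexI[of _ "tri 1 2 3"]) (auto simp: 1 lat2_def)
    next
      case 2
      have a: "cyc4 1 2 3 4 \<in> (alt n :: bit mat set)" using n by (intro cyc4_alt) auto
      moreover have "edges {1..n} (cyc4 1 2 3 4) = 0" using n by (intro edges_cyc4) auto
      moreover have False if f: "is_cut n f c (cyc4 1 2 3 4)" for f c
      proof -
        have *: "cyc4 1 2 3 4 (i, j) = f i + f j + c" if "i \<in> {1..6}" "j \<in> {1..6}" "i \<noteq> j" for i j
          using f that n unfolding is_cut_def by simp
        \<comment> \<open>Vertex 5 is isolated, which puts 1, 2 and 3 on the same side; the missing
          edge between 1 and 2 then gives \<open>c = 0\<close>, against the edge between 1 and
          3.\<close>
        have "(cyc4 1 2 3 4 :: bit mat) (1, 3) = 1" "(cyc4 1 2 3 4 :: bit mat) (1, 5) = 0"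
          "(cyc4 1 2 3 4 :: bit mat) (3, 5) = 0" "(cyc4 1 2 3 4 :: bit mat) (1, 2) = 0"
          "(cyc4 1 2 3 4 :: bit mat) (2, 5) = 0"
          by (simp_all add: cyc4_def wedge_def uvec_def)
        with *[of 1 3] *[of 1 5] *[of 3 5] *[of 1 2] *[of 2 5]
        have "f 1 + f 3 + c = 1" "f 1 + f 5 + c = 0" "f 3 + f 5 + c = 0" "f 1 + f 2 + c = 0" "f 2 + f 5 + c = 0"
          by simp_all
        then show False
          by (cases "f 1"; cases "f 2"; cases "f 3"; cases "f 5"; cases c) simp_all
      qed
      ultimately show ?thesis
        by (intro bexI[of _ "cyc4 1 2 3 4"]) (auto simp: 2 lat2_def)
    next
      case 3
      \<comment> \<open>The complement of the cut of \<open>{n}\<close>: a complete graph on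
        \<open>n - 1\<close> vertices, with even degrees \<open>n - 2\<close>.\<close>
      define X :: "bit mat" where "X = (\<lambda>(i, j). if i \<in> {1..<n} \<and> j \<in> {1..<n} \<and> i \<noteq> j then 1 else 0)"
      have X: "X \<in> alt n"
      proof (rule altI)
        fix i assume i: "i \<in> {1..n}"
        show "(\<Sum>j = 1..n. X (i, j)) = 0"
        proof (cases "i = n")
          case False
          have "(\<Sum>j = 1..n. X (i, j)) = (\<Sum>j\<in>{1..<n} - {i}. 1)"
            unfolding X_def by (rule sum.mono_neutral_cong_right) (use i False in auto)
          also have "\<dots> = of_nat (card ({1..<n} - {i}))" by simp
          also have "card ({1..<n} - {i}) = 2 * (n div 2 - 1)" using i False m(1) by auto
          also have "(of_nat \<dots> :: bit) = 0"
            by (simp only: of_nat_mult of_nat_numeral bit_2_eq_0 mult_zero_left)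
          finally show ?thesis .
        qed (simp add: X_def)
      qed (auto simp: X_def)
      moreover have "is_cut n (uvec n) 1 X" by (auto simp: is_cut_def X_def uvec_def)
      moreover have False if f: "is_cut n f 0 X" for f
      proof -
        have *: "X (i, j) = f i + f j" if "i \<in> {1..3}" "j \<in> {1..3}" "i \<noteq> j" for i j
          using f that n unfolding is_cut_def by simp
        have **: "X (i, j) = 1" if "i \<in> {1..3}" "j \<in> {1..3}" "i \<noteq> j" for i j
          using that n by (simp add: X_def)
        \<comment> \<open>A cut contains no triangle.\<close>
        show False
          using *[of 1 2] *[of 2 3] *[of 1 3] **[of 1 2] **[of 2 3] **[of 1 3]
          by (cases "f 1"; cases "f 2"; cases "f 3") simp_all
      qed
      ultimately show ?thesis
        by (intro bexI[of _ X]) (auto simp: 3 lat2_def)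
    next
      case 4
      define z :: "padic2 mat" where "z = wedge (pair_diff 0) (pair_sum (n div 2))"
      have nm: "n = 2 * (n div 2)" using m(1) by simp
      have "z \<in> alt n"
        unfolding z_def using n pair_sum_sum0[of "n div 2"] nm by (intro wedge_alt pair_diff_sum0) auto
      moreover have f: "is_cut n (uvec 1 + uvec 2) 0 (mod2 z)"
        unfolding z_def by (rule mod2_pair_cut[OF nm m(2)])
      moreover have "mod2 z (1, 3) = 1"
        using f n by (simp add: is_cut_def uvec_def)
      then have "mod2 z \<noteq> 0" by auto
      ultimately show ?thesis
        using mod2_alt[of z n] by (intro bexI[of _ "mod2 z"]) (auto simp: 4 lat2_def)
    qed
  qed
  then obtain X where X: "X \<in> lat2 n i" "X \<notin> lat2 n (Suc i)" by blast
  have "X \<in> alt n" using X(1) latticeD(1)[OF lattice_lat2[of i n]] i by auto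
  then obtain A where "A \<in> alt n" "mod2 A = X" by (rule mod2_lift)
  then show ?thesis using X by (auto simp: lat_def)
qed

section \<open>Modules and linear maps\<close>

abbreviation (input) CR :: "'r::comm_ring_1 ring"
  where "CR \<equiv> cring_class_ops"

lemmas CR_simps = class_simps

text \<open>Scalars range over the whole type, which is the carrier of \<open>CR\<close>.\<close>

definition linear_map :: "('r::comm_ring_1, 'm, 'b) module_scheme \<Rightarrow> ('r, 'p, 'd) module_scheme \<Rightarrow> ('m \<Rightarrow> 'p) \<Rightarrow> bool"
  where "linear_map M P f \<longleftrightarrow> (\<forall>x\<in>carrier M. f x \<in> carrier P) \<and>
    (\<forall>x\<in>carrier M. \<forall>y\<in>carrier M. f (x \<oplus>\<^bsub>M\<^esub> y) = f x \<oplus>\<^bsub>P\<^esub> f y) \<and>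
    (\<forall>r. \<forall>x\<in>carrier M. f (r \<odot>\<^bsub>M\<^esub> x) = r \<odot>\<^bsub>P\<^esub> f x)"

lemma linear_mapI:
  assumes "\<And>x. x \<in> carrier M \<Longrightarrow> f x \<in> carrier P"
    "\<And>x y. x \<in> carrier M \<Longrightarrow> y \<in> carrier M \<Longrightarrow> f (x \<oplus>\<^bsub>M\<^esub> y) = f x \<oplus>\<^bsub>P\<^esub> f y"
    "\<And>r x. x \<in> carrier M \<Longrightarrow> f (r \<odot>\<^bsub>M\<^esub> x) = r \<odot>\<^bsub>P\<^esub> f x"
  shows "linear_map M P f"
  using assms by (simp add: linear_map_def)

lemma linear_mapD:
  assumes "linear_map M P f" "x \<in> carrier M"
  shows "f x \<in> carrier P" "y \<in> carrier M \<Longrightarrow> f (x \<oplus>\<^bsub>M\<^esub> y) = f x \<oplus>\<^bsub>P\<^esub> f y"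
    "f (r \<odot>\<^bsub>M\<^esub> x) = r \<odot>\<^bsub>P\<^esub> f x"
  using assms by (simp_all add: linear_map_def)

lemma linear_map_comp:
  "linear_map M P f \<Longrightarrow> linear_map P Q g \<Longrightarrow> linear_map M Q (\<lambda>x. g (f x))"
  by (simp add: linear_map_def)

lemma CR_module:
  assumes "module CR M"
  shows "abelian_group M" "x \<in> carrier M \<Longrightarrow> r \<odot>\<^bsub>M\<^esub> x \<in> carrier M"
    "x \<in> carrier M \<Longrightarrow> y \<in> carrier M \<Longrightarrow> r \<odot>\<^bsub>M\<^esub> (x \<oplus>\<^bsub>M\<^esub> y) = r \<odot>\<^bsub>M\<^esub> x \<oplus>\<^bsub>M\<^esub> r \<odot>\<^bsub>M\<^esub> y"
    "x \<in> carrier M \<Longrightarrow> (r + s) \<odot>\<^bsub>M\<^esub> x = r \<odot>\<^bsub>M\<^esub> x \<oplus>\<^bsub>M\<^esub> s \<odot>\<^bsub>M\<^esub> x"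
    "x \<in> carrier M \<Longrightarrow> (r * s) \<odot>\<^bsub>M\<^esub> x = r \<odot>\<^bsub>M\<^esub> (s \<odot>\<^bsub>M\<^esub> x)"
    "x \<in> carrier M \<Longrightarrow> 1 \<odot>\<^bsub>M\<^esub> x = x" "x \<in> carrier M \<Longrightarrow> 0 \<odot>\<^bsub>M\<^esub> x = \<zero>\<^bsub>M\<^esub>"
    "r \<odot>\<^bsub>M\<^esub> \<zero>\<^bsub>M\<^esub> = \<zero>\<^bsub>M\<^esub>" "x \<in> carrier M \<Longrightarrow> (- 1) \<odot>\<^bsub>M\<^esub> x = \<ominus>\<^bsub>M\<^esub> x"
proof -
  interpret M: module CR M by fact
  show "abelian_group M" ..
  show "x \<in> carrier M \<Longrightarrow> r \<odot>\<^bsub>M\<^esub> x \<in> carrier M" by (simp add: carrier_class)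
  show "x \<in> carrier M \<Longrightarrow> y \<in> carrier M \<Longrightarrow> r \<odot>\<^bsub>M\<^esub> (x \<oplus>\<^bsub>M\<^esub> y) = r \<odot>\<^bsub>M\<^esub> x \<oplus>\<^bsub>M\<^esub> r \<odot>\<^bsub>M\<^esub> y"
    by (rule M.smult_r_distr[OF carrier_class])
  show "x \<in> carrier M \<Longrightarrow> (r + s) \<odot>\<^bsub>M\<^esub> x = r \<odot>\<^bsub>M\<^esub> x \<oplus>\<^bsub>M\<^esub> s \<odot>\<^bsub>M\<^esub> x"
    using M.smult_l_distr[OF carrier_class carrier_class, of x r s] by (simp add: plus_class)
  show "x \<in> carrier M \<Longrightarrow> (r * s) \<odot>\<^bsub>M\<^esub> x = r \<odot>\<^bsub>M\<^esub> (s \<odot>\<^bsub>M\<^esub> x)"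
    using M.smult_assoc1[OF carrier_class carrier_class, of x r s] by (simp add: times_class)
  show "x \<in> carrier M \<Longrightarrow> 1 \<odot>\<^bsub>M\<^esub> x = x"
    using M.smult_one[of x] by (simp add: one_class)
  show "x \<in> carrier M \<Longrightarrow> 0 \<odot>\<^bsub>M\<^esub> x = \<zero>\<^bsub>M\<^esub>"
    using M.smult_l_null[of x] by (simp add: zero_class)
  show "r \<odot>\<^bsub>M\<^esub> \<zero>\<^bsub>M\<^esub> = \<zero>\<^bsub>M\<^esub>"
    by (rule M.smult_r_null[OF carrier_class])
  show "x \<in> carrier M \<Longrightarrow> (- 1) \<odot>\<^bsub>M\<^esub> x = \<ominus>\<^bsub>M\<^esub> x"
    using M.smult_l_minus[OF carrier_class, of x 1] M.smult_one[of x] by (simp add: uminus_class one_class)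
qed

lemma CR_moduleI:
  assumes "abelian_group M"
    "\<And>r x. x \<in> carrier M \<Longrightarrow> r \<odot>\<^bsub>M\<^esub> x \<in> carrier M"
    "\<And>r x y. x \<in> carrier M \<Longrightarrow> y \<in> carrier M \<Longrightarrow> r \<odot>\<^bsub>M\<^esub> (x \<oplus>\<^bsub>M\<^esub> y) = r \<odot>\<^bsub>M\<^esub> x \<oplus>\<^bsub>M\<^esub> r \<odot>\<^bsub>M\<^esub> y"
    "\<And>r s x. x \<in> carrier M \<Longrightarrow> (r + s) \<odot>\<^bsub>M\<^esub> x = r \<odot>\<^bsub>M\<^esub> x \<oplus>\<^bsub>M\<^esub> s \<odot>\<^bsub>M\<^esub> x"
    "\<And>r s x. x \<in> carrier M \<Longrightarrow> (r * s) \<odot>\<^bsub>M\<^esub> x = r \<odot>\<^bsub>M\<^esub> (s \<odot>\<^bsub>M\<^esub> x)"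
    "\<And>x. x \<in> carrier M \<Longrightarrow> 1 \<odot>\<^bsub>M\<^esub> x = x"
  shows "module CR M"
  using assms by (intro moduleI cring_class) (simp_all add: CR_simps)

lemma linear_map_zero:
  assumes "module CR M" "module CR P" "linear_map M P f"
  shows "f \<zero>\<^bsub>M\<^esub> = \<zero>\<^bsub>P\<^esub>"
proof -
  have z: "\<zero>\<^bsub>M\<^esub> \<in> carrier M"
    using CR_module(1)[OF assms(1)] by (simp add: abelian_group_def abelian_monoid.zero_closed)
  have "f (0 \<odot>\<^bsub>M\<^esub> \<zero>\<^bsub>M\<^esub>) = 0 \<odot>\<^bsub>P\<^esub> f \<zero>\<^bsub>M\<^esub>" by (rule linear_mapD(3)[OF assms(3) z])
  then show ?thesis
    using z linear_mapD(1)[OF assms(3) z] by (simp add: CR_module[OF assms(1)] CR_module[OF assms(2)])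
qed

lemma CR_submoduleI:
  assumes M: "module CR M" and "H \<subseteq> carrier M" "\<zero>\<^bsub>M\<^esub> \<in> H"
    and "\<And>x y. x \<in> H \<Longrightarrow> y \<in> H \<Longrightarrow> x \<oplus>\<^bsub>M\<^esub> y \<in> H" and sm: "\<And>r x. x \<in> H \<Longrightarrow> r \<odot>\<^bsub>M\<^esub> x \<in> H"
  shows "submodule H CR M"
proof (rule module.submoduleI[OF M])
  show "\<ominus>\<^bsub>M\<^esub> a \<in> H" if "a \<in> H" for a
    using sm[OF that, of "- 1"] that assms(2) CR_module(9)[OF M, of a] by auto
qed (use assms in auto)

lemma CR_submoduleD:
  assumes M: "module CR M" and H: "submodule H CR M"
  shows "H \<subseteq> carrier M" "\<zero>\<^bsub>M\<^esub> \<in> H" "x \<in> H \<Longrightarrow> y \<in> H \<Longrightarrow> x \<oplus>\<^bsub>M\<^esub> y \<in> H" "x \<in> H \<Longrightarrow> r \<odot>\<^bsub>M\<^esub> x \<in> H"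
    "x \<in> H \<Longrightarrow> \<ominus>\<^bsub>M\<^esub> x \<in> H"
proof -
  note E = module.submoduleE[OF M H]
  show "H \<subseteq> carrier M" "x \<in> H \<Longrightarrow> y \<in> H \<Longrightarrow> x \<oplus>\<^bsub>M\<^esub> y \<in> H" "x \<in> H \<Longrightarrow> \<ominus>\<^bsub>M\<^esub> x \<in> H"
    using E by blast+
  show sm: "x \<in> H \<Longrightarrow> r \<odot>\<^bsub>M\<^esub> x \<in> H" for x r using E(4)[OF carrier_class] .
  obtain x where "x \<in> H" using E(2) by blast
  then show "\<zero>\<^bsub>M\<^esub> \<in> H" using sm[of x 0] E(1) CR_module(7)[OF M, of x] by auto
qed

lemma linear_ker_submodule:
  assumes M: "module CR M" and P: "module CR P" and f: "linear_map M P f"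
  shows "submodule {x \<in> carrier M. f x = \<zero>\<^bsub>P\<^esub>} CR M"
proof (rule CR_submoduleI[OF M])
  interpret M: abelian_group M by (rule CR_module(1)[OF M])
  interpret P: abelian_group P by (rule CR_module(1)[OF P])
  show "\<zero>\<^bsub>M\<^esub> \<in> {x \<in> carrier M. f x = \<zero>\<^bsub>P\<^esub>}" using linear_map_zero[OF M P f] by simp
qed (use linear_mapD[OF f] CR_module[OF M] CR_module[OF P] in
  \<open>auto simp: abelian_group_def abelian_monoid.a_closed abelian_monoid.l_zero abelian_monoid.zero_closed\<close>)

lemma module_span_induct:
  assumes M: "module CR M" and X: "X \<subseteq> carrier M" and t: "t \<in> module_span CR M X"
    and "\<And>x. x \<in> X \<Longrightarrow> P x" "P \<zero>\<^bsub>M\<^esub>"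
    and "\<And>x y. x \<in> carrier M \<Longrightarrow> y \<in> carrier M \<Longrightarrow> P x \<Longrightarrow> P y \<Longrightarrow> P (x \<oplus>\<^bsub>M\<^esub> y)"
    and "\<And>r x. x \<in> carrier M \<Longrightarrow> P x \<Longrightarrow> P (r \<odot>\<^bsub>M\<^esub> x)"
  shows "P t"
proof -
  interpret M: abelian_group M by (rule CR_module(1)[OF M])
  have "submodule {x \<in> carrier M. P x} CR M"
    using assms(4-) CR_module(2)[OF M] by (intro CR_submoduleI[OF M]) auto
  moreover have "X \<subseteq> {x \<in> carrier M. P x}" using X assms(4) by blast
  ultimately show ?thesis using t unfolding module_span_def by blast
qed

lemma module_span_submodule:
  assumes M: "module CR M" and X: "X \<subseteq> carrier M"
  shows "submodule (module_span CR M X) CR M" "X \<subseteq> module_span CR M X"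
proof -
  have c: "submodule (carrier M) CR M" by (rule module.carrier_is_submodule[OF M])
  show "X \<subseteq> module_span CR M X" unfolding module_span_def by blast
  show "submodule (module_span CR M X) CR M"
  proof (rule CR_submoduleI[OF M])
    show "module_span CR M X \<subseteq> carrier M" using c X unfolding module_span_def by blast
    show "\<zero>\<^bsub>M\<^esub> \<in> module_span CR M X"
      unfolding module_span_def using CR_submoduleD(2)[OF M] by blast
    fix x assume x: "x \<in> module_span CR M X"
    show "r \<odot>\<^bsub>M\<^esub> x \<in> module_span CR M X" for r
      using x CR_submoduleD(4)[OF M] unfolding module_span_def by blast
    fix y assume y: "y \<in> module_span CR M X"
    show "x \<oplus>\<^bsub>M\<^esub> y \<in> module_span CR M X"
      using x y CR_submoduleD(3)[OF M] unfolding module_span_def by blast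
  qed
qed

lemma module_span_least:
  "submodule H CR M \<Longrightarrow> X \<subseteq> H \<Longrightarrow> module_span CR M X \<subseteq> H"
  unfolding module_span_def by blast

lemma with_action_simps [simp]:
  "carrier (with_action M a) = carrier M" "add (with_action M a) = add M"
  "zero (with_action M a) = zero M" "smult (with_action M a) = smult M" "act (with_action M a) = a"
  by (cases M, simp add: with_action_def module.defs gmodule.defs)+

lemma restrict_to_simps [simp]:
  "carrier (restrict_to M H) = H" "add (restrict_to M H) = add M"
  "zero (restrict_to M H) = zero M" "smult (restrict_to M H) = smult M" "act (restrict_to M H) = act M"
  by (simp_all add: restrict_to_def)

lemma abelian_group_cong:
  assumes "abelian_group M" "carrier P = carrier M" "add P = add M" "zero P = zero M"
  shows "abelian_group P"
proof -
  interpret abelian_group M by fact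
  show ?thesis
  proof (rule abelian_groupI, unfold assms(2-))
    fix x assume "x \<in> carrier M"
    then show "\<exists>y\<in>carrier M. y \<oplus>\<^bsub>M\<^esub> x = \<zero>\<^bsub>M\<^esub>" using l_neg by blast
  qed (auto simp: a_ac)
qed

lemma module_cong:
  assumes "module CR M" "carrier P = carrier M" "add P = add M" "zero P = zero M" "smult P = smult M"
  shows "module CR P"
  by (rule CR_moduleI) (simp_all add: abelian_group_cong[OF CR_module(1)[OF assms(1)] assms(2-4)]
      CR_module[OF assms(1)] assms(2-))

section \<open>Free modules\<close>

lemma free_module_simps [simp]:
  "carrier (free_module CR X) = {f. finite {x. f x \<noteq> 0} \<and> {x. f x \<noteq> 0} \<subseteq> X}"
  "add (free_module CR X) = (\<lambda>f g x. f x + g x)" "zero (free_module CR X) = (\<lambda>x. 0)"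
  "smult (free_module CR X) = (\<lambda>r f x. r * f x)"
  by (simp_all add: free_module_def CR_simps) (auto simp: cring_class_ops_def)

lemma module_free:
  fixes X :: "'x set"
  defines "F \<equiv> free_module (CR :: 'r::comm_ring_1 ring) X"
  shows "module CR F"
proof (rule CR_moduleI)
  have fin: "finite {x. f x + g x \<noteq> 0}" if "finite {x. f x \<noteq> 0}" "finite {x. g x \<noteq> 0}" for f g :: "'x \<Rightarrow> 'r"
    by (rule finite_subset[OF _ finite_UnI[OF that]]) auto
  have sub: "x \<in> X" if "f x + g x \<noteq> 0" "{x. f x \<noteq> 0} \<subseteq> X" "{x. g x \<noteq> 0} \<subseteq> X" for f g :: "'x \<Rightarrow> 'r" and x
  proof -
    have "f x \<noteq> 0 \<or> g x \<noteq> 0" using that(1) by auto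
    then show ?thesis using that by blast
  qed
  show "abelian_group F"
  proof (rule abelian_groupI)
    fix f assume "f \<in> carrier F"
    then show "\<exists>g\<in>carrier F. g \<oplus>\<^bsub>F\<^esub> f = \<zero>\<^bsub>F\<^esub>"
      by (intro bexI[of _ "\<lambda>x. - f x"]) (auto simp: F_def)
  qed (use fin sub in \<open>auto simp: F_def add.assoc add.commute\<close>)
next
  fix r :: 'r and f assume "f \<in> carrier F"
  moreover have "{x. r * f x \<noteq> 0} \<subseteq> {x. f x \<noteq> 0}" by auto
  ultimately show "r \<odot>\<^bsub>F\<^esub> f \<in> carrier F"
    by (auto simp: F_def intro: finite_subset)
qed (auto simp: F_def algebra_simps)

lemma basis_vec_carrier: "x \<in> X \<Longrightarrow> basis_vec CR x \<in> carrier (free_module CR X)"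
  by (auto simp: basis_vec_def CR_simps)

text \<open>\<open>lin_ext\<close> sums over the support, which changes under addition and scaling;
  a common larger finite set makes linearity visible.\<close>

lemma lin_ext_eq:
  assumes M: "module CR M" and p: "\<And>x. x \<in> X \<Longrightarrow> \<phi> x \<in> carrier M"
    and F: "finite F" "{x. f x \<noteq> 0} \<subseteq> F" "F \<subseteq> X"
  shows "lin_ext CR M \<phi> f = (\<Oplus>\<^bsub>M\<^esub>x\<in>F. f x \<odot>\<^bsub>M\<^esub> \<phi> x)"
proof -
  interpret M: abelian_group M by (rule CR_module(1)[OF M])
  have c: "f x \<odot>\<^bsub>M\<^esub> \<phi> x \<in> carrier M" if "x \<in> F" for x
    using that F p CR_module(2)[OF M] by blast
  show ?thesis
    unfolding lin_ext_def zero_class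
    by (rule M.add.finprod_mono_neutral_cong_left) (use F c CR_module(7)[OF M] p in \<open>auto simp: subset_iff\<close>)
qed

lemma lin_ext_linear:
  fixes M :: "('r::comm_ring_1, 'm, 'b) module_scheme" and X :: "'x set"
  assumes M: "module CR M" and p: "\<And>x. x \<in> X \<Longrightarrow> \<phi> x \<in> carrier M"
  shows "linear_map (free_module CR X) M (lin_ext CR M \<phi>)"
proof (rule linear_mapI)
  interpret M: abelian_group M by (rule CR_module(1)[OF M])
  have E: "lin_ext CR M \<phi> f = (\<Oplus>\<^bsub>M\<^esub>x\<in>F. f x \<odot>\<^bsub>M\<^esub> \<phi> x)"
    if "finite F" "{x. f x \<noteq> 0} \<subseteq> F" "F \<subseteq> X" for f F
    using lin_ext_eq[OF M, of X \<phi> F f] p that by blast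
  have c: "r \<odot>\<^bsub>M\<^esub> \<phi> x \<in> carrier M" if "x \<in> X" for x r
    using that p CR_module(2)[OF M] by blast
  fix f :: "'x \<Rightarrow> 'r" assume f: "f \<in> carrier (free_module CR X)"
  let ?F = "{x. f x \<noteq> 0}"
  have F: "finite ?F" "?F \<subseteq> X" using f by auto
  show "lin_ext CR M \<phi> f \<in> carrier M"
    unfolding E[OF F(1) order.refl F(2)] using F c by (intro M.finsum_closed) auto
  show "lin_ext CR M \<phi> (r \<odot>\<^bsub>free_module CR X\<^esub> f) = r \<odot>\<^bsub>M\<^esub> lin_ext CR M \<phi> f" for r
  proof -
    have sub: "{x. r * f x \<noteq> 0} \<subseteq> ?F" by auto
    have "lin_ext CR M \<phi> (r \<odot>\<^bsub>free_module CR X\<^esub> f) = (\<Oplus>\<^bsub>M\<^esub>x\<in>?F. (r * f x) \<odot>\<^bsub>M\<^esub> \<phi> x)"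
      using E[of ?F "\<lambda>x. r * f x"] F sub by simp
    also have "\<dots> = (\<Oplus>\<^bsub>M\<^esub>x\<in>?F. r \<odot>\<^bsub>M\<^esub> (f x \<odot>\<^bsub>M\<^esub> \<phi> x))"
      using F c p by (intro M.finsum_cong') (auto simp: CR_module[OF M] subset_iff)
    also have "\<dots> = r \<odot>\<^bsub>M\<^esub> (\<Oplus>\<^bsub>M\<^esub>x\<in>?F. f x \<odot>\<^bsub>M\<^esub> \<phi> x)"
      using F c by (intro module.finsum_smult_ldistr[OF M, symmetric]) (auto simp: carrier_class)
    finally show ?thesis using E[OF F(1) order.refl F(2)] by simp
  qed
  fix g :: "'x \<Rightarrow> 'r" assume g: "g \<in> carrier (free_module CR X)"
  let ?H = "?F \<union> {x. g x \<noteq> 0}"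
  have H: "finite ?H" "?H \<subseteq> X" using f g by auto
  have sub: "{x. f x + g x \<noteq> 0} \<subseteq> ?H" by auto
  have "lin_ext CR M \<phi> (f \<oplus>\<^bsub>free_module CR X\<^esub> g) = (\<Oplus>\<^bsub>M\<^esub>x\<in>?H. (f x + g x) \<odot>\<^bsub>M\<^esub> \<phi> x)"
    using E[of ?H "\<lambda>x. f x + g x"] H sub by simp
  also have "\<dots> = (\<Oplus>\<^bsub>M\<^esub>x\<in>?H. f x \<odot>\<^bsub>M\<^esub> \<phi> x \<oplus>\<^bsub>M\<^esub> g x \<odot>\<^bsub>M\<^esub> \<phi> x)"
    using H c p by (intro M.finsum_cong') (auto simp: CR_module[OF M] subset_iff)
  also have "\<dots> = (\<Oplus>\<^bsub>M\<^esub>x\<in>?H. f x \<odot>\<^bsub>M\<^esub> \<phi> x) \<oplus>\<^bsub>M\<^esub> (\<Oplus>\<^bsub>M\<^esub>x\<in>?H. g x \<odot>\<^bsub>M\<^esub> \<phi> x)"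
    using H c by (intro M.finsum_addf) auto
  also have "\<dots> = lin_ext CR M \<phi> f \<oplus>\<^bsub>M\<^esub> lin_ext CR M \<phi> g"
    using E[of ?H f] E[of ?H g] H by auto
  finally show "lin_ext CR M \<phi> (f \<oplus>\<^bsub>free_module CR X\<^esub> g) = lin_ext CR M \<phi> f \<oplus>\<^bsub>M\<^esub> lin_ext CR M \<phi> g" .
qed

lemma lin_ext_basis_vec:
  assumes M: "module CR M" and p: "\<phi> x \<in> carrier M"
  shows "lin_ext CR M \<phi> (basis_vec CR x) = \<phi> x"
proof -
  interpret M: abelian_group M by (rule CR_module(1)[OF M])
  have "lin_ext CR M \<phi> (basis_vec CR x) = (\<Oplus>\<^bsub>M\<^esub>y\<in>{x}. basis_vec CR x y \<odot>\<^bsub>M\<^esub> \<phi> y)"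
    using p by (intro lin_ext_eq[OF M, of "{x}"]) (auto simp: basis_vec_def CR_simps)
  also have "\<dots> = \<phi> x"
    using p CR_module[OF M] by (simp add: basis_vec_def CR_simps)
  finally show ?thesis .
qed

lemma free_module_span:
  fixes X :: "'x set"
  defines "F \<equiv> free_module (CR :: 'r::comm_ring_1 ring) X"
  shows "module_span CR F (basis_vec CR ` X) = carrier F"
proof
  let ?F = "free_module (CR :: 'r ring) X"
  have b: "basis_vec CR ` X \<subseteq> carrier ?F"
    by (rule image_subsetI) (rule basis_vec_carrier)
  note S = CR_submoduleD[OF module_free module_span_submodule(1)[OF module_free b]]
  show "module_span CR F (basis_vec CR ` X) \<subseteq> carrier F" unfolding F_def by (rule S(1))
  show "carrier F \<subseteq> module_span CR F (basis_vec CR ` X)"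
    unfolding F_def
  proof
    have *: "f \<in> module_span CR ?F (basis_vec CR ` X)" if "finite A" "{x. f x \<noteq> 0} = A" "A \<subseteq> X" for A and f :: "'x \<Rightarrow> 'r"
      using that
    proof (induction A arbitrary: f rule: finite_induct)
      case empty
      then have "f = \<zero>\<^bsub>?F\<^esub>" by auto
      then show ?case using S(2) by simp
    next
      case (insert a A)
      let ?g = "f(a := 0)"
      have "{x. ?g x \<noteq> 0} = A" using insert by auto
      then have g: "?g \<in> module_span CR ?F (basis_vec CR ` X)" using insert by blast
      have "basis_vec CR a \<in> module_span CR ?F (basis_vec CR ` X)"
        using module_span_submodule(2)[OF module_free b] insert by blast
      then have "?g \<oplus>\<^bsub>?F\<^esub> (f a \<odot>\<^bsub>?F\<^esub> basis_vec CR a) \<in> module_span CR ?F (basis_vec CR ` X)"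
        by (intro S(3,4) g)
      also have "?g \<oplus>\<^bsub>?F\<^esub> (f a \<odot>\<^bsub>?F\<^esub> basis_vec CR a) = f"
        by (auto simp: basis_vec_def CR_simps)
      finally show ?case .
    qed
    fix f assume "f \<in> carrier ?F"
    then have "finite {x. f x \<noteq> 0}" "{x. f x \<noteq> 0} \<subseteq> X" by simp_all
    then show "f \<in> module_span CR ?F (basis_vec CR ` X)" by (rule *[OF _ refl])
  qed
qed

section \<open>Quotient modules\<close>

lemma quot_module_simps [simp]:
  "carrier (quot_module M N) = a_rcosets\<^bsub>M\<^esub> N" "add (quot_module M N) = set_add M"
  "zero (quot_module M N) = N" "smult (quot_module M N) r = quot_map M N (\<lambda>x. r \<odot>\<^bsub>M\<^esub> x)"
  by (simp_all add: quot_module_def)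

context
  fixes M :: "('r::comm_ring_1, 'm, 'b) module_scheme" (structure) and N
  assumes M: "module CR M" and N: "submodule N CR M"
begin

lemma quot_abelian_subgroup: "abelian_subgroup N M"
  using N CR_module(1)[OF M] by (intro abelian_subgroupI3 additive_subgroup.intro) (auto simp: submodule_def)

lemma coset_carrier: "x \<in> carrier M \<Longrightarrow> N +> x \<in> carrier (quot_module M N)"
proof -
  interpret M: abelian_group M by (rule CR_module(1)[OF M])
  show "x \<in> carrier M \<Longrightarrow> N +> x \<in> carrier (quot_module M N)"
    using M.a_rcosetsI CR_submoduleD(1)[OF M N] by simp
qed

lemma coset_cases:
  assumes "C \<in> carrier (quot_module M N)" obtains x where "x \<in> carrier M" "C = N +> x"
proof -
  interpret abelian_subgroup N M by (rule quot_abelian_subgroup)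
  show ?thesis using assms that by (auto simp: A_RCOSETS_def')
qed

lemma coset_self: "x \<in> carrier M \<Longrightarrow> x \<in> N +> x"
proof -
  interpret abelian_subgroup N M by (rule quot_abelian_subgroup)
  show "x \<in> carrier M \<Longrightarrow> x \<in> N +> x" by (rule a_rcos_self)
qed

lemma coset_mem:
  assumes "x \<in> carrier M" "y \<in> N +> x"
  obtains h where "h \<in> N" "y = h \<oplus> x" "y \<in> carrier M"
proof -
  interpret abelian_subgroup N M by (rule quot_abelian_subgroup)
  show ?thesis
    using assms that a_elemrcos_carrier[OF assms] by (auto simp: a_r_coset_def')
qed

lemma coset_absorb: "x \<in> carrier M \<Longrightarrow> h \<in> N \<Longrightarrow> N +> (h \<oplus> x) = N +> x"
proof -
  interpret abelian_subgroup N M by (rule quot_abelian_subgroup)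
  assume "x \<in> carrier M" "h \<in> N"
  then have "h \<oplus> x \<in> N +> x" by (auto simp: a_r_coset_def')
  then show ?thesis using a_repr_independence'[of "h \<oplus> x" x] \<open>x \<in> carrier M\<close> by simp
qed

lemma coset_zero: "h \<in> N \<Longrightarrow> N +> h = N"
proof -
  interpret abelian_subgroup N M by (rule quot_abelian_subgroup)
  show "h \<in> N \<Longrightarrow> N +> h = N" by (rule a_rcos_const)
qed

lemma coset_add: "x \<in> carrier M \<Longrightarrow> y \<in> carrier M \<Longrightarrow>
  (N +> x) \<oplus>\<^bsub>quot_module M N\<^esub> (N +> y) = N +> (x \<oplus> y)"
proof -
  interpret abelian_subgroup N M by (rule quot_abelian_subgroup)
  show "x \<in> carrier M \<Longrightarrow> y \<in> carrier M \<Longrightarrow> (N +> x) \<oplus>\<^bsub>quot_module M N\<^esub> (N +> y) = N +> (x \<oplus> y)"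
    by (simp add: a_rcos_sum)
qed

lemma quot_map_coset:
  assumes "linear_map M M \<phi>" "\<And>h. h \<in> N \<Longrightarrow> \<phi> h \<in> N" and x: "x \<in> carrier M"
  shows "quot_map M N \<phi> (N +> x) = N +> \<phi> x"
proof -
  have "N +> \<phi> y = N +> \<phi> x" if y: "y \<in> N +> x" for y
  proof -
    obtain h where h: "h \<in> N" "y = h \<oplus> x" by (rule coset_mem[OF x y])
    have "\<phi> y = \<phi> h \<oplus> \<phi> x"
      using h x CR_submoduleD(1)[OF M N] linear_mapD(2)[OF assms(1)] by auto
    then show ?thesis using coset_absorb assms(2)[OF h(1)] linear_mapD(1)[OF assms(1) x] by simp
  qed
  then show ?thesis unfolding quot_map_def using coset_self[OF x] by blast
qed

lemma smult_linear: "linear_map M M (\<lambda>x. r \<odot> x)"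
proof (rule linear_mapI)
  show "r \<odot> (s \<odot> x) = s \<odot> (r \<odot> x)" if "x \<in> carrier M" for s x
    using that CR_module(5)[OF M, of x r s] CR_module(5)[OF M, of x s r] by (simp add: mult.commute)
qed (use CR_module[OF M] in auto)

lemma coset_smult: "x \<in> carrier M \<Longrightarrow> r \<odot>\<^bsub>quot_module M N\<^esub> (N +> x) = N +> (r \<odot> x)"
  by (simp add: quot_map_coset smult_linear CR_submoduleD(4)[OF M N])

lemma module_quot: "module CR (quot_module M N)"
proof (rule CR_moduleI)
  interpret M: abelian_group M by (rule CR_module(1)[OF M])
  let ?Q = "quot_module M N"
  have z: "\<zero>\<^bsub>?Q\<^esub> = N +> \<zero>" using coset_zero[OF CR_submoduleD(2)[OF M N]] by simp
  note S = coset_add coset_smult coset_carrier M.a_ac CR_module[OF M] z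
  note del = quot_module_simps
  show "abelian_group ?Q"
  proof (rule abelian_groupI)
    show "\<zero>\<^bsub>?Q\<^esub> \<in> carrier ?Q" unfolding z by (intro coset_carrier) simp
    fix C assume "C \<in> carrier ?Q"
    then obtain x where x: "x \<in> carrier M" "C = N +> x" by (rule coset_cases)
    show "\<zero>\<^bsub>?Q\<^esub> \<oplus>\<^bsub>?Q\<^esub> C = C"
      unfolding z x(2) using x(1) by (simp add: S del: del)
    show "\<exists>D\<in>carrier ?Q. D \<oplus>\<^bsub>?Q\<^esub> C = \<zero>\<^bsub>?Q\<^esub>"
      unfolding z x(2) using x(1) by (intro bexI[of _ "N +> (\<ominus> x)"]) (simp_all add: coset_add coset_carrier M.l_neg del: del)
    fix D assume "D \<in> carrier ?Q"
    then obtain y where y: "y \<in> carrier M" "D = N +> y" by (rule coset_cases)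
    show "C \<oplus>\<^bsub>?Q\<^esub> D \<in> carrier ?Q"
      unfolding x(2) y(2) using x(1) y(1) by (simp add: S del: del)
    show "C \<oplus>\<^bsub>?Q\<^esub> D = D \<oplus>\<^bsub>?Q\<^esub> C"
      unfolding x(2) y(2) using x(1) y(1) by (simp add: S del: del)
    fix E assume "E \<in> carrier ?Q"
    then obtain w where w: "w \<in> carrier M" "E = N +> w" by (rule coset_cases)
    show "C \<oplus>\<^bsub>?Q\<^esub> D \<oplus>\<^bsub>?Q\<^esub> E = C \<oplus>\<^bsub>?Q\<^esub> (D \<oplus>\<^bsub>?Q\<^esub> E)"
      unfolding x(2) y(2) w(2) using x(1) y(1) w(1) by (simp add: S del: del)
  qed
  fix r s C assume "C \<in> carrier ?Q"
  then obtain x where x: "x \<in> carrier M" "C = N +> x" by (rule coset_cases)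
  show "r \<odot>\<^bsub>?Q\<^esub> C \<in> carrier ?Q" "(r + s) \<odot>\<^bsub>?Q\<^esub> C = r \<odot>\<^bsub>?Q\<^esub> C \<oplus>\<^bsub>?Q\<^esub> s \<odot>\<^bsub>?Q\<^esub> C"
    "(r * s) \<odot>\<^bsub>?Q\<^esub> C = r \<odot>\<^bsub>?Q\<^esub> (s \<odot>\<^bsub>?Q\<^esub> C)" "1 \<odot>\<^bsub>?Q\<^esub> C = C"
    unfolding x(2) using x(1) by (simp_all add: S del: del)
  fix D assume "D \<in> carrier ?Q"
  then obtain y where y: "y \<in> carrier M" "D = N +> y" by (rule coset_cases)
  show "r \<odot>\<^bsub>?Q\<^esub> (C \<oplus>\<^bsub>?Q\<^esub> D) = r \<odot>\<^bsub>?Q\<^esub> C \<oplus>\<^bsub>?Q\<^esub> r \<odot>\<^bsub>?Q\<^esub> D"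
    unfolding x(2) y(2) using x(1) y(1) by (simp add: S del: del)
qed

lemma quot_map_linear:
  assumes "linear_map M M \<phi>" "\<And>h. h \<in> N \<Longrightarrow> \<phi> h \<in> N"
  shows "linear_map (quot_module M N) (quot_module M N) (quot_map M N \<phi>)"
proof (rule linear_mapI)
  note S = quot_map_coset[OF assms] coset_add coset_smult coset_carrier linear_mapD[OF assms(1)]
    CR_module(2)[OF M] abelian_monoid.a_closed[OF abelian_group.axioms(1)[OF CR_module(1)[OF M]]]
  fix C assume "C \<in> carrier (quot_module M N)"
  then obtain x where x: "x \<in> carrier M" "C = N +> x" by (rule coset_cases)
  show "quot_map M N \<phi> C \<in> carrier (quot_module M N)"
    "quot_map M N \<phi> (r \<odot>\<^bsub>quot_module M N\<^esub> C) = r \<odot>\<^bsub>quot_module M N\<^esub> quot_map M N \<phi> C" for r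
    unfolding x(2) using x(1) by (simp_all add: S del: quot_module_simps)
  fix D assume "D \<in> carrier (quot_module M N)"
  then obtain y where y: "y \<in> carrier M" "D = N +> y" by (rule coset_cases)
  show "quot_map M N \<phi> (C \<oplus>\<^bsub>quot_module M N\<^esub> D)
      = quot_map M N \<phi> C \<oplus>\<^bsub>quot_module M N\<^esub> quot_map M N \<phi> D"
    unfolding x(2) y(2) using x(1) y(1) by (simp add: S del: quot_module_simps)
qed

lemma quot_lift:
  assumes P: "module CR P" and h: "linear_map M P h" and k: "\<And>x. x \<in> N \<Longrightarrow> h x = \<zero>\<^bsub>P\<^esub>"
  obtains g where "linear_map (quot_module M N) P g" "\<And>x. x \<in> carrier M \<Longrightarrow> g (N +> x) = h x"
proof -
  interpret M: abelian_group M by (rule CR_module(1)[OF M])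
  interpret P: abelian_group P by (rule CR_module(1)[OF P])
  \<comment> \<open>Any member of the coset may be chosen, as \<open>h\<close> vanishes on
    \<open>N\<close>.\<close>
  define g where "g C = h (SOME y. y \<in> C)" for C
  have g: "g (N +> x) = h x" if x: "x \<in> carrier M" for x
  proof -
    have "(SOME y. y \<in> N +> x) \<in> N +> x" using coset_self[OF x] by (rule someI)
    then obtain n where n: "n \<in> N" "(SOME y. y \<in> N +> x) = n \<oplus> x" using coset_mem[OF x] by metis
    then show ?thesis
      unfolding g_def n(2)
      using x CR_submoduleD(1)[OF M N] linear_mapD[OF h] k by (auto simp: subset_iff)
  qed
  have "linear_map (quot_module M N) P g"
  proof (rule linear_mapI)
    note S = g coset_add coset_smult coset_carrier linear_mapD[OF h] CR_module(2)[OF M]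
    fix C assume "C \<in> carrier (quot_module M N)"
    then obtain x where x: "x \<in> carrier M" "C = N +> x" by (rule coset_cases)
    show "g C \<in> carrier P" "g (r \<odot>\<^bsub>quot_module M N\<^esub> C) = r \<odot>\<^bsub>P\<^esub> g C" for r
      unfolding x(2) using x(1) by (simp_all add: S del: quot_module_simps)
    fix D assume "D \<in> carrier (quot_module M N)"
    then obtain y where y: "y \<in> carrier M" "D = N +> y" by (rule coset_cases)
    show "g (C \<oplus>\<^bsub>quot_module M N\<^esub> D) = g C \<oplus>\<^bsub>P\<^esub> g D"
      unfolding x(2) y(2) using x(1) y(1) by (simp add: S del: quot_module_simps)
  qed
  then show ?thesis using g that by blast
qed

end

section \<open>Tensor products and exterior squares\<close>

lemma coset_eqI:
  assumes M: "module CR M" and N: "submodule N CR M" and x: "x \<in> carrier M" "y \<in> carrier M"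
    and "x \<ominus>\<^bsub>M\<^esub> y \<in> N"
  shows "N +>\<^bsub>M\<^esub> x = N +>\<^bsub>M\<^esub> y"
proof -
  interpret M: abelian_group M by (rule CR_module(1)[OF M])
  have "x = (x \<ominus>\<^bsub>M\<^esub> y) \<oplus>\<^bsub>M\<^esub> y" using x by (simp add: M.minus_eq M.a_assoc M.l_neg)
  then show ?thesis using coset_absorb[OF M N x(2) assms(5)] by simp
qed

lemma linear_map_minus:
  assumes M: "module CR M" and P: "module CR P" and f: "linear_map M P f" and x: "x \<in> carrier M" "y \<in> carrier M"
  shows "f (x \<ominus>\<^bsub>M\<^esub> y) = f x \<ominus>\<^bsub>P\<^esub> f y"
proof -
  interpret M: abelian_group M by (rule CR_module(1)[OF M])
  interpret P: abelian_group P by (rule CR_module(1)[OF P])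
  have "f (x \<ominus>\<^bsub>M\<^esub> y) = f (x \<oplus>\<^bsub>M\<^esub> (- 1) \<odot>\<^bsub>M\<^esub> y)"
    using x by (simp add: M.minus_eq CR_module(9)[OF M])
  also have "\<dots> = f x \<oplus>\<^bsub>P\<^esub> (- 1) \<odot>\<^bsub>P\<^esub> f y"
    using x linear_mapD[OF f] CR_module(2)[OF M] by simp
  also have "\<dots> = f x \<ominus>\<^bsub>P\<^esub> f y"
    using x linear_mapD(1)[OF f] by (simp add: P.minus_eq CR_module(9)[OF P])
  finally show ?thesis .
qed

definition bilinear_map :: "('r::comm_ring_1, 'm, 'b) module_scheme \<Rightarrow> ('r, 'n, 'c) module_scheme \<Rightarrow>
    ('r, 'p, 'd) module_scheme \<Rightarrow> ('m \<Rightarrow> 'n \<Rightarrow> 'p) \<Rightarrow> bool"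
  where "bilinear_map M N P \<beta> \<longleftrightarrow>
    (\<forall>y\<in>carrier N. linear_map M P (\<lambda>x. \<beta> x y)) \<and> (\<forall>x\<in>carrier M. linear_map N P (\<beta> x))"

lemma bilinear_mapD:
  assumes "bilinear_map M N P \<beta>" "x \<in> carrier M" "y \<in> carrier N"
  shows "\<beta> x y \<in> carrier P"
    "x' \<in> carrier M \<Longrightarrow> \<beta> (x \<oplus>\<^bsub>M\<^esub> x') y = \<beta> x y \<oplus>\<^bsub>P\<^esub> \<beta> x' y"
    "y' \<in> carrier N \<Longrightarrow> \<beta> x (y \<oplus>\<^bsub>N\<^esub> y') = \<beta> x y \<oplus>\<^bsub>P\<^esub> \<beta> x y'"
    "\<beta> (r \<odot>\<^bsub>M\<^esub> x) y = r \<odot>\<^bsub>P\<^esub> \<beta> x y" "\<beta> x (r \<odot>\<^bsub>N\<^esub> y) = r \<odot>\<^bsub>P\<^esub> \<beta> x y"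
  using assms by (simp_all add: bilinear_map_def linear_map_def)

context
  fixes M :: "('r::comm_ring_1, 'm, 'b) module_scheme" and N :: "('r, 'n, 'c) module_scheme"
  assumes M: "module CR M" and N: "module CR N"
begin

abbreviation (input) "FF \<equiv> free_module (CR :: 'r ring) (carrier M \<times> carrier N)"
abbreviation (input) "TT \<equiv> tensor CR M N"
abbreviation (input) "KK \<equiv> tensor_ker CR M N"
abbreviation (input) "ee \<equiv> basis_vec (CR :: 'r ring)"

lemma tensor_relsI:
  "x \<in> carrier M \<Longrightarrow> x' \<in> carrier M \<Longrightarrow> y \<in> carrier N \<Longrightarrow>
    ee (x \<oplus>\<^bsub>M\<^esub> x', y) \<ominus>\<^bsub>FF\<^esub> (ee (x, y) \<oplus>\<^bsub>FF\<^esub> ee (x', y)) \<in> tensor_rels CR M N"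
  "x \<in> carrier M \<Longrightarrow> y \<in> carrier N \<Longrightarrow> y' \<in> carrier N \<Longrightarrow>
    ee (x, y \<oplus>\<^bsub>N\<^esub> y') \<ominus>\<^bsub>FF\<^esub> (ee (x, y) \<oplus>\<^bsub>FF\<^esub> ee (x, y')) \<in> tensor_rels CR M N"
  "x \<in> carrier M \<Longrightarrow> y \<in> carrier N \<Longrightarrow>
    ee (r \<odot>\<^bsub>M\<^esub> x, y) \<ominus>\<^bsub>FF\<^esub> (r \<odot>\<^bsub>FF\<^esub> ee (x, y)) \<in> tensor_rels CR M N"
  "x \<in> carrier M \<Longrightarrow> y \<in> carrier N \<Longrightarrow>
    ee (x, r \<odot>\<^bsub>N\<^esub> y) \<ominus>\<^bsub>FF\<^esub> (r \<odot>\<^bsub>FF\<^esub> ee (x, y)) \<in> tensor_rels CR M N"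
  unfolding tensor_rels_def Let_def using carrier_class by blast+

lemma tensor_rels_cases:
  assumes "t \<in> tensor_rels CR M N"
  obtains x x' y where "x \<in> carrier M" "x' \<in> carrier M" "y \<in> carrier N"
      "t = ee (x \<oplus>\<^bsub>M\<^esub> x', y) \<ominus>\<^bsub>FF\<^esub> (ee (x, y) \<oplus>\<^bsub>FF\<^esub> ee (x', y))"
    | x y y' where "x \<in> carrier M" "y \<in> carrier N" "y' \<in> carrier N"
      "t = ee (x, y \<oplus>\<^bsub>N\<^esub> y') \<ominus>\<^bsub>FF\<^esub> (ee (x, y) \<oplus>\<^bsub>FF\<^esub> ee (x, y'))"
    | r x y where "x \<in> carrier M" "y \<in> carrier N" "t = ee (r \<odot>\<^bsub>M\<^esub> x, y) \<ominus>\<^bsub>FF\<^esub> (r \<odot>\<^bsub>FF\<^esub> ee (x, y))"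
    | r x y where "x \<in> carrier M" "y \<in> carrier N" "t = ee (x, r \<odot>\<^bsub>N\<^esub> y) \<ominus>\<^bsub>FF\<^esub> (r \<odot>\<^bsub>FF\<^esub> ee (x, y))"
  using assms unfolding tensor_rels_def Let_def by blast

lemma MN_closed:
  "x \<in> carrier M \<Longrightarrow> x' \<in> carrier M \<Longrightarrow> x \<oplus>\<^bsub>M\<^esub> x' \<in> carrier M"
  "y \<in> carrier N \<Longrightarrow> y' \<in> carrier N \<Longrightarrow> y \<oplus>\<^bsub>N\<^esub> y' \<in> carrier N"
  "x \<in> carrier M \<Longrightarrow> r \<odot>\<^bsub>M\<^esub> x \<in> carrier M" "y \<in> carrier N \<Longrightarrow> r \<odot>\<^bsub>N\<^esub> y \<in> carrier N"
  "\<zero>\<^bsub>M\<^esub> \<in> carrier M" "\<zero>\<^bsub>N\<^esub> \<in> carrier N"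
proof -
  interpret M: abelian_group M by (rule CR_module(1)[OF M])
  interpret N: abelian_group N by (rule CR_module(1)[OF N])
  show "x \<in> carrier M \<Longrightarrow> x' \<in> carrier M \<Longrightarrow> x \<oplus>\<^bsub>M\<^esub> x' \<in> carrier M"
    "y \<in> carrier N \<Longrightarrow> y' \<in> carrier N \<Longrightarrow> y \<oplus>\<^bsub>N\<^esub> y' \<in> carrier N"
    "x \<in> carrier M \<Longrightarrow> r \<odot>\<^bsub>M\<^esub> x \<in> carrier M" "y \<in> carrier N \<Longrightarrow> r \<odot>\<^bsub>N\<^esub> y \<in> carrier N"
    "\<zero>\<^bsub>M\<^esub> \<in> carrier M" "\<zero>\<^bsub>N\<^esub> \<in> carrier N"
    using CR_module(2)[OF M] CR_module(2)[OF N] by auto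
qed

lemma ee_carrier: "x \<in> carrier M \<Longrightarrow> y \<in> carrier N \<Longrightarrow> ee (x, y) \<in> carrier FF"
  by (intro basis_vec_carrier) simp

lemma FF_closed:
  "a \<in> carrier FF \<Longrightarrow> b \<in> carrier FF \<Longrightarrow> a \<oplus>\<^bsub>FF\<^esub> b \<in> carrier FF"
  "a \<in> carrier FF \<Longrightarrow> b \<in> carrier FF \<Longrightarrow> a \<ominus>\<^bsub>FF\<^esub> b \<in> carrier FF"
  "a \<in> carrier FF \<Longrightarrow> r \<odot>\<^bsub>FF\<^esub> a \<in> carrier FF"
proof -
  interpret F: abelian_group FF by (rule CR_module(1)[OF module_free])
  show "a \<in> carrier FF \<Longrightarrow> b \<in> carrier FF \<Longrightarrow> a \<oplus>\<^bsub>FF\<^esub> b \<in> carrier FF" by (rule F.a_closed)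
  show "a \<in> carrier FF \<Longrightarrow> b \<in> carrier FF \<Longrightarrow> a \<ominus>\<^bsub>FF\<^esub> b \<in> carrier FF" by (rule F.minus_closed)
  show "a \<in> carrier FF \<Longrightarrow> r \<odot>\<^bsub>FF\<^esub> a \<in> carrier FF" by (rule CR_module(2)[OF module_free])
qed

lemma tensor_rels_carrier: "tensor_rels CR M N \<subseteq> carrier FF"
proof
  fix t assume "t \<in> tensor_rels CR M N"
  then show "t \<in> carrier FF"
    by (rule tensor_rels_cases) (simp_all only: FF_closed ee_carrier MN_closed)
qed

lemma tensor_ker_submodule: "submodule KK CR FF"
  unfolding tensor_ker_def by (rule module_span_submodule(1)[OF module_free tensor_rels_carrier])

lemma tensor_rels_ker: "t \<in> tensor_rels CR M N \<Longrightarrow> t \<in> KK"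
  unfolding tensor_ker_def using module_span_submodule(2)[OF module_free tensor_rels_carrier] by blast

lemma tensor_ker_least: "submodule H CR FF \<Longrightarrow> tensor_rels CR M N \<subseteq> H \<Longrightarrow> KK \<subseteq> H"
  unfolding tensor_ker_def by (rule module_span_least)

lemma module_tensor: "module CR TT"
  unfolding tensor_def by (rule module_quot[OF module_free tensor_ker_submodule])

lemma pure_tensor_bilinear: "bilinear_map M N TT (pure_tensor CR M N)"
proof -
  note c = coset_carrier[OF module_free tensor_ker_submodule]
    coset_add[OF module_free tensor_ker_submodule] coset_smult[OF module_free tensor_ker_submodule]
  note eq = coset_eqI[OF module_free tensor_ker_submodule _ _ tensor_rels_ker]
  have car: "pure_tensor CR M N x y \<in> carrier TT" if "x \<in> carrier M" "y \<in> carrier N" for x y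
    unfolding pure_tensor_def tensor_def by (intro c ee_carrier that)
  show ?thesis
    unfolding bilinear_map_def
  proof (intro conjI ballI linear_mapI)
    fix x y assume x: "x \<in> carrier M" and y: "y \<in> carrier N"
    show "pure_tensor CR M N x y \<in> carrier TT" "pure_tensor CR M N x y \<in> carrier TT"
      using car x y by blast+
    show "pure_tensor CR M N (x \<oplus>\<^bsub>M\<^esub> x') y = pure_tensor CR M N x y \<oplus>\<^bsub>TT\<^esub> pure_tensor CR M N x' y"
      if "x' \<in> carrier M" for x'
      unfolding pure_tensor_def tensor_def c(2)[OF ee_carrier[OF x y] ee_carrier[OF that y]]
      by (intro eq tensor_relsI(1) FF_closed ee_carrier MN_closed x y that)
    show "pure_tensor CR M N x (y \<oplus>\<^bsub>N\<^esub> y') = pure_tensor CR M N x y \<oplus>\<^bsub>TT\<^esub> pure_tensor CR M N x y'"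
      if "y' \<in> carrier N" for y'
      unfolding pure_tensor_def tensor_def c(2)[OF ee_carrier[OF x y] ee_carrier[OF x that]]
      by (intro eq tensor_relsI(2) FF_closed ee_carrier MN_closed x y that)
    show "pure_tensor CR M N (r \<odot>\<^bsub>M\<^esub> x) y = r \<odot>\<^bsub>TT\<^esub> pure_tensor CR M N x y" for r
      unfolding pure_tensor_def tensor_def c(3)[OF ee_carrier[OF x y]]
      by (intro eq tensor_relsI(3) FF_closed ee_carrier MN_closed x y)
    show "pure_tensor CR M N x (r \<odot>\<^bsub>N\<^esub> y) = r \<odot>\<^bsub>TT\<^esub> pure_tensor CR M N x y" for r
      unfolding pure_tensor_def tensor_def c(3)[OF ee_carrier[OF x y]]
      by (intro eq tensor_relsI(4) FF_closed ee_carrier MN_closed x y)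
  qed
qed

text \<open>Pure tensors generate under sums and scalar multiples alone: zero is the multiple by 0
  of a pure tensor, so it needs no case.\<close>

lemma tensor_induct:
  assumes t: "t \<in> carrier TT"
    and pure: "\<And>x y. x \<in> carrier M \<Longrightarrow> y \<in> carrier N \<Longrightarrow> P (pure_tensor CR M N x y)"
    and add: "\<And>s t. s \<in> carrier TT \<Longrightarrow> t \<in> carrier TT \<Longrightarrow> P s \<Longrightarrow> P t \<Longrightarrow> P (s \<oplus>\<^bsub>TT\<^esub> t)"
    and smult: "\<And>r t. t \<in> carrier TT \<Longrightarrow> P t \<Longrightarrow> P (r \<odot>\<^bsub>TT\<^esub> t)"
  shows "P t"
proof -
  note c = coset_carrier[OF module_free tensor_ker_submodule]
    coset_add[OF module_free tensor_ker_submodule] coset_smult[OF module_free tensor_ker_submodule]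
  obtain f where f: "f \<in> carrier FF" "t = KK +>\<^bsub>FF\<^esub> f"
    using coset_cases[OF module_free tensor_ker_submodule t[unfolded tensor_def]] .
  have b: "ee ` (carrier M \<times> carrier N) \<subseteq> carrier FF"
    by (rule image_subsetI) (rule basis_vec_carrier)
  have "P (KK +>\<^bsub>FF\<^esub> f)"
  proof (rule module_span_induct[OF module_free b, of f])
    show "f \<in> module_span CR FF (ee ` (carrier M \<times> carrier N))"
      using f(1) free_module_span[where X = "carrier M \<times> carrier N" and ?'r = 'r] by simp
    show "P (KK +>\<^bsub>FF\<^esub> p)" if "p \<in> ee ` (carrier M \<times> carrier N)" for p
      using that pure unfolding pure_tensor_def by auto
    have "P (pure_tensor CR M N \<zero>\<^bsub>M\<^esub> \<zero>\<^bsub>N\<^esub>)" by (intro pure MN_closed)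
    moreover have "pure_tensor CR M N \<zero>\<^bsub>M\<^esub> \<zero>\<^bsub>N\<^esub> \<in> carrier TT"
      by (intro bilinear_mapD(1)[OF pure_tensor_bilinear] MN_closed)
    ultimately have "P (0 \<odot>\<^bsub>TT\<^esub> pure_tensor CR M N \<zero>\<^bsub>M\<^esub> \<zero>\<^bsub>N\<^esub>)" by (intro smult)
    also have "0 \<odot>\<^bsub>TT\<^esub> pure_tensor CR M N \<zero>\<^bsub>M\<^esub> \<zero>\<^bsub>N\<^esub> = \<zero>\<^bsub>TT\<^esub>"
      by (intro CR_module(7)[OF module_tensor] bilinear_mapD(1)[OF pure_tensor_bilinear] MN_closed)
    also have "\<zero>\<^bsub>TT\<^esub> = KK +>\<^bsub>FF\<^esub> \<zero>\<^bsub>FF\<^esub>"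
      using coset_zero[OF module_free tensor_ker_submodule CR_submoduleD(2)[OF module_free tensor_ker_submodule]]
      by (simp add: tensor_def)
    finally show "P (KK +>\<^bsub>FF\<^esub> \<zero>\<^bsub>FF\<^esub>)" .
  next
    fix a b assume ab: "a \<in> carrier FF" "b \<in> carrier FF" "P (KK +>\<^bsub>FF\<^esub> a)" "P (KK +>\<^bsub>FF\<^esub> b)"
    show "P (KK +>\<^bsub>FF\<^esub> (a \<oplus>\<^bsub>FF\<^esub> b))"
      using add[unfolded tensor_def, OF c(1)[OF ab(1)] c(1)[OF ab(2)] ab(3,4)]
      unfolding c(2)[OF ab(1,2)] .
  next
    fix r a assume a: "a \<in> carrier FF" "P (KK +>\<^bsub>FF\<^esub> a)"
    show "P (KK +>\<^bsub>FF\<^esub> (r \<odot>\<^bsub>FF\<^esub> a))"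
      using smult[unfolded tensor_def, OF c(1)[OF a(1)] a(2)] unfolding c(3)[OF a(1)] .
  qed
  then show ?thesis unfolding f(2) .
qed

text \<open>The universal property: bilinearity of \<open>\<beta>\<close> says that its linear
  extension to the free module kills the defining relations.\<close>

lemma tensor_lift:
  assumes P: "module CR P" and b: "bilinear_map M N P \<beta>"
  obtains h where "linear_map TT P h"
    "\<And>x y. x \<in> carrier M \<Longrightarrow> y \<in> carrier N \<Longrightarrow> h (pure_tensor CR M N x y) = \<beta> x y"
proof -
  interpret P: abelian_group P by (rule CR_module(1)[OF P])
  let ?\<phi> = "\<lambda>(x, y). \<beta> x y"
  let ?h = "lin_ext CR P ?\<phi>"
  have p: "?\<phi> z \<in> carrier P" if "z \<in> carrier M \<times> carrier N" for z
    using that bilinear_mapD(1)[OF b] by auto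
  have h: "linear_map FF P ?h" by (rule lin_ext_linear[OF P p])
  have he: "?h (ee (x, y)) = \<beta> x y" if "x \<in> carrier M" "y \<in> carrier N" for x y
    using that bilinear_mapD(1)[OF b] by (subst lin_ext_basis_vec[OF P]) auto
  note hm = linear_map_minus[OF module_free P h] linear_mapD[OF h]
  have "KK \<subseteq> {f \<in> carrier FF. ?h f = \<zero>\<^bsub>P\<^esub>}"
  proof (rule tensor_ker_least[OF linear_ker_submodule[OF module_free P h]], rule subsetI)
    fix t assume t: "t \<in> tensor_rels CR M N"
    have "?h t = \<zero>\<^bsub>P\<^esub>"
      using t
      by (cases rule: tensor_rels_cases)
        (simp_all add: hm he FF_closed ee_carrier MN_closed bilinear_mapD[OF b] CR_module(2)[OF P]
          P.r_neg P.minus_eq del: free_module_simps)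
    then show "t \<in> {f \<in> carrier FF. ?h f = \<zero>\<^bsub>P\<^esub>}" using t tensor_rels_carrier by blast
  qed
  then have k: "?h f = \<zero>\<^bsub>P\<^esub>" if "f \<in> KK" for f using that by blast
  obtain g where g: "linear_map TT P g" "\<And>f. f \<in> carrier FF \<Longrightarrow> g (KK +>\<^bsub>FF\<^esub> f) = ?h f"
    using quot_lift[OF module_free tensor_ker_submodule P h k] unfolding tensor_def by blast
  show ?thesis
    by (rule that[OF g(1)]) (simp add: pure_tensor_def g(2) ee_carrier he del: free_module_simps)
qed

lemma tensor_map:
  assumes f: "linear_map M M \<phi>" and g: "linear_map N N \<psi>"
  shows "linear_map TT TT (tensor_map CR M N \<phi> \<psi>)"
    and "x \<in> carrier M \<Longrightarrow> y \<in> carrier N \<Longrightarrow>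
      tensor_map CR M N \<phi> \<psi> (pure_tensor CR M N x y) = pure_tensor CR M N (\<phi> x) (\<psi> y)"
proof -
  let ?\<phi> = "\<lambda>(x, y). ee (\<phi> x, \<psi> y)"
  let ?h = "lin_ext CR FF ?\<phi>"
  note fg = linear_mapD[OF f] linear_mapD[OF g]
  have p: "?\<phi> z \<in> carrier FF" if "z \<in> carrier M \<times> carrier N" for z
    using that by (auto intro!: ee_carrier fg simp del: free_module_simps)
  have h: "linear_map FF FF ?h" by (rule lin_ext_linear[OF module_free p])
  have he: "?h (ee (x, y)) = ee (\<phi> x, \<psi> y)" if "x \<in> carrier M" "y \<in> carrier N" for x y
    using that by (subst lin_ext_basis_vec[OF module_free]) (auto intro!: ee_carrier fg simp del: free_module_simps)
  note hm = linear_map_minus[OF module_free module_free h] linear_mapD[OF h]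
  have sub: "submodule {f \<in> carrier FF. ?h f \<in> KK} CR FF"
    using CR_submoduleD[OF module_free tensor_ker_submodule]
    by (intro CR_submoduleI[OF module_free])
      (auto simp: hm FF_closed linear_map_zero[OF module_free module_free h]
        abelian_monoid.zero_closed[OF abelian_group.axioms(1)[OF CR_module(1)[OF module_free]]]
        simp del: free_module_simps)
  \<comment> \<open>Each defining relation is carried to one of the same kind, so the submodule they
    generate is preserved.\<close>
  have "KK \<subseteq> {f \<in> carrier FF. ?h f \<in> KK}"
  proof (rule tensor_ker_least[OF sub], rule subsetI)
    fix t assume t: "t \<in> tensor_rels CR M N"
    then have "?h t \<in> tensor_rels CR M N"
      by (cases rule: tensor_rels_cases)
        (simp_all add: hm he FF_closed ee_carrier MN_closed fg tensor_relsI del: free_module_simps)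
    then show "t \<in> {f \<in> carrier FF. ?h f \<in> KK}" using t tensor_rels_carrier tensor_rels_ker by blast
  qed
  then have k: "?h f \<in> KK" if "f \<in> KK" for f using that by blast
  have tm: "tensor_map CR M N \<phi> \<psi> = quot_map FF KK ?h" by (simp add: tensor_map_def Let_def)
  show "linear_map TT TT (tensor_map CR M N \<phi> \<psi>)"
    unfolding tm tensor_def by (rule quot_map_linear[OF module_free tensor_ker_submodule h k])
  show "x \<in> carrier M \<Longrightarrow> y \<in> carrier N \<Longrightarrow>
      tensor_map CR M N \<phi> \<psi> (pure_tensor CR M N x y) = pure_tensor CR M N (\<phi> x) (\<psi> y)"
    unfolding tm pure_tensor_def
    by (subst quot_map_coset[OF module_free tensor_ker_submodule h k])
      (simp_all add: ee_carrier he del: free_module_simps)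
qed

end

definition ext_wedge :: "('r::comm_ring_1, 'm, 'b) module_scheme \<Rightarrow> 'm \<Rightarrow> 'm \<Rightarrow> ('m \<times> 'm \<Rightarrow> 'r) set set"
  where "ext_wedge M x y = alternating_ker CR M +>\<^bsub>tensor CR M M\<^esub> pure_tensor CR M M x y"

context
  fixes M :: "('r::comm_ring_1, 'm, 'g, 'b) gmodule_scheme"
  assumes M: "module CR M"
begin

abbreviation (input) "T2 \<equiv> tensor CR M M"
abbreviation (input) "A2 \<equiv> alternating_ker CR M"
abbreviation (input) "E2 \<equiv> quot_module T2 A2"

lemma squares_carrier: "{pure_tensor CR M M x x | x. x \<in> carrier M} \<subseteq> carrier T2"
  using bilinear_mapD(1)[OF pure_tensor_bilinear[OF M M]] by blast

lemma alternating_ker_submodule: "submodule A2 CR T2"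
  unfolding alternating_ker_def
  by (rule module_span_submodule(1)[OF module_tensor[OF M M] squares_carrier])

lemmas E2 = module_tensor[OF M M] alternating_ker_submodule

lemma module_ext_square: "module CR (ext_square CR M)"
  by (rule module_cong[OF module_quot[OF E2]]) (simp_all add: ext_square_def fun_eq_iff)

lemma ext_wedge_bilinear: "bilinear_map M M (ext_square CR M) (ext_wedge M)"
proof -
  note b = bilinear_mapD[OF pure_tensor_bilinear[OF M M]]
  show ?thesis
    unfolding bilinear_map_def ext_wedge_def
    by (intro conjI ballI linear_mapI)
      (simp_all add: ext_square_def b coset_add[OF E2] coset_smult[OF E2] coset_carrier[OF E2] del: quot_module_simps)
qed

lemma ext_wedge_self: "x \<in> carrier M \<Longrightarrow> ext_wedge M x x = \<zero>\<^bsub>ext_square CR M\<^esub>"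
proof -
  assume "x \<in> carrier M"
  then have "pure_tensor CR M M x x \<in> A2"
    using module_span_submodule(2)[OF module_tensor[OF M M] squares_carrier] unfolding alternating_ker_def by blast
  then show ?thesis by (simp add: ext_wedge_def ext_square_def coset_zero[OF E2])
qed

lemma ext_induct:
  assumes t: "t \<in> carrier (ext_square CR M)"
    and pure: "\<And>x y. x \<in> carrier M \<Longrightarrow> y \<in> carrier M \<Longrightarrow> P (ext_wedge M x y)"
    and add: "\<And>s t. s \<in> carrier (ext_square CR M) \<Longrightarrow> t \<in> carrier (ext_square CR M) \<Longrightarrow> P s \<Longrightarrow> P t \<Longrightarrow>
      P (s \<oplus>\<^bsub>ext_square CR M\<^esub> t)"
    and smult: "\<And>r t. t \<in> carrier (ext_square CR M) \<Longrightarrow> P t \<Longrightarrow> P (r \<odot>\<^bsub>ext_square CR M\<^esub> t)"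
  shows "P t"
proof -
  have e: "carrier (ext_square CR M) = carrier E2" "add (ext_square CR M) = add E2"
    "smult (ext_square CR M) = smult E2" by (simp_all add: ext_square_def fun_eq_iff)
  obtain s where s: "s \<in> carrier T2" "t = A2 +>\<^bsub>T2\<^esub> s"
    using coset_cases[OF E2 t[unfolded e]] .
  have "P (A2 +>\<^bsub>T2\<^esub> s)"
    using s(1)
  proof (rule tensor_induct[OF M M])
    show "P (A2 +>\<^bsub>T2\<^esub> pure_tensor CR M M x y)" if "x \<in> carrier M" "y \<in> carrier M" for x y
      using pure[OF that] by (simp add: ext_wedge_def)
    show "P (A2 +>\<^bsub>T2\<^esub> (a \<oplus>\<^bsub>T2\<^esub> b))"
      if ab: "a \<in> carrier T2" "b \<in> carrier T2" "P (A2 +>\<^bsub>T2\<^esub> a)" "P (A2 +>\<^bsub>T2\<^esub> b)" for a b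
      using add[unfolded e, OF coset_carrier[OF E2 ab(1)] coset_carrier[OF E2 ab(2)] ab(3,4)]
      unfolding coset_add[OF E2 ab(1,2)] .
    show "P (A2 +>\<^bsub>T2\<^esub> (r \<odot>\<^bsub>T2\<^esub> a))" if a: "a \<in> carrier T2" "P (A2 +>\<^bsub>T2\<^esub> a)" for r a
      using smult[unfolded e, OF coset_carrier[OF E2 a(1)] a(2)]
      unfolding coset_smult[OF E2 a(1)] .
  qed
  then show ?thesis unfolding s(2) .
qed

text \<open>An alternating map vanishes on the generators of \<open>alternating_ker\<close>, so its
  lift to the tensor square factors once more.\<close>

lemma ext_lift:
  assumes P: "module CR P" and b: "bilinear_map M M P \<beta>" and alt: "\<And>x. x \<in> carrier M \<Longrightarrow> \<beta> x x = \<zero>\<^bsub>P\<^esub>"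
  obtains h where "linear_map (ext_square CR M) P h"
    "\<And>x y. x \<in> carrier M \<Longrightarrow> y \<in> carrier M \<Longrightarrow> h (ext_wedge M x y) = \<beta> x y"
proof -
  obtain h where h: "linear_map T2 P h"
    "\<And>x y. x \<in> carrier M \<Longrightarrow> y \<in> carrier M \<Longrightarrow> h (pure_tensor CR M M x y) = \<beta> x y"
    by (rule tensor_lift[OF M M P b]) blast
  have "A2 \<subseteq> {t \<in> carrier T2. h t = \<zero>\<^bsub>P\<^esub>}"
    unfolding alternating_ker_def
    by (rule module_span_least[OF linear_ker_submodule[OF module_tensor[OF M M] P h(1)]])
      (use squares_carrier h(2) alt in auto)
  then have k: "h t = \<zero>\<^bsub>P\<^esub>" if "t \<in> A2" for t using that by blast
  obtain g where g: "linear_map E2 P g" "\<And>t. t \<in> carrier T2 \<Longrightarrow> g (A2 +>\<^bsub>T2\<^esub> t) = h t"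
    using quot_lift[OF E2 P h(1) k] by blast
  have "linear_map (ext_square CR M) P g"
    using g(1) by (simp add: linear_map_def ext_square_def)
  then show ?thesis
    using that g(2) h(2) bilinear_mapD(1)[OF pure_tensor_bilinear[OF M M]] by (simp add: ext_wedge_def)
qed

lemma ext_act:
  assumes g: "linear_map M M (act M g)"
  shows "linear_map (ext_square CR M) (ext_square CR M) (act (ext_square CR M) g)"
    and "x \<in> carrier M \<Longrightarrow> y \<in> carrier M \<Longrightarrow>
      act (ext_square CR M) g (ext_wedge M x y) = ext_wedge M (act M g x) (act M g y)"
proof -
  note tm = tensor_map[OF M M g g]
  let ?t = "tensor_map CR M M (act M g) (act M g)"
  have sub: "submodule {t \<in> carrier T2. ?t t \<in> A2} CR T2"
    using CR_submoduleD[OF E2] CR_module(2)[OF module_tensor[OF M M]]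
      abelian_monoid.zero_closed[OF abelian_group.axioms(1)[OF CR_module(1)[OF module_tensor[OF M M]]]]
      abelian_monoid.a_closed[OF abelian_group.axioms(1)[OF CR_module(1)[OF module_tensor[OF M M]]]]
    by (intro CR_submoduleI[OF module_tensor[OF M M]])
      (auto simp: linear_mapD[OF tm(1)] linear_map_zero[OF module_tensor[OF M M] module_tensor[OF M M] tm(1)])
  have "A2 \<subseteq> {t \<in> carrier T2. ?t t \<in> A2}"
  proof (subst alternating_ker_def, rule module_span_least[OF sub], rule subsetI)
    fix t assume "t \<in> {pure_tensor CR M M x x | x. x \<in> carrier M}"
    then obtain x where x: "x \<in> carrier M" "t = pure_tensor CR M M x x" by blast
    have "?t t \<in> {pure_tensor CR M M x x | x. x \<in> carrier M}"
      unfolding x(2) tm(2)[OF x(1) x(1)] using linear_mapD(1)[OF g x(1)] by blast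
    then have "?t t \<in> A2"
      unfolding alternating_ker_def using module_span_submodule(2)[OF module_tensor[OF M M] squares_carrier] by blast
    then show "t \<in> {t \<in> carrier T2. ?t t \<in> A2}"
      using x squares_carrier by blast
  qed
  then have k: "?t t \<in> A2" if "t \<in> A2" for t using that by blast
  show "linear_map (ext_square CR M) (ext_square CR M) (act (ext_square CR M) g)"
    using quot_map_linear[OF E2 tm(1) k] by (simp add: linear_map_def ext_square_def)
  show "x \<in> carrier M \<Longrightarrow> y \<in> carrier M \<Longrightarrow>
      act (ext_square CR M) g (ext_wedge M x y) = ext_wedge M (act M g x) (act M g y)"
    by (simp add: ext_wedge_def ext_square_def quot_map_coset[OF E2 tm(1) k]
        bilinear_mapD(1)[OF pure_tensor_bilinear[OF M M]] tm(2))
qed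

end

section \<open>The exterior square as a module of alternating matrices\<close>

lemma fun_module:
  fixes P :: "('r::comm_ring_1, 'x \<Rightarrow> 'r, 'b) module_scheme"
  assumes P: "add P = (+)" "zero P = 0" "smult P = sc"
    and c: "0 \<in> carrier P" "\<And>x y. x \<in> carrier P \<Longrightarrow> y \<in> carrier P \<Longrightarrow> x + y \<in> carrier P"
      "\<And>r x. x \<in> carrier P \<Longrightarrow> sc r x \<in> carrier P"
  shows "module CR P"
proof (rule CR_moduleI)
  show "abelian_group P"
  proof (rule abelian_groupI)
    fix x assume "x \<in> carrier P"
    then have "sc (- 1) x \<in> carrier P" by (rule c)
    then show "\<exists>y\<in>carrier P. y \<oplus>\<^bsub>P\<^esub> x = \<zero>\<^bsub>P\<^esub>"
      by (intro bexI[of _ "sc (- 1) x"]) (simp_all add: P fun_eq_iff)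
  qed (use c in \<open>simp_all add: P add.assoc add.commute\<close>)
qed (use c in \<open>simp_all add: P sc_add sc_sc sc_1\<close>, simp add: fun_eq_iff distrib_right)

definition alt_mod :: "nat \<Rightarrow> ('r::comm_ring_1, 'r mat, nat \<Rightarrow> nat) gmodule"
  where "alt_mod n = \<lparr>carrier = alt n, monoid.mult = undefined, one = undefined,
    zero = 0, add = (+), smult = sc, act = pact\<rparr>"

lemma alt_mod_simps [simp]:
  "carrier (alt_mod n) = alt n" "zero (alt_mod n) = 0" "add (alt_mod n) = (+)" "smult (alt_mod n) = sc" "act (alt_mod n) = pact"
  by (simp_all add: alt_mod_def)

lemma module_alt_mod: "module CR (alt_mod n)"
  by (rule fun_module) (simp_all add: alt_zero alt_add alt_sc)

lemma group_moduleI: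
  assumes "module CR M" "group G"
    "\<And>g x. g \<in> carrier G \<Longrightarrow> x \<in> carrier M \<Longrightarrow> act M g x \<in> carrier M"
    "\<And>g x y. g \<in> carrier G \<Longrightarrow> x \<in> carrier M \<Longrightarrow> y \<in> carrier M \<Longrightarrow> act M g (x \<oplus>\<^bsub>M\<^esub> y) = act M g x \<oplus>\<^bsub>M\<^esub> act M g y"
    "\<And>g r x. g \<in> carrier G \<Longrightarrow> x \<in> carrier M \<Longrightarrow> act M g (r \<odot>\<^bsub>M\<^esub> x) = r \<odot>\<^bsub>M\<^esub> act M g x"
    "\<And>x. x \<in> carrier M \<Longrightarrow> act M \<one>\<^bsub>G\<^esub> x = x"
    "\<And>g h x. g \<in> carrier G \<Longrightarrow> h \<in> carrier G \<Longrightarrow> x \<in> carrier M \<Longrightarrow> act M (g \<otimes>\<^bsub>G\<^esub> h) x = act M g (act M h x)"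
  shows "group_module CR G M"
  using assms by (simp add: group_module_def group_module_axioms_def)

lemma group_module_alt_mod: "group_module CR (sym_group n) (alt_mod n)"
proof (rule group_moduleI[OF module_alt_mod sym_group_is_group])
  show "act (alt_mod n) (g \<otimes>\<^bsub>sym_group n\<^esub> h) x = act (alt_mod n) g (act (alt_mod n) h x)"
    if "g \<in> carrier (sym_group n)" "h \<in> carrier (sym_group n)" for g h x
    using that pact_comp[OF permutes_bij permutes_bij] by (simp add: sym_group_def)
qed (simp_all add: sym_group_def pact_alt pact_linear pact_id)

text \<open>The laws of an action are identities, which may be checked after an injective
  equivariant map. For submodules of the exterior square this replaces computations with cosets by
  computations with matrices.\<close>

lemma group_module_pullback:
  assumes M: "module CR M" and cl: "\<And>g x. g \<in> carrier G \<Longrightarrow> x \<in> carrier M \<Longrightarrow> act M g x \<in> carrier M"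
    and f: "linear_map M P f" "inj_on f (carrier M)"
      "\<And>g x. g \<in> carrier G \<Longrightarrow> x \<in> carrier M \<Longrightarrow> f (act M g x) = act P g (f x)"
    and P: "group_module CR G P"
  shows "group_module CR G M"
proof -
  interpret P: group_module CR G P by fact
  interpret M: abelian_group M by (rule CR_module(1)[OF M])
  note fl = linear_mapD[OF f(1)]
  note inj = inj_onD[OF f(2)]
  show ?thesis
  proof (rule group_moduleI[OF M P.G.is_group cl])
    fix g h x y r assume g: "g \<in> carrier G" and x: "x \<in> carrier M"
    show "act M g (r \<odot>\<^bsub>M\<^esub> x) = r \<odot>\<^bsub>M\<^esub> act M g x"
      using g x by (intro inj) (simp_all add: f(3) fl cl CR_module(2)[OF M] P.act_smult carrier_class)
    show "act M g (x \<oplus>\<^bsub>M\<^esub> y) = act M g x \<oplus>\<^bsub>M\<^esub> act M g y" if "y \<in> carrier M"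
      using g x that by (intro inj) (simp_all add: f(3) fl cl P.act_add)
    show "act M (g \<otimes>\<^bsub>G\<^esub> h) x = act M g (act M h x)" if "h \<in> carrier G"
      using g x that by (intro inj) (simp_all add: f(3) fl cl P.act_mult)
  next
    show "act M \<one>\<^bsub>G\<^esub> x = x" if x: "x \<in> carrier M" for x
      using x by (intro inj) (simp_all add: f(3) fl cl P.act_one)
  qed
qed

lemma finsum_CR: "finsum CR f A = sum f A" for f :: "'x \<Rightarrow> 'r::comm_ring_1"
proof (cases "finite A")
  case True
  then show ?thesis
    by (induction A rule: finite_induct) (simp_all add: cring_class.finsum_insert carrier_class)
next
  case False
  then show ?thesis by (simp add: cring_class.finsum_infinite)
qed

lemma natural_specht_simps [simp]:
  "carrier (natural_specht CR n) = sum0 n" "zero (natural_specht CR n) = 0"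
  "add (natural_specht CR n) = (+)" "smult (natural_specht CR n) = sc" "act (natural_specht CR n) = vact"
proof -
  have "finite {x. f x \<noteq> 0}" if "\<forall>i. f i \<noteq> 0 \<longrightarrow> Suc 0 \<le> i \<and> i \<le> n" for f :: "nat \<Rightarrow> 'r::comm_ring_1"
    by (rule finite_subset[of _ "{1..n}"]) (use that in auto)
  then show "carrier (natural_specht (CR :: 'r::comm_ring_1 ring) n) = sum0 n"
    by (auto simp: natural_specht_def perm_lattice_def sum0_def finsum_CR zero_class)
qed (auto simp: natural_specht_def perm_lattice_def fun_eq_iff vact_def)

lemma module_natural_specht: "module CR (natural_specht CR n)"
  by (rule fun_module) (simp_all add: sum0_zero sum0_add sum0_sc)

lemma wedge_bilinear_map_natural: "bilinear_map (natural_specht CR n) (natural_specht CR n) (alt_mod n) wedge"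
  unfolding bilinear_map_def
  by (intro conjI ballI linear_mapI) (simp_all add: wedge_alt wedge_bilinear)

text \<open>The vectors \<open>uvec i - uvec n\<close> generate, so an identity linear in its
  argument has to be checked only on them.\<close>

lemma sum0_induct [consumes 1, case_names unit zero add sc]:
  assumes "x \<in> sum0 n" "\<And>i. i \<in> {1..<n} \<Longrightarrow> P (uvec i - uvec n)"
    and "P 0" "\<And>x y. x \<in> sum0 n \<Longrightarrow> y \<in> sum0 n \<Longrightarrow> P x \<Longrightarrow> P y \<Longrightarrow> P (x + y)"
    and "\<And>r x. x \<in> sum0 n \<Longrightarrow> P x \<Longrightarrow> P (sc r x)"
  shows "P x"
proof -
  have u: "uvec i - uvec n \<in> sum0 n" if "i \<in> {1..<n}" for i using that by (intro uvec_diff_sum0) auto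
  have "P (\<Sum>i\<in>A. sc (x i) (uvec i - uvec n)) \<and> (\<Sum>i\<in>A. sc (x i) (uvec i - uvec n)) \<in> sum0 n"
    if "finite A" "A \<subseteq> {1..<n}" for A
    using that
  proof (induction A rule: finite_induct)
    case empty
    then show ?case using assms(3) by (simp only: sum.empty sum0_zero simp_thms)
  next
    case (insert i A)
    then have i: "i \<in> {1..<n}" and A: "P (\<Sum>i\<in>A. sc (x i) (uvec i - uvec n))" "(\<Sum>i\<in>A. sc (x i) (uvec i - uvec n)) \<in> sum0 n"
      by blast+
    have z: "sc (x i) (uvec i - uvec n) \<in> sum0 n" by (intro sum0_sc u i)
    show ?case
      unfolding sum.insert[OF insert.hyps]
      by (intro conjI assms(4) sum0_add z A assms(5) u i assms(2))
  qed
  from this[of "{1..<n}"] show ?thesis using sum0_expand[OF assms(1)] by simp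
qed

section \<open>The isomorphism from the Specht lattice to alternating matrices\<close>

context
  fixes n :: nat
begin

abbreviation (input) "NS \<equiv> natural_specht (CR :: 'r::comm_ring_1 ring) n"
abbreviation (input) "HS \<equiv> hook_specht (CR :: 'r::comm_ring_1 ring) n"

lemma module_hook: "module CR (HS :: ('r::comm_ring_1, _, _) gmodule)"
  unfolding hook_specht_def by (rule module_ext_square[OF module_natural_specht])

text \<open>The universal property gives \<open>\<eta>\<close>, but injectivity of a map out of an
  iterated quotient is not visible. It comes from an explicit inverse \<open>s\<close>: that
  \<open>s\<close> after \<open>\<eta>\<close> is the identity is checked on wedges, which generate,
  and the other composition is the expansion by triangles. The ring is arbitrary, as
  \<open>padic2\<close> and its fraction field are both needed.\<close>

lemma hook_alt_mod:
  obtains \<eta> where "linear_map HS (alt_mod n) \<eta>" "bij_betw \<eta> (carrier HS) (alt n)"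
    "\<And>\<sigma> x. \<sigma> permutes {1..n} \<Longrightarrow> x \<in> carrier HS \<Longrightarrow> \<eta> (act HS \<sigma> x) = pact \<sigma> (\<eta> x :: 'r::comm_ring_1 mat)"
    "\<And>\<sigma> x. \<sigma> permutes {1..n} \<Longrightarrow> x \<in> carrier HS \<Longrightarrow> act HS \<sigma> x \<in> carrier (HS :: ('r, _, _) gmodule)"
proof -
  let ?H = "HS :: ('r, _, _) gmodule"
  let ?N = "NS :: ('r, _, _) gmodule"
  let ?w = "ext_wedge ?N"
  note N = module_natural_specht[of n, where ?'a = 'r]
  note H = module_hook
  interpret H: abelian_group ?H by (rule CR_module(1)[OF H])
  obtain \<eta> where lin: "linear_map ?H (alt_mod n) \<eta>"
    and w: "\<And>x y. x \<in> sum0 n \<Longrightarrow> y \<in> sum0 n \<Longrightarrow> \<eta> (?w x y) = wedge x y"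
    by (rule ext_lift[OF N module_alt_mod wedge_bilinear_map_natural]) (simp_all add: wedge_self hook_specht_def)
  note b = bilinear_mapD[OF ext_wedge_bilinear[OF N], folded hook_specht_def, simplified]
  have bz: "?w 0 y = \<zero>\<^bsub>?H\<^esub>" "?w y 0 = \<zero>\<^bsub>?H\<^esub>" if "y \<in> sum0 n" for y
    using trans[OF b(4)[OF sum0_zero that, of 0] CR_module(7)[OF H b(1)[OF sum0_zero that]]]
      trans[OF b(5)[OF that sum0_zero, of 0] CR_module(7)[OF H b(1)[OF that sum0_zero]]]
    unfolding sc_0_right by blast+
  have self: "?w x x = \<zero>\<^bsub>?H\<^esub>" if "x \<in> sum0 n" for x
    using ext_wedge_self[OF N] that by (simp add: hook_specht_def)
  \<comment> \<open>Only the vanishing of squares is built into the exterior square; antisymmetry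
    results from the square of \<open>x + y\<close>.\<close>
  have swap: "?w y x = (- 1) \<odot>\<^bsub>?H\<^esub> ?w x y" if xy: "x \<in> sum0 n" "y \<in> sum0 n" for x y
  proof -
    have "\<zero>\<^bsub>?H\<^esub> = ?w (x + y) (x + y)" using self[OF sum0_add[OF xy]] by simp
    also have "\<dots> = (?w x x \<oplus>\<^bsub>?H\<^esub> ?w x y) \<oplus>\<^bsub>?H\<^esub> (?w y x \<oplus>\<^bsub>?H\<^esub> ?w y y)"
      unfolding b(2)[OF xy(1) sum0_add[OF xy] xy(2)] b(3)[OF xy(1) xy] b(3)[OF xy(2) xy] ..
    also have "\<dots> = ?w x y \<oplus>\<^bsub>?H\<^esub> ?w y x"
      using xy by (simp add: b(1) self)
    finally have "?w y x = \<ominus>\<^bsub>?H\<^esub> ?w x y"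
      using b(1) xy by (metis H.minus_equality H.a_comm)
    then show ?thesis by (rule trans[OF _ CR_module(9)[OF H b(1)[OF xy], symmetric]])
  qed
  define u where "u i = (uvec i - uvec n :: nat \<Rightarrow> 'r)" for i
  have u: "u i \<in> sum0 n" if "i \<in> {1..<n}" for i
    unfolding u_def using that by (intro uvec_diff_sum0) auto
  \<comment> \<open>The inverse of \<open>\<eta>\<close>: the entry of \<open>A\<close> at
    \<open>(k, l)\<close> becomes the coefficient of the wedge of \<open>u k\<close> and
    \<open>u l\<close>, whose matrix is \<open>tri k l n\<close>.\<close>
  define s where "s A = (\<Oplus>\<^bsub>?H\<^esub>p\<in>ind_less n. A p \<odot>\<^bsub>?H\<^esub> ?w (u (fst p)) (u (snd p)))" for A
  have uc: "?w (u (fst p)) (u (snd p)) \<in> carrier ?H" if "p \<in> ind_less n" for p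
    using that by (intro b(1) u) (auto simp: ind_less_def)
  have s_lin: "linear_map (alt_mod n) ?H s"
  proof (rule linear_mapI)
    fix A :: "'r mat"
    show "s A \<in> carrier ?H"
      unfolding s_def using uc CR_module(2)[OF H] by (intro H.finsum_closed) auto
    have c: "(\<lambda>p. a p \<odot>\<^bsub>?H\<^esub> ?w (u (fst p)) (u (snd p))) \<in> ind_less n \<rightarrow> carrier ?H" for a
      using uc CR_module(2)[OF H] by blast
    show "s (r \<odot>\<^bsub>alt_mod n\<^esub> A) = r \<odot>\<^bsub>?H\<^esub> s A" for r
    proof -
      have "s (r \<odot>\<^bsub>alt_mod n\<^esub> A) = (\<Oplus>\<^bsub>?H\<^esub>p\<in>ind_less n. r \<odot>\<^bsub>?H\<^esub> (A p \<odot>\<^bsub>?H\<^esub> ?w (u (fst p)) (u (snd p))))"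
        unfolding s_def
      proof (rule H.finsum_cong'[OF refl])
        show "(\<lambda>p. r \<odot>\<^bsub>?H\<^esub> (A p \<odot>\<^bsub>?H\<^esub> ?w (u (fst p)) (u (snd p)))) \<in> ind_less n \<rightarrow> carrier ?H"
          using uc CR_module(2)[OF H] by blast
        show "(r \<odot>\<^bsub>alt_mod n\<^esub> A) p \<odot>\<^bsub>?H\<^esub> ?w (u (fst p)) (u (snd p))
            = r \<odot>\<^bsub>?H\<^esub> (A p \<odot>\<^bsub>?H\<^esub> ?w (u (fst p)) (u (snd p)))" if "p \<in> ind_less n" for p
          unfolding alt_mod_simps sc_apply by (rule CR_module(5)[OF H uc[OF that]])
      qed
      also have "\<dots> = r \<odot>\<^bsub>?H\<^esub> s A"
        unfolding s_def by (rule module.finsum_smult_ldistr[OF H finite_ind_less carrier_class c, symmetric])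
      finally show ?thesis .
    qed
    fix B :: "'r mat"
    show "s (A \<oplus>\<^bsub>alt_mod n\<^esub> B) = s A \<oplus>\<^bsub>?H\<^esub> s B"
    proof -
      have "s (A \<oplus>\<^bsub>alt_mod n\<^esub> B) = (\<Oplus>\<^bsub>?H\<^esub>p\<in>ind_less n.
          A p \<odot>\<^bsub>?H\<^esub> ?w (u (fst p)) (u (snd p)) \<oplus>\<^bsub>?H\<^esub> B p \<odot>\<^bsub>?H\<^esub> ?w (u (fst p)) (u (snd p)))"
        unfolding s_def
      proof (rule H.finsum_cong'[OF refl])
        show "(\<lambda>p. A p \<odot>\<^bsub>?H\<^esub> ?w (u (fst p)) (u (snd p)) \<oplus>\<^bsub>?H\<^esub> B p \<odot>\<^bsub>?H\<^esub> ?w (u (fst p)) (u (snd p)))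
            \<in> ind_less n \<rightarrow> carrier ?H"
          using uc CR_module(2)[OF H] by blast
        show "(A \<oplus>\<^bsub>alt_mod n\<^esub> B) p \<odot>\<^bsub>?H\<^esub> ?w (u (fst p)) (u (snd p))
            = A p \<odot>\<^bsub>?H\<^esub> ?w (u (fst p)) (u (snd p)) \<oplus>\<^bsub>?H\<^esub> B p \<odot>\<^bsub>?H\<^esub> ?w (u (fst p)) (u (snd p))"
          if "p \<in> ind_less n" for p
          unfolding alt_mod_simps plus_fun_apply by (rule CR_module(4)[OF H uc[OF that]])
      qed
      also have "\<dots> = s A \<oplus>\<^bsub>?H\<^esub> s B"
        unfolding s_def by (rule H.finsum_addf[OF c c])
      finally show ?thesis .
    qed
  qed
  note sl = linear_mapD[OF s_lin, simplified]
  have s_u: "s (wedge (u i) (u j)) = ?w (u i) (u j)" if ij: "i \<in> {1..<n}" "j \<in> {1..<n}" for i j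
  proof -
    have less: "s (wedge (u i) (u j)) = ?w (u i) (u j)" if ij: "1 \<le> i" "i < j" "j < n" for i j
    proof -
      have wp: "wedge (u i) (u j) p = (if p = (i, j) then 1 else 0)" if "p \<in> ind_less n" for p
        using that ij by (auto simp: ind_less_def wedge_def u_def uvec_def split: if_splits)
      have "s (wedge (u i) (u j)) = (\<Oplus>\<^bsub>?H\<^esub>p\<in>ind_less n. if (i, j) = p then ?w (u (fst p)) (u (snd p)) else \<zero>\<^bsub>?H\<^esub>)"
        unfolding s_def
      proof (rule H.finsum_cong'[OF refl], rule Pi_I)
        fix p assume p: "p \<in> ind_less n"
        show "(if (i, j) = p then ?w (u (fst p)) (u (snd p)) else \<zero>\<^bsub>?H\<^esub>) \<in> carrier ?H"
          using uc[OF p] by (cases "(i, j) = p") simp_all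
        show "wedge (u i) (u j) p \<odot>\<^bsub>?H\<^esub> ?w (u (fst p)) (u (snd p))
            = (if (i, j) = p then ?w (u (fst p)) (u (snd p)) else \<zero>\<^bsub>?H\<^esub>)"
        proof (cases "(i, j) = p")
          case True
          then have "wedge (u i) (u j) p = 1" using wp[OF p] by simp
          then show ?thesis unfolding if_P[OF True] by (simp only: CR_module(6)[OF H uc[OF p]])
        next
          case False
          then have "wedge (u i) (u j) p = 0" using wp[OF p] by auto
          then show ?thesis unfolding if_not_P[OF False] by (simp only: CR_module(7)[OF H uc[OF p]])
        qed
      qed
      also have "\<dots> = ?w (u i) (u j)"
      proof -
        have "(i, j) \<in> ind_less n" using ij by (simp add: ind_less_def)
        moreover have "(\<lambda>p. ?w (u (fst p)) (u (snd p))) \<in> ind_less n \<rightarrow> carrier ?H"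
          by (rule Pi_I) (rule uc)
        ultimately show ?thesis
          using H.add.finprod_singleton[OF _ finite_ind_less, of "(i, j)" n "\<lambda>p. ?w (u (fst p)) (u (snd p))"]
          by simp
      qed
      finally show ?thesis .
    qed
    consider "i < j" | "i = j" | "j < i" by linarith
    then show ?thesis
    proof cases
      case 1
      then show ?thesis using less ij by simp
    next
      case 2
      have "s 0 = \<zero>\<^bsub>?H\<^esub>"
        using linear_map_zero[OF module_alt_mod H s_lin] by simp
      then show ?thesis using 2 self[OF u[OF ij(1)]] by (simp add: wedge_self)
    next
      case 3
      have "wedge (u i) (u j) = sc (- 1) (wedge (u j) (u i))"
        unfolding sc_minus_1 by (rule wedge_swap)
      then show ?thesis
        using less[of j i] 3 ij swap[OF u[OF ij(2)] u[OF ij(1)]] sl(3)[OF wedge_alt[OF u[OF ij(2)] u[OF ij(1)]], of "- 1"] by simp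
    qed
  qed
  have s0: "s 0 = \<zero>\<^bsub>?H\<^esub>"
    using linear_map_zero[OF module_alt_mod H s_lin] by simp
  \<comment> \<open>Bilinearity reduces the claim to pairs of generators, by one induction for each
    argument.\<close>
  have s_w: "s (wedge x y) = ?w x y" if x: "x \<in> sum0 n" and y: "y \<in> sum0 n" for x y
    using x
  proof (induction x rule: sum0_induct)
    case (unit i)
    show ?case
      using y
    proof (induction y rule: sum0_induct)
      case (unit j)
      show ?case unfolding u_def[symmetric] by (rule s_u[OF \<open>i \<in> {1..<n}\<close> \<open>j \<in> {1..<n}\<close>])
    next
      case zero
      show ?case
        using bz(2)[OF u[OF \<open>i \<in> {1..<n}\<close>]] s0 unfolding u_def[symmetric] wedge_bilinear by (simp only:)
    next
      case (add x y)
      note U = u[OF \<open>i \<in> {1..<n}\<close>]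
      show ?case
        using add unfolding u_def[symmetric] wedge_bilinear(2) b(3)[OF U add(1,2)]
          sl(2)[OF wedge_alt[OF U add(1)] wedge_alt[OF U add(2)]] by (simp only:)
    next
      case (sc r x)
      note U = u[OF \<open>i \<in> {1..<n}\<close>]
      show ?case
        using sc unfolding u_def[symmetric] wedge_bilinear(8) b(5)[OF U sc(1)] sl(3)[OF wedge_alt[OF U sc(1)]] by (simp only:)
    qed
  next
    case zero
    show ?case using bz(1)[OF y] s0 unfolding wedge_bilinear by (simp only:)
  next
    case (add x x')
    then show ?case
      unfolding wedge_bilinear(1) b(2)[OF add(1) y add(2)]
        sl(2)[OF wedge_alt[OF add(1) y] wedge_alt[OF add(2) y]] by (simp only:)
  next
    case (sc r x)
    then show ?case
      unfolding wedge_bilinear(7) b(4)[OF sc(1) y] sl(3)[OF wedge_alt[OF sc(1) y]] by (simp only:)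
  qed
  have s_eta: "s (\<eta> t) = t" if "t \<in> carrier ?H" for t
    using that[unfolded hook_specht_def]
  proof (rule ext_induct[OF N], fold hook_specht_def)
    show "s (\<eta> (?w x y)) = ?w x y" if "x \<in> carrier ?N" "y \<in> carrier ?N" for x y
      using that by (simp only: natural_specht_simps w s_w)
    fix a assume a: "a \<in> carrier ?H" "s (\<eta> a) = a"
    show "s (\<eta> (r \<odot>\<^bsub>?H\<^esub> a)) = r \<odot>\<^bsub>?H\<^esub> a" for r
      unfolding linear_mapD(3)[OF lin a(1)] linear_mapD(3)[OF s_lin linear_mapD(1)[OF lin a(1)]] a(2) ..
    fix b assume b: "b \<in> carrier ?H" "s (\<eta> b) = b"
    show "s (\<eta> (a \<oplus>\<^bsub>?H\<^esub> b)) = a \<oplus>\<^bsub>?H\<^esub> b"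
      unfolding linear_mapD(2)[OF lin a(1) b(1)]
        linear_mapD(2)[OF s_lin linear_mapD(1)[OF lin a(1)] linear_mapD(1)[OF lin b(1)]] a(2) b(2) ..
  qed
  have eta_s: "\<eta> (s A) = A" if A: "A \<in> alt n" for A
  proof -
    have "\<eta> (\<Oplus>\<^bsub>?H\<^esub>p\<in>F. A p \<odot>\<^bsub>?H\<^esub> ?w (u (fst p)) (u (snd p))) = (\<Sum>p\<in>F. sc (A p) (tri (fst p) (snd p) n))"
      if "finite F" "F \<subseteq> ind_less n" for F
      using that
    proof (induction F rule: finite_induct)
      case empty
      then show ?case using linear_map_zero[OF H module_alt_mod lin] by (simp only: H.finsum_empty alt_mod_simps sum.empty)
    next
      case (insert p F)
      then have p: "p \<in> ind_less n" "F \<subseteq> ind_less n" by auto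
      have c: "(\<lambda>p. A p \<odot>\<^bsub>?H\<^esub> ?w (u (fst p)) (u (snd p))) \<in> F \<rightarrow> carrier ?H"
        "A p \<odot>\<^bsub>?H\<^esub> ?w (u (fst p)) (u (snd p)) \<in> carrier ?H"
        using uc p CR_module(2)[OF H] by blast+
      have wp: "\<eta> (?w (u (fst p)) (u (snd p))) = tri (fst p) (snd p) n"
        using p by (subst w[OF u u]) (auto simp: ind_less_def tri_def u_def)
      show ?case
        unfolding H.finsum_insert[OF insert.hyps c] sum.insert[OF insert.hyps]
          linear_mapD(2)[OF lin c(2) H.finsum_closed[OF c(1)]] linear_mapD(3)[OF lin uc[OF p(1)]]
          insert.IH[OF p(2)] wp alt_mod_simps ..
    qed
    from this[OF finite_ind_less order.refl] show ?thesis
      using alt_expand[OF A] unfolding s_def by (simp add: case_prod_unfold)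
  qed
  have bij: "bij_betw \<eta> (carrier ?H) (alt n)"
    using s_eta eta_s linear_mapD(1)[OF lin] linear_mapD(1)[OF s_lin]
    by (intro bij_betw_byWitness[where f' = s]) auto
  have actl: "linear_map ?N ?N (act ?N \<sigma>)" if "\<sigma> permutes {1..n}" for \<sigma>
    by (rule linear_mapI) (simp_all add: vact_sum0[OF that] vact_linear)
  have eqv: "\<eta> (act ?H \<sigma> t) = pact \<sigma> (\<eta> t) \<and> act ?H \<sigma> t \<in> carrier ?H"
    if p: "\<sigma> permutes {1..n}" and t: "t \<in> carrier ?H" for \<sigma> t
  proof -
    note a = ext_act[OF N actl[OF p], folded hook_specht_def]
    have "\<eta> (act ?H \<sigma> t) = pact \<sigma> (\<eta> t)"
      using t unfolding hook_specht_def
    proof (rule ext_induct[OF N], fold hook_specht_def)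
      fix x y assume "x \<in> carrier ?N" "y \<in> carrier ?N"
      then show "\<eta> (act ?H \<sigma> (?w x y)) = pact \<sigma> (\<eta> (?w x y))"
        by (simp add: a(2) w vact_sum0[OF p] pact_wedge)
    qed (simp_all add: linear_mapD[OF a(1)] linear_mapD[OF lin] pact_def fun_eq_iff)
    then show ?thesis using linear_mapD(1)[OF a(1) t] by simp
  qed
  show ?thesis by (rule that[OF lin bij]) (simp_all only: eqv)
qed

end

section \<open>Forms\<close>

text \<open>The structure theorem for submodules of a free module over a discrete valuation ring, by
  induction over the coordinates: an element whose value at the new coordinate has least valuation
  splits off, and the elements vanishing there fall under the induction hypothesis.\<close>

lemma submodule_basis:
  fixes N :: "('x \<Rightarrow> padic2) set"
  assumes "finite X" "\<And>f x. f \<in> N \<Longrightarrow> x \<notin> X \<Longrightarrow> f x = 0"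
    and "0 \<in> N" "\<And>f g. f \<in> N \<Longrightarrow> g \<in> N \<Longrightarrow> f + g \<in> N" "\<And>r f. f \<in> N \<Longrightarrow> sc r f \<in> N"
  shows "\<exists>B. finite B \<and> B \<subseteq> N \<and> (\<forall>f\<in>N. \<exists>c. f = (\<Sum>b\<in>B. sc (c b) b)) \<and>
    (\<forall>c. (\<Sum>b\<in>B. sc (c b) b) = 0 \<longrightarrow> (\<forall>b\<in>B. c b = 0))"
  using assms
proof (induction X arbitrary: N rule: finite_induct)
  case empty
  have "f = 0" if "f \<in> N" for f using empty.prems(1)[OF that] by (simp add: fun_eq_iff)
  then show ?case
    by (intro exI[of _ "{}"], unfold sum.empty) blast
next
  case (insert x X)
  note N = insert.prems
  let ?N = "{f \<in> N. f x = 0}"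
  have "\<exists>B. finite B \<and> B \<subseteq> ?N \<and> (\<forall>f\<in>?N. \<exists>c. f = (\<Sum>b\<in>B. sc (c b) b)) \<and>
    (\<forall>c. (\<Sum>b\<in>B. sc (c b) b) = 0 \<longrightarrow> (\<forall>b\<in>B. c b = 0))"
  proof (rule insert.IH)
    show "f y = 0" if "f \<in> ?N" "y \<notin> X" for f y
      using that N(1)[of f y] by (cases "y = x") auto
  qed (use N in auto)
  then obtain B where B: "finite B" "B \<subseteq> ?N" "\<And>f. f \<in> ?N \<Longrightarrow> \<exists>c. f = (\<Sum>b\<in>B. sc (c b) b)"
    "\<And>c. (\<Sum>b\<in>B. sc (c b) b) = 0 \<Longrightarrow> (\<forall>b\<in>B. c b = 0)" by blast
  show ?case
  proof (cases "N \<subseteq> ?N")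
    case True
    then show ?thesis using B by (intro exI[of _ B]) blast
  next
    case False
    \<comment> \<open>\<open>Q k\<close> means that the valuation \<open>k\<close> occurs at the
      coordinate \<open>x\<close>. All values there are multiples of one with least
      valuation.\<close>
    define Q where "Q k \<longleftrightarrow> (\<exists>f\<in>N. \<exists>u. f x = 2 ^ k * u \<and> parity u = 1)" for k
    obtain f1 where "f1 \<in> N" "f1 x \<noteq> 0" using False by blast
    moreover obtain k1 u1 where "f1 x = 2 ^ k1 * u1" "parity u1 = 1" using padic2_factor[OF \<open>f1 x \<noteq> 0\<close>] .
    ultimately have "Q k1" unfolding Q_def by blast
    then have "Q (LEAST k. Q k)" by (rule LeastI)
    then obtain f0 u0 where f0: "f0 \<in> N" "f0 x = 2 ^ (LEAST k. Q k) * u0" "parity u0 = 1" unfolding Q_def by blast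
    obtain v0 where v0: "u0 * v0 = 1" using parity_1_unit[OF f0(3)] .
    have f0x: "f0 x \<noteq> 0" using f0(2) two_neq_0 v0 by auto
    have mult: "\<exists>c. f x = c * f0 x" if f: "f \<in> N" for f
    proof (cases "f x = 0")
      case True
      then show ?thesis by (intro exI[of _ 0]) simp
    next
      case False
      then obtain k u where k: "f x = 2 ^ k * u" "parity u = 1" by (rule padic2_factor)
      then have "Q k" unfolding Q_def using f by blast
      then have "(LEAST k. Q k) \<le> k" by (rule Least_le)
      then have "(2::padic2) ^ k = 2 ^ (k - (LEAST k. Q k)) * 2 ^ (LEAST k. Q k)" by (simp flip: power_add)
      then have "f x = (2 ^ (k - (LEAST k. Q k)) * u * v0) * f0 x"
        using k(1) f0(2) v0 by (simp add: mult.assoc mult.left_commute mult.commute)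
      then show ?thesis by blast
    qed
    have f0B: "f0 \<notin> B" using B(2) f0x by blast
    show ?thesis
    proof (intro exI[of _ "insert f0 B"] conjI ballI allI impI)
      show "finite (insert f0 B)" "insert f0 B \<subseteq> N" using B f0 by auto
    next
      fix f assume f: "f \<in> N"
      obtain c where c: "f x = c * f0 x" using mult[OF f] by blast
      have "f + sc (- c) f0 \<in> N" by (rule N(3)[OF f N(4)[OF f0(1)]])
      moreover have "(f + sc (- c) f0) x = 0" using c by simp
      ultimately have "f + sc (- c) f0 \<in> ?N" by blast
      then obtain d where d: "f + sc (- c) f0 = (\<Sum>b\<in>B. sc (d b) b)" using B(3) by blast
      have "f = sc c f0 + (f + sc (- c) f0)" by (simp add: fun_eq_iff)
      also have "\<dots> = sc c f0 + (\<Sum>b\<in>B. sc (d b) b)" by (simp only: d)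
      also have "(\<Sum>b\<in>B. sc (d b) b) = (\<Sum>b\<in>B. sc ((d(f0 := c)) b) b)"
        using f0B by (intro sum.cong) auto
      finally have "f = (\<Sum>b\<in>insert f0 B. sc ((d(f0 := c)) b) b)"
        unfolding sum.insert[OF B(1) f0B] by (simp only: fun_upd_same)
      then show "\<exists>c. f = (\<Sum>b\<in>insert f0 B. sc (c b) b)" by blast
    next
      fix c b assume z: "(\<Sum>b\<in>insert f0 B. sc (c b) b) = 0" and b: "b \<in> insert f0 B"
      have e: "sc (c f0) f0 + (\<Sum>b\<in>B. sc (c b) b) = 0"
        using z unfolding sum.insert[OF B(1) f0B] .
      have "(\<Sum>b\<in>B. sc (c b) b) x = 0"
        unfolding sum_fun_apply using B(2) by (intro sum.neutral) auto
      then have "c f0 * f0 x = 0" using fun_cong[OF e, of x] by simp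
      then have c0: "c f0 = 0" using f0x by simp
      then have "(\<Sum>b\<in>B. sc (c b) b) = 0" using e by (simp only: sc_0_left add_0)
      then show "c b = 0" using B(4) c0 b by blast
    qed
  qed
qed

lemma minus_zero_imp_eq:
  assumes "abelian_group M" "x \<in> carrier M" "y \<in> carrier M" "x \<ominus>\<^bsub>M\<^esub> y = \<zero>\<^bsub>M\<^esub>"
  shows "x = y"
proof -
  interpret M: abelian_group M by fact
  have "x = (x \<ominus>\<^bsub>M\<^esub> y) \<oplus>\<^bsub>M\<^esub> y" using assms(2,3) by (simp add: M.minus_eq M.a_assoc M.l_neg)
  then show ?thesis using assms(3,4) by simp
qed

text \<open>The coordinate of a basis element that occurs in \<open>m\<close>. Extended to the
  tensor product with the 2-adic numbers it shows that \<open>1 \<otimes> m\<close> is not zero, so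
  that a form embeds into its extension of scalars.\<close>

lemma free_coordinate:
  assumes M: "module CR M" and free: "is_free CR M" and m: "m \<in> carrier M" "m \<noteq> \<zero>\<^bsub>M\<^esub>"
  obtains l :: "'m \<Rightarrow> 'r::comm_ring_1" where
    "\<And>x y. x \<in> carrier M \<Longrightarrow> y \<in> carrier M \<Longrightarrow> l (x \<oplus>\<^bsub>M\<^esub> y) = l x + l y"
    "\<And>r x. x \<in> carrier M \<Longrightarrow> l (r \<odot>\<^bsub>M\<^esub> x) = r * l x" "l m \<noteq> 0"
proof -
  obtain B where B: "B \<subseteq> carrier M" "lin_indep CR M B" "module_span CR M B = carrier M"
    using free unfolding is_free_def by blast
  let ?F = "free_module (CR :: 'r ring) B"
  let ?L = "lin_ext CR M (\<lambda>b. b)"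
  have F: "module CR ?F" by (rule module_free)
  have L: "linear_map ?F M ?L" using B(1) by (intro lin_ext_linear[OF M]) auto
  note Ll = linear_mapD[OF L]
  interpret F: abelian_group ?F by (rule CR_module(1)[OF F])
  interpret M: abelian_group M by (rule CR_module(1)[OF M])
  have ker: "f = \<zero>\<^bsub>?F\<^esub>" if f: "f \<in> carrier ?F" "?L f = \<zero>\<^bsub>M\<^esub>" for f
  proof -
    have "f b = 0" for b
    proof (rule ccontr)
      assume "f b \<noteq> 0"
      then show False
        using B(2)[unfolded lin_indep_def, rule_format, of "{x. f x \<noteq> 0}" f b] f
        by (simp add: lin_ext_def zero_class Pi_def carrier_class)
    qed
    then show ?thesis by (simp add: fun_eq_iff)
  qed
  have inj: "inj_on ?L (carrier ?F)"
  proof (rule inj_onI)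
    fix f g assume fg: "f \<in> carrier ?F" "g \<in> carrier ?F" "?L f = ?L g"
    have "?L (f \<ominus>\<^bsub>?F\<^esub> g) = \<zero>\<^bsub>M\<^esub>"
      using linear_map_minus[OF F M L fg(1,2)] fg(3) Ll(1)[OF fg(2)] by (simp only: M.minus_eq M.r_neg)
    then have "f \<ominus>\<^bsub>?F\<^esub> g = \<zero>\<^bsub>?F\<^esub>" using ker F.minus_closed[OF fg(1,2)] by blast
    then show "f = g" using fg(1,2) minus_zero_imp_eq[OF CR_module(1)[OF F]] by blast
  qed
  have surj: "?L ` carrier ?F = carrier M"
  proof
    show "?L ` carrier ?F \<subseteq> carrier M" using Ll(1) by blast
    have "submodule (?L ` carrier ?F) CR M"
    proof (rule CR_submoduleI[OF M])
      show "\<zero>\<^bsub>M\<^esub> \<in> ?L ` carrier ?F"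
        using linear_map_zero[OF F M L] F.zero_closed by (metis image_eqI)
      show "x \<oplus>\<^bsub>M\<^esub> y \<in> ?L ` carrier ?F" if "x \<in> ?L ` carrier ?F" "y \<in> ?L ` carrier ?F" for x y
        using that Ll(2) F.a_closed by (elim imageE) (metis image_eqI)
      show "r \<odot>\<^bsub>M\<^esub> x \<in> ?L ` carrier ?F" if "x \<in> ?L ` carrier ?F" for r x
        using that Ll(3) CR_module(2)[OF F] by (elim imageE) (metis image_eqI)
    qed (use Ll(1) in blast)
    moreover have "B \<subseteq> ?L ` carrier ?F"
    proof
      fix b assume b: "b \<in> B"
      have "?L (basis_vec CR b) = b" using b B(1) by (intro lin_ext_basis_vec[OF M]) blast
      then show "b \<in> ?L ` carrier ?F" using basis_vec_carrier[OF b] by (metis image_eqI)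
    qed
    ultimately show "carrier M \<subseteq> ?L ` carrier ?F" using module_span_least B(3) by metis
  qed
  define co where "co = inv_into (carrier ?F) ?L"
  have co: "co x \<in> carrier ?F" "?L (co x) = x" if "x \<in> carrier M" for x
    unfolding co_def using that surj by (metis inv_into_into, metis f_inv_into_f)
  have coL: "co (?L f) = f" if "f \<in> carrier ?F" for f
    unfolding co_def using inv_into_f_f[OF inj that] .
  have co_add: "co (x \<oplus>\<^bsub>M\<^esub> y) = co x \<oplus>\<^bsub>?F\<^esub> co y" if "x \<in> carrier M" "y \<in> carrier M" for x y
    using coL[OF F.a_closed[OF co(1)[OF that(1)] co(1)[OF that(2)]]]
    unfolding Ll(2)[OF co(1)[OF that(1)] co(1)[OF that(2)]] co(2)[OF that(1)] co(2)[OF that(2)] .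
  have co_sc: "co (r \<odot>\<^bsub>M\<^esub> x) = r \<odot>\<^bsub>?F\<^esub> co x" if "x \<in> carrier M" for r x
    using coL[OF CR_module(2)[OF F co(1)[OF that]], of r]
    unfolding Ll(3)[OF co(1)[OF that]] co(2)[OF that] .
  have "co m \<noteq> \<zero>\<^bsub>?F\<^esub>" using co(2)[OF m(1)] m(2) linear_map_zero[OF F M L] by metis
  then obtain b where b: "co m b \<noteq> 0" by (auto simp: fun_eq_iff)
  show ?thesis
    by (rule that[of "\<lambda>x. co x b"]) (simp_all add: co_add co_sc b)
qed

lemma giso_intro:
  assumes "linear_map M N f" "bij_betw f (carrier M) (carrier N)"
    "\<And>g x. g \<in> carrier G \<Longrightarrow> x \<in> carrier M \<Longrightarrow> f (act M g x) = act N g (f x)"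
  shows "gmodule_isomorphic CR G M N"
  unfolding gmodule_isomorphic_def using assms by (intro exI[of _ f]) (simp add: linear_map_def)

lemma giso_elim:
  assumes "gmodule_isomorphic CR G M N"
  obtains f where "linear_map M N f" "bij_betw f (carrier M) (carrier N)"
    "\<And>g x. g \<in> carrier G \<Longrightarrow> x \<in> carrier M \<Longrightarrow> f (act M g x) = act N g (f x)"
proof -
  obtain f where f: "bij_betw f (carrier M) (carrier N)"
      "\<forall>x\<in>carrier M. \<forall>y\<in>carrier M. f (x \<oplus>\<^bsub>M\<^esub> y) = f x \<oplus>\<^bsub>N\<^esub> f y"
      "\<forall>r\<in>carrier CR. \<forall>x\<in>carrier M. f (r \<odot>\<^bsub>M\<^esub> x) = r \<odot>\<^bsub>N\<^esub> f x"
      "\<forall>g\<in>carrier G. \<forall>x\<in>carrier M. f (act M g x) = act N g (f x)"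
    using assms unfolding gmodule_isomorphic_def by blast
  have "linear_map M N f"
    using f bij_betwE[OF f(1)] carrier_class by (intro linear_mapI) blast+
  then show ?thesis using f that by blast
qed

lemma linear_map_inverse:
  assumes M: "module CR M" and f: "linear_map M N f" "bij_betw f (carrier M) (carrier N)"
  shows "linear_map N M (inv_into (carrier M) f)"
proof (rule linear_mapI)
  interpret M: abelian_group M by (rule CR_module(1)[OF M])
  let ?g = "inv_into (carrier M) f"
  have g: "?g x \<in> carrier M" "f (?g x) = x" if "x \<in> carrier N" for x
    using that f(2) by (metis bij_betw_def inv_into_into, metis bij_betw_inv_into_right)
  have gf: "?g (f x) = x" if "x \<in> carrier M" for x
    using that f(2) by (rule bij_betw_inv_into_left[rotated])
  note fl = linear_mapD[OF f(1)]
  fix x assume x: "x \<in> carrier N"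
  show "?g x \<in> carrier M" using g x by blast
  show "?g (r \<odot>\<^bsub>N\<^esub> x) = r \<odot>\<^bsub>M\<^esub> ?g x" for r
    using gf[OF CR_module(2)[OF M g(1)[OF x]], of r] fl(3)[OF g(1)[OF x], of r] g(2)[OF x] by simp
  fix y assume y: "y \<in> carrier N"
  show "?g (x \<oplus>\<^bsub>N\<^esub> y) = ?g x \<oplus>\<^bsub>M\<^esub> ?g y"
    using gf[OF M.a_closed[OF g(1)[OF x] g(1)[OF y]]] fl(2)[OF g(1)[OF x] g(1)[OF y]] g(2)[OF x] g(2)[OF y] by simp
qed

lemma inverse_equivariant:
  assumes f: "bij_betw f (carrier M) (carrier N)" and g: "x \<in> carrier N"
    and cl: "\<And>y. y \<in> carrier M \<Longrightarrow> act M g y \<in> carrier M"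
    and eq: "\<And>y. y \<in> carrier M \<Longrightarrow> f (act M g y) = act N g (f y)"
  shows "inv_into (carrier M) f (act N g x) = act M g (inv_into (carrier M) f x)"
proof -
  let ?g = "inv_into (carrier M) f"
  have gx: "?g x \<in> carrier M" "f (?g x) = x"
    using g f by (metis bij_betw_def inv_into_into, metis bij_betw_inv_into_right)
  show ?thesis
    using bij_betw_inv_into_left[OF f cl[OF gx(1)]] eq[OF gx(1)] gx(2) by simp
qed

section \<open>Extension of scalars to the 2-adic numbers\<close>

abbreviation Q2_module :: "(padic2, padic2 fract) module"
  where "Q2_module \<equiv> ring_as_module Q2 Z2_in_Q2"

lemma Q2_module_simps [simp]:
  "carrier Q2_module = UNIV" "add Q2_module = (+)" "zero Q2_module = 0"
  "smult Q2_module = (\<lambda>r k. Z2_in_Q2 r * k)"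
  by (simp_all add: ring_as_module_def CR_simps fun_eq_iff) (simp add: cring_class_ops_def)

lemma module_Q2: "module CR Q2_module"
proof (rule CR_moduleI)
  show "abelian_group Q2_module"
    by (rule abelian_groupI) (auto simp: add.assoc add.commute intro: exI[of _ "- x" for x])
qed (simp_all add: Z2_in_Q2_simps algebra_simps)

lemma Q2_mult_linear: "linear_map Q2_module Q2_module (\<lambda>k'. k * k')"
  by (rule linear_mapI) (simp_all add: algebra_simps)

lemma Q2_id_linear: "linear_map M M (\<lambda>x. x)"
  by (simp add: linear_map_def)

lemma extend_scalars_simps [simp]:
  "carrier (extend_scalars CR Q2 Z2_in_Q2 M) = carrier (tensor CR Q2_module M)"
  "add (extend_scalars CR Q2 Z2_in_Q2 M) = add (tensor CR Q2_module M)"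
  "smult (extend_scalars CR Q2 Z2_in_Q2 M) = (\<lambda>k. tensor_map CR Q2_module M (\<lambda>k'. k * k') (\<lambda>m. m))"
  "act (extend_scalars CR Q2 Z2_in_Q2 M) = (\<lambda>g. tensor_map CR Q2_module M (\<lambda>k. k) (act M g))"
  by (simp_all add: extend_scalars_def Let_def times_class)

definition incl :: "('x \<Rightarrow> padic2) \<Rightarrow> 'x \<Rightarrow> padic2 fract"
  where "incl A = (\<lambda>p. Z2_in_Q2 (A p))"

lemma incl_simps:
  "incl (A + B) = incl A + incl B" "incl (sc r A) = sc (Z2_in_Q2 r) (incl A)" "incl 0 = 0"
  by (simp_all add: incl_def fun_eq_iff Z2_in_Q2_simps)

lemma incl_pact: "incl (pact \<sigma> A) = pact \<sigma> (incl A)"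
  by (auto simp: incl_def pact_def fun_eq_iff)

lemma incl_inject: "incl A = incl B \<longleftrightarrow> A = B"
  by (simp add: incl_def fun_eq_iff Z2_in_Q2_inject)

lemma incl_alt_iff: "incl A \<in> alt n \<longleftrightarrow> A \<in> alt n"
proof
  have z: "Z2_in_Q2 x = 0 \<longleftrightarrow> x = 0" for x
    using Z2_in_Q2_inject[of x 0] by (simp add: Z2_in_Q2_simps)
  {
    assume A: "A \<in> alt n"
    show "incl A \<in> alt n"
    proof (rule altI)
      show "incl A (i, j) = 0" if "i \<notin> {1..n} \<or> j \<notin> {1..n}" for i j
        using that altD(1,2)[OF A] by (auto simp: incl_def z simp del: atLeastAtMost_iff)
      show "incl A (j, i) = - incl A (i, j)" for i j
        unfolding incl_def altD(3)[OF A, of j i] Z2_in_Q2_simps ..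
      show "incl A (i, i) = 0" for i
        unfolding incl_def altD(4)[OF A] Z2_in_Q2_simps ..
      show "(\<Sum>j = 1..n. incl A (i, j)) = 0" for i
        unfolding incl_def Z2_in_Q2_sum[symmetric] altD(5)[OF A] Z2_in_Q2_simps ..
    qed
  next
    assume A: "incl A \<in> alt n"
    show "A \<in> alt n"
    proof (rule altI)
      show "A (i, j) = 0" if "i \<notin> {1..n} \<or> j \<notin> {1..n}" for i j
        using that altD(1,2)[OF A] by (auto simp: incl_def z simp del: atLeastAtMost_iff)
      show "A (j, i) = - A (i, j)" for i j
        using altD(3)[OF A, of j i] by (simp only: incl_def Z2_in_Q2_simps(3)[symmetric] Z2_in_Q2_inject)
      show "A (i, i) = 0" for i
        using altD(4)[OF A, of i] by (simp only: incl_def z)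
      show "(\<Sum>j = 1..n. A (i, j)) = 0" for i
        using altD(5)[OF A, of i] by (simp only: incl_def z Z2_in_Q2_sum[symmetric])
    qed
  }
qed

lemma clear_denominators:
  fixes X :: "'x \<Rightarrow> padic2 fract"
  assumes "finite S" "\<And>p. p \<notin> S \<Longrightarrow> X p = 0"
  obtains k A where "sc (2 ^ k) X = incl A"
proof -
  have "\<exists>k. \<forall>p\<in>F. \<exists>a. 2 ^ k * X p = Z2_in_Q2 a" if "finite F" for F
    using that
  proof (induction F rule: finite_induct)
    case (insert q F)
    then obtain k where k: "\<forall>p\<in>F. \<exists>a. 2 ^ k * X p = Z2_in_Q2 a" by blast
    obtain l b where l: "2 ^ l * X q = Z2_in_Q2 b" by (rule Q2_clear_denominator)
    have "\<exists>a. 2 ^ (k + l) * X p = Z2_in_Q2 a" if "p \<in> insert q F" for p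
    proof (cases "p = q")
      case True
      have "2 ^ (k + l) * X q = 2 ^ k * (2 ^ l * X q)" by (simp only: power_add mult.assoc)
      also have "\<dots> = Z2_in_Q2 (2 ^ k * b)"
        by (simp only: l Z2_in_Q2_simps Z2_in_Q2_power Z2_in_Q2_2)
      finally have "2 ^ (k + l) * X q = Z2_in_Q2 (2 ^ k * b)" .
      then show ?thesis using True by blast
    next
      case False
      then have "p \<in> F" using that by blast
      then obtain a where a: "2 ^ k * X p = Z2_in_Q2 a" using k by blast
      have "2 ^ (k + l) * X p = 2 ^ l * (2 ^ k * X p)" by (simp only: power_add mult_ac)
      also have "\<dots> = Z2_in_Q2 (2 ^ l * a)"
        by (simp only: a Z2_in_Q2_simps Z2_in_Q2_power Z2_in_Q2_2)
      finally have "2 ^ (k + l) * X p = Z2_in_Q2 (2 ^ l * a)" .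
      then show ?thesis by blast
    qed
    then show ?case by blast
  qed simp
  then obtain k where k: "\<forall>p\<in>S. \<exists>a. 2 ^ k * X p = Z2_in_Q2 a" using assms(1) by blast
  have "\<exists>a. 2 ^ k * X p = Z2_in_Q2 a" for p
    using k assms(2)[of p] by (cases "p \<in> S") (auto intro: exI[of _ 0] simp: Z2_in_Q2_simps)
  then obtain A where "\<And>p. 2 ^ k * X p = Z2_in_Q2 (A p)" by metis
  then have "sc (2 ^ k) X = incl A" by (simp add: fun_eq_iff incl_def)
  then show ?thesis using that by blast
qed

lemma alt_clear_denominators:
  assumes "X \<in> alt n" obtains k A where "A \<in> alt n" "sc (2 ^ k) X = incl A"
proof -
  have "X p = 0" if "p \<notin> {1..n} \<times> {1..n}" for p
    using that altD(1,2)[OF assms] by (metis SigmaI surj_pair)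
  then obtain k A where kA: "sc (2 ^ k) X = incl A"
    using clear_denominators[of "{1..n} \<times> {1..n}" X] by (metis finite_SigmaI finite_atLeastAtMost)
  have "incl A \<in> alt n" unfolding kA[symmetric] by (rule alt_sc[OF assms])
  then show ?thesis using that kA incl_alt_iff by blast
qed

text \<open>Matrices over the 2-adic numbers with scalars restricted to the 2-adic integers, as the
  universal property of the tensor product over the latter requires of its target.\<close>

definition incl_alt_mod :: "nat \<Rightarrow> (padic2, padic2 fract mat) module"
  where "incl_alt_mod n = \<lparr>carrier = alt n, monoid.mult = undefined, one = undefined,
    zero = 0, add = (+), smult = (\<lambda>r. sc (Z2_in_Q2 r))\<rparr>"

lemma incl_alt_mod_simps [simp]:
  "carrier (incl_alt_mod n) = alt n" "zero (incl_alt_mod n) = 0" "add (incl_alt_mod n) = (+)"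
  "smult (incl_alt_mod n) = (\<lambda>r. sc (Z2_in_Q2 r))"
  by (simp_all add: incl_alt_mod_def)

lemma module_incl_alt_mod: "module CR (incl_alt_mod n)"
proof (rule CR_moduleI)
  show "abelian_group (incl_alt_mod n)"
    by (rule abelian_group_cong[OF CR_module(1)[OF module_alt_mod]]) simp_all
qed (simp_all only: incl_alt_mod_simps alt_sc sc_add sc_sc Z2_in_Q2_simps sc_1,
    simp add: fun_eq_iff distrib_right)

section \<open>Modules embedded with an image containing twice all integral matrices\<close>

context
  fixes n :: nat and M :: "(padic2, 'm, nat \<Rightarrow> nat) gmodule" and g
  assumes GM: "group_module CR (sym_group n) M"
    and g: "linear_map M (alt_mod n) g" "inj_on g (carrier M)"
      "\<And>\<sigma> x. \<sigma> \<in> carrier (sym_group n) \<Longrightarrow> x \<in> carrier M \<Longrightarrow> g (act M \<sigma> x) = pact \<sigma> (g x)"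
    and full: "sc 2 ` alt n \<subseteq> g ` carrier M"
begin

lemma embedded_module: "module CR M"
  using GM by (simp add: group_module_def)

text \<open>A basis of the image, provided by \<open>submodule_basis\<close>, is carried back along
  the inverse of \<open>g\<close>.\<close>

lemma embedded_basis: "finitely_generated CR M" "is_free CR M"
proof -
  note M = embedded_module
  interpret M: abelian_group M by (rule CR_module(1)[OF M])
  note gl = linear_mapD[OF g(1), unfolded alt_mod_simps]
  have g0: "g \<zero>\<^bsub>M\<^esub> = 0" using linear_map_zero[OF M module_alt_mod g(1)] by (simp only: alt_mod_simps)
  let ?N = "g ` carrier M"
  have "\<exists>B. finite B \<and> B \<subseteq> ?N \<and> (\<forall>f\<in>?N. \<exists>c. f = (\<Sum>b\<in>B. sc (c b) b)) \<and>
    (\<forall>c. (\<Sum>b\<in>B. sc (c b) b) = 0 \<longrightarrow> (\<forall>b\<in>B. c b = 0))"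
  proof (rule submodule_basis[of "{1..n} \<times> {1..n}"])
    show "f p = 0" if f: "f \<in> ?N" and p: "p \<notin> {1..n} \<times> {1..n}" for f p
    proof -
      have "f \<in> alt n" using f gl(1) by blast
      then show ?thesis using p altD(1,2)[of f n] by (metis SigmaI surj_pair)
    qed
    show "0 \<in> ?N" using g0 M.zero_closed by (metis image_eqI)
    show "x + y \<in> ?N" if "x \<in> ?N" "y \<in> ?N" for x y
      using that gl(2) M.a_closed by (elim imageE) (metis image_eqI)
    show "sc r x \<in> ?N" if "x \<in> ?N" for r x
      using that gl(3) CR_module(2)[OF M] by (elim imageE) (metis image_eqI)
  qed simp
  then obtain B where B: "finite B" "B \<subseteq> ?N" "\<And>f. f \<in> ?N \<Longrightarrow> \<exists>c. f = (\<Sum>b\<in>B. sc (c b) b)"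
    "\<And>c. (\<Sum>b\<in>B. sc (c b) b) = 0 \<Longrightarrow> (\<forall>b\<in>B. c b = 0)" by blast
  define h where "h = inv_into (carrier M) g"
  have h: "h b \<in> carrier M" "g (h b) = b" if "b \<in> ?N" for b
    unfolding h_def using that by (metis inv_into_into, metis f_inv_into_f)
  have hg: "h (g x) = x" if "x \<in> carrier M" for x
    unfolding h_def using that by (rule inv_into_f_f[OF g(2)])
  let ?B = "h ` B"
  have BM: "?B \<subseteq> carrier M" using h(1) B(2) by blast
  have sums: "g (\<Oplus>\<^bsub>M\<^esub>b\<in>F. c b \<odot>\<^bsub>M\<^esub> b) = (\<Sum>b\<in>F. sc (c b) (g b))" if "finite F" "F \<subseteq> carrier M" for F c
    using that
  proof (induction F rule: finite_induct)
    case empty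
    then show ?case by (simp only: M.finsum_empty g0 sum.empty)
  next
    case (insert b F)
    then have b: "b \<in> carrier M" "F \<subseteq> carrier M" by auto
    have c: "(\<lambda>b. c b \<odot>\<^bsub>M\<^esub> b) \<in> F \<rightarrow> carrier M" "c b \<odot>\<^bsub>M\<^esub> b \<in> carrier M"
      using b CR_module(2)[OF M] by blast+
    show ?case
      unfolding M.finsum_insert[OF insert.hyps c] sum.insert[OF insert.hyps]
        gl(2)[OF c(2) M.finsum_closed[OF c(1)]] gl(3)[OF b(1)] insert.IH[OF b(2)] ..
  qed
  have ind: "lin_indep CR M ?B"
    unfolding lin_indep_def
  proof (intro allI impI)
    fix F and c :: "'m \<Rightarrow> padic2"
    assume F: "finite F \<and> F \<subseteq> ?B \<and> c \<in> F \<rightarrow> carrier CR \<and> (\<Oplus>\<^bsub>M\<^esub>b\<in>F. c b \<odot>\<^bsub>M\<^esub> b) = \<zero>\<^bsub>M\<^esub>"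
    define d where "d b = (if h b \<in> F then c (h b) else 0)" for b
    have "inj_on h B" by (rule inj_on_inverseI[of _ g]) (use h(2) B(2) in blast)
    have "(\<Sum>b\<in>B. sc (d b) b) = (\<Sum>b\<in>{b \<in> B. h b \<in> F}. sc (c (h b)) b)"
      using B(1) by (intro sum.mono_neutral_cong_right) (auto simp: d_def sc_0_left simp flip: zero_fun_def)
    also have "\<dots> = (\<Sum>x\<in>F. sc (c x) (g x))"
    proof (rule sum.reindex_bij_witness[of _ g h])
      fix x assume "x \<in> F"
      then obtain b where b: "b \<in> B" "x = h b" using F by blast
      then have "g x = b" using h(2) B(2) by blast
      then show "h (g x) = x" "g x \<in> {b \<in> B. h b \<in> F}" using b \<open>x \<in> F\<close> by simp_all
    next
      fix b assume "b \<in> {b \<in> B. h b \<in> F}"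
      then show "g (h b) = b" "h b \<in> F" "sc (c (h b)) (g (h b)) = sc (c (h b)) b"
        using h(2) B(2) by auto
    qed
    also have "\<dots> = g (\<Oplus>\<^bsub>M\<^esub>b\<in>F. c b \<odot>\<^bsub>M\<^esub> b)"
      using F BM by (intro sums[symmetric]) auto
    also have "\<dots> = 0" using F g0 by metis
    finally have d: "\<forall>b\<in>B. d b = 0" by (rule B(4))
    show "\<forall>b\<in>F. c b = \<zero>\<^bsub>CR\<^esub>"
    proof
      fix x assume x: "x \<in> F"
      then obtain b where "b \<in> B" "x = h b" using F by blast
      then show "c x = \<zero>\<^bsub>CR\<^esub>" using d x by (auto simp: d_def zero_class)
    qed
  qed
  have span: "module_span CR M ?B = carrier M"
  proof
    show "module_span CR M ?B \<subseteq> carrier M"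
      by (rule module_span_least[OF module.carrier_is_submodule[OF M] BM])
    note S = CR_submoduleD[OF M module_span_submodule(1)[OF M BM]]
    show "carrier M \<subseteq> module_span CR M ?B"
    proof
      fix x assume x: "x \<in> carrier M"
      obtain c where c: "g x = (\<Sum>b\<in>B. sc (c b) b)" using B(3) x by blast
      have "(\<Sum>b\<in>F. sc (c b) b) \<in> g ` module_span CR M ?B" if "finite F" "F \<subseteq> B" for F
        using that
      proof (induction F rule: finite_induct)
        case empty
        then show ?case using S(2) g0 by (simp only: sum.empty) (metis image_eqI)
      next
        case (insert b F)
        then obtain y where y: "y \<in> module_span CR M ?B" "(\<Sum>b\<in>F. sc (c b) b) = g y" by blast
        have hb: "h b \<in> module_span CR M ?B" using module_span_submodule(2)[OF M BM] insert.prems by blast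
        have "b \<in> ?N" using B(2) insert.prems by blast
        then have b: "g (h b) = b" "h b \<in> carrier M" using h by blast+
        have "g (c b \<odot>\<^bsub>M\<^esub> h b \<oplus>\<^bsub>M\<^esub> y) = sc (c b) b + g y"
          using S(1) y(1) gl(2)[OF CR_module(2)[OF M b(2)], of y "c b"] gl(3)[OF b(2)] b(1) by (simp only: subset_iff)
        then have "(\<Sum>b\<in>insert b F. sc (c b) b) = g (c b \<odot>\<^bsub>M\<^esub> h b \<oplus>\<^bsub>M\<^esub> y)"
          unfolding sum.insert[OF insert.hyps] y(2) by (rule sym)
        then show ?case using S(3)[OF S(4)[OF hb] y(1)] by (metis image_eqI)
      qed
      then have "g x \<in> g ` module_span CR M ?B" unfolding c using B(1) by blast
      then obtain y where y: "y \<in> module_span CR M ?B" "g x = g y" by (elim imageE)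
      have "y \<in> carrier M" using y(1) S(1) by blast
      then have "x = y" by (rule inj_onD[OF g(2) y(2) x])
      then show "x \<in> module_span CR M ?B" using y(1) by simp
    qed
  qed
  show "finitely_generated CR M" unfolding finitely_generated_def using B(1) BM span by blast
  show "is_free CR M" unfolding is_free_def using BM ind span by blast
qed

text \<open>The comparison map sends \<open>k \<otimes> m\<close> to \<open>k\<close> times
  \<open>g m\<close>. It is injective because every tensor has the form
  \<open>2 ^ (- j) \<otimes> m\<close>, and onto because every matrix becomes twice an integral one
  after multiplication by a power of 2, hence falls into the image of \<open>g\<close>.\<close>

lemma embedded_extend_scalars:
  "gmodule_isomorphic CR (sym_group n) (extend_scalars CR Q2 Z2_in_Q2 M) (alt_mod n)"
proof -
  note M = embedded_module
  interpret M: abelian_group M by (rule CR_module(1)[OF M])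
  note gl = linear_mapD[OF g(1), unfolded alt_mod_simps]
  let ?E = "extend_scalars CR Q2 Z2_in_Q2 M"
  let ?T = "tensor CR Q2_module M"
  let ?p = "pure_tensor CR Q2_module M"
  note T = module_tensor[OF module_Q2 M]
  interpret T: abelian_group ?T by (rule CR_module(1)[OF T])
  note pb = bilinear_mapD[OF pure_tensor_bilinear[OF module_Q2 M], unfolded Q2_module_simps, OF UNIV_I]
  have "bilinear_map Q2_module M (incl_alt_mod n) (\<lambda>k m. sc k (incl (g m)))"
    unfolding bilinear_map_def
  proof (intro conjI ballI linear_mapI, unfold incl_alt_mod_simps Q2_module_simps)
    fix k m assume m: "m \<in> carrier M"
    show "sc k (incl (g m)) \<in> alt n" "sc k (incl (g m)) \<in> alt n"
      using gl(1)[OF m] by (simp_all add: alt_sc incl_alt_iff)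
    show "sc k (incl (g (m \<oplus>\<^bsub>M\<^esub> m'))) = sc k (incl (g m)) + sc k (incl (g m'))" if "m' \<in> carrier M" for m'
      unfolding gl(2)[OF m that] incl_simps sc_add ..
    show "sc k (incl (g (r \<odot>\<^bsub>M\<^esub> m))) = sc (Z2_in_Q2 r) (sc k (incl (g m)))" for r
      unfolding gl(3)[OF m] incl_simps sc_sc by (simp only: mult.commute)
    show "sc (k + k') (incl (g m)) = sc k (incl (g m)) + sc k' (incl (g m))" for k'
      by (simp add: fun_eq_iff distrib_right)
    show "sc (Z2_in_Q2 r * k) (incl (g m)) = sc (Z2_in_Q2 r) (sc k (incl (g m)))" for r
      by (simp only: sc_sc)
  qed
  then obtain F where F: "linear_map ?T (incl_alt_mod n) F"
    and Fp: "\<And>k m. m \<in> carrier M \<Longrightarrow> F (?p k m) = sc k (incl (g m))"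
    by (rule tensor_lift[OF module_Q2 M module_incl_alt_mod]) simp
  note Fl = linear_mapD[OF F, unfolded incl_alt_mod_simps]
  have smlin: "linear_map ?T ?T (tensor_map CR Q2_module M (\<lambda>k'. k * k') (\<lambda>m. m))"
    and sm: "m \<in> carrier M \<Longrightarrow> tensor_map CR Q2_module M (\<lambda>k'. k * k') (\<lambda>m. m) (?p k' m) = ?p (k * k') m" for k k' m
    using tensor_map[OF module_Q2 M Q2_mult_linear Q2_id_linear] by simp_all
  have sm_F: "F (tensor_map CR Q2_module M (\<lambda>k'. k * k') (\<lambda>m. m) t) = sc k (F t)" if "t \<in> carrier ?T" for k t
    using that
  proof (rule tensor_induct[OF module_Q2 M])
    fix k' m assume "m \<in> carrier M"
    then show "F (tensor_map CR Q2_module M (\<lambda>k'. k * k') (\<lambda>m. m) (?p k' m)) = sc k (F (?p k' m))"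
      by (simp only: sm Fp sc_sc)
  next
    fix s t assume "s \<in> carrier ?T" "t \<in> carrier ?T"
      "F (tensor_map CR Q2_module M (\<lambda>k'. k * k') (\<lambda>m. m) s) = sc k (F s)"
      "F (tensor_map CR Q2_module M (\<lambda>k'. k * k') (\<lambda>m. m) t) = sc k (F t)"
    then show "F (tensor_map CR Q2_module M (\<lambda>k'. k * k') (\<lambda>m. m) (s \<oplus>\<^bsub>?T\<^esub> t)) = sc k (F (s \<oplus>\<^bsub>?T\<^esub> t))"
      by (simp only: linear_mapD[OF smlin] Fl sc_add)
  next
    fix r t assume "t \<in> carrier ?T"
      "F (tensor_map CR Q2_module M (\<lambda>k'. k * k') (\<lambda>m. m) t) = sc k (F t)"
    then show "F (tensor_map CR Q2_module M (\<lambda>k'. k * k') (\<lambda>m. m) (r \<odot>\<^bsub>?T\<^esub> t)) = sc k (F (r \<odot>\<^bsub>?T\<^esub> t))"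
      by (simp only: linear_mapD[OF smlin] Fl sc_sc mult.commute[of k "Z2_in_Q2 r"])
  qed
  have act_F: "F (tensor_map CR Q2_module M (\<lambda>k. k) (act M \<sigma>) t) = pact \<sigma> (F t)"
    if s: "\<sigma> \<in> carrier (sym_group n)" and t: "t \<in> carrier ?T" for \<sigma> t
  proof -
    interpret GM: group_module CR "sym_group n" M by (rule GM)
    have "linear_map M M (act M \<sigma>)"
      using s by (intro linear_mapI) (simp_all add: GM.act_closed GM.act_add GM.act_smult carrier_class)
    note tm = tensor_map[OF module_Q2 M Q2_id_linear this]
    show ?thesis
      using t
    proof (rule tensor_induct[OF module_Q2 M])
      fix k m assume m: "m \<in> carrier M"
      show "F (tensor_map CR Q2_module M (\<lambda>k. k) (act M \<sigma>) (?p k m)) = pact \<sigma> (F (?p k m))"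
        using m GM.act_closed[OF s m] by (simp add: tm(2) Fp g(3)[OF s m] incl_pact pact_linear)
    next
      fix a b assume "a \<in> carrier ?T" "b \<in> carrier ?T"
        "F (tensor_map CR Q2_module M (\<lambda>k. k) (act M \<sigma>) a) = pact \<sigma> (F a)"
        "F (tensor_map CR Q2_module M (\<lambda>k. k) (act M \<sigma>) b) = pact \<sigma> (F b)"
      then show "F (tensor_map CR Q2_module M (\<lambda>k. k) (act M \<sigma>) (a \<oplus>\<^bsub>?T\<^esub> b)) = pact \<sigma> (F (a \<oplus>\<^bsub>?T\<^esub> b))"
        by (simp only: linear_mapD[OF tm(1)] Fl pact_linear)
    next
      fix r a assume "a \<in> carrier ?T"
        "F (tensor_map CR Q2_module M (\<lambda>k. k) (act M \<sigma>) a) = pact \<sigma> (F a)"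
      then show "F (tensor_map CR Q2_module M (\<lambda>k. k) (act M \<sigma>) (r \<odot>\<^bsub>?T\<^esub> a)) = pact \<sigma> (F (r \<odot>\<^bsub>?T\<^esub> a))"
        by (simp only: linear_mapD[OF tm(1)] Fl pact_linear)
    qed
  qed
  let ?h = "\<lambda>j. inverse (2 ^ j) :: padic2 fract"
  have move: "?p (Z2_in_Q2 r * k) m = ?p k (r \<odot>\<^bsub>M\<^esub> m)" if "m \<in> carrier M" for r k m
    using pb(4)[OF that, of r k] pb(5)[OF that, of k r] by (simp only:)
  have shift: "?h i = Z2_in_Q2 (2 ^ j) * ?h (i + j)" for i j
    using two_neq_0_Q2 by (simp add: Z2_in_Q2_power Z2_in_Q2_2 power_add)
  \<comment> \<open>A tensor is a single pure one: integral factors move to the right, and two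
    summands are brought to the common denominator \<open>2 ^ (i + j)\<close>.\<close>
  have rep: "\<exists>j. \<exists>m\<in>carrier M. t = ?p (?h j) m" if "t \<in> carrier ?T" for t
    using that
  proof (rule tensor_induct[OF module_Q2 M])
    fix k m assume m: "m \<in> carrier M"
    obtain j a where ja: "2 ^ j * k = Z2_in_Q2 a" by (rule Q2_clear_denominator)
    have "k = Z2_in_Q2 a * ?h j"
      unfolding ja[symmetric] using two_neq_0_Q2 by simp
    then have "?p k m = ?p (?h j) (a \<odot>\<^bsub>M\<^esub> m)" using move[OF m] by simp
    then show "\<exists>j. \<exists>m'\<in>carrier M. ?p k m = ?p (?h j) m'" using CR_module(2)[OF M m] by blast
  next
    fix s t assume "\<exists>j. \<exists>m\<in>carrier M. s = ?p (?h j) m" "\<exists>j. \<exists>m\<in>carrier M. t = ?p (?h j) m"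
    then obtain i j a b where s: "a \<in> carrier M" "s = ?p (?h i) a" and t: "b \<in> carrier M" "t = ?p (?h j) b" by blast
    have "s = ?p (?h (i + j)) ((2 ^ j) \<odot>\<^bsub>M\<^esub> a)"
      unfolding s(2) by (subst shift[of i j], rule move[OF s(1)])
    moreover have "t = ?p (?h (i + j)) ((2 ^ i) \<odot>\<^bsub>M\<^esub> b)"
      unfolding t(2) by (subst shift[of j i], subst add.commute, rule move[OF t(1)])
    ultimately have "s \<oplus>\<^bsub>?T\<^esub> t = ?p (?h (i + j)) ((2 ^ j) \<odot>\<^bsub>M\<^esub> a \<oplus>\<^bsub>M\<^esub> (2 ^ i) \<odot>\<^bsub>M\<^esub> b)"
      using pb(3)[OF CR_module(2)[OF M s(1)] CR_module(2)[OF M t(1)]] by simp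
    then show "\<exists>j. \<exists>m\<in>carrier M. s \<oplus>\<^bsub>?T\<^esub> t = ?p (?h j) m"
      using M.a_closed[OF CR_module(2)[OF M s(1)] CR_module(2)[OF M t(1)]] by blast
  next
    fix r t assume "\<exists>j. \<exists>m\<in>carrier M. t = ?p (?h j) m"
    then obtain j b where t: "b \<in> carrier M" "t = ?p (?h j) b" by blast
    then have "r \<odot>\<^bsub>?T\<^esub> t = ?p (?h j) (r \<odot>\<^bsub>M\<^esub> b)" using pb(5) by simp
    then show "\<exists>j. \<exists>m\<in>carrier M. r \<odot>\<^bsub>?T\<^esub> t = ?p (?h j) m" using CR_module(2)[OF M t(1)] by blast
  qed
  have ker: "t = \<zero>\<^bsub>?T\<^esub>" if t: "t \<in> carrier ?T" and Ft: "F t = 0" for t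
  proof -
    obtain j m where m: "m \<in> carrier M" "t = ?p (?h j) m" using rep[OF t] by blast
    have "sc (?h j) (incl (g m)) = 0" using Ft Fp[OF m(1)] m(2) by simp
    then have "sc (2 ^ j) (sc (?h j) (incl (g m))) = 0" by (simp only: sc_0_right)
    then have "incl (g m) = incl 0"
      using two_neq_0_Q2 by (simp add: sc_sc sc_1 incl_simps)
    then have "g m = g \<zero>\<^bsub>M\<^esub>"
      unfolding incl_inject using linear_map_zero[OF M module_alt_mod g(1)] by simp
    then have "m = \<zero>\<^bsub>M\<^esub>" using inj_onD[OF g(2) _ m(1)] by simp
    then have "t = ?p (?h j) (0 \<odot>\<^bsub>M\<^esub> \<zero>\<^bsub>M\<^esub>)" using m by (simp add: CR_module(8)[OF M])
    also have "\<dots> = 0 \<odot>\<^bsub>?T\<^esub> ?p (?h j) \<zero>\<^bsub>M\<^esub>" using pb(5)[OF M.zero_closed] .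
    also have "\<dots> = \<zero>\<^bsub>?T\<^esub>" using CR_module(7)[OF T pb(1)[OF M.zero_closed]] .
    finally show ?thesis .
  qed
  have inj: "inj_on F (carrier ?T)"
  proof (rule inj_onI)
    fix s t assume st: "s \<in> carrier ?T" "t \<in> carrier ?T" "F s = F t"
    interpret IF: abelian_group "incl_alt_mod n" by (rule CR_module(1)[OF module_incl_alt_mod])
    have "F (s \<ominus>\<^bsub>?T\<^esub> t) = F s \<ominus>\<^bsub>incl_alt_mod n\<^esub> F t"
      by (rule linear_map_minus[OF T module_incl_alt_mod F st(1,2)])
    also have "\<dots> = \<zero>\<^bsub>incl_alt_mod n\<^esub>"
      unfolding st(3) IF.minus_eq using linear_mapD(1)[OF F st(2)] by (rule IF.r_neg)
    finally have "s \<ominus>\<^bsub>?T\<^esub> t = \<zero>\<^bsub>?T\<^esub>"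
      using ker T.minus_closed[OF st(1,2)] by simp
    then show "s = t" using minus_zero_imp_eq[OF CR_module(1)[OF T] st(1,2)] by simp
  qed
  have surj: "alt n \<subseteq> F ` carrier ?T"
  proof
    fix X :: "padic2 fract mat" assume "X \<in> alt n"
    then obtain k A where A: "A \<in> alt n" "sc (2 ^ k) X = incl A" by (rule alt_clear_denominators)
    have "sc 2 A \<in> g ` carrier M" using A(1) full by blast
    then obtain m where m: "m \<in> carrier M" "g m = sc 2 A" by (metis imageE)
    \<comment> \<open>The exponent exceeds \<open>k\<close> by one because only
      \<open>sc 2 A\<close>, not \<open>A\<close>, is known to lie in the image.\<close>
    have "F (?p (?h (k + 1)) m) = sc (?h (k + 1)) (sc 2 (sc (2 ^ k) X))"
      unfolding Fp[OF m(1)] m(2) incl_simps A(2) Z2_in_Q2_2 ..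
    also have "\<dots> = X"
      using two_neq_0_Q2 by (simp add: sc_sc sc_1 mult.assoc)
    finally show "X \<in> F ` carrier ?T" using pb(1)[OF m(1)] by (metis image_eqI)
  qed
  show ?thesis
  proof (rule giso_intro)
    show "linear_map ?E (alt_mod n) F"
      by (rule linear_mapI) (simp_all only: extend_scalars_simps alt_mod_simps Fl sm_F)
    show "bij_betw F (carrier ?E) (carrier (alt_mod n))"
      using inj surj Fl(1) by (auto simp: bij_betw_def)
    show "F (act ?E \<sigma> t) = act (alt_mod n) \<sigma> (F t)" if "\<sigma> \<in> carrier (sym_group n)" "t \<in> carrier ?E" for \<sigma> t
      using act_F that by (simp only: extend_scalars_simps alt_mod_simps)
  qed
qed

end

section \<open>Forms as lattices of alternating matrices\<close>

lemma linear_map_inj: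
  assumes M: "module CR M" and P: "module CR P" and f: "linear_map M P f"
    and k: "\<And>x. x \<in> carrier M \<Longrightarrow> f x = \<zero>\<^bsub>P\<^esub> \<Longrightarrow> x = \<zero>\<^bsub>M\<^esub>"
  shows "inj_on f (carrier M)"
proof (rule inj_onI)
  interpret M: abelian_group M by (rule CR_module(1)[OF M])
  interpret P: abelian_group P by (rule CR_module(1)[OF P])
  fix x y assume xy: "x \<in> carrier M" "y \<in> carrier M" "f x = f y"
  have "f (x \<ominus>\<^bsub>M\<^esub> y) = f x \<ominus>\<^bsub>P\<^esub> f y" by (rule linear_map_minus[OF M P f xy(1,2)])
  also have "\<dots> = \<zero>\<^bsub>P\<^esub>"
    unfolding xy(3) P.minus_eq using linear_mapD(1)[OF f xy(2)] by (rule P.r_neg)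
  finally have "x \<ominus>\<^bsub>M\<^esub> y = \<zero>\<^bsub>M\<^esub>" by (rule k[OF M.minus_closed[OF xy(1,2)]])
  then show "x = y" by (rule minus_zero_imp_eq[OF CR_module(1)[OF M] xy(1,2)])
qed

text \<open>A form is sent to its extension of scalars and from there to alternating matrices over
  the 2-adic numbers. Finitely many generators have a common denominator \<open>2 ^ k\<close>, and
  multiplication by it makes all images integral.\<close>

lemma form_embedding:
  fixes M :: "(padic2, 'm, nat \<Rightarrow> nat) gmodule"
  assumes n: "n \<ge> 3" and form: "is_form Z2 Q2 Z2_in_Q2 (sym_group n) M (hook_specht Q2 n)"
  obtains h where "linear_map M (alt_mod n) h" "inj_on h (carrier M)"
    "\<And>\<sigma> x. \<sigma> permutes {1..n} \<Longrightarrow> x \<in> carrier M \<Longrightarrow> h (act M \<sigma> x) = pact \<sigma> (h x)"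
    "\<exists>x\<in>carrier M. h x \<noteq> 0"
proof -
  have GM: "group_module CR (sym_group n) M" and fg: "finitely_generated CR M" and free: "is_free CR M"
    and iso: "gmodule_isomorphic CR (sym_group n) (extend_scalars CR Q2 Z2_in_Q2 M) (hook_specht CR n)"
    using form unfolding is_form_def by blast+
  interpret GM: group_module CR "sym_group n" M by (rule GM)
  have M: "module CR M" using GM by (simp add: group_module_def)
  interpret M: abelian_group M by (rule CR_module(1)[OF M])
  let ?E = "extend_scalars CR Q2 Z2_in_Q2 M"
  let ?T = "tensor CR Q2_module M"
  let ?p = "pure_tensor CR Q2_module M"
  let ?H = "hook_specht Q2 n"
  note T = module_tensor[OF module_Q2 M]
  interpret T: abelian_group ?T by (rule CR_module(1)[OF T])
  note pb = bilinear_mapD[OF pure_tensor_bilinear[OF module_Q2 M], unfolded Q2_module_simps, OF UNIV_I]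
  obtain f where f: "linear_map ?E ?H f" "bij_betw f (carrier ?E) (carrier ?H)"
    "\<And>g x. g \<in> carrier (sym_group n) \<Longrightarrow> x \<in> carrier ?E \<Longrightarrow> f (act ?E g x) = act ?H g (f x)"
    using giso_elim[OF iso] by blast
  obtain \<eta> where eta: "linear_map ?H (alt_mod n) \<eta>" "bij_betw \<eta> (carrier ?H) (alt n)"
    "\<And>\<sigma> x. \<sigma> permutes {1..n} \<Longrightarrow> x \<in> carrier ?H \<Longrightarrow> \<eta> (act ?H \<sigma> x) = pact \<sigma> (\<eta> x)"
    by (rule hook_alt_mod[where n = n and ?'r = "padic2 fract"]) blast
  define \<phi> where "\<phi> = (\<lambda>t. \<eta> (f t))"
  have phi_lin: "linear_map ?E (alt_mod n) \<phi>"
    unfolding \<phi>_def by (rule linear_map_comp[OF f(1) eta(1)])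
  have phi_bij: "bij_betw \<phi> (carrier ?T) (alt n)"
    using bij_betw_trans[OF f(2) eta(2)] by (simp add: \<phi>_def comp_def)
  have phi_act: "\<phi> (act ?E \<sigma> t) = pact \<sigma> (\<phi> t)" if "\<sigma> permutes {1..n}" "t \<in> carrier ?E" for \<sigma> t
    using f(3)[of \<sigma> t] eta(3)[OF that(1) linear_mapD(1)[OF f(1) that(2)]] that
    by (simp add: \<phi>_def sym_group_def)
  note phl = linear_mapD[OF phi_lin, unfolded extend_scalars_simps alt_mod_simps]
  define g0 where "g0 m = \<phi> (?p 1 m)" for m
  have phi_p: "\<phi> (?p k m) = sc k (g0 m)" if m: "m \<in> carrier M" for k m
  proof -
    have "?p k m = tensor_map CR Q2_module M (\<lambda>k'. k * k') (\<lambda>m. m) (?p 1 m)"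
      using tensor_map(2)[OF module_Q2 M Q2_mult_linear Q2_id_linear, of 1 m k] m by simp
    then show ?thesis unfolding g0_def using phl(3)[OF pb(1)[OF m]] by simp
  qed
  have g0_lin: "linear_map M (incl_alt_mod n) g0"
  proof (rule linear_mapI, unfold incl_alt_mod_simps)
    fix m assume m: "m \<in> carrier M"
    show "g0 m \<in> alt n" unfolding g0_def by (rule phl(1)[OF pb(1)[OF m]])
    show "g0 (m \<oplus>\<^bsub>M\<^esub> m') = g0 m + g0 m'" if "m' \<in> carrier M" for m'
      unfolding g0_def pb(3)[OF m that] by (rule phl(2)[OF pb(1)[OF m] pb(1)[OF that]])
    show "g0 (r \<odot>\<^bsub>M\<^esub> m) = sc (Z2_in_Q2 r) (g0 m)" for r
    proof -
      have "?p 1 (r \<odot>\<^bsub>M\<^esub> m) = ?p (Z2_in_Q2 r * 1) m"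
        using pb(4)[OF m, of r 1] pb(5)[OF m, of 1 r] by (simp only:)
      then show ?thesis unfolding g0_def using phi_p[OF m, of "Z2_in_Q2 r"] by (simp only: g0_def mult_1_right)
    qed
  qed
  \<comment> \<open>\<open>\<phi>\<close> is linear for the scalars of the extension, which are
    defined through \<open>tensor_map\<close>. The tensor product also carries its own scalars from
    the 2-adic integers; on pure tensors the two can be compared.\<close>
  have phi_res: "linear_map ?T (incl_alt_mod n) \<phi>"
  proof (rule linear_mapI, unfold incl_alt_mod_simps)
    fix t assume t: "t \<in> carrier ?T"
    have "\<forall>r. \<phi> (r \<odot>\<^bsub>?T\<^esub> t) = sc (Z2_in_Q2 r) (\<phi> t)"
      using t
    proof (rule tensor_induct[OF module_Q2 M])
      fix k m assume m: "m \<in> carrier M"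
      show "\<forall>r. \<phi> (r \<odot>\<^bsub>?T\<^esub> ?p k m) = sc (Z2_in_Q2 r) (\<phi> (?p k m))"
        unfolding pb(4)[OF m, symmetric] phi_p[OF m] sc_sc by blast
    next
      fix a b assume ab: "a \<in> carrier ?T" "b \<in> carrier ?T"
        "\<forall>r. \<phi> (r \<odot>\<^bsub>?T\<^esub> a) = sc (Z2_in_Q2 r) (\<phi> a)" "\<forall>r. \<phi> (r \<odot>\<^bsub>?T\<^esub> b) = sc (Z2_in_Q2 r) (\<phi> b)"
      show "\<forall>r. \<phi> (r \<odot>\<^bsub>?T\<^esub> (a \<oplus>\<^bsub>?T\<^esub> b)) = sc (Z2_in_Q2 r) (\<phi> (a \<oplus>\<^bsub>?T\<^esub> b))"
        unfolding CR_module(3)[OF T ab(1,2)] phl(2)[OF ab(1,2)] sc_add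
          phl(2)[OF CR_module(2)[OF T ab(1)] CR_module(2)[OF T ab(2)]] ab(3,4)[rule_format] by blast
    next
      fix q a assume a: "a \<in> carrier ?T" "\<forall>r. \<phi> (r \<odot>\<^bsub>?T\<^esub> a) = sc (Z2_in_Q2 r) (\<phi> a)"
      show "\<forall>r. \<phi> (r \<odot>\<^bsub>?T\<^esub> (q \<odot>\<^bsub>?T\<^esub> a)) = sc (Z2_in_Q2 r) (\<phi> (q \<odot>\<^bsub>?T\<^esub> a))"
        unfolding CR_module(5)[OF T a(1), symmetric] a(2)[rule_format] Z2_in_Q2_simps sc_sc by blast
    qed
    then show "\<phi> (r \<odot>\<^bsub>?T\<^esub> t) = sc (Z2_in_Q2 r) (\<phi> t)" for r by blast
  qed (use phl in blast)+
  have g0_act: "g0 (act M \<sigma> m) = pact \<sigma> (g0 m)" if s: "\<sigma> permutes {1..n}" and m: "m \<in> carrier M" for \<sigma> m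
  proof -
    have s': "\<sigma> \<in> carrier (sym_group n)" using s by (simp add: sym_group_def)
    have "linear_map M M (act M \<sigma>)"
      using s' by (intro linear_mapI) (simp_all add: GM.act_closed GM.act_add GM.act_smult carrier_class)
    then have "?p 1 (act M \<sigma> m) = act ?E \<sigma> (?p 1 m)"
      using tensor_map(2)[OF module_Q2 M Q2_id_linear, of "act M \<sigma>" 1 m] m by simp
    then show ?thesis
      unfolding g0_def using phi_act[OF s, of "?p 1 m"] pb(1)[OF m] by simp
  qed
  have phi_0: "\<phi> \<zero>\<^bsub>?T\<^esub> = 0"
  proof -
    have "\<phi> (\<zero>\<^bsub>?T\<^esub> \<oplus>\<^bsub>?T\<^esub> \<zero>\<^bsub>?T\<^esub>) = \<phi> \<zero>\<^bsub>?T\<^esub> + \<phi> \<zero>\<^bsub>?T\<^esub>" by (rule phl(2)) simp_all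
    then show ?thesis by simp
  qed
  have g0_inj: "inj_on g0 (carrier M)"
  proof (rule linear_map_inj[OF M module_incl_alt_mod g0_lin], rule ccontr)
    fix m assume m: "m \<in> carrier M" "g0 m = \<zero>\<^bsub>incl_alt_mod n\<^esub>" "m \<noteq> \<zero>\<^bsub>M\<^esub>"
    have "\<phi> (?p 1 m) = \<phi> \<zero>\<^bsub>?T\<^esub>" using m(2) phi_0 by (simp only: g0_def incl_alt_mod_simps)
    then have z: "?p 1 m = \<zero>\<^bsub>?T\<^esub>"
      using phi_bij pb(1)[OF m(1)] T.zero_closed by (meson bij_betw_imp_inj_on inj_onD)
    \<comment> \<open>A coordinate \<open>l\<close> not vanishing at \<open>m\<close> induces a map
      on the tensor product with value \<open>l m\<close> at \<open>1 \<otimes> m\<close>, against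
      the vanishing of that tensor.\<close>
    obtain l :: "'m \<Rightarrow> padic2" where l: "\<And>x y. x \<in> carrier M \<Longrightarrow> y \<in> carrier M \<Longrightarrow> l (x \<oplus>\<^bsub>M\<^esub> y) = l x + l y"
      "\<And>r x. x \<in> carrier M \<Longrightarrow> l (r \<odot>\<^bsub>M\<^esub> x) = r * l x" "l m \<noteq> 0"
      using free_coordinate[OF M free m(1,3)] by blast
    have "bilinear_map Q2_module M Q2_module (\<lambda>k x. k * Z2_in_Q2 (l x))"
      unfolding bilinear_map_def
      by (intro conjI ballI linear_mapI) (simp_all add: l Z2_in_Q2_simps algebra_simps)
    then obtain F where F: "linear_map ?T Q2_module F"
      "\<And>k x. x \<in> carrier M \<Longrightarrow> F (?p k x) = k * Z2_in_Q2 (l x)"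
      by (rule tensor_lift[OF module_Q2 M module_Q2]) simp
    have "Z2_in_Q2 (l m) = F (?p 1 m)" using F(2)[OF m(1)] by simp
    also have "\<dots> = Z2_in_Q2 0"
      unfolding z using linear_map_zero[OF T module_Q2 F(1)] by (simp add: Z2_in_Q2_simps)
    finally show False using l(3) Z2_in_Q2_inject by blast
  qed
  have g0_nz: "\<exists>m\<in>carrier M. g0 m \<noteq> 0"
  proof (rule ccontr)
    assume "\<not> ?thesis"
    then have z: "g0 m = 0" if "m \<in> carrier M" for m using that by blast
    have "\<phi> t = 0" if "t \<in> carrier ?T" for t
      using that
    proof (rule tensor_induct[OF module_Q2 M])
      show "\<phi> (?p k m) = 0" if "m \<in> carrier M" for k m
        unfolding phi_p[OF that] z[OF that] by (rule sc_0_right)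
      show "\<phi> (s \<oplus>\<^bsub>?T\<^esub> t) = 0" if "s \<in> carrier ?T" "t \<in> carrier ?T" "\<phi> s = 0" "\<phi> t = 0" for s t
        unfolding phl(2)[OF that(1,2)] that(3,4) by (rule add_0)
      show "\<phi> (r \<odot>\<^bsub>?T\<^esub> t) = 0" if t: "t \<in> carrier ?T" "\<phi> t = 0" for r t
      proof -
        have "linear_map ?T (incl_alt_mod n) \<phi>" by (rule phi_res)
        from linear_mapD(3)[OF this t(1), of r] show ?thesis
          unfolding t(2) incl_alt_mod_simps sc_0_right .
      qed
    qed
    \<comment> \<open>\<open>\<phi>\<close> is onto and a triangle is a nonzero target, so
      \<open>\<phi>\<close> cannot vanish; this takes three vertices.\<close>
    moreover have "tri 1 2 3 \<in> \<phi> ` carrier ?T"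
      unfolding bij_betw_imp_surj_on[OF phi_bij] using n by (intro tri_alt) auto
    then obtain t where "t \<in> carrier ?T" "tri 1 2 3 = \<phi> t" by (elim imageE)
    ultimately have "(tri 1 2 3 :: padic2 fract mat) (1, 2) = 0" by simp
    then show False by (simp add: tri_def wedge_def uvec_def)
  qed
  obtain X where X: "finite X" "X \<subseteq> carrier M" "module_span CR M X = carrier M"
    using fg unfolding finitely_generated_def by blast
  have "\<exists>k. \<forall>x\<in>F. \<exists>A. sc (2 ^ k) (g0 x) = incl A" if "finite F" "F \<subseteq> carrier M" for F
    using that
  proof (induction F rule: finite_induct)
    case (insert y F)
    then obtain k where k: "\<forall>x\<in>F. \<exists>A. sc (2 ^ k) (g0 x) = incl A" by blast
    have "g0 y \<in> alt n" using linear_mapD(1)[OF g0_lin] insert.prems by simp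
    then obtain l B where B: "sc (2 ^ l) (g0 y) = incl B" by (rule alt_clear_denominators)
    have up: "sc (2 ^ (i + j)) C = incl (sc (2 ^ i) A)" if "sc (2 ^ j) C = incl A" for i j and C :: "padic2 fract mat" and A
      unfolding incl_simps that[symmetric] sc_sc Z2_in_Q2_power Z2_in_Q2_2 power_add ..
    have "\<exists>A. sc (2 ^ (k + l)) (g0 x) = incl A" if x: "x \<in> insert y F" for x
    proof (cases "x = y")
      case True
      then show ?thesis using up[OF B] by blast
    next
      case False
      then obtain A where "sc (2 ^ k) (g0 x) = incl A" using x k by blast
      then show ?thesis using up[of k "g0 x" A l] by (metis add.commute)
    qed
    then show ?case by blast
  qed simp
  then obtain k where k: "\<And>x. x \<in> X \<Longrightarrow> \<exists>A. sc (2 ^ k) (g0 x) = incl A" using X by meson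
  have ex: "\<exists>A. sc (2 ^ k) (g0 x) = incl A" if "x \<in> carrier M" for x
    using that unfolding X(3)[symmetric]
  proof (rule module_span_induct[OF M X(2)])
    show "\<exists>A. sc (2 ^ k) (g0 x) = incl A" if "x \<in> X" for x by (rule k[OF that])
    have "g0 \<zero>\<^bsub>M\<^esub> = 0" using linear_map_zero[OF M module_incl_alt_mod g0_lin] by (simp only: incl_alt_mod_simps)
    then show "\<exists>A. sc (2 ^ k) (g0 \<zero>\<^bsub>M\<^esub>) = incl A"
      by (intro exI[of _ 0]) (simp only: sc_0_right incl_simps)
  next
    fix x y assume xy: "x \<in> carrier M" "y \<in> carrier M"
      "\<exists>A. sc (2 ^ k) (g0 x) = incl A" "\<exists>A. sc (2 ^ k) (g0 y) = incl A"
    then obtain A B where "sc (2 ^ k) (g0 x) = incl A" "sc (2 ^ k) (g0 y) = incl B" by blast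
    then have "sc (2 ^ k) (g0 (x \<oplus>\<^bsub>M\<^esub> y)) = incl (A + B)"
      using linear_mapD(2)[OF g0_lin xy(1,2)] by (simp only: incl_alt_mod_simps sc_add incl_simps)
    then show "\<exists>A. sc (2 ^ k) (g0 (x \<oplus>\<^bsub>M\<^esub> y)) = incl A" by blast
  next
    fix r x assume x: "x \<in> carrier M" "\<exists>A. sc (2 ^ k) (g0 x) = incl A"
    then obtain A where A: "sc (2 ^ k) (g0 x) = incl A" by blast
    have "sc (2 ^ k) (g0 (r \<odot>\<^bsub>M\<^esub> x)) = sc (Z2_in_Q2 r) (sc (2 ^ k) (g0 x))"
      using linear_mapD(3)[OF g0_lin x(1), of r] by (simp only: incl_alt_mod_simps sc_sc mult.commute)
    also have "\<dots> = incl (sc r A)" unfolding A incl_simps ..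
    finally show "\<exists>A. sc (2 ^ k) (g0 (r \<odot>\<^bsub>M\<^esub> x)) = incl A" by blast
  qed
  then obtain h where h: "\<And>x. x \<in> carrier M \<Longrightarrow> sc (2 ^ k) (g0 x) = incl (h x)" by metis
  note g0l = linear_mapD[OF g0_lin, unfolded incl_alt_mod_simps]
  have "linear_map M (alt_mod n) h"
  proof (rule linear_mapI, unfold alt_mod_simps)
    fix x assume x: "x \<in> carrier M"
    have "incl (h x) \<in> alt n" unfolding h[OF x, symmetric] by (rule alt_sc[OF g0l(1)[OF x]])
    then show "h x \<in> alt n" by (simp only: incl_alt_iff)
    show "h (x \<oplus>\<^bsub>M\<^esub> y) = h x + h y" if y: "y \<in> carrier M" for y
    proof -
      have xy: "x \<oplus>\<^bsub>M\<^esub> y \<in> carrier M"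
        using x y by (rule abelian_monoid.a_closed[OF abelian_group.axioms(1)[OF CR_module(1)[OF M]]])
      have "incl (h (x \<oplus>\<^bsub>M\<^esub> y)) = incl (h x + h y)"
        unfolding incl_simps h[OF x, symmetric] h[OF y, symmetric] h[OF xy, symmetric] g0l(2)[OF x y] sc_add ..
      then show ?thesis by (simp only: incl_inject)
    qed
    show "h (r \<odot>\<^bsub>M\<^esub> x) = sc r (h x)" for r
    proof -
      have "incl (h (r \<odot>\<^bsub>M\<^esub> x)) = incl (sc r (h x))"
        unfolding incl_simps h[OF x, symmetric] h[OF CR_module(2)[OF M x], symmetric] g0l(3)[OF x] sc_sc
        by (simp only: mult.commute)
      then show ?thesis by (simp only: incl_inject)
    qed
  qed
  moreover have inj2: "x = y" if "sc (2 ^ k) x = sc (2 ^ k) y" for x y :: "padic2 fract mat"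
    using that two_neq_0_Q2 by (simp add: fun_eq_iff)
  have "inj_on h (carrier M)"
  proof (rule inj_onI)
    fix x y assume xy: "x \<in> carrier M" "y \<in> carrier M" "h x = h y"
    then have "sc (2 ^ k) (g0 x) = sc (2 ^ k) (g0 y)" using h by simp
    then show "x = y" using inj2 inj_onD[OF g0_inj _ xy(1,2)] by blast
  qed
  moreover have "h (act M \<sigma> x) = pact \<sigma> (h x)" if s: "\<sigma> permutes {1..n}" and x: "x \<in> carrier M" for \<sigma> x
  proof -
    have "act M \<sigma> x \<in> carrier M" using GM.act_closed s x by (simp add: sym_group_def)
    then have "incl (h (act M \<sigma> x)) = incl (pact \<sigma> (h x))"
      unfolding incl_pact h[OF x, symmetric] pact_linear g0_act[OF s x, symmetric] by (rule h[symmetric])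
    then show ?thesis by (simp only: incl_inject)
  qed
  moreover have "\<exists>x\<in>carrier M. h x \<noteq> 0"
  proof -
    obtain m where m: "m \<in> carrier M" "g0 m \<noteq> 0" using g0_nz by blast
    have "h m \<noteq> 0"
    proof
      assume "h m = 0"
      then have "sc (2 ^ k) (g0 m) = sc (2 ^ k) 0" using h[OF m(1)] by (simp only: incl_simps sc_0_right)
      then show False using inj2 m(2) by blast
    qed
    then show ?thesis using m(1) by blast
  qed
  ultimately show ?thesis by (rule that)
qed

lemma lattice_image:
  assumes M: "module CR M" and h: "linear_map M (alt_mod n) h"
    and eq: "\<And>\<sigma> x. \<sigma> permutes {1..n} \<Longrightarrow> x \<in> carrier M \<Longrightarrow> h (act M \<sigma> x) = pact \<sigma> (h x)"
    and H: "submodule H CR M" "\<And>\<sigma> x. \<sigma> permutes {1..n} \<Longrightarrow> x \<in> H \<Longrightarrow> act M \<sigma> x \<in> H"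
  shows "lattice n (h ` H)"
proof -
  note S = CR_submoduleD[OF M H(1)]
  note hl = linear_mapD[OF h, unfolded alt_mod_simps]
  show ?thesis
    unfolding lattice_def
  proof (intro conjI ballI allI impI)
    show "h ` H \<subseteq> alt n" using hl(1) S(1) by blast
    show "0 \<in> h ` H" using linear_map_zero[OF M module_alt_mod h, unfolded alt_mod_simps] S(2) by (metis image_eqI)
    show "A + B \<in> h ` H" if AB: "A \<in> h ` H" "B \<in> h ` H" for A B
    proof -
      obtain x y where xy: "x \<in> H" "A = h x" "y \<in> H" "B = h y" using AB by blast
      moreover have "x \<in> carrier M" "y \<in> carrier M" using xy S(1) by blast+
      ultimately have "A + B = h (x \<oplus>\<^bsub>M\<^esub> y)" by (simp only: hl(2))
      then show ?thesis using S(3)[OF xy(1,3)] by blast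
    qed
    show "sc c A \<in> h ` H" if A: "A \<in> h ` H" for c A
    proof -
      obtain x where x: "x \<in> H" "A = h x" using A by blast
      moreover have "x \<in> carrier M" using x S(1) by blast
      ultimately have "sc c A = h (c \<odot>\<^bsub>M\<^esub> x)" by (simp only: hl(3))
      then show ?thesis using S(4)[OF x(1)] by blast
    qed
    show "pact \<sigma> A \<in> h ` H" if s: "\<sigma> permutes {1..n}" and A: "A \<in> h ` H" for \<sigma> A
    proof -
      obtain x where x: "x \<in> H" "A = h x" using A by blast
      moreover have "x \<in> carrier M" using x S(1) by blast
      ultimately have "pact \<sigma> A = h (act M \<sigma> x)" by (simp only: eq[OF s])
      then show ?thesis using H(2)[OF s x(1)] by blast
    qed
  qed
qed

text \<open>The dictionary along an injective equivariant map, by which the classification of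
  lattices of matrices applies to submodules of the exterior square.\<close>

lemma gsubmodule_iff_lattice:
  assumes M: "module CR M" and h: "linear_map M (alt_mod n) h" "inj_on h (carrier M)"
    and eq: "\<And>\<sigma> x. \<sigma> permutes {1..n} \<Longrightarrow> x \<in> carrier M \<Longrightarrow> h (act M \<sigma> x) = pact \<sigma> (h x)"
    and cl: "\<And>\<sigma> x. \<sigma> permutes {1..n} \<Longrightarrow> x \<in> carrier M \<Longrightarrow> act M \<sigma> x \<in> carrier M"
  shows "gsubmodule CR (sym_group n) M H \<longleftrightarrow> H \<subseteq> carrier M \<and> lattice n (h ` H)"
proof
  assume "gsubmodule CR (sym_group n) M H"
  then have H: "submodule H CR M" "\<And>\<sigma> x. \<sigma> permutes {1..n} \<Longrightarrow> x \<in> H \<Longrightarrow> act M \<sigma> x \<in> H"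
    by (simp_all add: gsubmodule_def sym_group_def)
  then show "H \<subseteq> carrier M \<and> lattice n (h ` H)"
    using lattice_image[OF M h(1) eq H] CR_submoduleD(1)[OF M H(1)] by blast
next
  assume H: "H \<subseteq> carrier M \<and> lattice n (h ` H)"
  then have L: "lattice n (h ` H)" and HM: "H \<subseteq> carrier M" by blast+
  interpret M: abelian_group M by (rule CR_module(1)[OF M])
  note hl = linear_mapD[OF h(1), unfolded alt_mod_simps]
  have mem: "x \<in> H" if "x \<in> carrier M" "h x \<in> h ` H" for x
    using that HM inj_onD[OF h(2)] by (metis imageE subsetD)
  have "submodule H CR M"
  proof (rule CR_submoduleI[OF M HM])
    show "\<zero>\<^bsub>M\<^esub> \<in> H"
      by (rule mem[OF M.zero_closed]) (simp only: linear_map_zero[OF M module_alt_mod h(1), unfolded alt_mod_simps] latticeD(2)[OF L])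
    show "x \<oplus>\<^bsub>M\<^esub> y \<in> H" if "x \<in> H" "y \<in> H" for x y
    proof -
      have c: "x \<in> carrier M" "y \<in> carrier M" using that HM by blast+
      show ?thesis
        by (rule mem[OF M.a_closed[OF c]]) (simp only: hl(2)[OF c] latticeD(3)[OF L] imageI that)
    qed
    show "r \<odot>\<^bsub>M\<^esub> x \<in> H" if "x \<in> H" for r x
    proof -
      have c: "x \<in> carrier M" using that HM by blast
      show ?thesis
        by (rule mem[OF CR_module(2)[OF M c]]) (simp only: hl(3)[OF c] latticeD(4)[OF L] imageI that)
    qed
  qed
  moreover have "act M \<sigma> x \<in> H" if s: "\<sigma> permutes {1..n}" and x: "x \<in> H" for \<sigma> x
  proof -
    have c: "x \<in> carrier M" using x HM by blast
    show ?thesis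
      by (rule mem[OF cl[OF s c]]) (simp only: eq[OF s c] latticeD(5)[OF L s] imageI x)
  qed
  ultimately show "gsubmodule CR (sym_group n) M H"
    by (simp add: gsubmodule_def sym_group_def)
qed

text \<open>The valuation of a nonzero entry bounds the powers of 2 that divide all of
  \<open>L\<close>. Dividing by the largest of them normalises an embedded form.\<close>

lemma sc_pow_lattice:
  assumes L: "lattice n L" and nz: "L \<noteq> {0}"
  obtains j where "L \<subseteq> sc (2 ^ j) ` alt n" "\<not> L \<subseteq> sc (2 ^ Suc j) ` (alt n :: padic2 mat set)"
proof -
  define Q where "Q j \<longleftrightarrow> L \<subseteq> sc (2 ^ j) ` (alt n :: padic2 mat set)" for j
  have "Q 0" unfolding Q_def using latticeD(1)[OF L] by (auto simp: sc_1)
  moreover have "\<exists>j. \<not> Q j"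
  proof -
    obtain A where A: "A \<in> L" "A \<noteq> 0" using nz latticeD(2)[OF L] by blast
    then obtain p where "A p \<noteq> 0" by (auto simp: fun_eq_iff)
    then obtain k u where k: "A p = 2 ^ k * u" "parity u = 1" by (rule padic2_factor)
    have "\<not> Q (Suc k)"
    proof
      assume "Q (Suc k)"
      then obtain B where "A = sc (2 ^ Suc k) B" using A(1) unfolding Q_def by blast
      then have "A p = 2 ^ Suc k * B p" by (simp only: sc_apply)
      then have "2 ^ k * u = 2 ^ k * (2 * B p)" unfolding k(1) by (simp only: power_Suc mult_ac)
      moreover have "(2 :: padic2) ^ k \<noteq> 0" using two_neq_0 by simp
      ultimately have "u = 2 * B p" by (metis mult_left_cancel)
      then show False using k(2) by (simp add: parity_simps)
    qed
    then show ?thesis by blast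
  qed
  ultimately have "\<exists>j. Q j \<and> \<not> Q (Suc j)" by (metis nat_induct)
  then show ?thesis using that unfolding Q_def by blast
qed

lemma sc_pow_inject: "sc (2 ^ k) A = sc (2 ^ k) B \<longleftrightarrow> A = (B :: 'x \<Rightarrow> padic2)"
  using two_neq_0 by (simp add: fun_eq_iff)

text \<open>
  This line spanned by \<open>tri 1 2 3\<close> is preserved by every equivariant map, which forces isomorphisms
  between the lattices to be scalar.
\<close>

lemma tri_eigen:
  fixes B :: "padic2 mat"
  assumes n: "n \<ge> 3" and B: "B \<in> alt n"
    and s12: "pact (Transposition.transpose 1 2) B = - B" and s23: "pact (Transposition.transpose 2 3) B = - B"
    and skl: "\<And>k l. k \<in> {4..n} \<Longrightarrow> l \<in> {4..n} \<Longrightarrow> pact (Transposition.transpose k l) B = B"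
  shows "B = sc (B (1, 2)) (tri 1 2 3)"
proof (rule ext, clarify)
  have two: "x = 0" if "x = - x" for x :: padic2
  proof -
    have "x + x = 0" using that by (metis add.right_inverse)
    then have "2 * x = 0" by (simp only: mult_2)
    then show ?thesis using two_neq_0 by simp
  qed
  have e12: "B (Transposition.transpose 1 2 p, Transposition.transpose 1 2 q) = - B (p, q)" for p q
    using fun_cong[OF s12, of "(p, q)"] by (simp add: pact_def)
  have e23: "B (Transposition.transpose 2 3 p, Transposition.transpose 2 3 q) = - B (p, q)" for p q
    using fun_cong[OF s23, of "(p, q)"] by (simp add: pact_def)
  have ekl: "B (Transposition.transpose k l p, Transposition.transpose k l q) = B (p, q)" if "k \<in> {4..n}" "l \<in> {4..n}" for k l p q
    using fun_cong[OF skl[OF that], of "(p, q)"] by (simp add: pact_def)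
  have as: "B (q, p) = - B (p, q)" for p q by (rule altD(3)[OF B])
  \<comment> \<open>For \<open>k \<ge> 4\<close> the transposition of 1 and 2 fixes 3 and
    \<open>k\<close>, so \<open>B (3, k)\<close> equals its negative; the other two entries agree
    with it up to sign.\<close>
  have k1: "B (1, k) = 0 \<and> B (2, k) = 0 \<and> B (3, k) = 0" if "k \<ge> 4" for k
  proof -
    have "B (2, k) = - B (1, k)" "B (3, k) = - B (2, k)" "B (3, k) = - B (3, k)"
      using e12[of 1 k] e23[of 2 k] e12[of 3 k] that by (simp_all add: transpose_apply_other)
    then show ?thesis using two[of "B (3, k)"] by simp
  qed
  have kl: "B (k, l) = 0" if "k \<in> {4..n}" "l \<in> {4..n}" for k l
    using ekl[OF that, of k l] as[of k l] two[of "B (k, l)"] by simp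
  have b13: "B (1, 3) = - B (1, 2)" using e23[of 1 2] by (simp add: transpose_apply_other)
  have b23: "B (2, 3) = B (1, 2)" using e12[of 1 3] b13 by (simp add: transpose_apply_other)
  have b21: "B (2, 1) = - B (1, 2)" by (rule as)
  have b31: "B (3, 1) = B (1, 2)" using as[of 3 1] b13 by simp
  have b32: "B (3, 2) = - B (1, 2)" using as[of 3 2] b23 by simp
  fix p q
  have out: "B (p, q) = 0" if "p = 0 \<or> q = 0 \<or> p > n \<or> q > n" for p q
    using that altD(1,2)[OF B] by auto
  have tri: "tri 1 2 3 (p, q) = (0::padic2)" if "p = 0 \<or> q = 0 \<or> p \<ge> 4 \<or> q \<ge> 4" for p q
    using that by (auto simp: tri_def wedge_def uvec_def)
  have c: "x = 0 \<or> x > n \<or> x \<in> {1, 2, 3} \<or> x \<in> {4..n}" for x by auto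
  consider "p = 0 \<or> q = 0 \<or> p > n \<or> q > n" | "p \<in> {4..n}" "q \<in> {4..n}"
    | "p \<in> {1, 2, 3}" "q \<in> {4..n}" | "q \<in> {1, 2, 3}" "p \<in> {4..n}" | "p \<in> {1, 2, 3}" "q \<in> {1, 2, 3}"
    using c[of p] c[of q] by blast
  then show "B (p, q) = sc (B (1, 2)) (tri 1 2 3) (p, q)"
  proof cases
    case 1
    then have "p = 0 \<or> q = 0 \<or> p \<ge> 4 \<or> q \<ge> 4" using n by auto
    then show ?thesis using out[OF 1] tri[of p q] by simp
  next
    case 2
    then show ?thesis using kl[OF 2] tri[of p q] by simp
  next
    case 3
    then show ?thesis using k1[of q] tri[of p q] by auto
  next
    case 4
    then show ?thesis using k1[of p] tri[of p q] as[of q p] by auto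
  next
    case 5
    have "(tri 1 2 3 (1, 1) :: padic2) = 0" "(tri 1 2 3 (2, 2) :: padic2) = 0" "(tri 1 2 3 (3, 3) :: padic2) = 0"
      "(tri 1 2 3 (1, 2) :: padic2) = 1" "(tri 1 2 3 (2, 1) :: padic2) = - 1" "(tri 1 2 3 (1, 3) :: padic2) = - 1"
      "(tri 1 2 3 (3, 1) :: padic2) = 1" "(tri 1 2 3 (2, 3) :: padic2) = 1" "(tri 1 2 3 (3, 2) :: padic2) = - 1"
      by (simp_all add: tri_def wedge_def uvec_def)
    then show ?thesis
      using 5 b13 b23 b21 b31 b32 altD(4)[OF B] by auto
  qed
qed

lemma tri_perm: "tri j i k = - tri i j k" "tri i k j = - tri i j (k :: nat)"
  by (auto simp: tri_def wedge_def fun_eq_iff algebra_simps)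

text \<open>The eigenline and conjugation show that \<open>F\<close> multiplies every triangle by
  the same scalar, so \<open>F (sc 2 A) = sc a A\<close> for all \<open>A\<close>. Up to a unit
  \<open>a\<close> is a power of 2, and comparing valuations leaves only
  \<open>a = 2\<close>.\<close>

lemma lat_not_isomorphic:
  assumes n: "n \<ge> 6" "n mod 4 = 2" and ij: "i < 4" "j < 4"
    and add: "\<And>A B. A \<in> lat n i \<Longrightarrow> B \<in> lat n i \<Longrightarrow> F (A + B) = F A + F B"
    and scl: "\<And>c A. A \<in> lat n i \<Longrightarrow> F (sc c A) = sc c (F A)"
    and act: "\<And>\<sigma> A. \<sigma> permutes {1..n} \<Longrightarrow> A \<in> lat n i \<Longrightarrow> F (pact \<sigma> A) = pact \<sigma> (F A)"
    and img: "F ` lat n i = lat n j"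
  shows "i = j"
proof -
  note mono = lat_antimono[OF n(2)]
  have n4: "\<not> lat n a \<subseteq> lat n 4" if "a < 4" for a
    using mono[of "Suc a" 4] lat_strict[OF n that] that by auto
  have Li: "lattice n (lat n i)" using ij by (intro lattice_lat) simp
  have two: "sc 2 A \<in> lat n i" if "A \<in> alt n" for A
    using that mono[of i 4] ij unfolding lat_4 by auto
  have F_alt: "F A \<in> alt n" if "A \<in> lat n i" for A
    using that img latticeD(1)[OF lattice_lat[of j n]] ij by auto
  have F0: "F 0 = 0"
    using scl[OF latticeD(2)[OF Li], of 0] by (simp only: sc_0_left)
  have Fsum: "F (sum G X) = (\<Sum>x\<in>X. F (G x))" if "finite X" "\<And>x. x \<in> X \<Longrightarrow> G x \<in> lat n i" for G and X :: "(nat \<times> nat) set"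
    using that
  proof (induction X rule: finite_induct)
    case empty
    then show ?case by (simp only: sum.empty F0)
  next
    case (insert x X)
    have "sum G X \<in> lat n i" using insert.prems by (intro latticeD(8)[OF Li]) auto
    then have "F (G x + sum G X) = F (G x) + F (sum G X)" using insert.prems by (intro add) auto
    moreover have "F (sum G X) = (\<Sum>x\<in>X. F (G x))" using insert by blast
    ultimately show ?case unfolding sum.insert[OF insert.hyps] by (simp only:)
  qed
  \<comment> \<open>Twice the triangles, as a triangle itself need not lie in
    \<open>lat n i\<close>.\<close>
  let ?t = "\<lambda>k l m. sc 2 (tri k l m :: padic2 mat)"
  have tp: "pact \<sigma> (?t 1 2 3) = ?t (\<sigma> 1) (\<sigma> 2) (\<sigma> 3)" if "\<sigma> permutes {1..n}" for \<sigma>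
    by (simp only: pact_linear pact_tri[OF that])
  have t123: "?t 1 2 3 \<in> lat n i" using n by (intro two tri_alt) auto
  have perm: "Transposition.transpose k l permutes {1..n}" if "k \<in> {1..n}" "l \<in> {1..n}" for k l
    using that by (rule permutes_swap_id)
  define a where "a = F (?t 1 2 3) (1, 2)"
  have "F (?t 1 2 3) = sc a (tri 1 2 3)"
    unfolding a_def
  proof (rule tri_eigen)
    show "F (?t 1 2 3) \<in> alt n" by (rule F_alt[OF t123])
    have neg: "F (- A) = - F A" if "A \<in> lat n i" for A
      using scl[OF that, of "- 1"] by (simp only: sc_minus_1)
    have p: "Transposition.transpose 1 2 permutes {1..n}" "Transposition.transpose 2 3 permutes {1..n}"
      by (rule perm; use n in simp)+
    have "pact (Transposition.transpose 1 2) (?t 1 2 3) = - ?t 1 2 3"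
    proof -
      have "sc 2 (tri 2 1 3 :: padic2 mat) = - sc 2 (tri 1 2 3)"
        unfolding tri_perm(1)[of 2 1 3] by (simp add: fun_eq_iff)
      then show ?thesis unfolding tp[OF p(1)] by (simp add: transpose_apply_other)
    qed
    then show "pact (Transposition.transpose 1 2) (F (?t 1 2 3)) = - F (?t 1 2 3)"
      using act[OF p(1) t123] neg[OF t123] by simp
    have "pact (Transposition.transpose 2 3) (?t 1 2 3) = - ?t 1 2 3"
    proof -
      have "sc 2 (tri 1 3 2 :: padic2 mat) = - sc 2 (tri 1 2 3)"
        unfolding tri_perm(2)[of 1 3 2] by (simp add: fun_eq_iff)
      then show ?thesis unfolding tp[OF p(2)] by (simp add: transpose_apply_other)
    qed
    then show "pact (Transposition.transpose 2 3) (F (?t 1 2 3)) = - F (?t 1 2 3)"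
      using act[OF p(2) t123] neg[OF t123] by simp
    fix k l assume kl: "k \<in> {4..n}" "l \<in> {4..n}"
    have q: "Transposition.transpose k l permutes {1..n}" using kl by (intro perm) auto
    have "pact (Transposition.transpose k l) (?t 1 2 3) = ?t 1 2 3"
      unfolding tp[OF q] using kl by (simp add: transpose_apply_other)
    then show "pact (Transposition.transpose k l) (F (?t 1 2 3)) = F (?t 1 2 3)"
      using act[OF q t123] by simp
  qed (use n in simp)
  then have Ft: "F (?t k l m) = sc a (tri k l m)" if klm: "distinct [k, l, m]" "{k, l, m} \<subseteq> {1..n}" for k l m
  proof -
    obtain \<sigma> where s: "\<sigma> permutes {1..n}" "map \<sigma> [1, 2, 3] = [k, l, m]"
      using permutes_extend[of "[1, 2, 3]" "[k, l, m]" "{1..n}"] klm n by auto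
    have s': "\<sigma> 1 = k" "\<sigma> 2 = l" "\<sigma> 3 = m" using s(2) by simp_all
    have "F (?t k l m) = F (pact \<sigma> (?t 1 2 3))" unfolding tp[OF s(1)] s' ..
    also have "\<dots> = pact \<sigma> (sc a (tri 1 2 3))"
      unfolding act[OF s(1) t123] \<open>F (?t 1 2 3) = sc a (tri 1 2 3)\<close> ..
    also have "\<dots> = sc a (tri k l m)" unfolding pact_linear pact_tri[OF s(1)] s' ..
    finally show ?thesis .
  qed
  have FA: "F (sc 2 A) = sc a A" if A: "A \<in> alt n" for A
  proof -
    have t: "?t (fst p) (snd p) n \<in> lat n i" if "p \<in> ind_less n" for p
      using that by (intro two tri_alt) (auto simp: ind_less_def)
    have e: "A = (\<Sum>p\<in>ind_less n. sc (A p) (tri (fst p) (snd p) n))"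
      using alt_expand[OF A] by (simp add: case_prod_unfold)
    have "sc 2 A = (\<Sum>p\<in>ind_less n. sc (A p) (?t (fst p) (snd p) n))"
      by (subst e) (simp only: sc_sum sc_sc mult.commute[of _ 2])
    then have "F (sc 2 A) = (\<Sum>p\<in>ind_less n. F (sc (A p) (?t (fst p) (snd p) n)))"
      using Fsum[OF finite_ind_less, of n "\<lambda>p. sc (A p) (?t (fst p) (snd p) n)"] t latticeD(4)[OF Li] by simp
    also have "\<dots> = (\<Sum>p\<in>ind_less n. sc a (sc (A p) (tri (fst p) (snd p) n)))"
    proof (rule sum.cong[OF refl])
      fix p assume p: "p \<in> ind_less n"
      have "F (sc (A p) (?t (fst p) (snd p) n)) = sc (A p) (sc a (tri (fst p) (snd p) n))"
        using scl[OF t[OF p]] Ft[of "fst p" "snd p" n] p by (auto simp: ind_less_def)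
      then show "F (sc (A p) (?t (fst p) (snd p) n)) = sc a (sc (A p) (tri (fst p) (snd p) n))"
        by (simp only: sc_sc mult.commute)
    qed
    also have "\<dots> = sc a A" by (subst (2) e) (simp only: sc_sum)
    finally show ?thesis .
  qed
  have FA2: "sc 2 (F A) = sc a A" if "A \<in> lat n i" for A
    using FA[of A] scl[OF that, of 2] that latticeD(1)[OF Li] by auto
  have "a \<noteq> 0"
  proof
    assume "a = 0"
    have "F A = 0" if "A \<in> lat n i" for A
    proof -
      have "sc 2 (F A) = sc 2 0" unfolding FA2[OF that] \<open>a = 0\<close> sc_0_left sc_0_right ..
      then show ?thesis by (simp only: sc_2_inject)
    qed
    then have "lat n j \<subseteq> {0}" unfolding img[symmetric] by (intro image_subsetI) simp
    also have "{0} \<subseteq> lat n 4" using latticeD(2)[OF lattice_lat[of 4 n]] by simp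
    finally show False using n4[OF ij(2)] by contradiction
  qed
  then obtain k u where a: "a = 2 ^ k * u" "parity u = 1" by (rule padic2_factor)
  obtain v where v: "u * v = 1" using parity_1_unit[OF a(2)] .
  have 1: "sc 2 ` lat n j = sc (2 ^ k) ` lat n i"
  proof -
    have "sc 2 ` lat n j = sc a ` lat n i" unfolding img[symmetric] image_image using FA2 by (rule image_cong[OF refl])
    also have "\<dots> = sc (2 ^ k) ` sc u ` lat n i" unfolding image_image a(1) sc_sc ..
    also have "sc u ` lat n i = lat n i"
    proof
      show "sc u ` lat n i \<subseteq> lat n i" using latticeD(4)[OF Li] by blast
      show "lat n i \<subseteq> sc u ` lat n i"
      proof
        fix A assume "A \<in> lat n i"
        then have "sc v A \<in> lat n i" by (rule latticeD(4)[OF Li])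
        moreover have "A = sc u (sc v A)" using v by (simp add: sc_sc sc_1)
        ultimately show "A \<in> sc u ` lat n i" by blast
      qed
    qed
    finally show ?thesis .
  qed
  have sub4: "sc 2 ` lat n b \<subseteq> lat n 4" if "b < 4" for b
    unfolding lat_4 using latticeD(1)[OF lattice_lat[of b n]] that by auto
  \<comment> \<open>The equation relates the double of \<open>lat n j\<close> to the multiple of
    \<open>lat n i\<close> by \<open>2 ^ k\<close>. Both lattices lie in \<open>S\<close> but not in
    \<open>2 S\<close>, which leaves \<open>k = 1\<close>; equal lattices have equal indices because
    the chain is strict.\<close>
  show "i = j"
  proof (cases k)
    case 0
    then have "lat n i = sc 2 ` lat n j" using 1 by (simp add: sc_1)
    then show ?thesis using sub4[OF ij(2)] n4[OF ij(1)] by simp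
  next
    case (Suc m)
    have "sc 2 ` lat n j = sc 2 ` sc (2 ^ m) ` lat n i"
      unfolding 1 image_image sc_sc Suc power_Suc ..
    then have 2: "lat n j = sc (2 ^ m) ` lat n i"
      by (rule inj_image_eq_iff[THEN iffD1, rotated]) (simp add: inj_def sc_2_inject)
    show ?thesis
    proof (cases m)
      case 0
      then have eq: "lat n j = lat n i" using 2 by (simp add: sc_1)
      show ?thesis
      proof (rule ccontr)
        assume "i \<noteq> j"
        then consider "Suc i \<le> j" | "Suc j \<le> i" by linarith
        then show False
          by cases (use eq mono[of "Suc i" j] mono[of "Suc j" i] lat_strict[OF n ij(1)] lat_strict[OF n ij(2)] ij in auto)
      qed
    next
      case (Suc q)
      have "lat n j = sc 2 ` sc (2 ^ q) ` lat n i"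
        unfolding 2 image_image sc_sc Suc power_Suc ..
      also have "\<dots> \<subseteq> lat n 4"
        unfolding lat_4 using latticeD(1,4)[OF Li] by blast
      finally show ?thesis using n4[OF ij(2)] by simp
    qed
  qed
qed

text \<open>Isomorphisms are obtained by identifying both modules with the same module
  \<open>P\<close> of matrices, so one of the two identifications has to be inverted.\<close>

lemma gmodule_isomorphic_trans_inverse:
  assumes M: "module CR (N :: ('r::comm_ring_1, 'n, 'g, 'd) gmodule_scheme)"
    and F: "linear_map E P F" "bij_betw F (carrier E) (carrier P)"
      "\<And>g x. g \<in> carrier G \<Longrightarrow> x \<in> carrier E \<Longrightarrow> F (act E g x) = act P g (F x)"
    and h: "linear_map N P h" "bij_betw h (carrier N) (carrier P)"
      "\<And>g x. g \<in> carrier G \<Longrightarrow> x \<in> carrier N \<Longrightarrow> h (act N g x) = act P g (h x)"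
    and cl: "\<And>g x. g \<in> carrier G \<Longrightarrow> x \<in> carrier N \<Longrightarrow> act N g x \<in> carrier N"
  shows "gmodule_isomorphic CR G E N"
proof (rule giso_intro)
  let ?k = "inv_into (carrier N) h"
  show "linear_map E N (\<lambda>x. ?k (F x))"
    by (rule linear_map_comp[OF F(1) linear_map_inverse[OF M h(1,2)]])
  show "bij_betw (\<lambda>x. ?k (F x)) (carrier E) (carrier N)"
    using bij_betw_trans[OF F(2) bij_betw_inv_into[OF h(2)]] by (simp add: comp_def)
  show "?k (F (act E g x)) = act N g (?k (F x))" if g: "g \<in> carrier G" and x: "x \<in> carrier E" for g x
    unfolding F(3)[OF g x]
    by (rule inverse_equivariant[OF h(2) linear_mapD(1)[OF F(1) x] cl[OF g] h(3)[OF g]])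
qed

theorem theorem7p16:
  fixes n :: nat
  assumes "n \<ge> 6" and "n mod 4 = 2"
  shows "(\<exists>!T. is_lattice_chain n T) \<and>
    (\<forall>T. is_lattice_chain n T \<longrightarrow>
      (\<forall>i<4. is_form Z2 Q2 Z2_in_Q2 (sym_group n)
                (restrict_to (hook_specht Z2 n) (T ! i)) (hook_specht Q2 n)) \<and>
      (\<forall>i<4. \<forall>j<4. i \<noteq> j \<longrightarrow>
        \<not> gmodule_isomorphic Z2 (sym_group n)
            (restrict_to (hook_specht Z2 n) (T ! i)) (restrict_to (hook_specht Z2 n) (T ! j))) \<and>
      (\<forall>M :: (padic2, 'm, nat \<Rightarrow> nat) gmodule.
        is_form Z2 Q2 Z2_in_Q2 (sym_group n) M (hook_specht Q2 n) \<longrightarrow>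
        (\<exists>i<4. gmodule_isomorphic Z2 (sym_group n) M
                  (restrict_to (hook_specht Z2 n) (T ! i)))))"
proof -
  note n = assms
  let ?S = "hook_specht Z2 n"
  let ?G = "sym_group n"
  have Gc: "\<sigma> \<in> carrier ?G \<longleftrightarrow> \<sigma> permutes {1..n}" for \<sigma> by (simp add: sym_group_def)
  note S = module_hook[of n, where ?'r = padic2]
  obtain \<eta> where eta: "linear_map ?S (alt_mod n) \<eta>" "bij_betw \<eta> (carrier ?S) (alt n)"
    and eta_act: "\<And>\<sigma> x. \<sigma> permutes {1..n} \<Longrightarrow> x \<in> carrier ?S \<Longrightarrow> \<eta> (act ?S \<sigma> x) = pact \<sigma> (\<eta> x)"
    and act_S: "\<And>\<sigma> x. \<sigma> permutes {1..n} \<Longrightarrow> x \<in> carrier ?S \<Longrightarrow> act ?S \<sigma> x \<in> carrier ?S"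
    by (rule hook_alt_mod[where n = n and ?'r = padic2]) blast
  note etal = linear_mapD[OF eta(1), unfolded alt_mod_simps]
  have eta_inj: "inj_on \<eta> (carrier ?S)" using eta(2) by (rule bij_betw_imp_inj_on)
  have gsubS: "gsubmodule Z2 ?G ?S H \<longleftrightarrow> H \<subseteq> carrier ?S \<and> lattice n (\<eta> ` H)" for H
    by (rule gsubmodule_iff_lattice[OF S eta(1) eta_inj eta_act act_S])
  \<comment> \<open>The terms of the chain, pulled back from matrices to the exterior
    square.\<close>
  define U where "U i = {x \<in> carrier ?S. \<eta> x \<in> lat n i}" for i
  have US: "U i \<subseteq> carrier ?S" for i by (auto simp: U_def)
  have etaU: "\<eta> ` U i = lat n i" for i
  proof -
    have "lat n i \<subseteq> \<eta> ` carrier ?S" unfolding bij_betw_imp_surj_on[OF eta(2)] by (auto simp: lat_def)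
    then show ?thesis by (auto simp: U_def)
  qed
  have eta_mono: "A \<subseteq> B" if AB: "A \<subseteq> carrier ?S" "B \<subseteq> carrier ?S" "\<eta> ` A \<subseteq> \<eta> ` B" for A B
  proof
    fix x assume x: "x \<in> A"
    then obtain y where y: "y \<in> B" "\<eta> x = \<eta> y" using AB(3) by blast
    have "x = y" by (rule inj_onD[OF eta_inj y(2)]) (use x y(1) AB in blast)+
    then show "x \<in> B" using y(1) by simp
  qed
  have eta_eq: "A = B" if "A \<subseteq> carrier ?S" "B \<subseteq> carrier ?S" "\<eta> ` A = \<eta> ` B" for A B
    using eta_mono that by (metis order.antisym order.refl)
  have gsubU: "gsubmodule Z2 ?G ?S (U i)" if "i \<le> 4" for i
    unfolding gsubS etaU using US lattice_lat[OF that] by blast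
  have modR: "module CR (restrict_to ?S A)" if "gsubmodule Z2 ?G ?S A" for A
    using submodule.submodule_is_module[OF _ S] that by (simp add: gsubmodule_def restrict_to_def)
  have actR: "act ?S \<sigma> x \<in> A" if "gsubmodule Z2 ?G ?S A" "\<sigma> permutes {1..n}" "x \<in> A" for A \<sigma> x
    using that by (simp add: gsubmodule_def Gc)
  have linR: "linear_map (restrict_to ?S A) (alt_mod n) \<eta>" if "A \<subseteq> carrier ?S" for A
    by (rule linear_mapI, unfold restrict_to_simps alt_mod_simps)
      (rule etal; use that in blast)+
  have gsubR: "gsubmodule Z2 ?G (restrict_to ?S A) H \<longleftrightarrow> H \<subseteq> A \<and> lattice n (\<eta> ` H)"
    if A: "gsubmodule Z2 ?G ?S A" for A H
  proof -
    have AS: "A \<subseteq> carrier ?S" using A gsubS by blast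
    have "gsubmodule CR (sym_group n) (restrict_to ?S A) H
        \<longleftrightarrow> H \<subseteq> carrier (restrict_to ?S A) \<and> lattice n (\<eta> ` H)"
    proof (rule gsubmodule_iff_lattice[OF modR[OF A] linR[OF AS]], unfold restrict_to_simps)
      show "inj_on \<eta> A" using eta_inj AS by (rule inj_on_subset)
      show "\<eta> (act ?S \<sigma> x) = pact \<sigma> (\<eta> x)" if "\<sigma> permutes {1..n}" "x \<in> A" for \<sigma> x
        using that AS eta_act by blast
      show "act ?S \<sigma> x \<in> A" if "\<sigma> permutes {1..n}" "x \<in> A" for \<sigma> x
        by (rule actR[OF A that])
    qed
    then show ?thesis by simp
  qed
  have U0: "U 0 = carrier ?S" using etal(1) by (auto simp: U_def lat_0)
  have dbl: "{2 \<odot>\<^bsub>?S\<^esub> x | x. x \<in> carrier ?S} = U 4"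
  proof (rule eta_eq)
    show "{2 \<odot>\<^bsub>?S\<^esub> x | x. x \<in> carrier ?S} \<subseteq> carrier ?S" using CR_module(2)[OF S] by blast
    have "\<eta> ` {2 \<odot>\<^bsub>?S\<^esub> x | x. x \<in> carrier ?S} = sc 2 ` \<eta> ` carrier ?S"
      unfolding Setcompr_eq_image image_image by (rule image_cong[OF refl etal(3)])
    then show "\<eta> ` {2 \<odot>\<^bsub>?S\<^esub> x | x. x \<in> carrier ?S} = \<eta> ` U 4"
      unfolding etaU lat_4 bij_betw_imp_surj_on[OF eta(2)] .
  qed (rule US)
  define C where "C = map U [0..<5]"
  have Cn: "C ! i = U i" if "i < 5" for i using that by (simp add: C_def)
  have chain: "is_lattice_chain n C"
    unfolding is_lattice_chain_def Let_def
  proof (intro conjI allI impI ballI)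
    show "length C = 5" by (simp add: C_def)
    show "C ! 0 = carrier ?S" using Cn[of 0] U0 by simp
    show "C ! 4 = {2 \<odot>\<^bsub>?S\<^esub> x | x. x \<in> carrier ?S}" unfolding dbl using Cn[of 4] by simp
    show "gsubmodule Z2 ?G ?S (C ! i)" if "i < 5" for i using gsubU[of i] Cn[OF that] that by simp
    fix i :: nat assume "i \<in> {1..4}"
    then obtain j where i: "i = Suc j" and j: "j < 4" by (cases i) auto
    have g: "gsubmodule Z2 ?G ?S (U j)" using gsubU j by simp
    have sub: "U (Suc j) \<subseteq> U j"
      by (rule eta_mono[OF US US]) (simp only: etaU lat_chain[OF n(2) j])
    have nsub: "\<not> U j \<subseteq> U (Suc j)"
      using lat_strict[OF n j] image_mono[of "U j" "U (Suc j)" \<eta>] unfolding etaU by blast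
    have "maximal_gsubmodule Z2 ?G (restrict_to ?S (U j)) (U (Suc j))"
      unfolding maximal_gsubmodule_def restrict_to_simps gsubR[OF g] etaU
    proof (intro conjI allI impI)
      show "U (Suc j) \<subseteq> U j" by (rule sub)
      show "lattice n (lat n (Suc j))" using j by (intro lattice_lat) simp
      show "U (Suc j) \<noteq> U j" using nsub by blast
      fix L assume "(L \<subseteq> U j \<and> lattice n (\<eta> ` L)) \<and> U (Suc j) \<subseteq> L"
      then have L: "L \<subseteq> U j" "lattice n (\<eta> ` L)" "U (Suc j) \<subseteq> L" by blast+
      have LS: "L \<subseteq> carrier ?S" using L(1) US by blast
      show "L = U (Suc j) \<or> L = U j"
      proof (cases "\<eta> ` L \<subseteq> lat n (Suc j)")
        case True
        then have "L \<subseteq> U (Suc j)" unfolding etaU[symmetric] by (rule eta_mono[OF LS US])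
        then show ?thesis using L(3) by blast
      next
        case False
        have "\<eta> ` L \<subseteq> lat n j" unfolding etaU[symmetric] using L(1) by blast
        then have "\<eta> ` L = lat n j" by (rule lat_step[OF L(2) n j _ False])
        then have "L = U j" unfolding etaU[symmetric] by (rule eta_eq[OF LS US])
        then show ?thesis by blast
      qed
    qed
    then show "maximal_gsubmodule Z2 ?G (restrict_to ?S (C ! (i - 1))) (C ! i)"
      using Cn[of j] Cn[of "Suc j"] i j by simp
  qed
  note lat_mono = lat_antimono[OF n(2)]
  have uniq: "T = C" if T: "is_lattice_chain n T" for T
  proof -
    have len: "length T = 5" and T0: "T ! 0 = carrier ?S" and T4: "T ! 4 = U 4"
      and gs: "\<And>i. i < 5 \<Longrightarrow> gsubmodule Z2 ?G ?S (T ! i)"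
      and mx: "\<And>i. i \<in> {1..4} \<Longrightarrow> maximal_gsubmodule Z2 ?G (restrict_to ?S (T ! (i - 1))) (T ! i)"
      using T unfolding is_lattice_chain_def Let_def dbl by blast+
    have TS: "T ! i \<subseteq> carrier ?S" and Tl: "lattice n (\<eta> ` (T ! i))" if "i < 5" for i
      using gs[OF that] unfolding gsubS by blast+
    have step: "T ! Suc i \<subset> T ! i" if "i < 4" for i
      using mx[of "Suc i"] that gsubR[OF gs[of i]] unfolding maximal_gsubmodule_def by auto
    have steps: "i < j \<Longrightarrow> j < 5 \<Longrightarrow> T ! j \<subset> T ! i" for i j
    proof (induction j)
      case (Suc j)
      have j: "T ! Suc j \<subset> T ! j" using step Suc.prems(2) by simp
      show ?case
      proof (cases "i = j")
        case False
        then have "T ! j \<subset> T ! i" using Suc by simp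
        then show ?thesis by (rule psubset_trans[OF j])
      qed (use j in simp)
    qed simp
    \<comment> \<open>Strict descent to the last term, which is \<open>2 S\<close>, keeps the
      earlier terms out of \<open>2 S\<close>, so the classification applies to each of
      them.\<close>
    have "\<exists>k<4. \<eta> ` (T ! i) = lat n k" if i: "i < 4" for i
    proof (rule lattice_classify[OF Tl n])
      show "\<not> \<eta> ` (T ! i) \<subseteq> lat n 4"
      proof
        assume "\<eta> ` (T ! i) \<subseteq> lat n 4"
        then have "T ! i \<subseteq> T ! 4"
          unfolding T4 etaU[symmetric] using i by (intro eta_mono[OF TS US]) simp_all
        then show False using steps[of i 4] i by auto
      qed
    qed (use i in simp)
    then obtain \<kappa> where k: "\<And>i. i < 4 \<Longrightarrow> \<kappa> i < 4" "\<And>i. i < 4 \<Longrightarrow> \<eta> ` (T ! i) = lat n (\<kappa> i)"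
      by metis
    have TU: "T ! i = U (\<kappa> i)" if "i < 4" for i
      using that k(2)[OF that] by (intro eta_eq[OF TS US]) (simp_all add: etaU)
    have k_less: "\<kappa> i < \<kappa> (Suc i)" if "Suc i < 4" for i
    proof (rule ccontr)
      assume "\<not> ?thesis"
      then have "lat n (\<kappa> i) \<subseteq> lat n (\<kappa> (Suc i))" using k(1)[of i] that by (intro lat_mono) auto
      then have "T ! i \<subseteq> T ! Suc i"
        unfolding TU[OF that] TU[of i, OF Suc_lessD[OF that]] by (intro eta_mono[OF US US]) (simp add: etaU)
      then show False using step[of i] that by auto
    qed
    \<comment> \<open>Four strictly increasing indices below 4 can only be
      \<open>0, 1, 2, 3\<close>.\<close>
    have kid: "\<kappa> 0 = 0" "\<kappa> 1 = 1" "\<kappa> 2 = 2" "\<kappa> 3 = 3"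
      using k_less[of 0] k_less[of 1] k_less[of 2] k(1)[of 3]
      by (auto simp: numeral_2_eq_2 numeral_3_eq_3)
    have "T ! i = C ! i" if i: "i < 5" for i
    proof -
      consider "i = 0" | "i = 1" | "i = 2" | "i = 3" | "i = 4" using i by linarith
      then show ?thesis
        by cases (use TU[of 0] TU[of 1] TU[of 2] TU[of 3] kid T4 Cn[OF i] in simp_all)
    qed
    then show ?thesis using len by (intro nth_equalityI) (simp_all add: C_def)
  qed
  have full: "sc 2 ` alt n \<subseteq> \<eta> ` carrier (restrict_to ?S (U i))" if "i < 4" for i
    using lat_mono[of i 4] that unfolding restrict_to_simps etaU lat_4 by simp
  have gmR: "group_module CR ?G (restrict_to ?S (U i))"
    and actE: "\<And>\<sigma> x. \<sigma> \<in> carrier ?G \<Longrightarrow> x \<in> carrier (restrict_to ?S (U i)) \<Longrightarrow>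
      \<eta> (act (restrict_to ?S (U i)) \<sigma> x) = pact \<sigma> (\<eta> x)"
    and injR: "inj_on \<eta> (carrier (restrict_to ?S (U i)))"
    and clR: "\<And>\<sigma> x. \<sigma> \<in> carrier ?G \<Longrightarrow> x \<in> carrier (restrict_to ?S (U i)) \<Longrightarrow>
      act (restrict_to ?S (U i)) \<sigma> x \<in> carrier (restrict_to ?S (U i))" if i: "i < 4" for i
  proof -
    have g: "gsubmodule Z2 ?G ?S (U i)" using gsubU i by simp
    show aE: "\<eta> (act (restrict_to ?S (U i)) \<sigma> x) = pact \<sigma> (\<eta> x)"
      if "\<sigma> \<in> carrier ?G" "x \<in> carrier (restrict_to ?S (U i))" for \<sigma> x
      using that US eta_act unfolding Gc restrict_to_simps by blast
    show inj: "inj_on \<eta> (carrier (restrict_to ?S (U i)))"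
      unfolding restrict_to_simps by (rule inj_on_subset[OF eta_inj US])
    show cl: "act (restrict_to ?S (U i)) \<sigma> x \<in> carrier (restrict_to ?S (U i))"
      if "\<sigma> \<in> carrier ?G" "x \<in> carrier (restrict_to ?S (U i))" for \<sigma> x
      using that actR[OF g] unfolding Gc restrict_to_simps by blast
    show "group_module CR ?G (restrict_to ?S (U i))"
      by (rule group_module_pullback[OF modR[OF g] cl linR[OF US] inj _ group_module_alt_mod])
        (simp_all only: aE alt_mod_simps)
  qed
  have forms: "is_form Z2 Q2 Z2_in_Q2 ?G (restrict_to ?S (U i)) (hook_specht Q2 n)" if i: "i < 4" for i
  proof -
    note E = gmR[OF i] linR[OF US] injR[OF i] actE[OF i] full[OF i]
    obtain F where F: "linear_map (extend_scalars CR Q2 Z2_in_Q2 (restrict_to ?S (U i))) (alt_mod n) F"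
      "bij_betw F (carrier (extend_scalars CR Q2 Z2_in_Q2 (restrict_to ?S (U i)))) (carrier (alt_mod n))"
      "\<And>g x. g \<in> carrier ?G \<Longrightarrow> x \<in> carrier (extend_scalars CR Q2 Z2_in_Q2 (restrict_to ?S (U i))) \<Longrightarrow>
        F (act (extend_scalars CR Q2 Z2_in_Q2 (restrict_to ?S (U i))) g x) = act (alt_mod n) g (F x)"
      by (rule giso_elim[OF embedded_extend_scalars[OF E]]) blast+
    obtain \<theta> where th: "linear_map (hook_specht Q2 n) (alt_mod n) \<theta>" "bij_betw \<theta> (carrier (hook_specht Q2 n)) (alt n)"
      "\<And>\<sigma> x. \<sigma> permutes {1..n} \<Longrightarrow> x \<in> carrier (hook_specht Q2 n) \<Longrightarrow> \<theta> (act (hook_specht Q2 n) \<sigma> x) = pact \<sigma> (\<theta> x)"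
      "\<And>\<sigma> x. \<sigma> permutes {1..n} \<Longrightarrow> x \<in> carrier (hook_specht Q2 n) \<Longrightarrow> act (hook_specht Q2 n) \<sigma> x \<in> carrier (hook_specht Q2 n)"
      by (rule hook_alt_mod[where n = n and ?'r = "padic2 fract"]) blast
    have "gmodule_isomorphic Q2 ?G (extend_scalars CR Q2 Z2_in_Q2 (restrict_to ?S (U i))) (hook_specht Q2 n)"
      by (rule gmodule_isomorphic_trans_inverse[OF module_hook F th(1)]) (simp_all add: th Gc)
    then show ?thesis
      unfolding is_form_def using gmR[OF i] embedded_basis[OF E] by blast
  qed
  have noniso: "i = j" if ij: "i < 4" "j < 4"
    and iso: "gmodule_isomorphic Z2 ?G (restrict_to ?S (U i)) (restrict_to ?S (U j))" for i j
  proof -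
    obtain f where f: "linear_map (restrict_to ?S (U i)) (restrict_to ?S (U j)) f"
      "bij_betw f (carrier (restrict_to ?S (U i))) (carrier (restrict_to ?S (U j)))"
      "\<And>g x. g \<in> carrier ?G \<Longrightarrow> x \<in> carrier (restrict_to ?S (U i)) \<Longrightarrow>
        f (act (restrict_to ?S (U i)) g x) = act (restrict_to ?S (U j)) g (f x)"
      by (rule giso_elim[OF iso]) blast
    \<comment> \<open>Conjugating \<open>f\<close> by \<open>\<eta>\<close> turns it into a map
      between lattices of matrices.\<close>
    let ?k = "inv_into (U i) \<eta>"
    have mod: "module CR (restrict_to ?S (U i))" using gmR[OF ij(1)] by (simp add: group_module_def)
    have kl: "linear_map (alt_mod n\<lparr>carrier := lat n i\<rparr>) (restrict_to ?S (U i)) ?k"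
    proof -
      have "linear_map (restrict_to ?S (U i)) (alt_mod n\<lparr>carrier := lat n i\<rparr>) \<eta>"
        using linR[OF US[of i]] etaU[of i] by (auto simp: linear_map_def)
      then show ?thesis
        using linear_map_inverse[OF mod, of "alt_mod n\<lparr>carrier := lat n i\<rparr>" \<eta>] injR[OF ij(1)] etaU[of i]
        by (simp add: bij_betw_def)
    qed
    have k: "?k A \<in> U i" "\<eta> (?k A) = A" if "A \<in> lat n i" for A
      using that unfolding etaU[of i, symmetric] by (auto intro: inv_into_into f_inv_into_f)
    have keta: "?k (\<eta> x) = x" if "x \<in> U i" for x
      using injR[OF ij(1)] that by simp
    have fk: "f (?k A) \<in> U j" if "A \<in> lat n i" for A
      using linear_mapD(1)[OF f(1)] k(1)[OF that] by simp
    note fl = linear_mapD[OF f(1), unfolded restrict_to_simps]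
    note kll = linear_mapD[OF kl, simplified]
    note el = linear_mapD[OF linR[OF US[of j]], unfolded restrict_to_simps alt_mod_simps]
    show ?thesis
    proof (rule lat_not_isomorphic[OF n ij, where F = "\<lambda>A. \<eta> (f (?k A))"])
      fix A assume A: "A \<in> lat n i"
      show "\<eta> (f (?k (A + B))) = \<eta> (f (?k A)) + \<eta> (f (?k B))" if B: "B \<in> lat n i" for B
      proof -
        have "?k (A + B) = ?k A \<oplus>\<^bsub>?S\<^esub> ?k B"
          using linear_mapD(2)[OF kl, of A B] A B by simp
        then show ?thesis using fl(2)[OF k(1)[OF A] k(1)[OF B]] el(2)[OF fk[OF A] fk[OF B]] by (simp only:)
      qed
      show "\<eta> (f (?k (sc c A))) = sc c (\<eta> (f (?k A)))" for c
      proof -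
        have "?k (sc c A) = c \<odot>\<^bsub>?S\<^esub> ?k A"
          using linear_mapD(3)[OF kl, of A c] A by simp
        then show ?thesis using fl(3)[OF k(1)[OF A], of c] el(3)[OF fk[OF A], of c] by (simp only:)
      qed
      show "\<eta> (f (?k (pact \<sigma> A))) = pact \<sigma> (\<eta> (f (?k A)))" if s: "\<sigma> permutes {1..n}" for \<sigma>
      proof -
        have sc: "\<sigma> \<in> carrier ?G" using s Gc by blast
        have c: "act ?S \<sigma> (?k A) \<in> U i" using clR[OF ij(1) sc] k(1)[OF A] by simp
        have "\<eta> (act ?S \<sigma> (?k A)) = pact \<sigma> A" using actE[OF ij(1) sc] k[OF A] by simp
        then have "?k (pact \<sigma> A) = act ?S \<sigma> (?k A)" using keta[OF c] by simp
        then show ?thesis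
          using f(3)[OF sc] actE[OF ij(2) sc] k(1)[OF A] fk[OF A] by simp
      qed
    next
      have "(\<lambda>A. \<eta> (f (?k A))) ` lat n i = \<eta> ` f ` ?k ` lat n i" by (simp add: image_image)
      also have "?k ` lat n i = U i"
        unfolding etaU[of i, symmetric] using keta by (auto simp: image_iff)
      also have "f ` U i = U j" using bij_betw_imp_surj_on[OF f(2)] by simp
      also have "\<eta> ` U j = lat n j" by (rule etaU)
      finally show "(\<lambda>A. \<eta> (f (?k A))) ` lat n i = lat n j" .
    qed
  qed
  have complete: "\<exists>i<4. gmodule_isomorphic Z2 ?G M (restrict_to ?S (U i))"
    if form: "is_form Z2 Q2 Z2_in_Q2 ?G M (hook_specht Q2 n)" for M :: "(padic2, 'm, nat \<Rightarrow> nat) gmodule"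
  proof -
    have GM: "group_module CR ?G M" using form by (simp add: is_form_def)
    then have M: "module CR M" by (simp add: group_module_def)
    interpret GM: group_module CR ?G M by (rule GM)
    have n3: "n \<ge> 3" using n by simp
    obtain h where h: "linear_map M (alt_mod n) h" "inj_on h (carrier M)"
      and h_act: "\<And>\<sigma> x. \<sigma> permutes {1..n} \<Longrightarrow> x \<in> carrier M \<Longrightarrow> h (act M \<sigma> x) = pact \<sigma> (h x)"
      and nz: "\<exists>x\<in>carrier M. h x \<noteq> 0"
      by (rule form_embedding[OF n3 form]) blast
    note hl = linear_mapD[OF h(1), unfolded alt_mod_simps]
    have L: "lattice n (h ` carrier M)"
      by (rule lattice_image[OF M h(1) h_act module.carrier_is_submodule[OF M]])
        (simp_all add: GM.act_closed Gc)
    obtain j where j: "h ` carrier M \<subseteq> sc (2 ^ j) ` alt n" "\<not> h ` carrier M \<subseteq> sc (2 ^ Suc j) ` alt n"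
      using sc_pow_lattice[OF L] nz by blast
    \<comment> \<open>The image divided by the highest power of 2 that it admits. It no longer lies
      in \<open>2 S\<close>, as the classification requires.\<close>
    let ?L = "{B \<in> alt n. sc (2 ^ j) B \<in> h ` carrier M}"
    have "\<not> ?L \<subseteq> lat n 4"
    proof
      assume sub: "?L \<subseteq> lat n 4"
      have "h ` carrier M \<subseteq> sc (2 ^ Suc j) ` alt n"
      proof
        fix A assume A: "A \<in> h ` carrier M"
        then obtain B where B: "B \<in> alt n" "A = sc (2 ^ j) B" using j(1) by blast
        then have "B \<in> lat n 4" using sub A by blast
        then obtain D where "D \<in> alt n" "B = sc 2 D" unfolding lat_4 by blast
        then have "D \<in> alt n" "A = sc (2 ^ Suc j) D" using B(2) by (simp_all only: sc_sc power_Suc mult.commute)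
        then show "A \<in> sc (2 ^ Suc j) ` alt n" by blast
      qed
      then show False using j(2) by blast
    qed
    then obtain i where i: "i < 4" "?L = lat n i"
      using lattice_classify[OF lattice_divide[OF L] n] by blast
    have "\<exists>B\<in>alt n. h x = sc (2 ^ j) B" if "x \<in> carrier M" for x using j(1) that by blast
    then obtain g where g: "\<And>x. x \<in> carrier M \<Longrightarrow> h x = sc (2 ^ j) (g x)" "\<And>x. x \<in> carrier M \<Longrightarrow> g x \<in> alt n"
      by metis
    let ?P = "alt_mod n\<lparr>carrier := lat n i\<rparr>"
    have gi: "g x \<in> lat n i" if "x \<in> carrier M" for x
      unfolding i(2)[symmetric] using g[OF that] that by (metis (no_types, lifting) image_eqI mem_Collect_eq)
    have g_inj: "A = B" if "sc (2 ^ j) A = sc (2 ^ j) B" for A B :: "padic2 mat"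
      using that by (simp only: sc_pow_inject)
    have glin: "linear_map M ?P g"
    proof (rule linear_mapI)
      interpret MM: abelian_group M by (rule CR_module(1)[OF M])
      fix x assume x: "x \<in> carrier M"
      show "g x \<in> carrier ?P" using gi[OF x] by simp
      have "g (x \<oplus>\<^bsub>M\<^esub> y) = g x + g y" if y: "y \<in> carrier M" for y
        by (rule g_inj) (simp only: sc_add g(1)[OF x, symmetric] g(1)[OF y, symmetric]
            g(1)[OF abelian_monoid.a_closed[OF abelian_group.axioms(1)[OF CR_module(1)[OF M]] x y], symmetric] hl(2)[OF x y])
      then show "g (x \<oplus>\<^bsub>M\<^esub> y) = g x \<oplus>\<^bsub>?P\<^esub> g y" if "y \<in> carrier M" for y using that by simp
      have "g (r \<odot>\<^bsub>M\<^esub> x) = sc r (g x)" for r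
      proof (rule g_inj)
        have "sc (2 ^ j) (g (r \<odot>\<^bsub>M\<^esub> x)) = sc r (sc (2 ^ j) (g x))"
          unfolding g(1)[OF CR_module(2)[OF M x], symmetric] hl(3)[OF x] g(1)[OF x] ..
        then show "sc (2 ^ j) (g (r \<odot>\<^bsub>M\<^esub> x)) = sc (2 ^ j) (sc r (g x))"
          by (simp only: sc_sc mult.commute)
      qed
      then show "g (r \<odot>\<^bsub>M\<^esub> x) = r \<odot>\<^bsub>?P\<^esub> g x" for r by simp
    qed
    have "bij_betw g (carrier M) (lat n i)"
      unfolding bij_betw_def
    proof
      show "inj_on g (carrier M)"
        using inj_onD[OF h(2)] g(1) by (intro inj_onI) metis
      show "g ` carrier M = lat n i"
      proof
        show "g ` carrier M \<subseteq> lat n i" using gi by blast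
        show "lat n i \<subseteq> g ` carrier M"
        proof
          fix A assume "A \<in> lat n i"
          then have "sc (2 ^ j) A \<in> h ` carrier M" unfolding i(2)[symmetric] by blast
          then obtain x where x: "x \<in> carrier M" "sc (2 ^ j) A = h x" by blast
          then have "A = g x" using g_inj g(1)[OF x(1)] by (metis (no_types))
          then show "A \<in> g ` carrier M" using x(1) by blast
        qed
      qed
    qed
    then have gbij: "bij_betw g (carrier M) (carrier ?P)" by simp
    have gact: "g (act M \<sigma> x) = act ?P \<sigma> (g x)" if s: "\<sigma> \<in> carrier ?G" and x: "x \<in> carrier M" for \<sigma> x
    proof -
      have "g (act M \<sigma> x) = pact \<sigma> (g x)"
        by (rule g_inj) (simp only: g(1)[OF GM.act_closed[OF s x], symmetric] pact_linear(4)[symmetric]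
            g(1)[OF x, symmetric] h_act[OF s[unfolded Gc] x])
      then show ?thesis by simp
    qed
    have "gmodule_isomorphic CR ?G M (restrict_to ?S (U i))"
    proof (rule gmodule_isomorphic_trans_inverse[OF _ glin gbij gact])
      show "module CR (restrict_to ?S (U i))" using gmR[OF i(1)] by (simp add: group_module_def)
      show "linear_map (restrict_to ?S (U i)) ?P \<eta>"
        using linR[OF US[of i]] etaU[of i] by (auto simp: linear_map_def)
      show "bij_betw \<eta> (carrier (restrict_to ?S (U i))) (carrier ?P)"
        using injR[OF i(1)] etaU[of i] by (simp add: bij_betw_def)
      show "\<eta> (act (restrict_to ?S (U i)) \<sigma> x) = act ?P \<sigma> (\<eta> x)"
        if "\<sigma> \<in> carrier ?G" "x \<in> carrier (restrict_to ?S (U i))" for \<sigma> x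
        using actE[OF i(1) that] by simp
      show "act (restrict_to ?S (U i)) \<sigma> x \<in> carrier (restrict_to ?S (U i))"
        if "\<sigma> \<in> carrier ?G" "x \<in> carrier (restrict_to ?S (U i))" for \<sigma> x
        by (rule clR[OF i(1) that])
    qed
    then show ?thesis using i(1) by blast
  qed
  have CU: "C ! i = U i" if "i < 4" for i using that Cn by simp
  show ?thesis
  proof (intro conjI allI impI)
    show "\<exists>!T. is_lattice_chain n T" using chain uniq by blast
    fix T assume "is_lattice_chain n T"
    then have T: "T = C" by (rule uniq)
    show "is_form Z2 Q2 Z2_in_Q2 ?G (restrict_to ?S (T ! i)) (hook_specht Q2 n)" if "i < 4" for i
      unfolding T CU[OF that] by (rule forms[OF that])
    show "\<not> gmodule_isomorphic Z2 ?G (restrict_to ?S (T ! i)) (restrict_to ?S (T ! j))"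
      if "i < 4" "j < 4" "i \<noteq> j" for i j
      unfolding T CU[OF that(1)] CU[OF that(2)] using noniso[OF that(1,2)] that(3) by blast
    show "\<exists>i<4. gmodule_isomorphic Z2 ?G M (restrict_to ?S (T ! i))"
      if "is_form Z2 Q2 Z2_in_Q2 ?G M (hook_specht Q2 n)" for M :: "(padic2, 'm, nat \<Rightarrow> nat) gmodule"
      using complete[OF that] CU unfolding T by metis
  qed
qed

end
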